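(* Let $(P,-\mathbf d\theta)$ be a connected exact symplectic manifold which is the total space of a right principal $\mathcal O$-bundle, with $\theta\in\Omega^1_{\mathcal O}(P)$ an $\mathcal O$-invariant one-form. Let $\operatorname{Hom}(\mathcal O,\mathbb R)$ be the vector space of group homomorphisms from $\mathcal O$ to $(\mathbb R,+)$ and consider the map $$\Psi:\mathcal{A}ut_{\rm ham}(P)\to\operatorname{Hom}(\mathcal O,\mathbb R),\qquad\Psi(\varphi)(g):=F_\varphi-F_\varphi\circ\Phi_g,\quad\forall g\in\mathcal O,$$ where $F_\varphi\in\mathcal F(P)$ is such that $\mathbf dF_\varphi=\varphi^*\theta-\theta$. Then $\Psi$ is well defined and is a group homomorphism. Moreover, the formal Lie algebra of the normal subgroup $$\overline{\mathcal{A}ut}_{\rm ham}(P):=\ker\Psi\subset\mathcal{A}ut_{\rm ham}(P)$$ is the space $\overline{\mathfrak{aut}}_{\rm ham}(P)=\{X_h\mid h\in\mathcal F(P)^{\mathcal O}\}$ of Hamiltonian vector fields on $P$ associated to $\mathcal O$-invariant Hamiltonians.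
   Context: $\mathcal O$ is a Lie group acting on $P$ on the right by $\Phi_g$. $\mathcal F(P)$ is the space of smooth real functions on $P$ and $\mathcal F(P)^{\mathcal O}$ the subspace of $\mathcal O$-invariant ones. With $\omega=-\mathbf d\theta$, the Hamiltonian vector field $X_h$ of $h\in\mathcal F(P)$ is defined by $\mathbf i_{X_h}\omega=\mathbf dh$. $\operatorname{Diff}_{\rm ham}(P)$ is the group of Hamiltonian diffeomorphisms of $(P,\omega)$; it is a known fact that $\varphi^*\theta-\theta$ is exact for every $\varphi\in\operatorname{Diff}_{\rm ham}(P)$. $\mathcal{A}ut(P)$ is the group of $\mathcal O$-equivariant diffeomorphisms of $P$, and $\mathcal{A}ut_{\rm ham}(P):=\mathcal{A}ut(P)\cap\operatorname{Diff}_{\rm ham}(P)$, with formal Lie algebra $\mathfrak{aut}_{\rm ham}(P)$ the $\mathcal O$-equivariant Hamiltonian vector fields on $P$. The function $F_\varphi-F_\varphi\circ\Phi_g$ is regarded as an element of $\mathbb R$ (well-definedness includes that it is constant on $P$, independent of the choice of $F_\varphi$, and that $\Psi(\varphi)$ is a homomorphism). The formal Lie algebra of $\ker\Psi$ is understood as the kernel of the derivative $\beta:\mathfrak{aut}_{\rm ham}(P)\to\operatorname{Hom}(\mathcal O,\mathbb R)$ of $\Psi$, $\beta(X)(g)=\frac{d}{dt}|_{t=0}\Psi(\varphi_t)(g)$ for a curve $\varphi_t$ in $\mathcal{A}ut_{\rm ham}(P)$ with $\varphi_0=\mathrm{id}$ and $\frac{d}{dt}|_{t=0}\varphi_t=X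$.
   Formalization: The formal Lie algebra of ker Ψ is taken as the X in aut_ham(P) that are the velocity at 0 of some curve in Aut_ham(P) and have β(X)=0, since on noncompact P some X (e.g. d/dq on (0,1)×R with Z translating p) have no such curve and β(X) is then undefined. *)

theory Defs
  imports "HOL-Analysis.Analysis" "HOL-Algebra.Coset"
begin

section \<open>Smooth maps between open sets of normed spaces\<close>

text \<open>All model spaces below are finite-dimensional, so that a map is of class \<open>C\<^sup>n\<^sup>+\<^sup>1\<close> on an
  open set iff it is differentiable there and all its directional derivatives are of class \<open>C\<^sup>n\<close>.\<close>

fun Ck_on :: "nat \<Rightarrow> 'a::real_normed_vector set \<Rightarrow> ('a \<Rightarrow> 'b::real_normed_vector) \<Rightarrow> bool" where
  "Ck_on 0 S f \<longleftrightarrow> continuous_on S f"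
| "Ck_on (Suc n) S f \<longleftrightarrow>
     (\<forall>x\<in>S. f differentiable (at x)) \<and> (\<forall>v. Ck_on n S (\<lambda>x. frechet_derivative f (at x) v))"

definition smooth_on :: "'a::real_normed_vector set \<Rightarrow> ('a \<Rightarrow> 'b::real_normed_vector) \<Rightarrow> bool" where
  "smooth_on S f \<longleftrightarrow> (\<forall>n. Ck_on n S f)"

section \<open>Smooth manifolds\<close>

text \<open>The points of a manifold are all the points of a topological space \<open>'p\<close>; the smooth structure is
  given by an atlas, which need not be maximal.  A chart is its domain together with its coordinate
  map, whose values outside the domain are irrelevant.\<close>

type_synonym ('p, 'e) chart = "'p set \<times> ('p \<Rightarrow> 'e)"

definition is_chart :: "('p::topological_space, 'e::real_normed_vector) chart \<Rightarrow> bool" where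
  "is_chart c \<longleftrightarrow> (case c of (U, \<phi>) \<Rightarrow>
     open U \<and> open (\<phi> ` U) \<and> homeomorphism U (\<phi> ` U) \<phi> (inv_into U \<phi>))"

definition smooth_atlas :: "('p::topological_space, 'e::real_normed_vector) chart set \<Rightarrow> bool" where
  "smooth_atlas A \<longleftrightarrow> (\<forall>c\<in>A. is_chart c) \<and> (\<Union>(U, \<phi>)\<in>A. U) = UNIV \<and>
     (\<forall>(U, \<phi>)\<in>A. \<forall>(V, \<psi>)\<in>A. smooth_on (\<phi> ` (U \<inter> V)) (\<psi> \<circ> inv_into U \<phi>))"

text \<open>The model space is an arbitrary finite-dimensional normed space rather than a type of class
  \<open>euclidean_space\<close>, since the latter excludes dimension 0 and thereby discrete structure groups.\<close>

definition smooth_manifold ::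
    "('p::{t2_space, second_countable_topology}, 'e::real_normed_vector) chart set \<Rightarrow> bool" where
  "smooth_manifold A \<longleftrightarrow> smooth_atlas A \<and> (\<exists>B::'e set. finite B \<and> span B = UNIV)"

definition model_atlas :: "('e::real_normed_vector, 'e) chart set" where
  "model_atlas = {(UNIV, id)}"

definition prod_atlas ::
    "('p, 'e) chart set \<Rightarrow> ('q, 'f) chart set \<Rightarrow> ('p \<times> 'q, 'e \<times> 'f) chart set" where
  "prod_atlas A B = {(U \<times> V, map_prod \<phi> \<psi>) | U \<phi> V \<psi>. (U, \<phi>) \<in> A \<and> (V, \<psi>) \<in> B}"

text \<open>To be used for open \<open>S\<close>.\<close>

definition smooth_map_on ::
    "'p::topological_space set \<Rightarrow> ('p, 'e::real_normed_vector) chart set \<Rightarrow>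
     ('q::topological_space, 'f::real_normed_vector) chart set \<Rightarrow> ('p \<Rightarrow> 'q) \<Rightarrow> bool" where
  "smooth_map_on S A B f \<longleftrightarrow> continuous_on S f \<and>
     (\<forall>(U, \<phi>)\<in>A. \<forall>(V, \<psi>)\<in>B.
        smooth_on (\<phi> ` (U \<inter> S \<inter> f -` V)) (\<psi> \<circ> f \<circ> inv_into U \<phi>))"

abbreviation smooth_map ::
    "('p::topological_space, 'e::real_normed_vector) chart set \<Rightarrow>
     ('q::topological_space, 'f::real_normed_vector) chart set \<Rightarrow> ('p \<Rightarrow> 'q) \<Rightarrow> bool" where
  "smooth_map \<equiv> smooth_map_on UNIV"

definition diffeomorphism :: "('p::topological_space, 'e::real_normed_vector) chart set \<Rightarrow> ('p \<Rightarrow> 'p) \<Rightarrow> bool"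
  where "diffeomorphism A \<phi> \<longleftrightarrow> bij \<phi> \<and> smooth_map A A \<phi> \<and> smooth_map A A (inv_into UNIV \<phi>)"

definition smooth_fun :: "('p::topological_space, 'e::real_normed_vector) chart set \<Rightarrow> ('p \<Rightarrow> real) set"
  where "smooth_fun A = {f. smooth_map A model_atlas f}"

definition smooth_family ::
    "('p::topological_space, 'e::real_normed_vector) chart set \<Rightarrow>
     ('q::topological_space, 'f::real_normed_vector) chart set \<Rightarrow> (real \<Rightarrow> 'p \<Rightarrow> 'q) \<Rightarrow> bool" where
  "smooth_family A B c \<longleftrightarrow>
     smooth_map (prod_atlas (model_atlas :: (real, real) chart set) A) B (\<lambda>(t, p). c t p)"

section \<open>Tangent vectors, vector fields and differential forms\<close>

text \<open>A tangent vector at \<open>p\<close> is a derivation at \<open>p\<close> of the algebra of smooth functions.  Derivations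
  are set to 0 on non-smooth functions, so that equality of tangent vectors is equality in HOL.\<close>

type_synonym 'p tvec = "('p \<Rightarrow> real) \<Rightarrow> real"

definition tangent_space ::
    "('p::topological_space, 'e::real_normed_vector) chart set \<Rightarrow> 'p \<Rightarrow> 'p tvec set" where
  "tangent_space A p = {v.
     (\<forall>f\<in>smooth_fun A. \<forall>g\<in>smooth_fun A. v (\<lambda>q. f q + g q) = v f + v g) \<and>
     (\<forall>f\<in>smooth_fun A. \<forall>a. v (\<lambda>q. a * f q) = a * v f) \<and>
     (\<forall>f\<in>smooth_fun A. \<forall>g\<in>smooth_fun A. v (\<lambda>q. f q * g q) = f p * v g + g p * v f) \<and>
     (\<forall>f. f \<notin> smooth_fun A \<longrightarrow> v f = 0)}"

definition pushforward ::
    "('p::topological_space, 'e::real_normed_vector) chart set \<Rightarrow> ('p \<Rightarrow> 'p) \<Rightarrow> 'p tvec \<Rightarrow> 'p tvec" where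
  "pushforward A \<phi> v = (\<lambda>f. if f \<in> smooth_fun A then v (f \<circ> \<phi>) else 0)"

definition vector_fields ::
    "('p::topological_space, 'e::real_normed_vector) chart set \<Rightarrow> ('p \<Rightarrow> 'p tvec) set" where
  "vector_fields A = {X. (\<forall>p. X p \<in> tangent_space A p) \<and>
     (\<forall>f\<in>smooth_fun A. (\<lambda>p. X p f) \<in> smooth_fun A)}"

definition lie_bracket :: "('p \<Rightarrow> 'p tvec) \<Rightarrow> ('p \<Rightarrow> 'p tvec) \<Rightarrow> 'p \<Rightarrow> 'p tvec" where
  "lie_bracket X Y = (\<lambda>p f. X p (\<lambda>q. Y q f) - Y p (\<lambda>q. X q f))"

text \<open>The values of a one-form off the tangent spaces are irrelevant; identities between one-forms
  are therefore stated on tangent vectors.\<close>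

definition one_forms ::
    "('p::topological_space, 'e::real_normed_vector) chart set \<Rightarrow> ('p \<Rightarrow> 'p tvec \<Rightarrow> real) set" where
  "one_forms A = {\<alpha>.
     (\<forall>p. \<forall>v\<in>tangent_space A p. \<forall>w\<in>tangent_space A p. \<alpha> p (\<lambda>f. v f + w f) = \<alpha> p v + \<alpha> p w) \<and>
     (\<forall>p. \<forall>v\<in>tangent_space A p. \<forall>a. \<alpha> p (\<lambda>f. a * v f) = a * \<alpha> p v) \<and>
     (\<forall>X\<in>vector_fields A. (\<lambda>p. \<alpha> p (X p)) \<in> smooth_fun A)}"

definition differential :: "('p \<Rightarrow> real) \<Rightarrow> 'p \<Rightarrow> 'p tvec \<Rightarrow> real" where
  "differential f = (\<lambda>p v. v f)"

definition pullback ::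
    "('p::topological_space, 'e::real_normed_vector) chart set \<Rightarrow> ('p \<Rightarrow> 'p) \<Rightarrow>
     ('p \<Rightarrow> 'p tvec \<Rightarrow> real) \<Rightarrow> ('p \<Rightarrow> 'p tvec \<Rightarrow> real)" where
  "pullback A \<phi> \<alpha> = (\<lambda>p v. \<alpha> (\<phi> p) (pushforward A \<phi> v))"

text \<open>Two-forms are regarded as bilinear maps from vector fields to functions; the exterior
  derivative of a one-form is given by
  \<open>\<^bold>d\<alpha>(X, Y) = X(\<alpha>(Y)) - Y(\<alpha>(X)) - \<alpha>([X, Y])\<close>.\<close>

definition ext_deriv ::
    "('p \<Rightarrow> 'p tvec \<Rightarrow> real) \<Rightarrow> ('p \<Rightarrow> 'p tvec) \<Rightarrow> ('p \<Rightarrow> 'p tvec) \<Rightarrow> 'p \<Rightarrow> real" where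
  "ext_deriv \<alpha> X Y = (\<lambda>p. X p (\<lambda>q. \<alpha> q (Y q)) - Y p (\<lambda>q. \<alpha> q (X q)) - \<alpha> p (lie_bracket X Y p))"

section \<open>Exact symplectic manifolds\<close>

definition symp :: "('p \<Rightarrow> 'p tvec \<Rightarrow> real) \<Rightarrow> ('p \<Rightarrow> 'p tvec) \<Rightarrow> ('p \<Rightarrow> 'p tvec) \<Rightarrow> 'p \<Rightarrow> real" where
  "symp \<theta> X Y = (\<lambda>p. - ext_deriv \<theta> X Y p)"

text \<open>Closedness of \<open>\<omega> = -\<^bold>d\<theta>\<close> is automatic, so that being symplectic amounts to nondegeneracy
  at each point.  Every tangent vector extends to a vector field, and the value of a two-form at \<open>p\<close>
  only depends on the values of its arguments at \<open>p\<close>.\<close>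

definition exact_symplectic ::
    "('p::{t2_space, second_countable_topology}, 'e::real_normed_vector) chart set \<Rightarrow>
     ('p \<Rightarrow> 'p tvec \<Rightarrow> real) \<Rightarrow> bool" where
  "exact_symplectic A \<theta> \<longleftrightarrow> smooth_manifold A \<and> \<theta> \<in> one_forms A \<and>
     (\<forall>p. \<forall>X\<in>vector_fields A. (\<forall>Y\<in>vector_fields A. symp \<theta> X Y p = 0) \<longrightarrow> X p = (\<lambda>f. 0))"

text \<open>\<open>is_ham_vf A \<theta> h X\<close> says that \<open>X = X\<^sub>h\<close>, i.e. \<open>\<^bold>i\<^sub>X \<omega> = \<^bold>dh\<close>.\<close>

definition is_ham_vf ::
    "('p::topological_space, 'e::real_normed_vector) chart set \<Rightarrow> ('p \<Rightarrow> 'p tvec \<Rightarrow> real) \<Rightarrow>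
     ('p \<Rightarrow> real) \<Rightarrow> ('p \<Rightarrow> 'p tvec) \<Rightarrow> bool" where
  "is_ham_vf A \<theta> h X \<longleftrightarrow> X \<in> vector_fields A \<and>
     (\<forall>Y\<in>vector_fields A. \<forall>p. symp \<theta> X Y p = differential h p (Y p))"

text \<open>Hamiltonian diffeomorphisms are the time-one maps of isotopies generated by smooth time-dependent
  Hamiltonians, without any condition on supports.  Isotopies parametrized by \<open>[0, 1]\<close> can be
  reparametrized so as to extend smoothly to all times, whence time ranges over the reals.\<close>

definition Diff_ham ::
    "('p::topological_space, 'e::real_normed_vector) chart set \<Rightarrow> ('p \<Rightarrow> 'p tvec \<Rightarrow> real) \<Rightarrow>
     ('p \<Rightarrow> 'p) set" where
  "Diff_ham A \<theta> = {\<phi>. \<exists>c h X.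
     smooth_family A A c \<and> (\<forall>t. diffeomorphism A (c t)) \<and> c 0 = id \<and> c 1 = \<phi> \<and>
     smooth_family A (model_atlas :: (real, real) chart set) h \<and> (\<forall>t. is_ham_vf A \<theta> (h t) (X t)) \<and>
     (\<forall>t p. \<forall>f\<in>smooth_fun A. ((\<lambda>s. f (c s p)) has_real_derivative X t (c t p) f) (at t))}"

section \<open>Lie groups and principal bundles\<close>

definition lie_group ::
    "('g::{t2_space, second_countable_topology}, 'l::real_normed_vector) chart set \<Rightarrow> 'g monoid \<Rightarrow> bool" where
  "lie_group L G \<longleftrightarrow> smooth_manifold L \<and> group G \<and> carrier G = UNIV \<and>
     smooth_map (prod_atlas L L) L (\<lambda>(a, b). a \<otimes>\<^bsub>G\<^esub> b) \<and> smooth_map L L (\<lambda>a. inv\<^bsub>G\<^esub> a)"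

definition smooth_right_action ::
    "('p::topological_space, 'e::real_normed_vector) chart set \<Rightarrow>
     ('g::topological_space, 'l::real_normed_vector) chart set \<Rightarrow> 'g monoid \<Rightarrow> ('g \<Rightarrow> 'p \<Rightarrow> 'p) \<Rightarrow> bool" where
  "smooth_right_action A L G \<Phi> \<longleftrightarrow>
     \<Phi> \<one>\<^bsub>G\<^esub> = id \<and> (\<forall>a b. \<Phi> (a \<otimes>\<^bsub>G\<^esub> b) = \<Phi> b \<circ> \<Phi> a) \<and>
     smooth_map (prod_atlas A L) A (\<lambda>(p, g). \<Phi> g p)"

text \<open>A local trivialization is given by its second component \<open>\<tau>\<close>: the map
  \<open>p \<mapsto> (\<pi> p, \<tau> p)\<close> is an equivariant diffeomorphism from \<open>\<pi>\<^sup>-\<^sup>1(U)\<close> onto \<open>U \<times> G\<close>.\<close>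

definition principal_bundle ::
    "('p::{t2_space, second_countable_topology}, 'e::real_normed_vector) chart set \<Rightarrow>
     ('m::{t2_space, second_countable_topology}, 'b::real_normed_vector) chart set \<Rightarrow>
     ('g::{t2_space, second_countable_topology}, 'l::real_normed_vector) chart set \<Rightarrow> 'g monoid \<Rightarrow>
     ('p \<Rightarrow> 'm) \<Rightarrow> ('g \<Rightarrow> 'p \<Rightarrow> 'p) \<Rightarrow> bool" where
  "principal_bundle A M L G \<pi> \<Phi> \<longleftrightarrow>
     smooth_manifold A \<and> smooth_manifold M \<and> lie_group L G \<and> smooth_right_action A L G \<Phi> \<and>
     smooth_map A M \<pi> \<and> (\<forall>g p. \<pi> (\<Phi> g p) = \<pi> p) \<and>
     (\<forall>m. \<exists>U \<tau>. open U \<and> m \<in> U \<and>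
        smooth_map_on (\<pi> -` U) A L \<tau> \<and>
        (\<forall>p\<in>\<pi> -` U. \<forall>g. \<tau> (\<Phi> g p) = \<tau> p \<otimes>\<^bsub>G\<^esub> g) \<and>
        bij_betw (\<lambda>p. (\<pi> p, \<tau> p)) (\<pi> -` U) (U \<times> UNIV) \<and>
        smooth_map_on (U \<times> UNIV) (prod_atlas M L) A (inv_into (\<pi> -` U) (\<lambda>p. (\<pi> p, \<tau> p))))"

definition invariant_fun ::
    "('p::topological_space, 'e::real_normed_vector) chart set \<Rightarrow> ('g \<Rightarrow> 'p \<Rightarrow> 'p) \<Rightarrow> ('p \<Rightarrow> real) set" where
  "invariant_fun A \<Phi> = {h \<in> smooth_fun A. \<forall>g. h \<circ> \<Phi> g = h}"

definition invariant_one_forms ::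
    "('p::topological_space, 'e::real_normed_vector) chart set \<Rightarrow> ('g \<Rightarrow> 'p \<Rightarrow> 'p) \<Rightarrow>
     ('p \<Rightarrow> 'p tvec \<Rightarrow> real) set" where
  "invariant_one_forms A \<Phi> =
     {\<alpha> \<in> one_forms A. \<forall>g p. \<forall>v\<in>tangent_space A p. pullback A (\<Phi> g) \<alpha> p v = \<alpha> p v}"

section \<open>Equivariant Hamiltonian diffeomorphisms and the map \<open>\<Psi>\<close>\<close>

definition Aut ::
    "('p::topological_space, 'e::real_normed_vector) chart set \<Rightarrow> ('g \<Rightarrow> 'p \<Rightarrow> 'p) \<Rightarrow> ('p \<Rightarrow> 'p) set" where
  "Aut A \<Phi> = {\<phi>. diffeomorphism A \<phi> \<and> (\<forall>g. \<phi> \<circ> \<Phi> g = \<Phi> g \<circ> \<phi>)}"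

definition Aut_ham ::
    "('p::topological_space, 'e::real_normed_vector) chart set \<Rightarrow> ('p \<Rightarrow> 'p tvec \<Rightarrow> real) \<Rightarrow>
     ('g \<Rightarrow> 'p \<Rightarrow> 'p) \<Rightarrow> ('p \<Rightarrow> 'p) monoid" where
  "Aut_ham A \<theta> \<Phi> = \<lparr>carrier = Aut A \<Phi> \<inter> Diff_ham A \<theta>, mult = (\<circ>), one = id\<rparr>"

definition real_add_group :: "real monoid" where
  "real_add_group = \<lparr>carrier = UNIV, mult = (+), one = 0\<rparr>"

text \<open>Abstract group homomorphisms, not required to be continuous, with pointwise addition.\<close>

definition Hom_real :: "'g monoid \<Rightarrow> ('g \<Rightarrow> real) monoid" where
  "Hom_real G = \<lparr>carrier = hom G real_add_group, mult = (\<lambda>u w g. u g + w g), one = (\<lambda>g. 0)\<rparr>"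

text \<open>\<open>primitive A \<theta> \<phi> F\<close> says that \<open>F\<close> is a possible choice of \<open>F\<^sub>\<phi>\<close>.\<close>

definition primitive ::
    "('p::topological_space, 'e::real_normed_vector) chart set \<Rightarrow> ('p \<Rightarrow> 'p tvec \<Rightarrow> real) \<Rightarrow>
     ('p \<Rightarrow> 'p) \<Rightarrow> ('p \<Rightarrow> real) \<Rightarrow> bool" where
  "primitive A \<theta> \<phi> F \<longleftrightarrow> F \<in> smooth_fun A \<and>
     (\<forall>p. \<forall>v\<in>tangent_space A p. differential F p v = pullback A \<phi> \<theta> p v - \<theta> p v)"

definition Psi ::
    "('p::topological_space, 'e::real_normed_vector) chart set \<Rightarrow> ('p \<Rightarrow> 'p tvec \<Rightarrow> real) \<Rightarrow>
     ('g \<Rightarrow> 'p \<Rightarrow> 'p) \<Rightarrow> ('p \<Rightarrow> 'p) \<Rightarrow> 'g \<Rightarrow> real" where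
  "Psi A \<theta> \<Phi> \<phi> g = (THE r. \<forall>F. primitive A \<theta> \<phi> F \<longrightarrow> (\<forall>p. F p - F (\<Phi> g p) = r))"

section \<open>The formal Lie algebra of the kernel of \<open>\<Psi>\<close>\<close>

definition aut_ham ::
    "('p::topological_space, 'e::real_normed_vector) chart set \<Rightarrow> ('p \<Rightarrow> 'p tvec \<Rightarrow> real) \<Rightarrow>
     ('g \<Rightarrow> 'p \<Rightarrow> 'p) \<Rightarrow> ('p \<Rightarrow> 'p tvec) set" where
  "aut_ham A \<theta> \<Phi> = {X. (\<exists>h\<in>smooth_fun A. is_ham_vf A \<theta> h X) \<and>
     (\<forall>g p. pushforward A (\<Phi> g) (X p) = X (\<Phi> g p))}"

text \<open>\<open>Aut_ham_curve A \<theta> \<Phi> X c\<close>: \<open>c\<close> is a smooth curve of equivariant Hamiltonian diffeomorphisms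
  through the identity with initial velocity \<open>X\<close>.\<close>

definition Aut_ham_curve ::
    "('p::topological_space, 'e::real_normed_vector) chart set \<Rightarrow> ('p \<Rightarrow> 'p tvec \<Rightarrow> real) \<Rightarrow>
     ('g \<Rightarrow> 'p \<Rightarrow> 'p) \<Rightarrow> ('p \<Rightarrow> 'p tvec) \<Rightarrow> (real \<Rightarrow> 'p \<Rightarrow> 'p) \<Rightarrow> bool" where
  "Aut_ham_curve A \<theta> \<Phi> X c \<longleftrightarrow>
     smooth_family A A c \<and> (\<forall>t. c t \<in> carrier (Aut_ham A \<theta> \<Phi>)) \<and> c 0 = id \<and>
     (\<forall>p. \<forall>f\<in>smooth_fun A. ((\<lambda>t. f (c t p)) has_real_derivative X p f) (at 0))"

definition beta ::
    "('p::topological_space, 'e::real_normed_vector) chart set \<Rightarrow> ('p \<Rightarrow> 'p tvec \<Rightarrow> real) \<Rightarrow>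
     ('g \<Rightarrow> 'p \<Rightarrow> 'p) \<Rightarrow> ('p \<Rightarrow> 'p tvec) \<Rightarrow> 'g \<Rightarrow> real" where
  "beta A \<theta> \<Phi> X g = (THE b. \<forall>c. Aut_ham_curve A \<theta> \<Phi> X c \<longrightarrow>
     ((\<lambda>t. Psi A \<theta> \<Phi> (c t) g) has_real_derivative b) (at 0))"

text \<open>As \<open>\<beta>(X)\<close> is defined through a curve with velocity \<open>X\<close>, an element of the kernel of \<open>\<beta>\<close> has to
  be the velocity of some curve.  On a noncompact \<open>P\<close> there may be equivariant Hamiltonian vector
  fields which are not: take \<open>P = {(q, p). 0 < q < 1}\<close> with \<open>\<theta> = -q \<^bold>dp\<close>, the group of integers acting
  by translation of \<open>p\<close>, and \<open>h = p\<close>.\<close>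

definition formal_lie_algebra_ker_Psi ::
    "('p::topological_space, 'e::real_normed_vector) chart set \<Rightarrow> ('p \<Rightarrow> 'p tvec \<Rightarrow> real) \<Rightarrow>
     ('g \<Rightarrow> 'p \<Rightarrow> 'p) \<Rightarrow> ('p \<Rightarrow> 'p tvec) set" where
  "formal_lie_algebra_ker_Psi A \<theta> \<Phi> =
     {X \<in> aut_ham A \<theta> \<Phi>. (\<exists>c. Aut_ham_curve A \<theta> \<Phi> X c) \<and> beta A \<theta> \<Phi> X = (\<lambda>g. 0)}"

end

theory Submission
  imports Defs
begin

text \<open>Integrating Cartan's formula along a Hamiltonian isotopy gives a primitive \<open>F\<close> of \<open>\<phi>\<^sup>*\<theta> - \<theta>\<close>;
  by the invariance of \<open>\<theta>\<close> and \<open>\<phi> \<circ> \<Phi>\<^sub>g = \<Phi>\<^sub>g \<circ> \<phi>\<close>, the differential of \<open>F - F \<circ> \<Phi>\<^sub>g\<close> vanishes.  As \<open>F \<circ> \<psi> + F'\<close> is a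
  primitive for \<open>\<phi> \<circ> \<psi>\<close> if \<open>F\<close> and \<open>F'\<close> are primitives for \<open>\<phi>\<close> and \<open>\<psi>\<close>, \<open>\<Psi>\<close> is a homomorphism.  Since \<open>\<theta>(X)\<close> is
  invariant for equivariant \<open>X\<close>, differentiation of \<open>\<Psi>\<close> along a curve with velocity \<open>X\<^sub>h\<close> gives
  \<open>\<beta>(X\<^sub>h)(g) = h \<circ> \<Phi>\<^sub>g - h\<close>, which vanishes for all \<open>g\<close> iff \<open>h\<close> is invariant.

  It remains to find a curve of automorphisms with velocity \<open>X\<^sub>h\<close> for an invariant \<open>h\<close>, although \<open>X\<^sub>h\<close> may be
  incomplete.  With a proper function \<open>r\<close> on the base, \<open>h\<close> is the sum of two invariant functions which
  vanish near the sets \<open>{r \<circ> \<pi> \<in> 2\<int> + 1}\<close> and \<open>{r \<circ> \<pi> \<in> 2\<int>}\<close>, respectively.  The integral curves of their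
  Hamiltonian vector fields cannot cross these sets, so they stay over a compact part of the base, where
  equivariance bounds their life times from below.  Hence both fields are complete, and the composition of
  their flows is the required curve.\<close>

section \<open>Finite-dimensional normed spaces\<close>

text \<open>The model spaces are normed spaces of any finite dimension, zero included, so the
  analysis rests on coordinates in a chosen basis: derivatives in moving directions and
  antiderivatives are reduced to finitely many scalar functions.

  Two features of the definitions shape the rest. Tangent vectors are derivations, so the components
  of a field have to be recovered through Hadamard's lemma and bump functions. And a curve in the
  automorphism group consists of maps each of which has its own, unrelated Hamiltonian isotopy;
  hence the primitives \<open>F t\<close> along it are arbitrary choices without any regularity in
  \<open>t\<close>. Only differences \<open>F t b - F t a\<close>, integrals of a known differential
  along paths, can be differentiated. As \<Psi> is itself such a difference, its derivative exists,
  and it depends on the velocity at time 0 alone.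

  Splitting \<open>h\<close> into two summands is enough because velocities at the identity add
  under composition, whether or not the two flows commute.\<close>

definition fin_dim :: "'e::real_normed_vector itself \<Rightarrow> bool" where
  "fin_dim _ \<longleftrightarrow> (\<exists>B::'e set. finite B \<and> span B = UNIV)"

text \<open>One basis is fixed by choice for each type, so that coordinates are available
  throughout; it is meaningful under \<open>fin_dim\<close>.\<close>

definition fbasis :: "'e::real_normed_vector set" where
  "fbasis = (SOME B. finite B \<and> independent B \<and> span B = UNIV)"

definition crd :: "'e::real_normed_vector \<Rightarrow> 'e \<Rightarrow> real" where
  "crd b x = representation fbasis x b"

lemma fbasis:
  assumes "fin_dim TYPE('e::real_normed_vector)"
  shows "finite (fbasis :: 'e set)" "independent (fbasis :: 'e set)" "span (fbasis :: 'e set) = UNIV"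
proof -
  obtain B :: "'e set" where B: "finite B" "span B = UNIV"
    using assms by (auto simp: fin_dim_def)
  obtain B' where "B' \<subseteq> B" "independent B'" "B \<subseteq> span B'"
    using maximal_independent_subset by blast
  then have "finite B' \<and> independent B' \<and> span B' = UNIV"
    using B by (metis finite_subset span_mono span_span top.extremum_uniqueI)
  then have "\<exists>B::'e set. finite B \<and> independent B \<and> span B = UNIV" by blast
  from someI_ex[OF this]
  show "finite (fbasis :: 'e set)" "independent (fbasis :: 'e set)" "span (fbasis :: 'e set) = UNIV"
    unfolding fbasis_def by auto
qed

lemma crd_expand:
  assumes "fin_dim TYPE('e::real_normed_vector)"
  shows "(\<Sum>b\<in>fbasis. crd b x *\<^sub>R b) = (x::'e)"
  unfolding crd_def
  by (rule sum_representation_eq) (use fbasis[OF assms] in auto)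

lemma linear_crd:
  assumes "fin_dim TYPE('e::real_normed_vector)"
  shows "linear (crd (b::'e))"
  unfolding crd_def
  by (intro linearI) (use fbasis[OF assms] in \<open>auto simp: representation_add representation_scale\<close>)

lemma crd_basis:
  assumes "fin_dim TYPE('e::real_normed_vector)" "b' \<in> (fbasis :: 'e set)"
  shows "crd b b' = (if b = b' then 1 else 0)"
  unfolding crd_def using representation_basis[OF fbasis(2)[OF assms(1)] assms(2)] by auto

text \<open>The box is built one basis vector at a time, as the Minkowski sum of a segment and a
  smaller box. This gives compactness before any comparison of norms is available.\<close>

lemma compact_coordinate_box:
  assumes "finite B"
  shows "compact ((\<lambda>a. \<Sum>b\<in>B. a b *\<^sub>R (b::'e::real_normed_vector)) ` {a. \<forall>b\<in>B. \<bar>a b\<bar> \<le> r})"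
  using assms
proof (induction B)
  case empty
  then show ?case by (simp add: image_constant_conv)
next
  case (insert b B)
  let ?K = "(\<lambda>a. \<Sum>b\<in>B. a b *\<^sub>R b) ` {a. \<forall>b\<in>B. \<bar>a b\<bar> \<le> r}"
  have c: "compact ((\<lambda>c. c *\<^sub>R b) ` {-r..r})"
    by (intro compact_continuous_image continuous_intros) auto
  have "(\<lambda>a. \<Sum>b\<in>insert b B. a b *\<^sub>R b) ` {a. \<forall>b\<in>insert b B. \<bar>a b\<bar> \<le> r}
      = {x + y | x y. x \<in> (\<lambda>c. c *\<^sub>R b) ` {-r..r} \<and> y \<in> ?K}" (is "?L = ?R")
  proof
    show "?L \<subseteq> ?R"
    proof
      fix z assume "z \<in> ?L"
      then obtain a where a: "\<forall>b\<in>insert b B. \<bar>a b\<bar> \<le> r" "z = (\<Sum>b\<in>insert b B. a b *\<^sub>R b)" by blast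
      have "a b *\<^sub>R b \<in> (\<lambda>c. c *\<^sub>R b) ` {-r..r}" "(\<Sum>b\<in>B. a b *\<^sub>R b) \<in> ?K"
        using a(1) by (auto simp: abs_le_iff)
      moreover have "z = a b *\<^sub>R b + (\<Sum>b\<in>B. a b *\<^sub>R b)"
        using a(2) insert.hyps by simp
      ultimately show "z \<in> ?R" by blast
    qed
    show "?R \<subseteq> ?L"
    proof
      fix z assume "z \<in> ?R"
      then obtain c a where ca: "c \<in> {-r..r}" "\<forall>b\<in>B. \<bar>a b\<bar> \<le> r" "z = c *\<^sub>R b + (\<Sum>b\<in>B. a b *\<^sub>R b)" by blast
      have "(\<Sum>x\<in>insert b B. (a(b := c)) x *\<^sub>R x) = (a(b := c)) b *\<^sub>R b + (\<Sum>x\<in>B. (a(b := c)) x *\<^sub>R x)"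
        using insert.hyps by (rule sum.insert)
      also have "(\<Sum>x\<in>B. (a(b := c)) x *\<^sub>R x) = (\<Sum>x\<in>B. a x *\<^sub>R x)"
        using insert.hyps by (intro sum.cong) auto
      finally show "z \<in> ?L"
        using ca by (intro image_eqI[of _ _ "a(b := c)"]) auto
    qed
  qed
  then show ?case
    using compact_sums[OF c insert.IH] by simp
qed

text \<open>Dividing a nonzero vector by its largest coordinate puts it into the compact set
  \<open>S\<close> of points with one coordinate equal to 1 and the others of modulus at most 1. As
  \<open>S\<close> misses 0, the norm has a positive lower bound there, and homogeneity carries the
  bound back.\<close>

lemma norm_equivalence:
  assumes fd: "fin_dim TYPE('e::real_normed_vector)"
  shows "\<exists>C>0. \<forall>(x::'e) b. \<bar>crd b x\<bar> \<le> C * norm x"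
proof (cases "fbasis = ({} :: 'e set)")
  case True
  have "x = 0" for x :: 'e using crd_expand[OF fd, of x] True by simp
  then have "crd b x = 0" for x b :: 'e
    using linear_0[OF linear_crd[OF fd]] by metis
  then show ?thesis by (intro exI[of _ 1]) auto
next
  case False
  note B = fbasis[OF fd]
  define K where "K b = (\<lambda>a. \<Sum>x\<in>fbasis - {b}. a x *\<^sub>R x) ` {a. \<forall>x\<in>fbasis - {b}. \<bar>a x\<bar> \<le> 1}" for b :: 'e
  have K: "compact (K b)" for b unfolding K_def by (rule compact_coordinate_box) (use B in auto)
  define S where "S = (\<Union>b\<in>fbasis. (+) b ` K b)"
  have cS: "compact S" unfolding S_def
    by (intro compact_UN B compact_translation K)
  have Sspan: "\<exists>b\<in>fbasis. crd b z = 1" if "z \<in> S" for z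
  proof -
    from that obtain b a where b: "b \<in> fbasis" "z = b + (\<Sum>x\<in>fbasis - {b}. a x *\<^sub>R x)"
      unfolding S_def K_def by auto
    have "crd b z = crd b b + (\<Sum>x\<in>fbasis - {b}. a x * crd b x)"
      unfolding b(2) linear_add[OF linear_crd[OF fd]] linear_sum[OF linear_crd[OF fd]]
      by (simp add: linear_cmul[OF linear_crd[OF fd]])
    also have "(\<Sum>x\<in>fbasis - {b}. a x * crd b x) = 0"
      by (intro sum.neutral) (auto simp: crd_basis[OF fd])
    finally show ?thesis using b crd_basis[OF fd, of b b] by auto
  qed
  have "0 \<notin> S" using Sspan linear_0[OF linear_crd[OF fd]] by fastforce
  then obtain e where e: "e > 0" "\<And>z. z \<in> S \<Longrightarrow> e \<le> norm z"
  proof (cases "S = {}")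
    case False
    then obtain z where z: "z \<in> S" "\<And>y. y \<in> S \<Longrightarrow> norm z \<le> norm y"
      using continuous_attains_inf[OF cS, of norm] by (auto intro: continuous_intros)
    with \<open>0 \<notin> S\<close> have "norm z > 0" by auto
    with z that show ?thesis by blast
  qed (use that[of 1] in auto)
  have main: "\<bar>crd b x\<bar> \<le> (1/e) * norm x" for x b :: 'e
  proof -
    define m where "m = Max ((\<lambda>b. \<bar>crd b x\<bar>) ` fbasis)"
    have m: "\<bar>crd b x\<bar> \<le> m" if "b \<in> fbasis" for b
      unfolding m_def using that B by (intro Max_ge) auto
    have "m \<in> (\<lambda>b. \<bar>crd b x\<bar>) ` fbasis"
      unfolding m_def using B False by (intro Max_in) auto
    then obtain c where c: "c \<in> fbasis" "m = \<bar>crd c x\<bar>" by auto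
    have le: "m \<le> (1/e) * norm x"
    proof (cases "m = 0")
      case True then show ?thesis using e by simp
    next
      case False
      let ?z = "(1 / crd c x) *\<^sub>R x"
      have "?z = (\<Sum>b\<in>fbasis. (crd b x / crd c x) *\<^sub>R b)"
        by (subst crd_expand[OF fd, of x, symmetric]) (simp add: scaleR_sum_right)
      also have "\<dots> = c + (\<Sum>b\<in>fbasis - {c}. (crd b x / crd c x) *\<^sub>R b)"
        using False c by (subst sum.remove[OF B(1) c(1)]) auto
      finally have "?z = c + (\<Sum>b\<in>fbasis - {c}. (crd b x / crd c x) *\<^sub>R b)" .
      moreover have "(\<Sum>b\<in>fbasis - {c}. (crd b x / crd c x) *\<^sub>R b) \<in> K c"
        unfolding K_def using m c False
        by (intro imageI) (auto simp: divide_le_eq)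
      ultimately have "?z \<in> S" unfolding S_def using c by (intro UN_I[of c]) auto
      then have "e \<le> norm ?z" by (rule e)
      then show ?thesis using False c e by (simp add: field_simps)
    qed
    show ?thesis
    proof (cases "b \<in> fbasis")
      case True then show ?thesis using m le by force
    next
      case False
      then have "crd b x = 0" unfolding crd_def by (metis representation_ne_zero)
      then show ?thesis using e by simp
    qed
  qed
  then show ?thesis using e by (intro exI[of _ "1/e"]) auto
qed

lemma bounded_linear_crd:
  assumes "fin_dim TYPE('e::real_normed_vector)"
  shows "bounded_linear (crd (b::'e))"
proof -
  obtain C where "\<forall>(x::'e) b. \<bar>crd b x\<bar> \<le> C * norm x" using norm_equivalence[OF assms] by auto
  then have "\<bar>crd b x\<bar> \<le> norm x * C" for x :: 'e by (simp add: mult.commute)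
  then show ?thesis
    using linear_crd[OF assms, of b] unfolding bounded_linear_def bounded_linear_axioms_def
    by (auto simp: linear_def)
qed

lemma linear_eq_sum_basis:
  assumes "fin_dim TYPE('e::real_normed_vector)" "linear (f::'e \<Rightarrow> 'f::real_normed_vector)"
  shows "f x = (\<Sum>b\<in>fbasis. crd b x *\<^sub>R f b)"
  by (subst crd_expand[OF assms(1), of x, symmetric])
     (simp add: linear_sum[OF assms(2)] linear_cmul[OF assms(2)])

lemma linear_imp_bounded_linear:
  assumes "fin_dim TYPE('e::real_normed_vector)" "linear (f::'e \<Rightarrow> 'f::real_normed_vector)"
  shows "bounded_linear f"
proof -
  have "f = (\<lambda>x. \<Sum>b\<in>fbasis. crd b x *\<^sub>R f b)"
    by (intro ext) (rule linear_eq_sum_basis[OF assms])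
  moreover have "bounded_linear (\<lambda>x. \<Sum>b\<in>fbasis. crd b x *\<^sub>R f b)"
    by (intro bounded_linear_sum bounded_linear_scaleR_const bounded_linear_crd assms)
  ultimately show ?thesis by simp
qed

text \<open>Bounded coordinates confine the set to a coordinate box, which is compact.\<close>

lemma fin_dim_closed_bounded_compact:
  assumes fd: "fin_dim TYPE('e::real_normed_vector)" and "closed S" "bounded (S::'e set)"
  shows "compact S"
proof -
  obtain C where C: "\<forall>(x::'e) b. \<bar>crd b x\<bar> \<le> C * norm x" "C > 0" using norm_equivalence[OF fd] by auto
  obtain D where D: "\<forall>x\<in>S. norm x \<le> D" using assms(3) by (auto simp: bounded_iff)
  let ?K = "(\<lambda>a. \<Sum>b\<in>fbasis. a b *\<^sub>R (b::'e)) ` {a. \<forall>b\<in>fbasis. \<bar>a b\<bar> \<le> C * D}"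
  have "x \<in> ?K" if "x \<in> S" for x
  proof -
    have "\<bar>crd b x\<bar> \<le> C * D" for b
      using C D that by (metis mult_left_mono order_trans less_imp_le)
    then show ?thesis by (intro image_eqI[where x = "\<lambda>b. crd b x"]) (auto simp: crd_expand[OF fd])
  qed
  then have "S \<inter> ?K = S" by blast
  moreover have "compact (S \<inter> ?K)"
    by (rule closed_Int_compact[OF assms(2) compact_coordinate_box[OF fbasis(1)[OF fd]]])
  ultimately show ?thesis by simp
qed

text \<open>A Cauchy sequence is bounded, hence lies in a compact ball.\<close>

lemma fin_dim_complete:
  assumes fd: "fin_dim TYPE('e::real_normed_vector)"
  shows "complete (UNIV::'e set)"
  unfolding complete_def
proof (intro allI impI)
  fix f :: "nat \<Rightarrow> 'e" assume "(\<forall>n. f n \<in> UNIV) \<and> Cauchy f"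
  then have f: "Cauchy f" by simp
  then obtain D where "\<forall>x\<in>range f. norm x \<le> D" using cauchy_imp_bounded[OF f] unfolding bounded_iff by blast
  then have D: "range f \<subseteq> cball 0 D" by auto
  have "bounded (cball (0::'e) D)" unfolding bounded_def by (intro exI[of _ 0] exI[of _ D]) auto
  then have "complete (cball (0::'e) D)"
    by (intro compact_imp_complete fin_dim_closed_bounded_compact fd) auto
  then show "\<exists>l\<in>UNIV. f \<longlonglongrightarrow> l" using D f unfolding complete_def by blast
qed

lemma fin_dim_real: "fin_dim TYPE(real)"
  unfolding fin_dim_def
proof (intro exI[of _ "{1::real}"] conjI)
  have "x \<in> span {1::real}" for x :: real
    using span_scale[OF span_base, of 1 "{1::real}" x] by simp
  then show "span {1::real} = UNIV" by auto
qed simp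

lemma fin_dim_prod:
  assumes "fin_dim TYPE('a::real_normed_vector)" "fin_dim TYPE('b::real_normed_vector)"
  shows "fin_dim TYPE('a \<times> 'b)"
proof -
  obtain A :: "'a set" where A: "finite A" "span A = UNIV" using assms(1) by (auto simp: fin_dim_def)
  obtain B :: "'b set" where B: "finite B" "span B = UNIV" using assms(2) by (auto simp: fin_dim_def)
  let ?C = "(\<lambda>a. (a, 0)) ` A \<union> (\<lambda>b. (0, b)) ` B"
  have 1: "linear (\<lambda>a::'a. (a, 0::'b))" "linear (\<lambda>b::'b. (0::'a, b))" by (auto intro!: linearI)
  have 2: "(a, 0) \<in> span ?C" for a
  proof -
    have "(a, 0) \<in> (\<lambda>a. (a, 0::'b)) ` span A" using A by simp
    also have "\<dots> = span ((\<lambda>a. (a, 0)) ` A)" using 1(1) by (simp add: linear_span_image)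
    also have "\<dots> \<subseteq> span ?C" by (rule span_mono) simp
    finally show ?thesis .
  qed
  have 3: "(0, b) \<in> span ?C" for b
  proof -
    have "(0, b) \<in> (\<lambda>b. (0::'a, b)) ` span B" using B by simp
    also have "\<dots> = span ((\<lambda>b. (0, b)) ` B)" using 1(2) by (simp add: linear_span_image)
    also have "\<dots> \<subseteq> span ?C" by (rule span_mono) simp
    finally show ?thesis .
  qed
  have "(a, b) \<in> span ?C" for a b using span_add[OF 2 3, of a b] by simp
  then have "span ?C = UNIV" by auto
  then show ?thesis using A B unfolding fin_dim_def by (intro exI[of _ ?C]) auto
qed

section \<open>The calculus of smooth maps\<close>

lemma Ck_on_cong:
  assumes "open S" "\<And>x. x \<in> S \<Longrightarrow> f x = g x" "Ck_on n S f"
  shows "Ck_on n S g"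
  using assms(2,3)
proof (induction n arbitrary: f g)
  case 0 then show ?case by (metis Ck_on.simps(1) continuous_on_cong)
next
  case (Suc n)
  have d: "(g has_derivative frechet_derivative f (at x)) (at x)" if "x \<in> S" for x
    using Suc.prems that assms(1)
    by (metis Ck_on.simps(2) frechet_derivative_works has_derivative_transform_within_open)
  then have "frechet_derivative g (at x) = frechet_derivative f (at x)" if "x \<in> S" for x
    using that frechet_derivative_at by metis
  then have "Ck_on n S (\<lambda>x. frechet_derivative g (at x) v)" for v
    using Suc.IH[of "\<lambda>x. frechet_derivative f (at x) v" "\<lambda>x. frechet_derivative g (at x) v"] Suc.prems(2)
    by simp
  then show ?case using d by (auto simp: differentiable_def)
qed

lemma Ck_on_SucI:
  assumes "open S" "\<And>x. x \<in> S \<Longrightarrow> (f has_derivative f' x) (at x)" "\<And>v. Ck_on n S (\<lambda>x. f' x v)"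
  shows "Ck_on (Suc n) S f"
proof -
  have "frechet_derivative f (at x) = f' x" if "x \<in> S" for x
    using frechet_derivative_at[OF assms(2)[OF that]] by simp
  then have "Ck_on n S (\<lambda>x. frechet_derivative f (at x) v)" for v
    using Ck_on_cong[OF assms(1) _ assms(3)[of v]] by simp
  then show ?thesis using assms(2) by (auto simp: differentiable_def)
qed

lemma frechet_derivative_worksI:
  "f differentiable net \<Longrightarrow> (f has_derivative frechet_derivative f net) net"
  by (simp add: frechet_derivative_works)

lemma Ck_on_has_derivative:
  "Ck_on (Suc n) S f \<Longrightarrow> x \<in> S \<Longrightarrow> (f has_derivative frechet_derivative f (at x)) (at x)"
  by (simp add: frechet_derivative_worksI)

lemma Ck_on_imp_continuous_on: "open S \<Longrightarrow> Ck_on n S f \<Longrightarrow> continuous_on S f"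
  by (cases n) (auto simp: continuous_on_eq_continuous_at differentiable_imp_continuous_within)

lemma Ck_on_SucD: "open S \<Longrightarrow> Ck_on (Suc n) S f \<Longrightarrow> Ck_on n S f"
proof (induction n arbitrary: f)
  case 0 then show ?case using Ck_on_imp_continuous_on[of S "Suc 0" f] by simp
next
  case (Suc n)
  then have "Ck_on n S (\<lambda>x. frechet_derivative f (at x) v)" for v by (intro Suc.IH) simp_all
  with Suc.prems show ?case by simp
qed

lemma Ck_on_mono: "open S \<Longrightarrow> Ck_on n S f \<Longrightarrow> m \<le> n \<Longrightarrow> Ck_on m S f"
proof (induction n)
  case (Suc n) then show ?case using Ck_on_SucD[of S n f] by (cases "m = Suc n") simp_all
qed simp

lemma Ck_on_subset: "Ck_on n S f \<Longrightarrow> T \<subseteq> S \<Longrightarrow> Ck_on n T f"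
proof (induction n arbitrary: f)
  case 0 then show ?case using continuous_on_subset by auto
next
  case (Suc n) then show ?case by (simp add: subset_iff)
qed

lemma Ck_on_local:
  assumes "open S" "\<And>x. x \<in> S \<Longrightarrow> \<exists>N. open N \<and> x \<in> N \<and> Ck_on n (N \<inter> S) f"
  shows "Ck_on n S f"
  using assms(2)
proof (induction n arbitrary: f)
  case 0
  have "isCont f x" if "x \<in> S" for x
    using 0[OF that] that assms(1) by (metis Ck_on.simps(1) IntI continuous_on_eq_continuous_at open_Int)
  then show ?case by (simp add: continuous_at_imp_continuous_on)
next
  case (Suc n)
  have "f differentiable at x" if "x \<in> S" for x using Suc.prems[OF that] that by auto
  moreover have "Ck_on n S (\<lambda>x. frechet_derivative f (at x) v)" for v
  proof (rule Suc.IH)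
    fix x assume "x \<in> S"
    then obtain N where "open N" "x \<in> N" "Ck_on (Suc n) (N \<inter> S) f" using Suc.prems by blast
    then show "\<exists>N. open N \<and> x \<in> N \<and> Ck_on n (N \<inter> S) (\<lambda>x. frechet_derivative f (at x) v)"
      by (intro exI[of _ N]) auto
  qed
  ultimately show ?case by simp
qed

lemma Ck_on_const: "Ck_on n S (\<lambda>x. c)"
proof (induction n arbitrary: c)
  case (Suc n) then show ?case by (simp add: frechet_derivative_const)
qed simp

lemma Ck_on_bounded_linear: "open S \<Longrightarrow> bounded_linear f \<Longrightarrow> Ck_on n S f"
proof (cases n)
  case 0 then show "bounded_linear f \<Longrightarrow> Ck_on n S f" by (simp add: linear_continuous_on)
next
  case (Suc m)
  assume "open S" "bounded_linear f"
  then show "Ck_on n S f" unfolding Suc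
    by (intro Ck_on_SucI[where f' = "\<lambda>_. f"] Ck_on_const bounded_linear_imp_has_derivative)
qed

lemma Ck_on_linear_compose:
  assumes "open S" "bounded_linear L" "Ck_on n S f" shows "Ck_on n S (\<lambda>x. L (f x))"
  using assms(3)
proof (induction n arbitrary: f)
  case 0 then show ?case using assms(2) by (simp add: bounded_linear.continuous_on)
next
  case (Suc n)
  show ?case
    by (rule Ck_on_SucI[where f' = "\<lambda>x v. L (frechet_derivative f (at x) v)"])
       (use assms Suc in \<open>auto intro!: bounded_linear.has_derivative[OF assms(2)] simp: frechet_derivative_worksI\<close>)
qed

lemma Ck_on_add:
  assumes "open S" "Ck_on n S f" "Ck_on n S g" shows "Ck_on n S (\<lambda>x. f x + g x)"
  using assms(2,3)
proof (induction n arbitrary: f g)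
  case 0 then show ?case by (simp add: continuous_on_add)
next
  case (Suc n)
  show ?case
    by (rule Ck_on_SucI[where f' = "\<lambda>x v. frechet_derivative f (at x) v + frechet_derivative g (at x) v"])
       (use assms Suc in \<open>auto intro!: has_derivative_add simp: frechet_derivative_worksI\<close>)
qed

lemma Ck_on_bilinear:
  assumes "open S" "bounded_bilinear pr" "Ck_on n S f" "Ck_on n S g"
  shows "Ck_on n S (\<lambda>x. pr (f x) (g x))"
  using assms(3,4)
proof (induction n arbitrary: f g)
  case 0 then show ?case using assms(2) by (simp add: bounded_bilinear.continuous_on)
next
  case (Suc n)
  have "Ck_on n S f" "Ck_on n S g" using Suc.prems assms(1) Ck_on_SucD by blast+
  then have "Ck_on n S (\<lambda>x. pr (f x) (frechet_derivative g (at x) v) + pr (frechet_derivative f (at x) v) (g x))" for v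
    using Suc by (intro Ck_on_add Suc.IH assms) auto
  then show ?case
    by (intro Ck_on_SucI[OF assms(1) bounded_bilinear.FDERIV[OF assms(2)]])
       (use Suc.prems Ck_on_has_derivative in blast)+
qed

lemma Ck_on_sum:
  assumes "open S" "\<And>i. i \<in> I \<Longrightarrow> Ck_on n S (f i)" shows "Ck_on n S (\<lambda>x. \<Sum>i\<in>I. f i x)"
  using assms(2) by (induction I rule: infinite_finite_induct) (auto intro!: Ck_on_add Ck_on_const assms(1))

lemma Ck_on_Pair:
  assumes "open S" "Ck_on n S f" "Ck_on n S g" shows "Ck_on n S (\<lambda>x. (f x, g x))"
  using assms(2,3)
proof (induction n arbitrary: f g)
  case 0 then show ?case by (simp add: continuous_on_Pair)
next
  case (Suc n)
  show ?case
    by (rule Ck_on_SucI[where f' = "\<lambda>x v. (frechet_derivative f (at x) v, frechet_derivative g (at x) v)"])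
       (use assms Suc in \<open>auto intro!: has_derivative_Pair simp: frechet_derivative_worksI\<close>)
qed

text \<open>The chain rule applies the derivative of \<open>g\<close> at a moving point to a moving
  vector. Expanding that vector in the basis leaves products of coordinates of the derivative of
  \<open>f\<close> with partial derivatives of \<open>g\<close> along \<open>f\<close>; the
  induction hypothesis applies to the latter with the partial derivative in place of
  \<open>g\<close>.\<close>

lemma Ck_on_compose:
  fixes f :: "'a::real_normed_vector \<Rightarrow> 'b::real_normed_vector" and g :: "'b \<Rightarrow> 'c::real_normed_vector"
  assumes fd: "fin_dim TYPE('b)" and S: "open S" and T: "open T" and ST: "\<And>x. x \<in> S \<Longrightarrow> f x \<in> T"
    and "Ck_on n S f" "Ck_on n T g"
  shows "Ck_on n S (\<lambda>x. g (f x))"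
  using assms(5,6)
proof (induction n arbitrary: g)
  case 0 then show ?case using ST by (auto intro!: continuous_on_compose2[of T g S f])
next
  case (Suc n)
  let ?D = "\<lambda>x v. \<Sum>b\<in>fbasis. crd b (frechet_derivative f (at x) v) *\<^sub>R frechet_derivative g (at (f x)) b"
  have "((\<lambda>x. g (f x)) has_derivative ?D x) (at x)" if "x \<in> S" for x
  proof -
    have f: "(f has_derivative frechet_derivative f (at x)) (at x)"
      using Ck_on_has_derivative[OF Suc.prems(1) that] .
    have g: "(g has_derivative frechet_derivative g (at (f x))) (at (f x))"
      using Ck_on_has_derivative[OF Suc.prems(2) ST[OF that]] .
    have expand: "frechet_derivative g (at (f x)) w = (\<Sum>b\<in>fbasis. crd b w *\<^sub>R frechet_derivative g (at (f x)) b)" for w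
      by (rule linear_eq_sum_basis[OF fd has_derivative_linear[OF g]])
    have "?D x = (\<lambda>v. frechet_derivative g (at (f x)) (frechet_derivative f (at x) v))"
      by (intro ext) (rule expand[symmetric])
    then show ?thesis using has_derivative_compose[OF f g] by simp
  qed
  moreover have "Ck_on n S (\<lambda>x. ?D x v)" for v
    using Suc.prems Ck_on_SucD[OF S Suc.prems(1)]
    by (intro Ck_on_sum Ck_on_bilinear[OF S bounded_bilinear_scaleR] Ck_on_linear_compose[OF S bounded_linear_crd[OF fd]]
        Suc.IH S) auto
  ultimately show ?case by (intro Ck_on_SucI S)
qed

section \<open>Rules for smooth maps\<close>

lemma smooth_onI: "(\<And>n. Ck_on n S f) \<Longrightarrow> smooth_on S f" by (simp add: smooth_on_def)
lemma smooth_onD: "smooth_on S f \<Longrightarrow> Ck_on n S f" by (simp add: smooth_on_def)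

lemma smooth_on_has_derivative:
  "smooth_on S f \<Longrightarrow> x \<in> S \<Longrightarrow> (f has_derivative frechet_derivative f (at x)) (at x)"
  using Ck_on_has_derivative smooth_onD by blast

lemma smooth_on_continuous_on: "open S \<Longrightarrow> smooth_on S f \<Longrightarrow> continuous_on S f"
  using Ck_on_imp_continuous_on smooth_onD by blast

lemma smooth_on_cong: "open S \<Longrightarrow> (\<And>x. x \<in> S \<Longrightarrow> f x = g x) \<Longrightarrow> smooth_on S f \<Longrightarrow> smooth_on S g"
  using Ck_on_cong[of S f g] by (auto simp: smooth_on_def)

lemma smooth_on_subset: "smooth_on S f \<Longrightarrow> T \<subseteq> S \<Longrightarrow> smooth_on T f"
  using Ck_on_subset[of _ S f T] by (auto simp: smooth_on_def)

lemma smooth_on_local: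
  assumes "open S" "\<And>x. x \<in> S \<Longrightarrow> \<exists>N. open N \<and> x \<in> N \<and> smooth_on (N \<inter> S) f"
  shows "smooth_on S f"
proof (rule smooth_onI)
  show "Ck_on n S f" for n
    by (rule Ck_on_local[OF assms(1)]) (use assms(2) smooth_onD in blast)
qed

lemma smooth_on_const: "smooth_on S (\<lambda>x. c)"
  by (simp add: smooth_on_def Ck_on_const)

lemma smooth_on_bounded_linear: "open S \<Longrightarrow> bounded_linear f \<Longrightarrow> smooth_on S f"
  by (simp add: smooth_on_def Ck_on_bounded_linear)

lemma smooth_on_id: "open S \<Longrightarrow> smooth_on S (\<lambda>x. x)"
  by (intro smooth_on_bounded_linear bounded_linear_ident)

lemma smooth_on_linear_compose: "open S \<Longrightarrow> bounded_linear L \<Longrightarrow> smooth_on S f \<Longrightarrow> smooth_on S (\<lambda>x. L (f x))"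
  by (simp add: smooth_on_def Ck_on_linear_compose)

lemma smooth_on_bilinear:
  "open S \<Longrightarrow> bounded_bilinear pr \<Longrightarrow> smooth_on S f \<Longrightarrow> smooth_on S g \<Longrightarrow> smooth_on S (\<lambda>x. pr (f x) (g x))"
  by (simp add: smooth_on_def Ck_on_bilinear)

lemma smooth_on_add: "open S \<Longrightarrow> smooth_on S f \<Longrightarrow> smooth_on S g \<Longrightarrow> smooth_on S (\<lambda>x. f x + g x)"
  by (simp add: smooth_on_def Ck_on_add)

lemma smooth_on_scaleR: "open S \<Longrightarrow> smooth_on S f \<Longrightarrow> smooth_on S g \<Longrightarrow> smooth_on S (\<lambda>x. f x *\<^sub>R g x)"
  using smooth_on_bilinear bounded_bilinear_scaleR by blast

lemma smooth_on_mult: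
  fixes f g :: "_ \<Rightarrow> 'b::real_normed_algebra"
  shows "open S \<Longrightarrow> smooth_on S f \<Longrightarrow> smooth_on S g \<Longrightarrow> smooth_on S (\<lambda>x. f x * g x)"
  using smooth_on_bilinear bounded_bilinear_mult by blast

lemma smooth_on_diff: "open S \<Longrightarrow> smooth_on S f \<Longrightarrow> smooth_on S g \<Longrightarrow> smooth_on S (\<lambda>x. f x - g x)"
  using smooth_on_add[of S f "\<lambda>x. - g x"] smooth_on_linear_compose[OF _ bounded_linear_minus[OF bounded_linear_ident], of S g]
  by simp

lemma smooth_on_sum:
  "open S \<Longrightarrow> (\<And>i. i \<in> I \<Longrightarrow> smooth_on S (f i)) \<Longrightarrow> smooth_on S (\<lambda>x. \<Sum>i\<in>I. f i x)"
  by (simp add: smooth_on_def Ck_on_sum)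

lemma smooth_on_Pair: "open S \<Longrightarrow> smooth_on S f \<Longrightarrow> smooth_on S g \<Longrightarrow> smooth_on S (\<lambda>x. (f x, g x))"
  by (simp add: smooth_on_def Ck_on_Pair)

lemma smooth_on_compose:
  fixes f :: "'a::real_normed_vector \<Rightarrow> 'b::real_normed_vector" and g :: "'b \<Rightarrow> 'c::real_normed_vector"
  assumes "fin_dim TYPE('b)" "open S" "open T" "smooth_on S f" "smooth_on T g" "\<And>x. x \<in> S \<Longrightarrow> f x \<in> T"
  shows "smooth_on S (\<lambda>x. g (f x))"
proof (rule smooth_onI)
  show "Ck_on n S (\<lambda>x. g (f x))" for n
    by (rule Ck_on_compose[OF assms(1-3) _ smooth_onD smooth_onD]) (use assms in auto)
qed

lemma smooth_on_fst: "open S \<Longrightarrow> smooth_on S fst" and smooth_on_snd: "open S \<Longrightarrow> smooth_on S snd"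
  by (rule smooth_on_bounded_linear, assumption, rule bounded_linear_fst)
     (rule smooth_on_bounded_linear, assumption, rule bounded_linear_snd)

lemma smooth_on_crd:
  fixes f :: "_ \<Rightarrow> 'e::real_normed_vector"
  shows "fin_dim TYPE('e) \<Longrightarrow> open S \<Longrightarrow> smooth_on S f \<Longrightarrow> smooth_on S (\<lambda>x. crd b (f x))"
  by (rule smooth_on_linear_compose[OF _ bounded_linear_crd])

lemma smooth_on_crdI:
  fixes f :: "_ \<Rightarrow> 'e::real_normed_vector"
  assumes "fin_dim TYPE('e)" "open S" "\<And>b. b \<in> fbasis \<Longrightarrow> smooth_on S (\<lambda>x. crd b (f x))"
  shows "smooth_on S f"
proof -
  have "smooth_on S (\<lambda>x. \<Sum>b\<in>fbasis. crd b (f x) *\<^sub>R b)"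
    by (intro smooth_on_sum smooth_on_scaleR assms smooth_on_const)
  then show ?thesis by (simp add: crd_expand[OF assms(1)])
qed

lemma smooth_on_frechet: "smooth_on S f \<Longrightarrow> smooth_on S (\<lambda>x. frechet_derivative f (at x) v)"
proof (rule smooth_onI)
  fix n assume "smooth_on S f"
  then have "Ck_on (Suc n) S f" by (rule smooth_onD)
  then show "Ck_on n S (\<lambda>x. frechet_derivative f (at x) v)" by simp
qed

text \<open>Base point and direction both move with the parameter; the expansion in the basis
  separates them.\<close>

lemma smooth_on_frechet_compose:
  fixes f :: "'a::real_normed_vector \<Rightarrow> 'b::real_normed_vector" and y :: "'x::real_normed_vector \<Rightarrow> 'a"
  assumes fd: "fin_dim TYPE('a)" and "open S" "open T" "smooth_on S f" "smooth_on T y" "smooth_on T w"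
    and "\<And>z. z \<in> T \<Longrightarrow> y z \<in> S"
  shows "smooth_on T (\<lambda>z. frechet_derivative f (at (y z)) (w z))"
proof -
  have A: "smooth_on T (\<lambda>z. \<Sum>b\<in>fbasis. crd b (w z) *\<^sub>R frechet_derivative f (at (y z)) b)"
  proof (intro smooth_on_sum smooth_on_scaleR smooth_on_crd)
    show "smooth_on T (\<lambda>z. frechet_derivative f (at (y z)) b)" for b
      by (rule smooth_on_compose[OF fd \<open>open T\<close> \<open>open S\<close> assms(5) smooth_on_frechet[OF assms(4)] assms(7)])
  qed (use assms in auto)
  have eq: "frechet_derivative f (at (y z)) (w z) = (\<Sum>b\<in>fbasis. crd b (w z) *\<^sub>R frechet_derivative f (at (y z)) b)"
    if "z \<in> T" for z
    by (rule linear_eq_sum_basis[OF fd has_derivative_linear[OF smooth_on_has_derivative[OF assms(4) assms(7)[OF that]]]])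
  show ?thesis by (rule smooth_on_cong[OF \<open>open T\<close> sym[OF eq] A])
qed

lemma Ck_on_real_derivative:
  fixes f :: "real \<Rightarrow> 'b::real_normed_vector"
  assumes "open S" "\<And>x. x \<in> S \<Longrightarrow> (f has_vector_derivative f' x) (at x)" "Ck_on n S f'"
  shows "Ck_on (Suc n) S f"
proof (rule Ck_on_SucI[OF assms(1)])
  show "(f has_derivative (\<lambda>h. h *\<^sub>R f' x)) (at x)" if "x \<in> S" for x
    using assms(2)[OF that] by (simp add: has_vector_derivative_def)
  show "Ck_on n S (\<lambda>x. v *\<^sub>R f' x)" for v
    using Ck_on_linear_compose[OF assms(1) bounded_linear_scaleR_right assms(3)] .
qed

section \<open>Uniform differentiability and parametric integrals\<close>

lemma Ck_on_1D:
  assumes "Ck_on 1 S f"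
  shows "x \<in> S \<Longrightarrow> (f has_derivative frechet_derivative f (at x)) (at x)"
    and "continuous_on S (\<lambda>x. frechet_derivative f (at x) v)"
  using assms by (auto intro: frechet_derivative_worksI)

text \<open>The radius is a Lebesgue number for the cover of \<open>K\<close> by open sets on which
  \<open>h\<close> oscillates by less than \<open>e\<close>. The filter form lets finitely many
  functions share one radius.\<close>

lemma uniform_near_compact:
  fixes h :: "'a::metric_space \<Rightarrow> 'b::metric_space"
  assumes "compact K" "K \<subseteq> S" "open S" "continuous_on S h" "e > 0"
  shows "\<forall>\<^sub>F d in at_right 0. \<forall>z\<in>K. \<forall>z'. dist z' z < d \<longrightarrow> z' \<in> S \<and> dist (h z') (h z) < e"
proof -
  define \<G> where "\<G> = {U. open U \<and> U \<subseteq> S \<and> (\<forall>a\<in>U. \<forall>b\<in>U. dist (h a) (h b) < e)}"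
  have "\<exists>U\<in>\<G>. z \<in> U" if "z \<in> K" for z
  proof
    let ?U = "S \<inter> h -` ball (h z) (e/2)"
    have "open ?U" using continuous_open_preimage[OF assms(4,3)] by blast
    moreover have "dist (h a) (h b) < e" if "a \<in> ?U" "b \<in> ?U" for a b
      using that dist_triangle_half_r[of "h z" "h a" e "h b"] by auto
    ultimately show "?U \<in> \<G>" unfolding \<G>_def by blast
    show "z \<in> ?U" using that assms by auto
  qed
  then have "K \<subseteq> \<Union>\<G>" by blast
  moreover have "\<And>G. G \<in> \<G> \<Longrightarrow> open G" by (simp add: \<G>_def)
  ultimately obtain d where d: "d > 0" "\<And>z. z \<in> K \<Longrightarrow> \<exists>G\<in>\<G>. ball z d \<subseteq> G"
    using Heine_Borel_lemma[OF assms(1)] by metis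
  show ?thesis
  proof (rule eventually_at_rightI[OF _ d(1)])
    fix d' assume d': "d' \<in> {0<..<d}"
    show "\<forall>z\<in>K. \<forall>z'. dist z' z < d' \<longrightarrow> z' \<in> S \<and> dist (h z') (h z) < e"
    proof (intro ballI allI impI)
      fix z z' assume z: "z \<in> K" "dist z' z < d'"
      obtain G where G: "G \<in> \<G>" "ball z d \<subseteq> G" using d z by blast
      have "z \<in> G" "z' \<in> G" using G z d' d by (auto simp: dist_commute subset_iff)
      then show "z' \<in> S \<and> dist (h z') (h z) < e" using G by (auto simp: \<G>_def)
    qed
  qed
qed

text \<open>The mean value inequality bounds the remainder by the oscillation of the derivative on a
  ball around \<open>z\<close>. That oscillation is uniform over \<open>K\<close> because finitely
  many partial derivatives control it.\<close>

lemma uniform_differentiability: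
  fixes g :: "'z::real_normed_vector \<Rightarrow> 'w::real_normed_vector"
  assumes fd: "fin_dim TYPE('z)" and S: "open S" and g: "Ck_on 1 S g" and K: "compact K" "K \<subseteq> S" and e: "e > 0"
  shows "\<exists>d>0. \<forall>z\<in>K. \<forall>w. norm w < d \<longrightarrow>
    z + w \<in> S \<and> norm (g (z + w) - g z - frechet_derivative g (at z) w) \<le> e * norm w"
proof -
  let ?D = "\<lambda>z. frechet_derivative g (at z)"
  have gD: "(g has_derivative ?D z) (at z)" if "z \<in> S" for z
    using Ck_on_1D(1)[OF g that] .
  obtain C where C: "\<forall>(x::'z) b. \<bar>crd b x\<bar> \<le> C * norm x" "C > 0" using norm_equivalence[OF fd] by auto
  \<comment> \<open>Summed over the basis, an oscillation \<open>e'\<close> of the partial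
    derivatives gives operator norm at most \<open>e\<close>; the added 1 covers dimension
    0.\<close>
  define e' where "e' = e / (C * (card (fbasis :: 'z set) + 1))"
  have e': "e' > 0" using e C unfolding e'_def by (simp add: add_pos_nonneg)
  have "\<forall>b\<in>fbasis. \<forall>\<^sub>F d in at_right 0. \<forall>z\<in>K. \<forall>z'. dist z' z < d \<longrightarrow> z' \<in> S \<and> dist (?D z' b) (?D z b) < e'"
    using g by (intro ballI uniform_near_compact K S e') simp
  then have "\<forall>\<^sub>F d in at_right 0. \<forall>b\<in>fbasis. \<forall>z\<in>K. \<forall>z'. dist z' z < d \<longrightarrow> z' \<in> S \<and> dist (?D z' b) (?D z b) < e'"
    by (rule eventually_ball_finite[OF fbasis(1)[OF fd]])
  \<comment> \<open>For a constant function the lemma just says that points close to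
    \<open>K\<close> lie in \<open>S\<close>. This is stated separately because the basis may be
    empty.\<close>
  moreover have "\<forall>\<^sub>F d in at_right 0. \<forall>z\<in>K. \<forall>z'. dist z' z < d \<longrightarrow> z' \<in> S \<and> dist (0::real) 0 < 1"
    by (rule uniform_near_compact[where h = "\<lambda>_. 0", OF K S]) auto
  moreover have "\<forall>\<^sub>F d::real in at_right 0. d > 0" by (rule eventually_at_right_less)
  ultimately have ev: "\<forall>\<^sub>F d in at_right 0. d > 0 \<and> (\<forall>z\<in>K. \<forall>z'. dist z' z < d \<longrightarrow> z' \<in> S)
      \<and> (\<forall>b\<in>fbasis. \<forall>z\<in>K. \<forall>z'. dist z' z < d \<longrightarrow> dist (?D z' b) (?D z b) < e')"
    by eventually_elim auto
  have "at_right (0::real) \<noteq> bot" by simp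
  from eventually_happens'[OF this ev]
  obtain d where dd: "d > 0 \<and> (\<forall>z\<in>K. \<forall>z'. dist z' z < d \<longrightarrow> z' \<in> S)
      \<and> (\<forall>b\<in>fbasis. \<forall>z\<in>K. \<forall>z'. dist z' z < d \<longrightarrow> dist (?D z' b) (?D z b) < e')" ..
  have d: "d > 0" "\<And>z z'. z \<in> K \<Longrightarrow> dist z' z < d \<Longrightarrow> z' \<in> S"
    "\<And>b z z'. b \<in> fbasis \<Longrightarrow> z \<in> K \<Longrightarrow> dist z' z < d \<Longrightarrow> dist (?D z' b) (?D z b) < e'"
    using dd by auto
  have "z + w \<in> S \<and> norm (g (z + w) - g z - ?D z w) \<le> e * norm w" if z: "z \<in> K" and w: "norm w < d" for z w
  proof
    show "z + w \<in> S" using d(2)[OF z, of "z + w"] w by (simp add: dist_norm)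
    have on_le: "onorm (?D z' - ?D z) \<le> e" if z': "z' \<in> ball z d" for z'
    proof (rule onorm_bound)
      show "0 \<le> e" using e by simp
      fix v
      have zS: "z \<in> S" "z' \<in> S" using K z d(2)[OF z, of z'] z' by (auto simp: dist_commute)
      have "(?D z' - ?D z) v = (\<Sum>b\<in>fbasis. crd b v *\<^sub>R (?D z' b - ?D z b))"
      proof -
        note 1 = linear_eq_sum_basis[OF fd has_derivative_linear[OF gD[OF zS(1)]], of v]
          and 2 = linear_eq_sum_basis[OF fd has_derivative_linear[OF gD[OF zS(2)]], of v]
        show ?thesis by (simp only: fun_diff_def scaleR_diff_right sum_subtractf 1[symmetric] 2[symmetric])
      qed
      also have "norm \<dots> \<le> (\<Sum>b\<in>(fbasis::'z set). (C * norm v) * e')"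
      proof (rule sum_norm_le)
        fix b :: 'z assume "b \<in> fbasis"
        then have "norm (?D z' b - ?D z b) \<le> e'" using d(3)[of b z z'] z z' by (simp add: dist_norm norm_minus_commute)
        then show "norm (crd b v *\<^sub>R (?D z' b - ?D z b)) \<le> (C * norm v) * e'"
          unfolding norm_scaleR real_norm_def using C by (intro mult_mono) auto
      qed
      also have "\<dots> = (e * norm v) * (card (fbasis::'z set) / (card (fbasis::'z set) + 1))"
        using C unfolding e'_def by simp
      also have "\<dots> \<le> (e * norm v) * 1" using e by (intro mult_left_mono) auto
      finally show "norm ((?D z' - ?D z) v) \<le> e * norm v" by simp
    qed
    have "norm (g (z + w) - g z - ?D z (z + w - z)) \<le> norm (z + w - z) * e"
    proof (rule differentiable_bound_linearization[where S = "ball z d"])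
      show "z + t *\<^sub>R (z + w - z) \<in> ball z d" if "t \<in> {0..1}" for t
      proof -
        have "norm (t *\<^sub>R w) \<le> 1 * norm w" unfolding norm_scaleR using that by (intro mult_right_mono) auto
        then show ?thesis using w by (simp add: dist_norm)
      qed
      show "(g has_derivative ?D x) (at x within ball z d)" if "x \<in> ball z d" for x
        by (rule has_derivative_at_withinI, rule gD, rule d(2)[OF z]) (use that in \<open>simp add: dist_commute\<close>)
      show "onorm (?D x - ?D z) \<le> e" if "x \<in> ball z d" for x by (rule on_le[OF that])
      show "z \<in> ball z d" using d(1) by simp
    qed
    then show "norm (g (z + w) - g z - ?D z w) \<le> e * norm w" by (simp add: mult.commute)
  qed
  then show ?thesis using d by blast
qed

text \<open>The remainder estimate is uniform along the compact segment
  \<open>{0..1} \<times> {x}\<close>, so it survives integration. The domain \<open>U\<close> is a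
  general open set because some integrands met later make sense only where a segment stays inside a
  chart.\<close>

lemma has_derivative_integral_param:
  fixes g :: "real \<times> 'e::real_normed_vector \<Rightarrow> real"
  assumes fd: "fin_dim TYPE('e)" and U: "open U" and sub: "{0..1} \<times> S \<subseteq> U" and g: "Ck_on 1 U g" and x: "x \<in> S"
  shows "((\<lambda>x. integral {0..1} (\<lambda>s. g (s, x))) has_derivative
     (\<lambda>v. integral {0..1} (\<lambda>s. frechet_derivative g (at (s, x)) (0, v)))) (at x)"
proof -
  let ?D = "\<lambda>z. frechet_derivative g (at z)"
  let ?L = "\<lambda>v. integral {0..1} (\<lambda>s. ?D (s, x) (0, v))"
  have fd2: "fin_dim TYPE(real \<times> 'e)" by (rule fin_dim_prod[OF fin_dim_real fd])
  have gD: "(g has_derivative ?D z) (at z)" if "z \<in> U" for z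
    using Ck_on_1D(1)[OF g that] .
  have lin: "linear (?D (s, x))" if "s \<in> {0..1}" for s
  proof -
    have "(s, x) \<in> U" using that sub x by auto
    from has_derivative_linear[OF gD[OF this]] show ?thesis .
  qed
  have gc: "continuous_on U g" using g U by (intro Ck_on_imp_continuous_on)
  have ig: "(\<lambda>s. g (s, y)) integrable_on {0..1}" if "{0..1} \<times> {y} \<subseteq> U" for y
    using that by (intro integrable_continuous_interval continuous_on_compose2[OF gc]) (auto intro!: continuous_intros)
  have iD: "(\<lambda>s. ?D (s, x) (0, v)) integrable_on {0..1}" for v
  proof -
    have "continuous_on {0..1} (\<lambda>s. (s, x))" by (intro continuous_intros)
    moreover have "(\<lambda>s. (s, x)) ` {0..1} \<subseteq> U" using sub x by auto
    ultimately show ?thesis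
      using continuous_on_compose2[OF Ck_on_1D(2)[OF g]] by (intro integrable_continuous_interval)
  qed
  have "linear ?L"
  proof (rule linearI)
    fix v w
    have "?L (v + w) = integral {0..1} (\<lambda>s. ?D (s, x) (0, v) + ?D (s, x) (0, w))"
      by (rule integral_cong) (use linear_add[OF lin, of _ "(0, v)" "(0, w)"] in simp)
    also have "\<dots> = ?L v + ?L w" by (rule integral_add[OF iD iD])
    finally show "?L (v + w) = ?L v + ?L w" .
  next
    fix c v
    have "?L (c *\<^sub>R v) = integral {0..1} (\<lambda>s. c *\<^sub>R ?D (s, x) (0, v))"
      by (rule integral_cong) (use linear_cmul[OF lin, of _ c "(0, v)"] in simp)
    also have "\<dots> = c *\<^sub>R ?L v" by (rule integral_cmul)
    finally show "?L (c *\<^sub>R v) = c *\<^sub>R ?L v" .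
  qed
  then have bl: "bounded_linear ?L" by (rule linear_imp_bounded_linear[OF fd])
  show ?thesis unfolding has_derivative_at_alt
  proof (intro conjI bl allI impI)
    fix e :: real assume e: "e > 0"
    have "compact ({0..1::real} \<times> {x})" by (intro compact_Times) auto
    moreover have "{0..1} \<times> {x} \<subseteq> U" using sub x by auto
    ultimately obtain d where d0: "d > 0" "\<forall>z\<in>{0..1} \<times> {x}. \<forall>w. norm w < d \<longrightarrow>
        z + w \<in> U \<and> norm (g (z + w) - g z - ?D z w) \<le> e * norm w"
      using uniform_differentiability[OF fd2 U g _ _ e] by blast
    have d: "d > 0" "\<And>s w. s \<in> {0..1} \<Longrightarrow> norm w < d \<Longrightarrow> (s, x) + w \<in> U \<and> norm (g ((s, x) + w) - g (s, x) - ?D (s, x) w) \<le> e * norm w"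
      using d0 by auto
    show "\<exists>d>0. \<forall>y. norm (y - x) < d \<longrightarrow>
      norm (integral {0..1} (\<lambda>s. g (s, y)) - integral {0..1} (\<lambda>s. g (s, x)) - ?L (y - x)) \<le> e * norm (y - x)"
    proof (intro exI[of _ d] conjI d(1) allI impI)
      fix y assume y: "norm (y - x) < d"
      have n: "norm (0::real, y - x) = norm (y - x)" by (simp add: norm_Pair)
      have *: "(s, y) \<in> U \<and> norm (g (s, y) - g (s, x) - ?D (s, x) (0, y - x)) \<le> e * norm (y - x)" if "s \<in> {0..1}" for s
        using d(2)[OF that, of "(0, y - x)"] y n by simp
      have iy: "(\<lambda>s. g (s, y)) integrable_on {0..1}" using * by (intro ig) auto
      have ix: "(\<lambda>s. g (s, x)) integrable_on {0..1}" using sub x by (intro ig) auto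
      have "integral {0..1} (\<lambda>s. g (s, y)) - integral {0..1} (\<lambda>s. g (s, x)) - ?L (y - x)
          = integral {0..1} (\<lambda>s. g (s, y) - g (s, x) - ?D (s, x) (0, y - x))"
        by (simp add: integral_diff integrable_diff iy ix iD)
      also have "norm \<dots> \<le> integral {0..1} (\<lambda>s::real. e * norm (y - x))"
        using * by (intro integral_norm_bound_integral integrable_diff iy ix iD) auto
      finally show "norm (integral {0..1} (\<lambda>s. g (s, y)) - integral {0..1} (\<lambda>s. g (s, x)) - ?L (y - x)) \<le> e * norm (y - x)"
        by simp
    qed
  qed
qed

text \<open>Each directional derivative is an integral of the same shape, with a partial derivative
  of \<open>g\<close> as integrand.\<close>

lemma Ck_on_integral_param:
  fixes g :: "real \<times> 'e::real_normed_vector \<Rightarrow> real"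
  assumes fd: "fin_dim TYPE('e)" and U: "open U" and sub: "{0..1} \<times> S \<subseteq> U" and S: "open S" and g: "Ck_on n U g"
  shows "Ck_on n S (\<lambda>x. integral {0..1} (\<lambda>s. g (s, x)))"
  using g
proof (induction n arbitrary: g)
  case 0
  then have "continuous_on (S \<times> cbox 0 1) (\<lambda>(x, t). g (t, x))"
    using sub by (auto simp: split_def intro!: continuous_on_compose2[of U g] continuous_intros)
  from integral_continuous_on_param[OF this] show ?case by simp
next
  case (Suc n)
  have "Ck_on n U (\<lambda>z. frechet_derivative g (at z) (0, v))" for v using Suc.prems by simp
  then show ?case
    using Ck_on_mono[OF U Suc.prems, of 1]
    by (intro Ck_on_SucI[OF S has_derivative_integral_param[OF fd U sub]] Suc.IH) auto
qed

lemma smooth_on_integral_param: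
  fixes g :: "real \<times> 'e::real_normed_vector \<Rightarrow> real"
  assumes "fin_dim TYPE('e)" "open U" "{0..1} \<times> S \<subseteq> U" "open S" "smooth_on U g"
  shows "smooth_on S (\<lambda>x. integral {0..1} (\<lambda>s. g (s, x)))"
  by (rule smooth_onI, rule Ck_on_integral_param[OF assms(1-4)], rule smooth_onD, rule assms)

text \<open>Integrate the derivative of \<open>f\<close> along the segment from \<open>z0\<close> to
  \<open>z\<close>; the factor \<open>g b\<close> is the mean of a partial derivative over it. In
  this form a derivation at \<open>z0\<close> can evaluate \<open>f\<close>.\<close>

lemma hadamard:
  fixes f :: "'e::real_normed_vector \<Rightarrow> real"
  assumes fd: "fin_dim TYPE('e)" and r: "ball z0 r \<subseteq> S" "r > 0" and S: "open S" "smooth_on S f"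
  shows "\<exists>g. (\<forall>b\<in>fbasis. smooth_on (ball z0 r) (g b) \<and> g b z0 = frechet_derivative f (at z0) b) \<and>
    (\<forall>z\<in>ball z0 r. f z = f z0 + (\<Sum>b\<in>fbasis. crd b (z - z0) * g b z))"
proof -
  let ?D = "\<lambda>z. frechet_derivative f (at z)"
  let ?y = "\<lambda>(s::real, z). z0 + s *\<^sub>R (z - z0)"
  define U where "U = ?y -` ball z0 r"
  have U: "open U" unfolding U_def by (intro open_vimage) (auto intro!: continuous_intros simp: split_def)
  have sub: "{0..1} \<times> ball z0 r \<subseteq> U"
  proof (clarsimp simp: U_def dist_norm)
    fix s :: real and z assume "0 \<le> s" "s \<le> 1" "norm (z0 - z) < r"
    then show "s * norm (z - z0) < r"
      by (metis mult_left_le_one_le norm_ge_zero norm_minus_commute order_le_less_trans)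
  qed
  have ysm: "smooth_on U ?y"
    unfolding split_def
    by (intro smooth_on_add smooth_on_scaleR smooth_on_diff smooth_on_const smooth_on_fst smooth_on_snd U)
  define G where "G b = (\<lambda>z. ?D (?y z) b)" for b
  have G: "smooth_on U (G b)" for b
    unfolding G_def by (rule smooth_on_compose[OF fd U open_ball ysm smooth_on_subset[OF smooth_on_frechet[OF S(2)] r(1)]]) (auto simp: U_def)
  define g where "g b z = integral {0..1} (\<lambda>s. G b (s, z))" for b z
  have "smooth_on (ball z0 r) (g b)" for b
    unfolding g_def by (rule smooth_on_integral_param[OF fd U sub open_ball G])
  moreover have "g b z0 = ?D z0 b" for b by (simp add: g_def G_def)
  moreover have "f z = f z0 + (\<Sum>b\<in>fbasis. crd b (z - z0) * g b z)" if z: "z \<in> ball z0 r" for z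
  proof -
    have inU: "(s, z) \<in> U" if "s \<in> {0..1}" for s using sub that z by blast
    have der: "((\<lambda>s. f (z0 + s *\<^sub>R (z - z0))) has_vector_derivative ?D (z0 + s *\<^sub>R (z - z0)) (z - z0)) (at s within {0..1})"
      if "s \<in> {0..1}" for s
    proof -
      have "z0 + s *\<^sub>R (z - z0) \<in> S" using inU[OF that] r by (auto simp: U_def)
      from smooth_on_has_derivative[OF S(2) this]
      have f: "(f has_derivative ?D (z0 + s *\<^sub>R (z - z0))) (at (z0 + s *\<^sub>R (z - z0)))" .
      have "((\<lambda>s. z0 + s *\<^sub>R (z - z0)) has_derivative (\<lambda>h. h *\<^sub>R (z - z0))) (at s within {0..1})"
        by (auto intro!: derivative_eq_intros)
      from has_derivative_compose[OF this f] show ?thesis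
        unfolding has_vector_derivative_def
        by (simp add: linear_cmul[OF has_derivative_linear[OF f]])
    qed
    have "((\<lambda>s. ?D (z0 + s *\<^sub>R (z - z0)) (z - z0)) has_integral (f (z0 + 1 *\<^sub>R (z - z0)) - f (z0 + 0 *\<^sub>R (z - z0)))) {0..1}"
      by (rule fundamental_theorem_of_calculus) (use der in auto)
    then have "f z - f z0 = integral {0..1} (\<lambda>s. ?D (z0 + s *\<^sub>R (z - z0)) (z - z0))"
      by (simp add: integral_unique)
    also have "\<dots> = integral {0..1} (\<lambda>s. \<Sum>b\<in>fbasis. crd b (z - z0) *\<^sub>R G b (s, z))"
    proof (rule integral_cong)
      fix s :: real assume "s \<in> {0..1}"
      then have "z0 + s *\<^sub>R (z - z0) \<in> S" using inU r by (auto simp: U_def)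
      from has_derivative_linear[OF smooth_on_has_derivative[OF S(2) this]]
      show "?D (z0 + s *\<^sub>R (z - z0)) (z - z0) = (\<Sum>b\<in>fbasis. crd b (z - z0) *\<^sub>R G b (s, z))"
        unfolding G_def split_conv by (rule linear_eq_sum_basis[OF fd])
    qed
    also have "\<dots> = (\<Sum>b\<in>fbasis. crd b (z - z0) *\<^sub>R g b z)"
    proof -
      have "(\<lambda>s. G b (s, z)) integrable_on {0..1}" for b
        using inU by (intro integrable_continuous_interval continuous_on_compose2[OF smooth_on_continuous_on[OF U G]])
           (auto intro!: continuous_intros)
      then show ?thesis unfolding g_def
        by (subst integral_sum) (auto simp: fbasis(1)[OF fd] intro!: integrable_on_mult_right)
    qed
    finally show ?thesis by simp
  qed
  ultimately show ?thesis by blast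
qed

section \<open>Symmetry of second derivatives\<close>

text \<open>The second difference does not change when \<open>u\<close> and \<open>w\<close> are
  exchanged, so an expansion that differentiates along \<open>u\<close> first and \<open>w\<close>
  second captures both mixed derivatives. The estimate is the mean value inequality in the
  \<open>u\<close>-direction for the increment of \<open>f\<close> by
  \<open>t *\<^sub>R w\<close>.\<close>

lemma second_difference:
  fixes f :: "'a::real_normed_vector \<Rightarrow> 'b::real_normed_vector"
  assumes r: "r > 0" and f: "\<And>y. y \<in> ball x r \<Longrightarrow> (f has_derivative f' y) (at y)"
    and D: "((\<lambda>y. f' y u) has_derivative D) (at x)" and e: "e > 0"
  shows "\<forall>\<^sub>F t in at_right 0. norm (f (x + t *\<^sub>R u + t *\<^sub>R w) - f (x + t *\<^sub>R u) - f (x + t *\<^sub>R w) + f x - t^2 *\<^sub>R D w) \<le> e * t^2"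
proof -
  define c where "c = norm u + norm w + 1"
  have c: "c > 0" by (simp add: c_def add_nonneg_pos)
  \<comment> \<open>The bound on \<open>q'\<close> has two remainder terms, each at most
    \<open>e' * (t * c)\<close>; together they give \<open>e * t\<close>.\<close>
  define e' where "e' = e / (2 * c)"
  have e': "e' > 0" using e c by (simp add: e'_def)
  obtain d where d: "d > 0" "\<And>y. norm (y - x) < d \<Longrightarrow> norm (f' y u - f' x u - D (y - x)) \<le> e' * norm (y - x)"
    using D e' unfolding has_derivative_at_alt by blast
  have linD: "linear D" by (rule has_derivative_linear[OF D])
  show ?thesis
  proof (rule eventually_at_rightI[of 0 "min d r / c"])
    show "0 < min d r / c" using d r c by simp
    fix t assume "t \<in> {0<..<min d r / c}"
    then have t: "t > 0" "t * c < d" "t * c < r" using c by (auto simp: field_simps)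
    have small: "norm (s *\<^sub>R u + k *\<^sub>R w) \<le> t * c" if "0 \<le> s" "s \<le> t" "0 \<le> k" "k \<le> t" for s k
    proof -
      have "norm (s *\<^sub>R u + k *\<^sub>R w) \<le> s * norm u + k * norm w"
        using norm_triangle_ineq[of "s *\<^sub>R u" "k *\<^sub>R w"] that by simp
      also have "\<dots> \<le> t * norm u + t * norm w" using that by (intro add_mono mult_right_mono) auto
      also have "\<dots> \<le> t * c" using t by (simp add: c_def algebra_simps)
      finally show ?thesis .
    qed
    \<comment> \<open>The increment in the \<open>w\<close>-direction at the moving point
      \<open>x + s *\<^sub>R u\<close>, minus its expected linear growth in \<open>s\<close>. Its
      total change over \<open>{0..t}\<close> is the quantity to be estimated.\<close>
    define q where "q s = f (x + s *\<^sub>R u + t *\<^sub>R w) - f (x + s *\<^sub>R u) - (s * t) *\<^sub>R D w" for s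
    define q' where "q' s = f' (x + s *\<^sub>R u + t *\<^sub>R w) u - f' (x + s *\<^sub>R u) u - t *\<^sub>R D w" for s
    have "norm (q t - q 0) \<le> (e * t) * norm (t - 0)"
    proof (rule differentiable_bound[where S = "{0..t}" and f' = "\<lambda>s h. h *\<^sub>R q' s"])
      fix s assume s: "s \<in> {0..t}"
      have in1: "norm (s *\<^sub>R u + t *\<^sub>R w) \<le> t * c" and in2: "norm (s *\<^sub>R u) \<le> t * c"
        using small[of s t] small[of s 0] s t by auto
      have b: "x + s *\<^sub>R u + t *\<^sub>R w \<in> ball x r" "x + s *\<^sub>R u \<in> ball x r"
      proof -
        have *: "dist x (x + a) = norm a" for a by (simp add: dist_norm)
        show "x + s *\<^sub>R u + t *\<^sub>R w \<in> ball x r" "x + s *\<^sub>R u \<in> ball x r"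
          unfolding mem_ball add.assoc * using in1 in2 t(3) by auto
      qed
      have 1: "((\<lambda>s. f (x + s *\<^sub>R u + t *\<^sub>R w)) has_derivative (\<lambda>h. f' (x + s *\<^sub>R u + t *\<^sub>R w) (h *\<^sub>R u))) (at s within {0..t})"
      proof -
        have "((\<lambda>s. x + s *\<^sub>R u + t *\<^sub>R w) has_derivative (\<lambda>h. h *\<^sub>R u)) (at s within {0..t})"
          by (auto intro!: derivative_eq_intros)
        from has_derivative_compose[OF this f[OF b(1)]] show ?thesis .
      qed
      have 2: "((\<lambda>s. f (x + s *\<^sub>R u)) has_derivative (\<lambda>h. f' (x + s *\<^sub>R u) (h *\<^sub>R u))) (at s within {0..t})"
      proof -
        have "((\<lambda>s. x + s *\<^sub>R u) has_derivative (\<lambda>h. h *\<^sub>R u)) (at s within {0..t})"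
          by (auto intro!: derivative_eq_intros)
        from has_derivative_compose[OF this f[OF b(2)]] show ?thesis .
      qed
      have 3: "((\<lambda>s. (s * t) *\<^sub>R D w) has_derivative (\<lambda>h. (h * t) *\<^sub>R D w)) (at s within {0..t})"
        by (auto intro!: derivative_eq_intros)
      show "(q has_derivative (\<lambda>h. h *\<^sub>R q' s)) (at s within {0..t})"
        using has_derivative_diff[OF has_derivative_diff[OF 1 2] 3] unfolding q_def q'_def
        by (simp add: linear_cmul[OF has_derivative_linear[OF f[OF b(1)]]]
            linear_cmul[OF has_derivative_linear[OF f[OF b(2)]]] scaleR_diff_right)
      have "q' s = (f' (x + s *\<^sub>R u + t *\<^sub>R w) u - f' x u - D (s *\<^sub>R u + t *\<^sub>R w)) - (f' (x + s *\<^sub>R u) u - f' x u - D (s *\<^sub>R u))"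
        unfolding q'_def by (simp add: linear_add[OF linD] linear_cmul[OF linD])
      also have "norm \<dots> \<le> e' * norm (s *\<^sub>R u + t *\<^sub>R w) + e' * norm (s *\<^sub>R u)"
        using d(2)[of "x + s *\<^sub>R u + t *\<^sub>R w"] d(2)[of "x + s *\<^sub>R u"] in1 in2 t(2)
        by (intro order_trans[OF norm_triangle_ineq4 add_mono]) (simp_all add: add.assoc)
      also have "\<dots> \<le> e' * (t * c) + e' * (t * c)" using in1 in2 e' by (intro add_mono mult_left_mono) auto
      also have "\<dots> = e * t" using c by (simp add: e'_def)
      finally have "norm (q' s) \<le> e * t" .
      then have "norm (h *\<^sub>R q' s) \<le> e * t * norm h" for h
        by (simp add: mult.commute mult_left_mono)
      then show "onorm (\<lambda>h. h *\<^sub>R q' s) \<le> e * t" by (rule onorm_le)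
    qed (use t in auto)
    then have "norm (q t - q 0) \<le> e * t^2" using t by (simp add: power2_eq_square)
    then show "norm (f (x + t *\<^sub>R u + t *\<^sub>R w) - f (x + t *\<^sub>R u) - f (x + t *\<^sub>R w) + f x - t^2 *\<^sub>R D w) \<le> e * t^2"
      by (simp add: q_def power2_eq_square algebra_simps)
  qed
qed

text \<open>Both mixed derivatives approximate the same second difference with error
  \<open>e * t^2\<close>; dividing by \<open>t^2\<close> leaves \<open>2 * e\<close>.\<close>

lemma second_derivative_symmetric:
  fixes f :: "'a::real_normed_vector \<Rightarrow> 'b::real_normed_vector"
  assumes S: "open S" "smooth_on S f" "x \<in> S"
  shows "frechet_derivative (\<lambda>y. frechet_derivative f (at y) u) (at x) w
       = frechet_derivative (\<lambda>y. frechet_derivative f (at y) w) (at x) u"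
proof -
  let ?D = "\<lambda>u. frechet_derivative (\<lambda>y. frechet_derivative f (at y) u) (at x)"
  obtain r where r: "r > 0" "ball x r \<subseteq> S" using S openE by blast
  have f: "\<And>y. y \<in> ball x r \<Longrightarrow> (f has_derivative frechet_derivative f (at y)) (at y)"
    using smooth_on_has_derivative[OF S(2)] r by blast
  have D: "((\<lambda>y. frechet_derivative f (at y) u) has_derivative ?D u) (at x)" for u
    by (rule smooth_on_has_derivative[OF smooth_on_frechet[OF S(2)] S(3)])
  have "norm (?D u w - ?D w u) \<le> 2 * e" if e: "e > 0" for e
  proof -
    have "\<forall>\<^sub>F t::real in at_right 0. t > 0" by (rule eventually_at_right_less)
    moreover have "\<forall>\<^sub>F t in at_right 0. norm (f (x + t *\<^sub>R u + t *\<^sub>R w) - f (x + t *\<^sub>R u) - f (x + t *\<^sub>R w) + f x - t^2 *\<^sub>R ?D u w) \<le> e * t^2" for u w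
      by (rule second_difference[OF r(1) f D e])
    note this[of u w] this[of w u]
    ultimately have "\<forall>\<^sub>F t::real in at_right 0. norm (?D u w - ?D w u) \<le> 2 * e"
    proof eventually_elim
      case (elim t)
      let ?X = "f (x + t *\<^sub>R u + t *\<^sub>R w) - f (x + t *\<^sub>R u) - f (x + t *\<^sub>R w) + f x"
      have sw: "f (x + t *\<^sub>R w + t *\<^sub>R u) - f (x + t *\<^sub>R w) - f (x + t *\<^sub>R u) + f x = ?X" by (simp add: algebra_simps)
      have "t^2 * norm (?D u w - ?D w u) = norm ((?X - t^2 *\<^sub>R ?D w u) - (?X - t^2 *\<^sub>R ?D u w))"
      proof -
        have "(?X - t^2 *\<^sub>R ?D w u) - (?X - t^2 *\<^sub>R ?D u w) = t^2 *\<^sub>R (?D u w - ?D w u)" by (simp add: algebra_simps)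
        then show ?thesis by (simp only: norm_scaleR) simp
      qed
      also have "\<dots> \<le> e * t^2 + e * t^2"
        using elim(2,3) unfolding sw by (intro order_trans[OF norm_triangle_ineq4 add_mono])
      finally have "t^2 * norm (?D u w - ?D w u) \<le> t^2 * (2 * e)" by (simp add: algebra_simps)
      then show ?case using elim(1) by simp
    qed
    then show ?thesis by simp
  qed
  note main = this
  have "norm (?D u w - ?D w u) \<le> 0 + e" if "e > 0" for e
    using main[of "e / 2"] that by simp
  then have "norm (?D u w - ?D w u) \<le> 0" by (rule field_le_epsilon)
  then show ?thesis by simp
qed

section \<open>Cutoff functions\<close>

lemma pow_div_fact_le_exp:
  assumes "0 \<le> (y::real)" shows "y ^ n / fact n \<le> exp y"
proof -
  have "(\<Sum>i\<in>{n}. inverse (fact i) * y ^ i) \<le> (\<Sum>i. inverse (fact i) * y ^ i)"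
    using summable_exp[of y] assms by (intro sum_le_suminf) auto
  then show ?thesis by (simp add: exp_def divide_inverse mult.commute)
qed

text \<open>The exponent \<open>k\<close> makes the family closed under differentiation up to linear
  combinations, so that smoothness of the classical function \<open>exp (- 1 / x)\<close> follows by
  an induction over all \<open>k\<close> at once.\<close>

definition flat :: "nat \<Rightarrow> real \<Rightarrow> real" where
  "flat k x = (if x > 0 then exp (- 1 / x) / x ^ k else 0)"

text \<open>Exponential decay beats every power of \<open>x\<close>; two powers are kept so that the
  difference quotient at 0 still tends to 0.\<close>

lemma flat_le: "\<bar>flat k x\<bar> \<le> fact (k + 2) * x\<^sup>2"
proof (cases "x > 0")
  case True
  have "(1 / x) ^ (k + 2) / fact (k + 2) \<le> exp (1 / x)"
    using True by (intro pow_div_fact_le_exp) auto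
  then have "1 / exp (1 / x) \<le> 1 / ((1 / x) ^ (k + 2) / fact (k + 2))"
    using True by (intro divide_left_mono) auto
  then have "exp (- 1 / x) \<le> fact (k + 2) * x ^ (k + 2)"
    by (simp add: exp_minus power_divide inverse_eq_divide mult.commute)
  then have "exp (- 1 / x) / x ^ k \<le> fact (k + 2) * x ^ (k + 2) / x ^ k"
    using True by (intro divide_right_mono) auto
  also have "\<dots> = fact (k + 2) * x\<^sup>2" using True by (simp add: power_add power2_eq_square)
  finally show ?thesis using True by (simp add: flat_def)
qed (simp add: flat_def)

lemma flat_has_derivative:
  "(flat k has_real_derivative flat (k + 2) x - k * flat (k + 1) x) (at x)"
proof -
  consider "x > 0" | "x < 0" | "x = 0" by linarith
  then show ?thesis
  proof cases
    case 1
    have "((\<lambda>x. exp (- 1 / x) / x ^ k) has_real_derivative flat (k + 2) x - k * flat (k + 1) x) (at x)"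
    proof (cases k)
      case 0
      then show ?thesis using 1
        by (auto intro!: derivative_eq_intros simp: flat_def power2_eq_square field_simps)
    next
      case (Suc m)
      have "((\<lambda>x. exp (- 1 / x) / x ^ k) has_real_derivative
        ((exp (- 1 / x) * (1 / x\<^sup>2)) * x ^ k - exp (- 1 / x) * (k * x ^ (k - 1))) / (x ^ k * x ^ k)) (at x)"
        using 1 by (auto intro!: derivative_eq_intros simp: power2_eq_square)
      moreover have "((exp (- 1 / x) * (1 / x\<^sup>2)) * x ^ k - exp (- 1 / x) * (k * x ^ (k - 1))) / (x ^ k * x ^ k)
         = flat (k + 2) x - k * flat (k + 1) x"
        using 1 Suc by (simp add: flat_def field_simps power2_eq_square)
      ultimately show ?thesis by simp
    qed
    moreover have "\<forall>\<^sub>F y in nhds x. exp (- 1 / y) / y ^ k = flat k y"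
      using 1 eventually_nhds_in_open[of "{0<..}" x] by (auto simp: flat_def elim!: eventually_mono)
    ultimately show ?thesis by (rule DERIV_cong_ev[OF refl _ refl, THEN iffD1, rotated])
  next
    case 2
    have "((\<lambda>x. 0) has_real_derivative 0) (at x)" by simp
    moreover have "\<forall>\<^sub>F y in nhds x. 0 = flat k y"
      using 2 eventually_nhds_in_open[of "{..<0}" x] by (auto simp: flat_def elim!: eventually_mono)
    ultimately have "(flat k has_real_derivative 0) (at x)" by (rule DERIV_cong_ev[OF refl _ refl, THEN iffD1, rotated])
    then show ?thesis using 2 by (simp add: flat_def)
  next
    case 3
    have "((\<lambda>h. flat k h / h) \<longlongrightarrow> 0) (at 0)"
    proof (rule Lim_null_comparison)
      have "norm (flat k h / h) \<le> fact (k + 2) * \<bar>h\<bar>" for h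
        using flat_le[of k h] by (cases "h = 0") (auto simp: divide_le_eq power2_eq_square abs_mult mult.assoc)
      then show "\<forall>\<^sub>F h in at 0. norm (flat k h / h) \<le> fact (k + 2) * \<bar>h\<bar>" by simp
      have "((\<lambda>h::real. fact (k + 2) * \<bar>h\<bar>) \<longlongrightarrow> fact (k + 2) * \<bar>0\<bar>) (at 0)" by (intro tendsto_intros)
      then show "((\<lambda>h::real. fact (k + 2) * \<bar>h\<bar>) \<longlongrightarrow> 0) (at 0)" by simp
    qed
    then show ?thesis using 3 by (simp add: has_field_derivative_iff flat_def)
  qed
qed

lemma Ck_on_flat: "Ck_on n UNIV (flat k)"
proof (induction n arbitrary: k)
  case 0
  show ?case using flat_has_derivative by (auto intro!: continuous_at_imp_continuous_on DERIV_isCont)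
next
  case (Suc n)
  have "Ck_on n UNIV (\<lambda>x. flat (k + 2) x + (- real k) *\<^sub>R flat (k + 1) x)"
    by (rule Ck_on_add[OF open_UNIV Suc.IH Ck_on_linear_compose[OF open_UNIV bounded_linear_scaleR_right Suc.IH]])
  then show ?case
    using flat_has_derivative[of k]
    by (intro Ck_on_real_derivative[where f' = "\<lambda>x. flat (k + 2) x - k * flat (k + 1) x"])
       (auto simp: has_real_derivative_iff_has_vector_derivative)
qed

lemma Ck_on_inverse: "Ck_on n {x::real. x \<noteq> 0} inverse"
proof (induction n)
  case 0 show ?case by (auto intro!: continuous_intros)
next
  case (Suc n)
  have op: "open {x::real. x \<noteq> 0}" by (simp add: open_Collect_neq)
  have "Ck_on n {x::real. x \<noteq> 0} (\<lambda>x. (-1) *\<^sub>R (inverse x * inverse x))"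
    by (rule Ck_on_linear_compose[OF op bounded_linear_scaleR_right Ck_on_bilinear[OF op bounded_bilinear_mult Suc Suc]])
  moreover have "(inverse has_vector_derivative (-1) *\<^sub>R (inverse x * inverse x)) (at x)" if "x \<in> {x::real. x \<noteq> 0}" for x
    using that unfolding has_real_derivative_iff_has_vector_derivative[symmetric]
    by (auto intro!: derivative_eq_intros)
  ultimately show ?case by (intro Ck_on_real_derivative[OF op])
qed

lemma Ck_on_sin_cos: "Ck_on n UNIV (sin :: real \<Rightarrow> real) \<and> Ck_on n UNIV (cos :: real \<Rightarrow> real)"
proof (induction n)
  case 0 show ?case by (auto intro!: continuous_intros)
next
  case (Suc n)
  have "Ck_on n UNIV (\<lambda>x::real. (-1) *\<^sub>R sin x)"
    by (rule Ck_on_linear_compose[OF open_UNIV bounded_linear_scaleR_right]) (use Suc in simp)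
  then have "Ck_on (Suc n) UNIV (cos :: real \<Rightarrow> real)"
    by (intro Ck_on_real_derivative[where f' = "\<lambda>x. - sin x"])
       (auto intro!: derivative_eq_intros simp: has_real_derivative_iff_has_vector_derivative[symmetric])
  moreover have "Ck_on (Suc n) UNIV (sin :: real \<Rightarrow> real)"
    by (intro Ck_on_real_derivative[where f' = cos])
       (use Suc in \<open>auto intro!: derivative_eq_intros simp: has_real_derivative_iff_has_vector_derivative[symmetric]\<close>)
  ultimately show ?case by simp
qed

lemma smooth_on_cos: "smooth_on UNIV (cos :: real \<Rightarrow> real)"
  using Ck_on_sin_cos by (auto simp: smooth_on_def)

text \<open>The usual quotient of flat functions, a smooth transition from 0 for
  \<open>x \<le> 0\<close> to 1 for \<open>x \<ge> 1\<close>. The denominator is positive because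
  \<open>x\<close> and \<open>1 - x\<close> are never both nonpositive.\<close>

definition step :: "real \<Rightarrow> real" where
  "step x = flat 0 x / (flat 0 x + flat 0 (1 - x))"

lemma flat_nonneg: "0 \<le> flat k x" and flat_pos: "x > 0 \<Longrightarrow> 0 < flat k x"
  by (auto simp: flat_def)

lemma step_denominator: "0 < flat 0 x + flat 0 (1 - x)"
  using flat_pos[of x 0] flat_pos[of "1 - x" 0] flat_nonneg[of 0 x] flat_nonneg[of 0 "1 - x"]
  by (cases "x > 0") auto

lemma step_eq_0: "x \<le> 0 \<Longrightarrow> step x = 0"
  and step_eq_1: "x \<ge> 1 \<Longrightarrow> step x = 1"
  using step_denominator[of x] by (auto simp: step_def flat_def)

lemma step_bounds: "0 \<le> step x" "step x \<le> 1"
  using step_denominator[of x] flat_nonneg[of 0 x] flat_nonneg[of 0 "1 - x"] by (auto simp: step_def)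

lemma smooth_on_step: "smooth_on UNIV step"
proof -
  have f: "smooth_on UNIV (flat 0)" by (simp add: smooth_on_def Ck_on_flat)
  have m: "smooth_on UNIV (\<lambda>x::real. 1 - x)" by (intro smooth_on_diff smooth_on_const smooth_on_id open_UNIV)
  have d: "smooth_on UNIV (\<lambda>x. flat 0 x + flat 0 (1 - x))"
    by (rule smooth_on_add[OF open_UNIV f smooth_on_compose[OF fin_dim_real open_UNIV open_UNIV m f]]) simp
  have op: "open {x::real. x \<noteq> 0}" by (simp add: open_Collect_neq)
  have i: "smooth_on {x::real. x \<noteq> 0} inverse" by (simp add: smooth_on_def Ck_on_inverse)
  have "smooth_on UNIV (\<lambda>x. inverse (flat 0 x + flat 0 (1 - x)))"
    by (rule smooth_on_compose[OF fin_dim_real open_UNIV op d i]) (use step_denominator in \<open>simp add: less_imp_neq[symmetric]\<close>)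
  from smooth_on_mult[OF open_UNIV f this] show ?thesis
    by (simp add: step_def[abs_def] divide_inverse)
qed

text \<open>The norm may fail to be smooth, so the bump is a function of the quadratic form
  \<open>q\<close> in the coordinates, which has compact sublevel sets around
  \<open>z0\<close>.\<close>

lemma smooth_bump:
  assumes fd: "fin_dim TYPE('e::real_normed_vector)" and W: "open W" "(z0::'e) \<in> W"
  shows "\<exists>\<beta>::'e \<Rightarrow> real. \<exists>V K. smooth_on UNIV \<beta> \<and> (\<forall>z. 0 \<le> \<beta> z \<and> \<beta> z \<le> 1) \<and> open V \<and> z0 \<in> V \<and> (\<forall>z\<in>V. \<beta> z = 1)
    \<and> V \<subseteq> K \<and> compact K \<and> K \<subseteq> W \<and> (\<forall>z. z \<notin> K \<longrightarrow> \<beta> z = 0)"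
proof -
  define q where "q z = (\<Sum>b\<in>fbasis. (crd b (z - z0))\<^sup>2)" for z :: 'e
  define D where "D = (\<Sum>b\<in>(fbasis :: 'e set). norm b) + 1"
  have D: "D > 0" unfolding D_def by (intro add_nonneg_pos sum_nonneg) auto
  obtain e where e: "e > 0" "ball z0 e \<subseteq> W" using W openE by blast
  \<comment> \<open>On the sublevel set each coordinate of \<open>z - z0\<close> is at most
    \<open>e / (2 * D)\<close>, which makes the norm at most \<open>e / 2\<close>.\<close>
  define \<rho> where "\<rho> = (e / (2 * D))\<^sup>2"
  have \<rho>: "\<rho> > 0" using e D by (simp add: \<rho>_def)
  have nb: "norm (z - z0) \<le> e / 2" if "q z \<le> \<rho>" for z
  proof -
    have c: "\<bar>crd b (z - z0)\<bar> \<le> e / (2 * D)" if "b \<in> fbasis" for b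
    proof -
      have "(crd b (z - z0))\<^sup>2 \<le> q z" unfolding q_def
        by (rule member_le_sum[OF that]) (auto simp: fbasis(1)[OF fd])
      then have "(crd b (z - z0))\<^sup>2 \<le> (e / (2 * D))\<^sup>2" using \<open>q z \<le> \<rho>\<close> by (simp add: \<rho>_def)
      then show ?thesis using e D by (simp add: abs_le_square_iff[symmetric])
    qed
    have "norm (z - z0) = norm (\<Sum>b\<in>fbasis. crd b (z - z0) *\<^sub>R b)" by (simp add: crd_expand[OF fd])
    also have "\<dots> \<le> (\<Sum>b\<in>(fbasis :: 'e set). e / (2 * D) * norm b)"
    proof (rule sum_norm_le)
      show "norm (crd b (z - z0) *\<^sub>R b) \<le> e / (2 * D) * norm b" if "b \<in> fbasis" for b
        unfolding norm_scaleR by (rule mult_right_mono[OF c[OF that] norm_ge_zero])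
    qed
    also have "\<dots> = e / (2 * D) * (D - 1)" by (simp add: D_def sum_distrib_left)
    also have "\<dots> \<le> e / (2 * D) * D" using e D by (intro mult_left_mono) auto
    finally show ?thesis using D by simp
  qed
  have qs: "smooth_on UNIV q" unfolding q_def power2_eq_square
  proof (intro smooth_on_sum smooth_on_mult open_UNIV)
    have "smooth_on UNIV (\<lambda>z. z - z0)" by (intro smooth_on_diff smooth_on_const smooth_on_id open_UNIV)
    from smooth_on_crd[OF fd open_UNIV this]
    show "smooth_on UNIV (\<lambda>z. crd b (z - z0))" "smooth_on UNIV (\<lambda>z. crd b (z - z0))" for b by auto
  qed
  have qc: "continuous_on UNIV q" by (rule smooth_on_continuous_on[OF open_UNIV qs])
  define K where "K = {z. q z \<le> \<rho>}"
  define V where "V = {z. q z < \<rho> / 2}"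
  \<comment> \<open>The argument of \<open>step\<close> is nonpositive for
    \<open>q z \<le> \<rho> / 2\<close> and at least 1 for \<open>q z \<ge> \<rho>\<close>.\<close>
  define \<beta> where "\<beta> z = 1 - step (2 / \<rho> * q z - 1)" for z
  have "smooth_on UNIV (\<lambda>z. 2 / \<rho> * q z - 1)"
    by (intro smooth_on_diff smooth_on_mult smooth_on_const qs open_UNIV)
  from smooth_on_compose[OF fin_dim_real open_UNIV open_UNIV this smooth_on_step]
  have "smooth_on UNIV \<beta>" unfolding \<beta>_def by (intro smooth_on_diff smooth_on_const open_UNIV) simp
  moreover have "0 \<le> \<beta> z \<and> \<beta> z \<le> 1" for z using step_bounds by (simp add: \<beta>_def)
  moreover have "open V" unfolding V_def by (intro open_Collect_less qc continuous_intros)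
  moreover have "z0 \<in> V" using \<rho> by (simp add: V_def q_def linear_0[OF linear_crd[OF fd]])
  moreover have "\<beta> z = 1" if "z \<in> V" for z
    using that \<rho> unfolding \<beta>_def V_def by (subst step_eq_0) (auto simp: field_simps)
  moreover have "\<beta> z = 0" if "z \<notin> K" for z
    using that \<rho> unfolding \<beta>_def K_def by (subst step_eq_1) (auto simp: field_simps)
  moreover have "compact K"
  proof (rule fin_dim_closed_bounded_compact[OF fd])
    show "closed K" unfolding K_def by (intro closed_Collect_le qc continuous_intros)
    show "bounded K" unfolding bounded_def K_def
      using nb by (intro exI[of _ z0] exI[of _ "e/2"]) (auto simp: dist_norm norm_minus_commute)
  qed
  moreover have "K \<subseteq> W" using nb e by (force simp: K_def dist_norm norm_minus_commute)
  moreover have "V \<subseteq> K" using \<rho> by (auto simp: V_def K_def)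
  ultimately show ?thesis by blast
qed

section \<open>Linear systems with smooth coefficients\<close>

text \<open>In finite dimension an injective endomorphism is bijective; the locale of
  finite-dimensional spaces is interpreted at the chosen basis.\<close>

lemma linear_injective_inverse:
  assumes fd: "fin_dim TYPE('e::real_normed_vector)" and f: "linear (f :: 'e \<Rightarrow> 'e)" "inj f"
  shows "\<exists>g. linear g \<and> (\<forall>x. g (f x) = x) \<and> (\<forall>x. f (g x) = x)"
proof -
  interpret F: finite_dimensional_vector_space_pair "scaleR :: real \<Rightarrow> 'e \<Rightarrow> 'e" "fbasis :: 'e set"
    "scaleR :: real \<Rightarrow> 'e \<Rightarrow> 'e" "fbasis :: 'e set"
    by unfold_locales (use fbasis[OF fd] in \<open>auto simp: span_raw_def dependent_raw_def\<close>)
  from F.linear_injective_isomorphism[OF f[unfolded linear_def] refl] show ?thesis unfolding linear_def by blast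
qed

text \<open>Near \<open>x\<close> the factor \<open>h\<close> is of the order of the distance to
  \<open>x\<close>, so continuity of \<open>g\<close> alone makes
  \<open>(g y - g x) *\<^sub>R h y\<close> negligible to first order. This permits differentiating a
  product before its scalar factor is known to be differentiable.\<close>

lemma has_derivative_scaleR_vanishing:
  fixes h :: "'a::real_normed_vector \<Rightarrow> 'b::real_normed_vector" and g :: "'a \<Rightarrow> real"
  assumes g: "isCont g x" and h: "(h has_derivative h') (at x)" "h x = 0"
  shows "((\<lambda>y. g y *\<^sub>R h y) has_derivative (\<lambda>v. g x *\<^sub>R h' v)) (at x)"
proof -
  obtain K where K: "K > 0" "\<forall>\<^sub>F y in at x. norm (h y) \<le> K * norm (y - x)"
  proof -
    obtain K where K: "K > 0" "\<And>v. norm (h' v) \<le> norm v * K"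
      using bounded_linear.pos_bounded[OF has_derivative_bounded_linear[OF h(1)]] by blast
    obtain d where d: "d > 0" "\<And>y. norm (y - x) < d \<Longrightarrow> norm (h y - h x - h' (y - x)) \<le> 1 * norm (y - x)"
      using h(1) zero_less_one unfolding has_derivative_at_alt by blast
    have "norm (h y) \<le> (K + 1) * norm (y - x)" if "norm (y - x) < d" for y
    proof -
      have "norm (h y) \<le> norm (h y - h x - h' (y - x)) + norm (h' (y - x))"
        using norm_triangle_ineq[of "h y - h' (y - x)" "h' (y - x)"] h(2) by simp
      then show ?thesis using d(2)[OF that] K(2)[of "y - x"] by (simp add: algebra_simps)
    qed
    then have "\<forall>\<^sub>F y in at x. norm (h y) \<le> (K + 1) * norm (y - x)"
      using d(1) by (auto simp: eventually_at dist_norm)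
    then show ?thesis using that[of "K + 1"] K by simp
  qed
  have "((\<lambda>y. (g y - g x) *\<^sub>R h y) has_derivative (\<lambda>v. 0)) (at x)"
    unfolding has_derivative_at_alt
  proof (intro conjI allI impI bounded_linear_zero)
    fix e :: real assume e: "e > 0"
    then have "\<forall>\<^sub>F y in at x. dist (g y) (g x) < e / K"
      using g K by (intro tendstoD) (auto simp: isCont_def)
    with K(2) have "\<forall>\<^sub>F y in at x. norm ((g y - g x) *\<^sub>R h y) \<le> e * norm (y - x)"
    proof eventually_elim
      case (elim y)
      have "norm ((g y - g x) *\<^sub>R h y) \<le> (e / K) * (K * norm (y - x))"
        unfolding norm_scaleR using elim e K by (intro mult_mono) (auto simp: dist_norm)
      then show ?case using K by simp
    qed
    then obtain d where "d > 0" "\<And>y. y \<noteq> x \<Longrightarrow> dist y x < d \<Longrightarrow> norm ((g y - g x) *\<^sub>R h y) \<le> e * norm (y - x)"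
      unfolding eventually_at by blast
    then show "\<exists>d>0. \<forall>y. norm (y - x) < d \<longrightarrow> norm ((g y - g x) *\<^sub>R h y - (g x - g x) *\<^sub>R h x - 0) \<le> e * norm (y - x)"
      by (intro exI[of _ d]) (metis diff_self diff_zero dist_norm h(2) mult_zero_right norm_zero order_refl scaleR_zero_left scaleR_zero_right)
  qed
  from has_derivative_add[OF this has_derivative_scaleR_right[OF h(1), of "g x"]]
  show ?thesis by (simp add: algebra_simps)
qed

text \<open>Differentiating \<open>A x (\<xi> x) = k x\<close> shows that each directional
  derivative of \<xi> solves a system with the same matrix and a right-hand side built from \<xi>
  itself, so regularity is gained one order at a time. Hence the induction is over all
  \<open>k\<close> and \<xi>, with \<open>A\<close> fixed.\<close>

lemma smooth_on_linear_solution: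
  fixes A :: "'x::real_normed_vector \<Rightarrow> 'e::real_normed_vector \<Rightarrow> 'e"
  assumes fd: "fin_dim TYPE('e)" and S: "open S"
    and A: "\<And>x. x \<in> S \<Longrightarrow> linear (A x)" "\<And>x. x \<in> S \<Longrightarrow> inj (A x)" "\<And>b. smooth_on S (\<lambda>x. A x b)"
    and k: "smooth_on S k" and \<xi>: "\<And>x. x \<in> S \<Longrightarrow> A x (\<xi> x) = k x"
  shows "smooth_on S \<xi>"
proof -
  have expand: "A y z = (\<Sum>b\<in>fbasis. crd b z *\<^sub>R A y b)" if "y \<in> S" for y z
    by (rule linear_eq_sum_basis[OF fd A(1)[OF that]])
  \<comment> \<open>A perturbation argument with the inverse frozen at \<open>x0\<close>. The sum
    \<open>N y\<close> controls \<open>A y - A x0\<close>; once it is below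
    \<open>1 / (2 * c)\<close>, half of \<open>norm (\<xi> y - \<xi> x0)\<close> can be absorbed,
    whence the factor 2 in the estimate.\<close>
  have isCont: "isCont \<xi> x0" if x0: "x0 \<in> S" and k: "isCont k x0" and \<xi>: "\<And>x. x \<in> S \<Longrightarrow> A x (\<xi> x) = k x" for x0 k \<xi>
  proof -
    obtain B where B: "linear B" "\<And>x. B (A x0 x) = x"
      using linear_injective_inverse[OF fd A(1,2)[OF x0]] by blast
    obtain c where c: "c > 0" "\<And>v. norm (B v) \<le> norm v * c"
      using bounded_linear.pos_bounded[OF linear_imp_bounded_linear[OF fd B(1)]] by blast
    obtain C where C: "\<forall>(x::'e) b. \<bar>crd b x\<bar> \<le> C * norm x" "C > 0" using norm_equivalence[OF fd] by auto
    define N where "N y = (\<Sum>b\<in>(fbasis :: 'e set). C * norm (A y b - A x0 b))" for y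
    have Acont: "((\<lambda>y. A y b) \<longlongrightarrow> A x0 b) (at x0)" for b
      using smooth_on_continuous_on[OF S A(3)] S x0 by (simp add: continuous_on_eq_continuous_at isCont_def)
    have "(N \<longlongrightarrow> (\<Sum>b\<in>(fbasis :: 'e set). C * norm (A x0 b - A x0 b))) (at x0)"
      unfolding N_def by (intro tendsto_intros Acont)
    then have N0: "(N \<longlongrightarrow> 0) (at x0)" by simp
    have est: "norm (\<xi> y - \<xi> x0) \<le> 2 * c * norm (k y - A y (\<xi> x0))" if y: "y \<in> S" "N y < 1 / (2 * c)" for y
    proof -
      let ?z = "\<xi> y - \<xi> x0"
      have "norm ?z \<le> norm (A x0 ?z) * c" using c(2)[of "A x0 ?z"] B(2) by simp
      also have "A x0 ?z = (k y - A y (\<xi> x0)) - (A y ?z - A x0 ?z)"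
        using \<xi>[OF y(1)] by (simp add: linear_diff[OF A(1)[OF y(1)]])
      also have "norm \<dots> \<le> norm (k y - A y (\<xi> x0)) + norm (A y ?z - A x0 ?z)" by (rule norm_triangle_ineq4)
      also have "A y ?z - A x0 ?z = (\<Sum>b\<in>fbasis. crd b ?z *\<^sub>R (A y b - A x0 b))"
        unfolding expand[OF y(1), of ?z] expand[OF x0, of ?z] by (simp add: scaleR_diff_right sum_subtractf)
      also have "norm \<dots> \<le> (\<Sum>b\<in>fbasis. (C * norm ?z) * norm (A y b - A x0 b))"
        by (rule sum_norm_le) (use C in \<open>auto intro!: mult_right_mono\<close>)
      also have "\<dots> = N y * norm ?z" by (simp add: N_def sum_distrib_left sum_distrib_right mult_ac)
      also have "\<dots> \<le> 1 / (2 * c) * norm ?z" using y(2) by (intro mult_right_mono) auto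
      finally have "norm ?z \<le> (norm (k y - A y (\<xi> x0)) + 1 / (2 * c) * norm ?z) * c"
        using c by (simp add: mult_right_mono)
      then show ?thesis using c by (simp add: field_simps)
    qed
    have "((\<lambda>y. A y (\<xi> x0)) \<longlongrightarrow> k x0) (at x0)" using Acont[of "\<xi> x0"] \<xi>[OF x0] by simp
    moreover have "(k \<longlongrightarrow> k x0) (at x0)" using k by (simp add: isCont_def)
    ultimately have "((\<lambda>y. 2 * c * norm (k y - A y (\<xi> x0))) \<longlongrightarrow> 2 * c * norm (k x0 - k x0)) (at x0)"
      by (intro tendsto_intros)
    then have lim: "((\<lambda>y. 2 * c * norm (k y - A y (\<xi> x0))) \<longlongrightarrow> 0) (at x0)" by simp
    have "\<forall>\<^sub>F y in at x0. y \<in> S" using S x0 eventually_at_topological by blast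
    moreover have "\<forall>\<^sub>F y in at x0. N y < 1 / (2 * c)" using c by (intro order_tendstoD(2)[OF N0]) auto
    ultimately have "\<forall>\<^sub>F y in at x0. norm (\<xi> y - \<xi> x0) \<le> 2 * c * norm (k y - A y (\<xi> x0))"
      by eventually_elim (rule est)
    from Lim_null_comparison[OF this lim] show ?thesis by (simp add: isCont_def Lim_null[symmetric])
  qed
  have "Ck_on n S \<xi>" if "Ck_on n S k" "\<And>x. x \<in> S \<Longrightarrow> A x (\<xi> x) = k x" for n k \<xi>
    using that
  proof (induction n arbitrary: k \<xi>)
    case 0
    have "isCont \<xi> x" if "x \<in> S" for x
    proof (rule isCont[OF that _ 0(2)])
      show "isCont k x" using 0(1) S that by (simp add: continuous_on_eq_continuous_at)
    qed
    then show ?case using S by (simp add: continuous_on_eq_continuous_at)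
  next
    case (Suc n)
    let ?Dk = "\<lambda>x. frechet_derivative k (at x)"
    let ?DA = "\<lambda>b x. frechet_derivative (\<lambda>x. A x b) (at x)"
    \<comment> \<open>The right-hand side of the differentiated system: the derivative of
      \<open>k\<close> minus the derivative of the matrix applied to \<xi>.\<close>
    define rhs where "rhs v x = ?Dk x v - (\<Sum>b\<in>fbasis. crd b (\<xi> x) *\<^sub>R ?DA b x v)" for v x
    have Ck: "Ck_on n S k" by (rule Ck_on_SucD[OF S Suc.prems(1)])
    have IH: "Ck_on n S \<xi>" by (rule Suc.IH[OF Ck Suc.prems(2)])
    have "\<exists>B. linear B \<and> (\<forall>v. B (A x v) = v) \<and> (\<forall>v. A x (B v) = v)" if "x \<in> S" for x
      by (rule linear_injective_inverse[OF fd A(1,2)[OF that]])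
    then obtain B where B: "\<And>x. x \<in> S \<Longrightarrow> linear (B x)" "\<And>x v. x \<in> S \<Longrightarrow> B x (A x v) = v" "\<And>x v. x \<in> S \<Longrightarrow> A x (B x v) = v"
      by metis
    have der: "(\<xi> has_derivative (\<lambda>v. B x (rhs v x))) (at x)" if x: "x \<in> S" for x
    proof -
      have blB: "bounded_linear (B x)" by (rule linear_imp_bounded_linear[OF fd B(1)[OF x]])
      have cont: "isCont (\<lambda>y. crd b (\<xi> y)) x" for b
      proof -
        have "isCont \<xi> x" using Ck_on_imp_continuous_on[OF S IH] S x by (simp add: continuous_on_eq_continuous_at)
        then show ?thesis by (rule bounded_linear.isCont[OF bounded_linear_crd[OF fd]])
      qed
      have 1: "((\<lambda>y. B x (k y)) has_derivative (\<lambda>v. B x (?Dk x v))) (at x)"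
        by (rule bounded_linear.has_derivative[OF blB Ck_on_has_derivative[OF Suc.prems(1) x]])
      \<comment> \<open>With the inverse frozen at \<open>x\<close>, \<xi> equals
        \<open>B x (k y)\<close> minus these products. Their last factor vanishes at
        \<open>y = x\<close>, so they are differentiable there although their coefficients are so
        far only known to be continuous.\<close>
      have 2: "((\<lambda>y. crd b (\<xi> y) *\<^sub>R B x (A y b - A x b)) has_derivative (\<lambda>v. crd b (\<xi> x) *\<^sub>R B x (?DA b x v))) (at x)" for b
      proof (rule has_derivative_scaleR_vanishing[OF cont])
        have "((\<lambda>y. A y b - A x b) has_derivative ?DA b x) (at x)"
          using has_derivative_diff[OF smooth_on_has_derivative[OF A(3) x, of b] has_derivative_const, of "A x b"] by simp
        from bounded_linear.has_derivative[OF blB this]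
        show "((\<lambda>y. B x (A y b - A x b)) has_derivative (\<lambda>v. B x (?DA b x v))) (at x)" .
        show "B x (A x b - A x b) = 0" using linear_0[OF B(1)[OF x]] by simp
      qed
      have 3: "((\<lambda>y. B x (k y) - (\<Sum>b\<in>fbasis. crd b (\<xi> y) *\<^sub>R B x (A y b - A x b))) has_derivative
        (\<lambda>v. B x (?Dk x v) - (\<Sum>b\<in>fbasis. crd b (\<xi> x) *\<^sub>R B x (?DA b x v)))) (at x)"
        by (intro has_derivative_diff has_derivative_sum 1 2)
      have eq: "B x (?Dk x v) - (\<Sum>b\<in>fbasis. crd b (\<xi> x) *\<^sub>R B x (?DA b x v)) = B x (rhs v x)" for v
        unfolding rhs_def by (simp add: linear_diff[OF B(1)[OF x]] linear_sum[OF B(1)[OF x]] linear_cmul[OF B(1)[OF x]])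
      have val: "B x (k y) - (\<Sum>b\<in>fbasis. crd b (\<xi> y) *\<^sub>R B x (A y b - A x b)) = \<xi> y" if y: "y \<in> S" for y
      proof -
        have "(\<Sum>b\<in>fbasis. crd b (\<xi> y) *\<^sub>R B x (A y b - A x b)) = B x (A y (\<xi> y)) - B x (A x (\<xi> y))"
          unfolding expand[OF y, of "\<xi> y"] expand[OF x, of "\<xi> y"]
          by (simp add: linear_diff[OF B(1)[OF x]] linear_sum[OF B(1)[OF x]] linear_cmul[OF B(1)[OF x]]
              scaleR_diff_right sum_subtractf)
        then show ?thesis using B(2)[OF x] Suc.prems(2)[OF y] by simp
      qed
      from has_derivative_transform_within_open[OF 3[unfolded eq] S x val] show ?thesis .
    qed
    have "Ck_on n S (rhs v)" for v
    proof -
      have "Ck_on n S (\<lambda>x. ?DA b x v)" for b using smooth_onD[OF smooth_on_frechet[OF A(3)]] .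
      then have "Ck_on n S (\<lambda>x. crd b (\<xi> x) *\<^sub>R ?DA b x v)" for b
        by (rule Ck_on_bilinear[OF S bounded_bilinear_scaleR Ck_on_linear_compose[OF S bounded_linear_crd[OF fd] IH]])
      then have sm: "Ck_on n S (\<lambda>x. \<Sum>b\<in>fbasis. crd b (\<xi> x) *\<^sub>R ?DA b x v)" by (intro Ck_on_sum S)
      have "Ck_on n S (\<lambda>x. ?Dk x v)" using Suc.prems(1) by simp
      from Ck_on_add[OF S this Ck_on_linear_compose[OF S bounded_linear_minus[OF bounded_linear_ident] sm]]
      show ?thesis by (simp add: rhs_def[abs_def])
    qed
    then have "Ck_on n S (\<lambda>x. B x (rhs v x))" for v
      by (rule Suc.IH) (rule B(3))
    then show ?case by (intro Ck_on_SucI[OF S der])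
  qed
  then show ?thesis using k \<xi> by (auto simp: smooth_on_def)
qed

section \<open>Ordinary differential equations\<close>

lemma vector_derivative_reflect:
  assumes "(u has_vector_derivative u') (at (- s))"
  shows "((\<lambda>s. u (- s)) has_vector_derivative - u') (at s)"
proof -
  have "((\<lambda>s::real. - s) has_vector_derivative - 1) (at s)"
    by (auto intro!: derivative_eq_intros)
  from vector_diff_chain_at[OF this assms] show ?thesis by (simp add: o_def)
qed

text \<open>The integral majorant \<open>I\<close> dominates \<open>norm u\<close> and satisfies
  \<open>I' \<le> L * I + e\<close>, so \<open>I t * exp (- L * t) - e * t\<close> cannot
  increase.\<close>

lemma gronwall_forward:
  fixes u :: "real \<Rightarrow> 'a::real_normed_vector"
  assumes T: "0 \<le> T" and u: "\<And>s. s \<in> {0..T} \<Longrightarrow> (u has_vector_derivative u' s) (at s)"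
    and le: "\<And>s. s \<in> {0..T} \<Longrightarrow> norm (u' s) \<le> L * norm (u s) + e" and L: "L \<ge> 0" and e: "e \<ge> 0"
  shows "norm (u T) \<le> (norm (u 0) + e * T) * exp (L * T)"
proof (cases "T = 0")
  case False
  have cu: "continuous_on {0..T} u"
    by (intro continuous_at_imp_continuous_on ballI, rule has_vector_derivative_continuous, rule u)
  then have cn: "continuous_on {0..T} (\<lambda>s. norm (u s))" by (intro continuous_intros)
  define I where "I t = norm (u 0) + e * t + L * integral {0..t} (\<lambda>s. norm (u s))" for t
  have dI: "(I has_real_derivative e + L * norm (u t)) (at t within {0..T})" if "t \<in> {0..T}" for t
    using integral_has_vector_derivative[OF cn that] unfolding I_def
    by (auto intro!: derivative_eq_intros simp: has_real_derivative_iff_has_vector_derivative[symmetric])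
  have cI: "continuous_on {0..T} I"
    by (rule DERIV_continuous_on, rule dI)
  have dI': "(I has_real_derivative e + L * norm (u t)) (at t)" if "0 < t" "t < T" for t
    using dI[of t] that at_within_Icc_at[of 0 t T] by simp
  have uI: "norm (u t) \<le> I t" if t: "t \<in> {0..T}" for t
  proof (cases "t = 0")
    case False
    have "norm (u t - u 0) \<le> I t - I 0"
    proof (rule differentiable_bound_general)
      show "continuous_on {0..t} u" "continuous_on {0..t} I" using t cu cI by (auto intro: continuous_on_subset)
      show "(u has_vector_derivative u' x) (at x)" if "0 < x" "x < t" for x using u that t by auto
      show "(I has_vector_derivative e + L * norm (u x)) (at x)" if "0 < x" "x < t" for x
        using dI'[of x] that t by (simp add: has_real_derivative_iff_has_vector_derivative)
      show "norm (u' x) \<le> e + L * norm (u x)" if "0 < x" "x < t" for x using le[of x] that t by auto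
    qed (use t False in auto)
    moreover have "I 0 = norm (u 0)" by (simp add: I_def)
    moreover have "norm (u t) \<le> norm (u t - u 0) + norm (u 0)" using norm_triangle_ineq[of "u t - u 0" "u 0"] by simp
    ultimately show ?thesis by linarith
  qed (simp add: I_def)
  have "I T * exp (- L * T) - e * T \<le> I 0 * exp (- L * 0) - e * 0"
  proof (rule DERIV_nonpos_imp_decreasing_open[where f = "\<lambda>t. I t * exp (- L * t) - e * t"])
    show "continuous_on {0..T} (\<lambda>t. I t * exp (- L * t) - e * t)" by (intro continuous_intros cI)
    fix t assume t: "0 < t" "t < T"
    have "((\<lambda>t. I t * exp (- L * t) - e * t) has_real_derivative
        (e + L * norm (u t)) * exp (- L * t) + I t * (exp (- L * t) * - L) - e) (at t)"
      by (rule derivative_eq_intros dI'[OF t] | simp)+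
    moreover have "(e + L * norm (u t)) * exp (- L * t) + I t * (exp (- L * t) * - L) - e \<le> 0"
    proof -
      have "L * norm (u t) \<le> L * I t" using uI[of t] t L by (intro mult_left_mono) auto
      then have "exp (- L * t) * (L * norm (u t)) \<le> exp (- L * t) * (L * I t)" by (rule mult_left_mono) simp
      moreover have "e * exp (- L * t) \<le> e * 1" using e L t by (intro mult_left_mono) auto
      ultimately show ?thesis by (simp add: algebra_simps)
    qed
    ultimately show "\<exists>y. ((\<lambda>t. I t * exp (- L * t) - e * t) has_real_derivative y) (at t) \<and> y \<le> 0" by blast
  qed (use T in auto)
  then have "I T * exp (- L * T) \<le> norm (u 0) + e * T" by (simp add: I_def)
  then have "I T * exp (- L * T) * exp (L * T) \<le> (norm (u 0) + e * T) * exp (L * T)" by (intro mult_right_mono) auto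
  then have "I T \<le> (norm (u 0) + e * T) * exp (L * T)" by (simp add: mult.assoc exp_add[symmetric])
  then show ?thesis using uI[of T] T by auto
qed simp

lemma gronwall:
  fixes u :: "real \<Rightarrow> 'a::real_normed_vector"
  assumes u: "\<And>s. \<bar>s\<bar> \<le> T \<Longrightarrow> (u has_vector_derivative u' s) (at s)"
    and le: "\<And>s. \<bar>s\<bar> \<le> T \<Longrightarrow> norm (u' s) \<le> L * norm (u s) + e" and L: "L \<ge> 0" and e: "e \<ge> 0" and t: "\<bar>t\<bar> \<le> T"
  shows "norm (u t) \<le> (norm (u 0) + e * T) * exp (L * T)"
proof -
  have "norm (u t) \<le> (norm (u 0) + e * \<bar>t\<bar>) * exp (L * \<bar>t\<bar>)"
  proof (cases "t \<ge> 0")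
    case True
    then show ?thesis using gronwall_forward[of t u u' L e] u le L e t by simp
  next
    case False
    have "norm (u (- (- t))) \<le> (norm (u (- 0)) + e * (- t)) * exp (L * (- t))"
      by (rule gronwall_forward[where u' = "\<lambda>s. - u' (- s)"])
         (use False t L e in \<open>auto intro!: vector_derivative_reflect u le[of "- s" for s, simplified]\<close>)
    then show ?thesis using False by simp
  qed
  also have "\<dots> \<le> (norm (u 0) + e * T) * exp (L * T)"
    using t L e by (intro mult_mono add_mono) (auto intro!: mult_left_mono)
  finally show ?thesis .
qed

text \<open>This is the contraction estimate in the norm weighted by
  \<open>exp (- a * \<bar>t\<bar>)\<close>: integrating the bound on the derivative gains a factor
  \<open>1 / a\<close>.\<close>

lemma norm_le_exp:
  fixes w :: "real \<Rightarrow> 'a::real_normed_vector"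
  assumes w: "\<And>s. \<bar>s\<bar> \<le> T \<Longrightarrow> (w has_vector_derivative w' s) (at s)" and w0: "w 0 = 0"
    and le: "\<And>s. \<bar>s\<bar> \<le> T \<Longrightarrow> norm (w' s) \<le> C * a * exp (a * \<bar>s\<bar>)" and C: "C \<ge> 0" and t: "\<bar>t\<bar> \<le> T"
  shows "norm (w t) \<le> C * exp (a * \<bar>t\<bar>)"
proof -
  have fw: "norm (w t) \<le> C * exp (a * t)"
    if t: "0 \<le> t" "t \<le> T" and w: "\<And>s. \<bar>s\<bar> \<le> T \<Longrightarrow> (w has_vector_derivative w' s) (at s)" and w0: "w 0 = 0"
    and le: "\<And>s. \<bar>s\<bar> \<le> T \<Longrightarrow> norm (w' s) \<le> C * a * exp (a * \<bar>s\<bar>)"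
    for t and w w' :: "real \<Rightarrow> 'a"
  proof (cases "t = 0")
    case False
    have "norm (w t - w 0) \<le> C * exp (a * t) - C * exp (a * 0)"
    proof (rule differentiable_bound_general)
      show "continuous_on {0..t} w"
        by (intro continuous_at_imp_continuous_on ballI, rule has_vector_derivative_continuous, rule w) (use t in auto)
      show "continuous_on {0..t} (\<lambda>t. C * exp (a * t))" by (intro continuous_intros)
      show "(w has_vector_derivative w' x) (at x)" if "0 < x" "x < t" for x using w[of x] that t by auto
      show "((\<lambda>t. C * exp (a * t)) has_vector_derivative C * a * exp (a * \<bar>x\<bar>)) (at x)" if "0 < x" "x < t" for x
        using that by (auto intro!: derivative_eq_intros simp: has_real_derivative_iff_has_vector_derivative[symmetric])
      show "norm (w' x) \<le> C * a * exp (a * \<bar>x\<bar>)" if "0 < x" "x < t" for x using le[of x] that t by auto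
    qed (use t False in auto)
    then show ?thesis using C w0 by simp
  qed (use w0 C in simp)
  show ?thesis
  proof (cases "t \<ge> 0")
    case True then show ?thesis using fw[OF _ _ w w0 le] t by simp
  next
    case False
    have "norm (w (- (- t))) \<le> C * exp (a * (- t))"
      by (rule fw[where w' = "\<lambda>s. - w' (- s)"])
         (use False t w0 in \<open>auto intro!: vector_derivative_reflect w le[of "- s" for s, simplified]\<close>)
    then show ?thesis using False by simp
  qed
qed

section \<open>Global solutions for Lipschitz right-hand sides\<close>

lemma antiderivative_exists:
  fixes g :: "real \<Rightarrow> 'e::real_normed_vector"
  assumes fd: "fin_dim TYPE('e)" and g: "continuous_on UNIV g"
  shows "\<exists>G. G 0 = x0 \<and> (\<forall>t. (G has_vector_derivative g t) (at t))"
proof -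
  have real: "((\<lambda>u. LBINT y=0..ereal u. h y) has_vector_derivative h t) (at t)"
    if h: "continuous_on UNIV h" for h :: "real \<Rightarrow> real" and t
  proof -
    \<comment> \<open>The interval contains 0 and has \<open>t\<close> in its interior, whatever the
      sign of \<open>t\<close>.\<close>
    have "((\<lambda>u. LBINT y=ereal 0..ereal u. h y) has_vector_derivative h t) (at t within {- \<bar>t\<bar> - 1..\<bar>t\<bar> + 1})"
      by (rule interval_integral_FTC2) (auto intro: continuous_on_subset[OF h])
    moreover have "at t within {- \<bar>t\<bar> - 1..\<bar>t\<bar> + 1} = at t" by (rule at_within_interior) auto
    ultimately show ?thesis by (simp add: zero_ereal_def)
  qed
  define H where "H b t = (LBINT y=0..ereal t. crd b (g y))" for b t
  have H: "(H b has_vector_derivative crd b (g t)) (at t)" for b t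
    unfolding H_def by (rule real[OF bounded_linear.continuous_on[OF bounded_linear_crd[OF fd] g]])
  define G where "G t = x0 + (\<Sum>b\<in>fbasis. (H b t - H b 0) *\<^sub>R b)" for t
  have "(G has_vector_derivative 0 + (\<Sum>b\<in>fbasis. crd b (g t) *\<^sub>R b)) (at t)" for t
    unfolding G_def
  proof (intro has_vector_derivative_add has_vector_derivative_const has_vector_derivative_sum)
    fix b :: 'e
    have "((\<lambda>t. H b t - H b 0) has_vector_derivative crd b (g t) - 0) (at t)"
      by (intro has_vector_derivative_diff H has_vector_derivative_const)
    from bounded_linear.has_vector_derivative[OF bounded_linear_scaleR_left this]
    show "((\<lambda>t. (H b t - H b 0) *\<^sub>R b) has_vector_derivative crd b (g t) *\<^sub>R b) (at t)" by simp
  qed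
  then have "(G has_vector_derivative g t) (at t)" for t by (simp only: add_0 crd_expand[OF fd])
  moreover have "G 0 = x0" by (simp add: G_def)
  ultimately show ?thesis by blast
qed

text \<open>The iteration converges on the whole line at once because its contraction comes from an
  exponential weight and not from a short time interval.\<close>

lemma picard:
  fixes g :: "real \<times> 'e::real_normed_vector \<Rightarrow> 'e"
  assumes fd: "fin_dim TYPE('e)" and g: "continuous_on UNIV g"
    and L: "L \<ge> 0" and lip: "\<And>t a b. norm (g (t, a) - g (t, b)) \<le> L * norm (a - b)"
  shows "\<exists>u. u 0 = x0 \<and> (\<forall>t. (u has_vector_derivative g (t, u t)) (at t))"
proof -
  \<comment> \<open>At least twice the Lipschitz constant, so that each iteration halves the
    weighted distance; the added 1 keeps \<open>a\<close> positive for \<open>L = 0\<close>.\<close>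
  define a where "a = 2 * (L + 1)"
  have a: "a > 0" "2 * L \<le> a" using L by (auto simp: a_def)
  define P where "P u = (SOME v. v 0 = x0 \<and> (\<forall>t. (v has_vector_derivative g (t, u t)) (at t)))" for u
  have P: "P u 0 = x0" "(P u has_vector_derivative g (t, u t)) (at t)" if u: "continuous_on UNIV u" for u t
  proof -
    have "continuous_on UNIV (\<lambda>t. g (t, u t))"
      by (rule continuous_on_compose2[OF g]) (auto intro!: continuous_intros u)
    from someI_ex[OF antiderivative_exists[OF fd this]]
    show "P u 0 = x0" "(P u has_vector_derivative g (t, u t)) (at t)" unfolding P_def by blast+
  qed
  have Pc: "continuous_on UNIV (P u)" if "continuous_on UNIV u" for u
    using P(2)[OF that] by (intro continuous_at_imp_continuous_on ballI) (rule has_vector_derivative_continuous)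
  define U where "U n = (P ^^ n) (\<lambda>_. x0)" for n
  have U0: "U 0 = (\<lambda>_. x0)" and US: "U (Suc n) = P (U n)" for n by (auto simp: U_def)
  have Uc: "continuous_on UNIV (U n)" for n
    by (induction n) (auto simp: U0 US intro: Pc)
  have cauchy: "\<exists>K\<ge>0. \<forall>n t. \<bar>t\<bar> \<le> T \<longrightarrow> norm (U (Suc n) t - U n t) \<le> K * (1/2) ^ n" for T
  proof -
    have "compact ((\<lambda>t. norm (U 1 t - U 0 t)) ` {-T..T})"
      by (intro compact_continuous_image continuous_intros continuous_on_subset[OF Uc]) auto
    then have "bounded ((\<lambda>t. norm (U 1 t - U 0 t)) ` {-T..T})" by (rule compact_imp_bounded)
    then obtain M where "M > 0" "\<forall>x\<in>(\<lambda>t. norm (U 1 t - U 0 t)) ` {-T..T}. norm x \<le> M"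
      unfolding bounded_pos by blast
    then have M: "M \<ge> 0" "\<And>t. \<bar>t\<bar> \<le> T \<Longrightarrow> norm (U 1 t - U 0 t) \<le> M"
      by (auto simp: abs_le_iff)
    have est: "norm (U (Suc n) t - U n t) \<le> (M * (1/2) ^ n) * exp (a * \<bar>t\<bar>)" if "\<bar>t\<bar> \<le> T" for n t
      using that
    proof (induction n arbitrary: t)
      case 0
      have "M * 1 \<le> M * exp (a * \<bar>t\<bar>)" using M a by (intro mult_left_mono) auto
      then show ?case using M(2)[OF 0] by simp
    next
      case (Suc n)
      show ?case
      proof (rule norm_le_exp[where T = T and w' = "\<lambda>s. g (s, U (Suc n) s) - g (s, U n s)"])
        fix s assume s: "\<bar>s\<bar> \<le> T"
        show "((\<lambda>t. U (Suc (Suc n)) t - U (Suc n) t) has_vector_derivative g (s, U (Suc n) s) - g (s, U n s)) (at s)"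
          unfolding US[of "Suc n"] using P(2)[OF Uc, of n s] P(2)[OF Uc, of "Suc n" s]
          by (auto intro!: has_vector_derivative_diff simp: US)
        have "norm (g (s, U (Suc n) s) - g (s, U n s)) \<le> L * norm (U (Suc n) s - U n s)" by (rule lip)
        also have "\<dots> \<le> L * ((M * (1/2) ^ n) * exp (a * \<bar>s\<bar>))" using Suc.IH[OF s] L by (intro mult_left_mono)
        also have "\<dots> = (2 * L) * (M * (1/2) ^ Suc n * exp (a * \<bar>s\<bar>))" by simp
        also have "\<dots> \<le> a * (M * (1/2) ^ Suc n * exp (a * \<bar>s\<bar>))" using a M by (intro mult_right_mono) auto
        finally show "norm (g (s, U (Suc n) s) - g (s, U n s)) \<le> M * (1/2) ^ Suc n * a * exp (a * \<bar>s\<bar>)" by (simp add: mult_ac)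
      qed (use M Suc.prems Uc in \<open>auto simp: US P Pc\<close>)
    qed
    show ?thesis
    proof (intro exI[of _ "M * exp (a * T)"] conjI allI impI)
      show "0 \<le> M * exp (a * T)" using M by simp
      fix n t assume t: "\<bar>t\<bar> \<le> T"
      note est[OF t, of n]
      also have "(M * (1/2) ^ n) * exp (a * \<bar>t\<bar>) \<le> (M * (1/2) ^ n) * exp (a * T)"
        using M a t by (intro mult_left_mono) auto
      finally show "norm (U (Suc n) t - U n t) \<le> M * exp (a * T) * (1/2) ^ n" by (simp add: mult_ac)
    qed
  qed
  have tele: "norm (U (n + m) t - U n t) \<le> 2 * K * (1/2) ^ n"
    if K: "K \<ge> 0" "\<And>n. norm (U (Suc n) t - U n t) \<le> K * (1/2) ^ n" for n m t K
  proof -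
    \<comment> \<open>The subtracted term is the tail of the geometric series; with it the induction
      closes.\<close>
    have "norm (U (n + m) t - U n t) \<le> 2 * K * (1/2) ^ n - 2 * K * (1/2) ^ (n + m)"
    proof (induction m)
      case (Suc m)
      have "norm (U (n + Suc m) t - U n t) \<le> norm (U (Suc (n + m)) t - U (n + m) t) + norm (U (n + m) t - U n t)"
        using norm_triangle_ineq[of "U (Suc (n + m)) t - U (n + m) t" "U (n + m) t - U n t"] by simp
      also have "\<dots> \<le> K * (1/2) ^ (n + m) + (2 * K * (1/2) ^ n - 2 * K * (1/2) ^ (n + m))"
        by (rule add_mono[OF K(2) Suc])
      also have "\<dots> = 2 * K * (1/2) ^ n - 2 * K * (1/2) ^ (n + Suc m)" by simp
      finally show ?case .
    qed simp
    also have "\<dots> \<le> 2 * K * (1/2) ^ n" using K(1) by simp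
    finally show ?thesis .
  qed
  have "\<exists>l. (\<lambda>n. U n t) \<longlonglongrightarrow> l" for t
  proof -
    obtain K where K: "K \<ge> 0" "\<And>n. norm (U (Suc n) t - U n t) \<le> K * (1/2) ^ n" using cauchy[of "\<bar>t\<bar>"] by auto
    have "Cauchy (\<lambda>n. U n t)"
    proof (rule CauchyI')
      fix e :: real assume e: "e > 0"
      have "(\<lambda>n. 2 * K * (1/2) ^ n) \<longlonglongrightarrow> 2 * K * 0" by (intro tendsto_intros LIMSEQ_power_zero) auto
      then have "\<forall>\<^sub>F n in sequentially. 2 * K * (1/2) ^ n < e" using e by (intro order_tendstoD(2)) auto
      then obtain N where N: "\<And>n. n \<ge> N \<Longrightarrow> 2 * K * (1/2) ^ n < e" by (auto simp: eventually_sequentially)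
      show "\<exists>M. \<forall>m\<ge>M. \<forall>n>m. dist (U m t) (U n t) < e"
      proof (intro exI[of _ N] allI impI)
        fix m n assume mn: "N \<le> m" "m < n"
        have "norm (U (m + (n - m)) t - U m t) \<le> 2 * K * (1/2) ^ m" by (rule tele[OF K])
        also have "\<dots> < e" by (rule N[OF mn(1)])
        finally show "dist (U m t) (U n t) < e" using mn by (simp add: dist_norm norm_minus_commute)
      qed
    qed
    then show ?thesis using fin_dim_complete[OF fd] unfolding complete_def by blast
  qed
  then obtain u where u: "\<And>t. (\<lambda>n. U n t) \<longlonglongrightarrow> u t" by metis
  have conv: "\<exists>K\<ge>0. \<forall>n t. \<bar>t\<bar> \<le> T \<longrightarrow> norm (u t - U n t) \<le> K * (1/2) ^ n" for T
  proof -
    obtain K where K: "K \<ge> 0" "\<And>n t. \<bar>t\<bar> \<le> T \<Longrightarrow> norm (U (Suc n) t - U n t) \<le> K * (1/2) ^ n" using cauchy by blast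
    have "norm (u t - U n t) \<le> 2 * K * (1/2) ^ n" if t: "\<bar>t\<bar> \<le> T" for n t
    proof (rule tendsto_upperbound)
      show "(\<lambda>m. norm (U (n + m) t - U n t)) \<longlonglongrightarrow> norm (u t - U n t)"
        using LIMSEQ_ignore_initial_segment[OF u[of t], of n] by (intro tendsto_intros) (simp add: add.commute)
      show "\<forall>\<^sub>F m in sequentially. norm (U (n + m) t - U n t) \<le> 2 * K * (1/2) ^ n"
        using tele[OF K(1) K(2)[OF t]] by simp
    qed simp
    then show ?thesis using K by (intro exI[of _ "2 * K"]) auto
  qed
  have uc: "isCont u t" for t
  proof -
    obtain K where K: "K \<ge> 0" "\<And>n s. \<bar>s\<bar> \<le> \<bar>t\<bar> + 1 \<Longrightarrow> norm (u s - U n s) \<le> K * (1/2) ^ n" using conv by blast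
    have "uniform_limit {-(\<bar>t\<bar> + 1)<..<\<bar>t\<bar> + 1} U u sequentially"
    proof (rule uniform_limitI)
      fix e :: real assume e: "e > 0"
      have "(\<lambda>n. K * (1/2) ^ n) \<longlonglongrightarrow> K * 0" by (intro tendsto_intros LIMSEQ_power_zero) auto
      then have "\<forall>\<^sub>F n in sequentially. K * (1/2) ^ n < e" using e by (intro order_tendstoD(2)) auto
      then show "\<forall>\<^sub>F n in sequentially. \<forall>x\<in>{-(\<bar>t\<bar> + 1)<..<\<bar>t\<bar> + 1}. dist (U n x) (u x) < e"
      proof eventually_elim
        case (elim n)
        show ?case
        proof
          fix x assume "x \<in> {-(\<bar>t\<bar> + 1)<..<\<bar>t\<bar> + 1}"
          then have "norm (u x - U n x) \<le> K * (1/2) ^ n" by (intro K) auto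
          then show "dist (U n x) (u x) < e" using elim by (simp add: dist_norm norm_minus_commute)
        qed
      qed
    qed
    then have "continuous_on {-(\<bar>t\<bar> + 1)<..<\<bar>t\<bar> + 1} u"
      by (rule uniform_limit_theorem[rotated]) (auto intro!: always_eventually continuous_on_subset[OF Uc])
    then have "\<forall>x\<in>{-(\<bar>t\<bar> + 1)<..<\<bar>t\<bar> + 1}. isCont u x" by (simp add: continuous_on_eq_continuous_at)
    moreover have "t \<in> {-(\<bar>t\<bar> + 1)<..<\<bar>t\<bar> + 1}" by auto
    ultimately show ?thesis by blast
  qed
  then have uC: "continuous_on UNIV u" by (simp add: continuous_at_imp_continuous_on)
  \<comment> \<open>\<open>P u\<close> is the limit of \<open>P (U n)\<close>, and these are the
    iterates shifted by one.\<close>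
  have "P u t = u t" for t
  proof -
    obtain K where K: "K \<ge> 0" "\<And>n s. \<bar>s\<bar> \<le> \<bar>t\<bar> \<Longrightarrow> norm (u s - U n s) \<le> K * (1/2) ^ n" using conv by blast
    have "norm (P u t - U (Suc n) t) \<le> (L * K * (1/2) ^ n) * exp (1 * \<bar>t\<bar>)" for n
    proof (rule norm_le_exp[where T = "\<bar>t\<bar>" and w' = "\<lambda>s. g (s, u s) - g (s, U n s)"])
      fix s assume s: "\<bar>s\<bar> \<le> \<bar>t\<bar>"
      show "((\<lambda>t. P u t - U (Suc n) t) has_vector_derivative g (s, u s) - g (s, U n s)) (at s)"
        unfolding US by (intro has_vector_derivative_diff P uC Uc)
      have "norm (g (s, u s) - g (s, U n s)) \<le> L * norm (u s - U n s)" by (rule lip)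
      also have "\<dots> \<le> L * (K * (1/2) ^ n)" using K(2)[OF s] L by (intro mult_left_mono)
      also have "\<dots> = (L * K * (1/2) ^ n) * 1" by simp
      also have "\<dots> \<le> (L * K * (1/2) ^ n) * exp (1 * \<bar>s\<bar>)" using L K(1) by (intro mult_left_mono) auto
      finally show "norm (g (s, u s) - g (s, U n s)) \<le> L * K * (1/2) ^ n * 1 * exp (1 * \<bar>s\<bar>)" by simp
    qed (use L K(1) uC Uc in \<open>auto simp: US P\<close>)
    note bnd = this
    have "(\<lambda>n. (L * K * (1/2) ^ n) * exp (1 * \<bar>t\<bar>)) \<longlonglongrightarrow> (L * K * 0) * exp (1 * \<bar>t\<bar>)"
      by (intro tendsto_intros LIMSEQ_power_zero) auto
    then have "(\<lambda>n. (L * K * (1/2) ^ n) * exp (1 * \<bar>t\<bar>)) \<longlonglongrightarrow> 0" by simp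
    then have "(\<lambda>n. P u t - U (Suc n) t) \<longlonglongrightarrow> 0"
      by (rule Lim_null_comparison[rotated]) (rule always_eventually, rule allI, rule bnd)
    moreover have "(\<lambda>n. P u t - U (Suc n) t) \<longlonglongrightarrow> P u t - u t"
      by (intro tendsto_intros LIMSEQ_Suc u)
    ultimately have "0 = P u t - u t" by (rule LIMSEQ_unique)
    then show ?thesis by simp
  qed
  then have "P u = u" by auto
  then show ?thesis using P[OF uC] by auto
qed

section \<open>Dependence of solutions on parameters and initial values\<close>

lemma ode_continuous_dependence:
  fixes g :: "real \<times> 'x::real_normed_vector \<times> 'e::real_normed_vector \<Rightarrow> 'e"
  assumes g: "continuous_on UNIV g" and L: "L \<ge> 0"
    and lip: "\<And>t x a b. norm (g (t, x, a) - g (t, x, b)) \<le> L * norm (a - b)"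
    and u: "\<And>t x. ((\<lambda>t. u t x) has_vector_derivative g (t, x, u t x)) (at t)"
    and i: "continuous_on UNIV (u 0)"
  shows "continuous_on UNIV (\<lambda>(t, x). u t x)"
proof -
  have uc: "continuous_on S (\<lambda>t. u t x)" for x S
    using u by (intro continuous_at_imp_continuous_on ballI) (rule has_vector_derivative_continuous)
  \<comment> \<open>Gronwall's inequality for the difference of two solutions. The inhomogeneous
    term is the change of \<open>g\<close> with the parameter along the reference trajectory, which
    is uniformly small because that trajectory is compact.\<close>
  have unif: "\<forall>\<^sub>F x in nhds x0. \<forall>t. \<bar>t\<bar> \<le> T \<longrightarrow> norm (u t x - u t x0) < e" if e: "e > 0" and T: "T > 0" for x0 e T
  proof -
    \<comment> \<open>Makes the Gronwall bound \<open>(E + E * T) * exp (L * T)\<close> equal to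
      \<open>e / 2\<close>.\<close>
    define E where "E = e / (2 * exp (L * T) * (T + 1))"
    have E: "E > 0" using e T by (simp add: E_def)
    have "(E + E * T) * exp (L * T) = E * (T + 1) * exp (L * T)" by (simp add: algebra_simps)
    also have "\<dots> = e / 2" using T by (simp add: E_def)
    finally have ET: "(E + E * T) * exp (L * T) < e" using e by simp
    have "compact ((\<lambda>t. (t, x0, u t x0)) ` {-T..T})"
      by (intro compact_continuous_image continuous_intros uc) auto
    from uniform_near_compact[OF this subset_UNIV open_UNIV g E]
    have "\<forall>\<^sub>F d in at_right 0. \<forall>z\<in>(\<lambda>t. (t, x0, u t x0)) ` {-T..T}. \<forall>z'. dist z' z < d \<longrightarrow> dist (g z') (g z) < E"
      by (simp add: eventually_mono)
    with eventually_at_right_less[of "0::real"]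
    have ev: "\<forall>\<^sub>F d in at_right 0. 0 < d \<and> (\<forall>z\<in>(\<lambda>t. (t, x0, u t x0)) ` {-T..T}. \<forall>z'. dist z' z < d \<longrightarrow> dist (g z') (g z) < E)"
      by eventually_elim simp
    have "at_right (0::real) \<noteq> bot" by simp
    from eventually_happens'[OF this ev] obtain d where
      d: "0 < d" "\<forall>z\<in>(\<lambda>t. (t, x0, u t x0)) ` {-T..T}. \<forall>z'. dist z' z < d \<longrightarrow> dist (g z') (g z) < E" by blast
    have "isCont (u 0) x0" using i by (simp add: continuous_on_eq_continuous_at)
    then have "\<forall>\<^sub>F x in nhds x0. dist (u 0 x) (u 0 x0) < E"
      using E unfolding isCont_def tendsto_at_iff_tendsto_nhds by (rule tendstoD)
    moreover have "\<forall>\<^sub>F x in nhds x0. dist x x0 < d"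
      using d(1) by (auto simp: eventually_nhds_metric)
    ultimately show ?thesis
    proof eventually_elim
      case (elim x)
      show ?case
      proof (intro allI impI)
        fix t assume t: "\<bar>t\<bar> \<le> T"
        have "norm (u t x - u t x0) \<le> (norm (u 0 x - u 0 x0) + E * T) * exp (L * T)"
        proof (rule gronwall[OF _ _ L less_imp_le[OF E] t])
          fix s assume s: "\<bar>s\<bar> \<le> T"
          show "((\<lambda>t. u t x - u t x0) has_vector_derivative g (s, x, u s x) - g (s, x0, u s x0)) (at s)"
            by (intro has_vector_derivative_diff u)
          have "(s, x0, u s x0) \<in> (\<lambda>t. (t, x0, u t x0)) ` {-T..T}" using s by (intro image_eqI[of _ _ s]) auto
          moreover have "dist (s, x, u s x0) (s, x0, u s x0) < d" using elim by (simp add: dist_Pair_Pair)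
          ultimately have "norm (g (s, x, u s x0) - g (s, x0, u s x0)) < E" using d(2) unfolding dist_norm[symmetric] by blast
          moreover have "norm (g (s, x, u s x) - g (s, x, u s x0)) \<le> L * norm (u s x - u s x0)" by (rule lip)
          moreover have "norm (g (s, x, u s x) - g (s, x0, u s x0)) \<le>
              norm (g (s, x, u s x) - g (s, x, u s x0)) + norm (g (s, x, u s x0) - g (s, x0, u s x0))"
            using norm_triangle_ineq[of "g (s, x, u s x) - g (s, x, u s x0)" "g (s, x, u s x0) - g (s, x0, u s x0)"] by simp
          ultimately show "norm (g (s, x, u s x) - g (s, x0, u s x0)) \<le> L * norm (u s x - u s x0) + E" by linarith
        qed
        also have "\<dots> \<le> (E + E * T) * exp (L * T)"
          using elim(1) by (intro mult_right_mono add_right_mono) (auto simp: dist_norm)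
        finally show "norm (u t x - u t x0) < e" using ET by linarith
      qed
    qed
  qed
  have "isCont (\<lambda>(t, x). u t x) (t0, x0)" for t0 x0
    unfolding isCont_def
  proof (rule tendstoI)
    fix e :: real assume e: "e > 0"
    have "\<forall>\<^sub>F x in nhds x0. \<forall>t. \<bar>t\<bar> \<le> \<bar>t0\<bar> + 1 \<longrightarrow> norm (u t x - u t x0) < e / 2"
      by (rule unif) (use e in auto)
    moreover have "isCont (\<lambda>t. u t x0) t0" using uc[of UNIV x0] by (simp add: continuous_on_eq_continuous_at)
    then have "\<forall>\<^sub>F t in nhds t0. dist (u t x0) (u t0 x0) < e / 2"
      using e tendstoD[of "\<lambda>t. u t x0" "u t0 x0" "nhds t0" "e / 2"] tendsto_at_iff_tendsto_nhds[of "\<lambda>t. u t x0" t0]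
      by (simp add: isCont_def)
    moreover have "\<forall>\<^sub>F t in nhds t0. dist t t0 < 1"
      by (auto simp: eventually_nhds_metric intro!: exI[of _ 1])
    ultimately have "\<forall>\<^sub>F z in nhds t0 \<times>\<^sub>F nhds x0. (dist (u (fst z) x0) (u t0 x0) < e / 2 \<and> dist (fst z) t0 < 1) \<and>
        (\<forall>t. \<bar>t\<bar> \<le> \<bar>t0\<bar> + 1 \<longrightarrow> norm (u t (snd z) - u t x0) < e / 2)"
      by (intro eventually_conj eventually_prodI[where P = "\<lambda>t. dist (u t x0) (u t0 x0) < e / 2 \<and> dist t t0 < 1", THEN eventually_mono]
          eventually_prodI[where P = "\<lambda>t. True", THEN eventually_mono]) (auto intro: eventually_conj)
    then have "\<forall>\<^sub>F z in nhds (t0, x0). dist (case z of (t, x) \<Rightarrow> u t x) (u t0 x0) < e"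
      unfolding nhds_prod
    proof eventually_elim
      case (elim z)
      obtain t x where z: "z = (t, x)" by fastforce
      have "dist (u t x) (u t x0) < e / 2" using elim unfolding z by (auto simp: dist_norm)
      moreover have "dist (u t x0) (u t0 x0) < e / 2" using elim unfolding z by simp
      ultimately show ?case unfolding z using dist_triangle_half_l[of "u t x" "u t x0" e "u t0 x0"]
        by (simp add: dist_commute)
    qed
    then show "\<forall>\<^sub>F z in at (t0, x0). dist (case z of (t, x) \<Rightarrow> u t x) (case (t0, x0) of (t, x) \<Rightarrow> u t x) < e"
      unfolding eventually_at_filter by (simp add: eventually_mono)
  qed
  then show ?thesis by (auto intro!: continuous_at_imp_continuous_on)
qed

text \<open>A Lipschitz bound along one line passes to the difference quotients and to their limit.
  In this way the Lipschitz constant of a field also bounds its linearisation.\<close>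

lemma norm_derivative_le:
  assumes f: "(f has_derivative D) (at z)" and le: "\<And>s::real. norm (f (z + s *\<^sub>R v) - f z) \<le> B * \<bar>s\<bar>"
  shows "norm (D v) \<le> B"
proof -
  have lin: "linear D" by (rule has_derivative_linear[OF f])
  have B: "B \<ge> 0" using order_trans[OF norm_ge_zero le[of 1]] by simp
  show ?thesis
  proof (rule field_le_epsilon)
    fix e :: real assume e: "e > 0"
    define e' where "e' = e / (norm v + 1)"
    have e': "e' > 0" using e by (simp add: e'_def add_nonneg_pos)
    then obtain d where d: "d > 0" "\<And>y. norm (y - z) < d \<Longrightarrow> norm (f y - f z - D (y - z)) \<le> e' * norm (y - z)"
      using f unfolding has_derivative_at_alt by blast
    define c where "c = norm v + 1"
    have n: "c > 0" by (simp add: c_def add_nonneg_pos)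
    define s where "s = d / (2 * c)"
    have s: "s > 0" using d n by (simp add: s_def)
    have "s * norm v \<le> s * c" using s by (intro mult_left_mono) (auto simp: c_def)
    also have "\<dots> = d / 2" using n by (simp add: s_def)
    finally have sv: "norm (s *\<^sub>R v) < d" using s d by simp
    have "s * norm (D v) = norm (D (s *\<^sub>R v))" using s by (simp add: linear_cmul[OF lin])
    also have "\<dots> \<le> norm (f (z + s *\<^sub>R v) - f z) + norm (f (z + s *\<^sub>R v) - f z - D (s *\<^sub>R v))"
      using norm_triangle_ineq4[of "f (z + s *\<^sub>R v) - f z" "f (z + s *\<^sub>R v) - f z - D (s *\<^sub>R v)"] by simp
    also have "\<dots> \<le> B * s + e' * norm (s *\<^sub>R v)"
      using le[of s] d(2)[of "z + s *\<^sub>R v"] sv s by (intro add_mono) auto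
    also have "\<dots> = s * (B + e' * norm v)" using s by (simp add: algebra_simps)
    also have "\<dots> \<le> s * (B + e)"
    proof -
      have "e' * norm v \<le> e' * (norm v + 1)" using e' by (intro mult_left_mono) auto
      also have "\<dots> = e" using n unfolding e'_def c_def[symmetric] by simp
      finally show ?thesis using s by simp
    qed
    finally show "norm (D v) \<le> B + e" using s by simp
  qed
qed

text \<open>The candidate \<open>w\<close> for the derivative in the parameter solves the linearised
  equation. The derivative of the remainder \<open>u t y - u t x0 - w t x0 (y - x0)\<close> is at
  most \<open>L\<close> times the remainder plus a term of smaller order than \<open>y - x0\<close>,
  so Gronwall's inequality gives differentiability.\<close>

lemma ode_differentiable_dependence:
  fixes g :: "real \<times> 'x::real_normed_vector \<times> 'e::real_normed_vector \<Rightarrow> 'e"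
  assumes fdx: "fin_dim TYPE('x)" and fde: "fin_dim TYPE('e)" and g: "Ck_on 1 UNIV g" and L: "L \<ge> 0"
    and lip: "\<And>t x a b. norm (g (t, x, a) - g (t, x, b)) \<le> L * norm (a - b)"
    and u: "\<And>t x. ((\<lambda>t. u t x) has_vector_derivative g (t, x, u t x)) (at t)"
    and J: "linear J" "\<And>x v. u 0 (x + v) = u 0 x + J v"
  shows "\<exists>w. (\<forall>x v. w 0 x v = J v) \<and>
    (\<forall>t x v. ((\<lambda>t. w t x v) has_vector_derivative frechet_derivative g (at (t, x, u t x)) (0, v, w t x v)) (at t)) \<and>
    (\<forall>t x. ((\<lambda>(t, x). u t x) has_derivative (\<lambda>(\<tau>, v). \<tau> *\<^sub>R g (t, x, u t x) + w t x v)) (at (t, x)))"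
proof -
  let ?D = "\<lambda>z. frechet_derivative g (at z)"
  have fdxe: "fin_dim TYPE('x \<times> 'e)" by (rule fin_dim_prod[OF fdx fde])
  have fd3: "fin_dim TYPE(real \<times> 'x \<times> 'e)" by (rule fin_dim_prod[OF fin_dim_real fdxe])
  have gD: "(g has_derivative ?D z) (at z)" for z using Ck_on_1D(1)[OF g] by simp
  have gDc: "continuous_on UNIV (\<lambda>z. ?D z h)" for h using Ck_on_1D(2)[OF g] .
  have gc: "continuous_on UNIV g" using g by (intro Ck_on_imp_continuous_on open_UNIV)
  have Dlin: "linear (?D z)" for z by (rule has_derivative_linear[OF gD])
  have Dsplit: "?D z (0, v, a) = ?D z (0, v, 0) + ?D z (0, 0, a)" for z v a
    using linear_add[OF Dlin, of z "(0, v, 0)" "(0, 0, a)"] by simp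
  have Dle: "norm (?D z (0, 0, a)) \<le> L * norm a" for z a
  proof (rule norm_derivative_le[OF gD])
    fix s :: real
    obtain t x b where z: "z = (t, x, b)" by (cases z) auto
    show "norm (g (z + s *\<^sub>R (0, 0, a)) - g z) \<le> L * norm a * \<bar>s\<bar>"
      using lip[of t x "b + s *\<^sub>R a" b] by (simp add: z mult_ac)
  qed
  have bJ: "bounded_linear J" by (rule linear_imp_bounded_linear[OF fdx J(1)])
  have uc: "continuous_on S (\<lambda>t. u t x)" for x S
    using u by (intro continuous_at_imp_continuous_on ballI) (rule has_vector_derivative_continuous)
  have "continuous_on UNIV (u 0)"
  proof -
    have "continuous_on UNIV (\<lambda>x. u 0 0 + J x)"
      by (intro continuous_on_add continuous_on_const linear_continuous_on[OF bJ])
    moreover have "u 0 x = u 0 0 + J x" for x using J(2)[of 0 x] by simp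
    then have "u 0 = (\<lambda>x. u 0 0 + J x)" by (rule ext)
    ultimately show ?thesis by (rule ssubst[rotated])
  qed
  have ucont: "continuous_on UNIV (\<lambda>(t, x). u t x)"
    by (rule ode_continuous_dependence[OF gc L lip u]) fact
  \<comment> \<open>The linearised equation is again globally Lipschitz with constant
    \<open>L\<close>, so \<open>picard\<close> solves it for all times.\<close>
  have ex: "\<exists>w. w 0 = J v \<and> (\<forall>t. (w has_vector_derivative ?D (t, x, u t x) (0, v, w t)) (at t))" for x v
  proof -
    define h where "h z = ?D (fst z, x, u (fst z) x) (0, v, snd z)" for z :: "real \<times> 'e"
    have hc: "continuous_on UNIV h"
    proof -
      have c: "continuous_on UNIV (\<lambda>z::real \<times> 'e. ?D (fst z, x, u (fst z) x) k)" for k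
        by (rule continuous_on_compose2[OF gDc]) (auto intro!: continuous_intros continuous_on_compose2[OF uc])
      have "h = (\<lambda>z. ?D (fst z, x, u (fst z) x) (0, v, 0) + (\<Sum>b\<in>fbasis. crd b (snd z) *\<^sub>R ?D (fst z, x, u (fst z) x) (0, 0, b)))"
      proof
        fix z :: "real \<times> 'e"
        have "linear (\<lambda>a. ?D (fst z, x, u (fst z) x) (0, 0, a))"
          using linear_add[OF Dlin, of _ "(0, 0, a)" "(0, 0, b)" for a b] linear_cmul[OF Dlin, of _ c "(0, 0, a)" for a c]
          by (intro linearI) simp_all
        from linear_eq_sum_basis[OF fde this, of "snd z"]
        show "h z = ?D (fst z, x, u (fst z) x) (0, v, 0) + (\<Sum>b\<in>fbasis. crd b (snd z) *\<^sub>R ?D (fst z, x, u (fst z) x) (0, 0, b))"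
          by (simp only: h_def Dsplit[of _ v "snd z"])
      qed
      moreover have "continuous_on UNIV (\<lambda>z::real \<times> 'e. ?D (fst z, x, u (fst z) x) (0, v, 0) + (\<Sum>b\<in>fbasis. crd b (snd z) *\<^sub>R ?D (fst z, x, u (fst z) x) (0, 0, b)))"
        by (intro continuous_intros c bounded_linear.continuous_on[OF bounded_linear_crd[OF fde]])
      ultimately show ?thesis by simp
    qed
    have "norm (h (t, a) - h (t, b)) \<le> L * norm (a - b)" for t a b
    proof -
      have "h (t, a) - h (t, b) = ?D (t, x, u t x) (0, 0, a - b)"
        unfolding h_def using linear_diff[OF Dlin, of "(t, x, u t x)" "(0, v, a)" "(0, v, b)"] by simp
      then show ?thesis using Dle by simp
    qed
    from picard[OF fde hc L this, of "J v"] show ?thesis by (simp add: h_def)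
  qed
  define w where "w t x v = (SOME w. w 0 = J v \<and> (\<forall>t. (w has_vector_derivative ?D (t, x, u t x) (0, v, w t)) (at t))) t" for t x v
  have w: "w 0 x v = J v" "((\<lambda>t. w t x v) has_vector_derivative ?D (t, x, u t x) (0, v, w t x v)) (at t)" for t x v
    using someI_ex[OF ex[of v x]] unfolding w_def by blast+
  \<comment> \<open>Applied to the defects of additivity and homogeneity, which start at 0 and solve
    the homogeneous equation, this makes \<open>w\<close> linear in \<open>v\<close>.\<close>
  have uniq: "y t = 0" if y: "y 0 = 0" "\<And>t. (y has_vector_derivative ?D (t, x, u t x) (0, 0, y t)) (at t)" for y x t
    using gronwall[OF y(2) _ L order_refl, of "\<bar>t\<bar>" t] Dle y(1) by simp
  have wlin: "linear (w t x)" for t x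
  proof (rule linearI)
    fix v1 v2
    have "(\<lambda>t. w t x (v1 + v2) - w t x v1 - w t x v2) t = 0"
    proof (rule uniq)
      fix t
      have eq: "?D (t, x, u t x) (0, v1 + v2, w t x (v1 + v2)) - ?D (t, x, u t x) (0, v1, w t x v1) - ?D (t, x, u t x) (0, v2, w t x v2)
        = ?D (t, x, u t x) (0, 0, w t x (v1 + v2) - w t x v1 - w t x v2)"
        unfolding linear_diff[OF Dlin, symmetric] by simp
      have "((\<lambda>t. w t x (v1 + v2) - w t x v1 - w t x v2) has_vector_derivative
        ?D (t, x, u t x) (0, v1 + v2, w t x (v1 + v2)) - ?D (t, x, u t x) (0, v1, w t x v1) - ?D (t, x, u t x) (0, v2, w t x v2)) (at t)"
        by (intro has_vector_derivative_diff w)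
      then show "((\<lambda>t. w t x (v1 + v2) - w t x v1 - w t x v2) has_vector_derivative
        ?D (t, x, u t x) (0, 0, w t x (v1 + v2) - w t x v1 - w t x v2)) (at t)" by (simp only: eq)
    qed (simp add: w linear_add[OF J(1)])
    then show "w t x (v1 + v2) = w t x v1 + w t x v2" by (simp add: algebra_simps)
  next
    fix c v
    have "(\<lambda>t. w t x (c *\<^sub>R v) - c *\<^sub>R w t x v) t = 0"
    proof (rule uniq)
      fix t
      have eq: "?D (t, x, u t x) (0, c *\<^sub>R v, w t x (c *\<^sub>R v)) - c *\<^sub>R ?D (t, x, u t x) (0, v, w t x v)
        = ?D (t, x, u t x) (0, 0, w t x (c *\<^sub>R v) - c *\<^sub>R w t x v)"
        unfolding linear_cmul[OF Dlin, symmetric] linear_diff[OF Dlin, symmetric] by simp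
      have "((\<lambda>t. w t x (c *\<^sub>R v) - c *\<^sub>R w t x v) has_vector_derivative
        ?D (t, x, u t x) (0, c *\<^sub>R v, w t x (c *\<^sub>R v)) - c *\<^sub>R ?D (t, x, u t x) (0, v, w t x v)) (at t)"
        by (intro has_vector_derivative_diff w bounded_linear.has_vector_derivative[OF bounded_linear_scaleR_right])
      then show "((\<lambda>t. w t x (c *\<^sub>R v) - c *\<^sub>R w t x v) has_vector_derivative
        ?D (t, x, u t x) (0, 0, w t x (c *\<^sub>R v) - c *\<^sub>R w t x v)) (at t)" by (simp only: eq)
    qed (simp add: w linear_cmul[OF J(1)])
    then show "w t x (c *\<^sub>R v) = c *\<^sub>R w t x v" by simp
  qed
  have der: "((\<lambda>x. u t x) has_derivative w t x0) (at x0)" for t x0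
    unfolding has_derivative_at_alt
  proof (intro conjI linear_imp_bounded_linear[OF fdx] wlin allI impI)
    fix e :: real assume e: "e > 0"
    define T where "T = \<bar>t\<bar>"
    define K where "K = (\<lambda>s. (s, x0, u s x0)) ` {-T..T}"
    have K: "compact K" unfolding K_def by (intro compact_continuous_image continuous_intros uc) auto
    have Kin: "(s, x0, u s x0) \<in> K" if "\<bar>s\<bar> \<le> T" for s
      unfolding K_def by (rule image_eqI[of _ _ s]) (use that in auto)
    obtain C where C: "C > 0" "\<And>s v. \<bar>s\<bar> \<le> T \<Longrightarrow> norm (w s x0 v) \<le> C * norm v"
    proof -
      have sum: "w s x0 v = (\<Sum>b\<in>fbasis. crd b v *\<^sub>R w s x0 b)" for s v
        by (rule linear_eq_sum_basis[OF fdx wlin])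
      obtain C1 where C1: "\<forall>(x::'x) b. \<bar>crd b x\<bar> \<le> C1 * norm x" "C1 > 0" using norm_equivalence[OF fdx] by auto
      have "\<exists>M\<ge>0. \<forall>s. \<bar>s\<bar> \<le> T \<longrightarrow> norm (w s x0 b) \<le> M" for b
      proof -
        have "continuous_on {-T..T} (\<lambda>s. w s x0 b)"
          using w(2) by (intro continuous_at_imp_continuous_on ballI) (rule has_vector_derivative_continuous)
        then have "bounded ((\<lambda>s. w s x0 b) ` {-T..T})"
          by (intro compact_imp_bounded compact_continuous_image) auto
        then obtain M where "M > 0" "\<forall>y\<in>(\<lambda>s. w s x0 b) ` {-T..T}. norm y \<le> M" unfolding bounded_pos by blast
        then show ?thesis by (intro exI[of _ M]) (auto simp: abs_le_iff)
      qed
      then obtain M where M: "\<And>b. M b \<ge> 0" "\<And>b s. \<bar>s\<bar> \<le> T \<Longrightarrow> norm (w s x0 b) \<le> M b" by metis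
      define C where "C = (\<Sum>b\<in>fbasis. C1 * M b) + 1"
      have C0: "(\<Sum>b\<in>fbasis. C1 * M b) \<ge> 0" using M C1 by (intro sum_nonneg) auto
      have "norm (w s x0 v) \<le> C * norm v" if s: "\<bar>s\<bar> \<le> T" for s v
      proof -
        have "norm (w s x0 v) \<le> (\<Sum>b\<in>fbasis. (C1 * norm v) * M b)"
          unfolding sum[of s v]
        proof (rule sum_norm_le)
          show "norm (crd b v *\<^sub>R w s x0 b) \<le> (C1 * norm v) * M b" for b
            unfolding norm_scaleR real_norm_def using C1 M(2)[OF s, of b] by (intro mult_mono) auto
        qed
        also have "\<dots> = (\<Sum>b\<in>fbasis. C1 * M b) * norm v" by (simp add: sum_distrib_left mult_ac)
        also have "\<dots> \<le> C * norm v" by (intro mult_right_mono) (auto simp: C_def)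
        finally show ?thesis .
      qed
      then show ?thesis using that[of C] C0 by (simp add: C_def)
    qed
    \<comment> \<open>The factor \<open>1 + C\<close> bounds the direction
      \<open>(0, v, w s x0 v)\<close> in terms of \<open>norm v\<close>; the other two factors come
      from Gronwall's inequality.\<close>
    define E where "E = e / ((1 + C) * (T + 1) * exp (L * T))"
    have T0: "T \<ge> 0" by (simp add: T_def)
    have E: "E > 0" using e C T0 unfolding E_def by (intro divide_pos_pos mult_pos_pos) auto
    have E2: "E * (1 + C) * T * exp (L * T) \<le> e"
    proof -
      have "E * (1 + C) * T * exp (L * T) \<le> E * (1 + C) * (T + 1) * exp (L * T)"
        using E C T0 by (intro mult_right_mono mult_left_mono) auto
      also have "\<dots> = e" using C T0 by (simp add: E_def add_nonneg_eq_0_iff)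
      finally show ?thesis .
    qed
    obtain d where d: "d > 0" "\<And>z h. z \<in> K \<Longrightarrow> norm h < d \<Longrightarrow> norm (g (z + h) - g z - ?D z h) \<le> E * norm h"
      using uniform_differentiability[OF fd3 open_UNIV g K subset_UNIV E] by blast
    show "\<exists>d>0. \<forall>y. norm (y - x0) < d \<longrightarrow> norm (u t y - u t x0 - w t x0 (y - x0)) \<le> e * norm (y - x0)"
    proof (intro exI[of _ "d / (1 + C)"] conjI allI impI)
      show "0 < d / (1 + C)" using d C by simp
      fix y assume y: "norm (y - x0) < d / (1 + C)"
      define v where "v = y - x0"
      have vd: "(1 + C) * norm v < d" using y C by (simp add: v_def field_simps)
      define R where "R s = u s y - u s x0 - w s x0 v" for s
      define R' where "R' s = g (s, y, u s y) - g (s, x0, u s x0) - ?D (s, x0, u s x0) (0, v, w s x0 v)" for s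
      have "norm (R t) \<le> (norm (R 0) + (E * ((1 + C) * norm v)) * T) * exp (L * T)"
      proof (rule gronwall[OF _ _ L])
        fix s assume s: "\<bar>s\<bar> \<le> T"
        show "(R has_vector_derivative R' s) (at s)"
          unfolding R_def R'_def by (intro has_vector_derivative_diff u w)
        let ?h = "(0::real, v, w s x0 v)"
        have "norm ?h \<le> norm v + norm (w s x0 v)"
          using norm_Pair_le[of "0::real" "(v, w s x0 v)"] norm_Pair_le[of v "w s x0 v"] by simp
        also have "\<dots> \<le> (1 + C) * norm v" using C(2)[OF s, of v] by (simp add: algebra_simps)
        finally have h: "norm ?h \<le> (1 + C) * norm v" .
        have "(s, x0, u s x0) + ?h = (s, y, u s x0 + w s x0 v)" by (simp add: v_def)
        with d(2)[OF Kin[OF s], of ?h] h vd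
        have 1: "norm (g (s, y, u s x0 + w s x0 v) - g (s, x0, u s x0) - ?D (s, x0, u s x0) ?h) \<le> E * norm ?h" by simp
        have 2: "norm (g (s, y, u s y) - g (s, y, u s x0 + w s x0 v)) \<le> L * norm (R s)"
          using lip[of s y "u s y" "u s x0 + w s x0 v"] by (simp add: R_def algebra_simps)
        have "R' s = (g (s, y, u s y) - g (s, y, u s x0 + w s x0 v))
          + (g (s, y, u s x0 + w s x0 v) - g (s, x0, u s x0) - ?D (s, x0, u s x0) ?h)" by (simp add: R'_def)
        also have "norm \<dots> \<le> L * norm (R s) + E * norm ?h" by (rule norm_triangle_mono[OF 2 1])
        also have "\<dots> \<le> L * norm (R s) + E * ((1 + C) * norm v)" using h E by (intro add_left_mono mult_left_mono) auto
        finally show "norm (R' s) \<le> L * norm (R s) + E * ((1 + C) * norm v)" .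
      qed (use E C in \<open>auto simp: T_def\<close>)
      moreover have "R 0 = 0" using J(2)[of x0 v] by (simp add: R_def w v_def)
      ultimately have "norm (R t) \<le> (E * (1 + C) * T * exp (L * T)) * norm v" by (simp add: mult_ac)
      also have "\<dots> \<le> e * norm v" using E2 by (intro mult_right_mono) auto
      finally show "norm (u t y - u t x0 - w t x0 (y - x0)) \<le> e * norm (y - x0)" by (simp add: R_def v_def)
    qed
  qed
  have joint: "((\<lambda>(t, x). u t x) has_derivative (\<lambda>(\<tau>, v). \<tau> *\<^sub>R g (t, x, u t x) + w t x v)) (at (t, x))" for t x
  proof -
    \<comment> \<open>The criterion wants a continuous partial derivative in the second variable.
      The time derivative is continuous by the equation itself, hence the exchanged order of the
      variables.\<close>
    have "((\<lambda>(x, t). u t x) has_derivative (\<lambda>(v, \<tau>). w t x v + blinfun_scaleR_left (g (t, x, u t x)) \<tau>)) (at (x, t) within UNIV \<times> UNIV)"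
    proof (rule has_derivative_partialsI[where fy = "\<lambda>x t. blinfun_scaleR_left (g (t, x, u t x))"])
      show "((\<lambda>x. u t x) has_derivative w t x) (at x within UNIV)" using der by simp
      show "((\<lambda>t. u t x) has_derivative blinfun_apply (blinfun_scaleR_left (g (t, x, u t x)))) (at t within UNIV)" for x t
        using u[of x t] by (simp add: has_vector_derivative_def)
      have "continuous_on UNIV (\<lambda>(x, t). blinfun_scaleR_left (g (t, x, u t x)))"
        unfolding split_def
        by (intro bounded_linear.continuous_on[OF bounded_linear_blinfun_scaleR_left] continuous_on_compose2[OF gc] continuous_intros
            continuous_on_compose2[OF ucont[unfolded split_def], of _ "\<lambda>z. (snd z, fst z)", simplified]) auto
      then show "continuous (at (x, t) within UNIV \<times> UNIV) (\<lambda>(x, t). blinfun_scaleR_left (g (t, x, u t x)))"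
        by (simp add: continuous_on_eq_continuous_within)
    qed auto
    then have 1: "((\<lambda>z. u (snd z) (fst z)) has_derivative (\<lambda>h. w t x (fst h) + snd h *\<^sub>R g (t, x, u t x)))
        (at ((\<lambda>z. (snd z, fst z)) (t, x)))" by (simp add: split_def)
    have 2: "((\<lambda>z::real \<times> 'x. (snd z, fst z)) has_derivative (\<lambda>z. (snd z, fst z))) (at (t, x))"
      by (rule bounded_linear_imp_has_derivative, rule bounded_linear_Pair, rule bounded_linear_snd, rule bounded_linear_fst)
    from has_derivative_compose[OF 2 1] show ?thesis by (simp add: split_def add.commute)
  qed
  show ?thesis using w joint by blast
qed

text \<open>The derivative of a solution in \<open>x\<close> solves an equation with the same linear
  part and a new inhomogeneity \<open>cv\<close>, which involves \<open>w\<close> and the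
  derivatives of \<open>A\<close> and \<open>c\<close>; its initial value is 0 because
  \<open>w0\<close> does not depend on \<open>x\<close>. The induction is therefore over all
  inhomogeneities and solutions.\<close>

lemma linear_ode_Ck:
  fixes A :: "real \<times> 'x::real_normed_vector \<Rightarrow> 'e::real_normed_vector \<Rightarrow> 'e"
  assumes fdx: "fin_dim TYPE('x)" and fde: "fin_dim TYPE('e)" and L: "L \<ge> 0"
    and A: "\<And>z. linear (A z)" "\<And>z a. norm (A z a) \<le> L * norm a" "\<And>b. Ck_on n UNIV (\<lambda>z. A z b)"
    and c: "Ck_on n UNIV c"
    and w: "\<And>x. w 0 x = w0" "\<And>t x. ((\<lambda>t. w t x) has_vector_derivative A (t, x) (w t x) + c (t, x)) (at t)"
  shows "Ck_on n UNIV (\<lambda>(t, x). w t x)"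
  using A(3) c w
proof (induction n arbitrary: c w w0)
  case (0 c w w0)
  have expand: "A z a = (\<Sum>b\<in>fbasis. crd b a *\<^sub>R A z b)" for z a by (rule linear_eq_sum_basis[OF fde A(1)])
  define g where "g = (\<lambda>(t, x, a). A (t, x) a + c (t, x))"
  have "continuous_on UNIV (\<lambda>(t, x). w t x)"
  proof (rule ode_continuous_dependence[where g = g, OF _ L])
    have cA: "continuous_on UNIV (\<lambda>z::real \<times> 'x \<times> 'e. A (fst z, fst (snd z)) b)" for b
      by (rule continuous_on_compose2[of UNIV "\<lambda>z. A z b"]) (use 0(1) in \<open>auto intro!: continuous_intros\<close>)
    have cc: "continuous_on UNIV (\<lambda>z::real \<times> 'x \<times> 'e. c (fst z, fst (snd z)))"
      by (rule continuous_on_compose2[of UNIV c]) (use 0(2) in \<open>auto intro!: continuous_intros\<close>)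
    have "continuous_on UNIV (\<lambda>z::real \<times> 'x \<times> 'e. (\<Sum>b\<in>fbasis. crd b (snd (snd z)) *\<^sub>R A (fst z, fst (snd z)) b) + c (fst z, fst (snd z)))"
      by (intro continuous_intros cA cc bounded_linear.continuous_on[OF bounded_linear_crd[OF fde]])
    then show "continuous_on UNIV g" by (simp add: g_def split_def expand[symmetric])
    show "norm (g (t, x, a) - g (t, x, b)) \<le> L * norm (a - b)" for t x a b
      using A(2)[of "(t, x)" "a - b"] by (simp add: g_def linear_diff[OF A(1)])
    show "((\<lambda>t. w t x) has_vector_derivative g (t, x, w t x)) (at t)" for t x
      using 0(4) by (simp add: g_def)
    show "continuous_on UNIV (w 0)" using 0(3) by simp
  qed
  then show ?case by simp
next
  case (Suc n c w w0)
  have expand: "A z a = (\<Sum>b\<in>fbasis. crd b a *\<^sub>R A z b)" for z a by (rule linear_eq_sum_basis[OF fde A(1)])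
  have CkA: "Ck_on n UNIV (\<lambda>z. A z b)" for b using Ck_on_SucD[OF open_UNIV Suc.prems(1)] .
  have Ckc: "Ck_on n UNIV c" using Ck_on_SucD[OF open_UNIV Suc.prems(2)] .
  have Ckw: "Ck_on n UNIV (\<lambda>(t, x). w t x)" by (rule Suc.IH[OF CkA Ckc Suc.prems(3,4)])
  define g where "g z = (\<Sum>b\<in>fbasis. crd b (snd (snd z)) *\<^sub>R A (fst z, fst (snd z)) b) + c (fst z, fst (snd z))" for z
  have g: "g (t, x, a) = A (t, x) a + c (t, x)" for t x a by (simp add: g_def expand[symmetric])
  let ?DA = "\<lambda>b z. frechet_derivative (\<lambda>z. A z b) (at z)"
  let ?Dc = "\<lambda>z. frechet_derivative c (at z)"
  have bl: "bounded_linear (\<lambda>z::real \<times> 'x \<times> 'e. (fst z, fst (snd z)))"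
    by (intro bounded_linear_Pair bounded_linear_fst bounded_linear_compose[OF bounded_linear_fst bounded_linear_snd])
  have bl2: "bounded_linear (\<lambda>z::real \<times> 'x \<times> 'e. snd (snd z))"
    by (rule bounded_linear_compose[OF bounded_linear_snd bounded_linear_snd])
  have fdrx: "fin_dim TYPE(real \<times> 'x)" by (rule fin_dim_prod[OF fin_dim_real fdx])
  have "Ck_on (Suc n) UNIV g"
    unfolding g_def
  proof (intro Ck_on_add Ck_on_sum open_UNIV)
    show "Ck_on (Suc n) UNIV (\<lambda>z::real \<times> 'x \<times> 'e. crd b (snd (snd z)) *\<^sub>R A (fst z, fst (snd z)) b)" for b
      by (rule Ck_on_bilinear[OF open_UNIV bounded_bilinear_scaleR
          Ck_on_bounded_linear[OF open_UNIV bounded_linear_compose[OF bounded_linear_crd[OF fde] bl2]]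
          Ck_on_compose[OF fdrx open_UNIV open_UNIV UNIV_I Ck_on_bounded_linear[OF open_UNIV bl] Suc.prems(1)]])
    show "Ck_on (Suc n) UNIV (\<lambda>z::real \<times> 'x \<times> 'e. c (fst z, fst (snd z)))"
      by (rule Ck_on_compose[OF fdrx open_UNIV open_UNIV UNIV_I Ck_on_bounded_linear[OF open_UNIV bl] Suc.prems(2)])
  qed
  then have g1: "Ck_on 1 UNIV g" by (rule Ck_on_mono[OF open_UNIV]) simp
  have Dg: "frechet_derivative g (at (t, x, a)) (0, v, k)
      = A (t, x) k + ((\<Sum>b\<in>fbasis. crd b a *\<^sub>R ?DA b (t, x) (0, v)) + ?Dc (t, x) (0, v))" for t x a v k
  proof -
    have dA: "((\<lambda>z. A (fst z, fst (snd z)) b) has_derivative (\<lambda>h. ?DA b (t, x) (fst h, fst (snd h)))) (at (t, x, a))" for b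
    proof -
      have "((\<lambda>z. A z b) has_derivative ?DA b (t, x)) (at ((\<lambda>z. (fst z, fst (snd z))) (t, x, a)))"
        using Ck_on_has_derivative[OF Suc.prems(1), of "(t, x)" b] by simp
      from has_derivative_compose[OF bounded_linear_imp_has_derivative[OF bl] this] show ?thesis .
    qed
    have dc: "((\<lambda>z. c (fst z, fst (snd z))) has_derivative (\<lambda>h. ?Dc (t, x) (fst h, fst (snd h)))) (at (t, x, a))"
    proof -
      have "(c has_derivative ?Dc (t, x)) (at ((\<lambda>z. (fst z, fst (snd z))) (t, x, a)))"
        using Ck_on_has_derivative[OF Suc.prems(2), of "(t, x)"] by simp
      from has_derivative_compose[OF bounded_linear_imp_has_derivative[OF bl] this] show ?thesis .
    qed
    have "(g has_derivative (\<lambda>h. (\<Sum>b\<in>fbasis. crd b (snd (snd (t, x, a))) *\<^sub>R ?DA b (t, x) (fst h, fst (snd h))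
        + crd b (snd (snd h)) *\<^sub>R A (fst (t, x, a), fst (snd (t, x, a))) b) + ?Dc (t, x) (fst h, fst (snd h)))) (at (t, x, a))"
      unfolding g_def
      by (intro has_derivative_add has_derivative_sum bounded_bilinear.FDERIV[OF bounded_bilinear_scaleR] dA dc
          bounded_linear_imp_has_derivative bounded_linear_compose[OF bounded_linear_crd[OF fde] bl2])
    from frechet_derivative_at[OF this, symmetric] show ?thesis
      by (simp add: sum.distrib expand[of "(t, x)" k, symmetric])
  qed
  have lip: "norm (g (t, x, a) - g (t, x, b)) \<le> L * norm (a - b)" for t x a b
    using A(2)[of "(t, x)" "a - b"] by (simp add: g linear_diff[OF A(1)])
  have wd: "((\<lambda>t. w t x) has_vector_derivative g (t, x, w t x)) (at t)" for t x
    using Suc.prems(4) by (simp add: g)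
  have "linear (\<lambda>v::'x. 0::'e)" by (rule linearI) auto
  from ode_differentiable_dependence[OF fdx fde g1 L lip wd this] Suc.prems(3)
  obtain W where W: "\<And>x v. W 0 x v = 0"
    "\<And>t x v. ((\<lambda>t. W t x v) has_vector_derivative frechet_derivative g (at (t, x, w t x)) (0, v, W t x v)) (at t)"
    "\<And>t x. ((\<lambda>(t, x). w t x) has_derivative (\<lambda>(\<tau>, v). \<tau> *\<^sub>R g (t, x, w t x) + W t x v)) (at (t, x))"
    by auto
  define cv where "cv v z = (\<Sum>b\<in>fbasis. crd b ((\<lambda>(t, x). w t x) z) *\<^sub>R ?DA b z (0, v)) + ?Dc z (0, v)" for v z
  have Ckcv: "Ck_on n UNIV (cv v)" for v
    unfolding cv_def
  proof (intro Ck_on_add Ck_on_sum open_UNIV)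
    show "Ck_on n UNIV (\<lambda>z. crd b ((\<lambda>(t, x). w t x) z) *\<^sub>R ?DA b z (0, v))" for b
      using Suc.prems(1)[of b]
      by (intro Ck_on_bilinear[OF open_UNIV bounded_bilinear_scaleR Ck_on_linear_compose[OF open_UNIV bounded_linear_crd[OF fde] Ckw]]) simp
    show "Ck_on n UNIV (\<lambda>z. ?Dc z (0, v))" using Suc.prems(2) by simp
  qed
  have CkW: "Ck_on n UNIV (\<lambda>(t, x). W t x v)" for v
  proof (rule Suc.IH[where w = "\<lambda>t x. W t x v" and c = "cv v", OF CkA Ckcv W(1)])
    show "((\<lambda>t. W t x v) has_vector_derivative A (t, x) (W t x v) + cv v (t, x)) (at t)" for t x
      using W(2)[of x v t] unfolding Dg by (simp add: cv_def)
  qed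
  have Ckg: "Ck_on n UNIV (\<lambda>(t, x). g (t, x, w t x))"
  proof -
    have "Ck_on n UNIV (\<lambda>z. (\<Sum>b\<in>fbasis. crd b ((\<lambda>(t, x). w t x) z) *\<^sub>R A z b) + c z)"
      by (intro Ck_on_add Ck_on_sum open_UNIV Ckc
          Ck_on_bilinear[OF open_UNIV bounded_bilinear_scaleR Ck_on_linear_compose[OF open_UNIV bounded_linear_crd[OF fde] Ckw] CkA])
    then show ?thesis by (simp add: g split_def expand[symmetric])
  qed
  show ?case
  proof (rule Ck_on_SucI[OF open_UNIV, where f' = "\<lambda>z h. fst h *\<^sub>R (\<lambda>(t, x). g (t, x, w t x)) z + (\<lambda>(t, x). W t x (snd h)) z"])
    show "((\<lambda>(t, x). w t x) has_derivative (\<lambda>h. fst h *\<^sub>R (\<lambda>(t, x). g (t, x, w t x)) z + (\<lambda>(t, x). W t x (snd h)) z)) (at z)" for z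
      using W(3)[of "fst z" "snd z"] by (simp add: split_def)
    show "Ck_on n UNIV (\<lambda>z. fst h *\<^sub>R (\<lambda>(t, x). g (t, x, w t x)) z + (\<lambda>(t, x). W t x (snd h)) z)" for h
      by (rule Ck_on_add[OF open_UNIV Ck_on_linear_compose[OF open_UNIV bounded_linear_scaleR_right Ckg] CkW])
  qed
qed

section \<open>Flows of smooth Lipschitz fields\<close>

lemma smooth_flow:
  fixes f :: "'e::real_normed_vector \<Rightarrow> 'e"
  assumes fd: "fin_dim TYPE('e)" and f: "smooth_on UNIV f" and L: "L \<ge> 0"
    and lip: "\<And>a b. norm (f a - f b) \<le> L * norm (a - b)"
  shows "\<exists>\<phi>. smooth_on UNIV (\<lambda>(t, x). \<phi> t x) \<and> (\<forall>x. \<phi> 0 x = x) \<and>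
    (\<forall>t x. ((\<lambda>t. \<phi> t x) has_vector_derivative f (\<phi> t x)) (at t))"
proof -
  have bl: "bounded_linear (\<lambda>z::real \<times> 'e \<times> 'e. snd (snd z))"
    by (rule bounded_linear_compose[OF bounded_linear_snd bounded_linear_snd])
  \<comment> \<open>The parameter of the dependence theorem is here the initial value; the field
    does not see it, and the initial map is the identity.\<close>
  define g where "g z = f (snd (snd z))" for z :: "real \<times> 'e \<times> 'e"
  have Ckg: "Ck_on n UNIV g" for n
    unfolding g_def
    by (rule Ck_on_compose[OF fd open_UNIV open_UNIV UNIV_I Ck_on_bounded_linear[OF open_UNIV bl] smooth_onD[OF f]])
  have fc: "continuous_on UNIV f" by (rule smooth_on_continuous_on[OF open_UNIV f])
  have fD: "(f has_derivative frechet_derivative f (at x)) (at x)" for x by (rule smooth_on_has_derivative[OF f UNIV_I])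
  have "\<exists>u. u 0 = x \<and> (\<forall>t. (u has_vector_derivative f (u t)) (at t))" for x
    using picard[OF fd continuous_on_compose2[OF fc continuous_on_snd[OF continuous_on_id] subset_UNIV] L, of x] lip by simp
  then obtain \<phi>' where "\<forall>x. \<phi>' x 0 = x \<and> (\<forall>t. (\<phi>' x has_vector_derivative f (\<phi>' x t)) (at t))" by metis
  then obtain \<phi> where \<phi>: "\<And>x. \<phi> 0 x = x" "\<And>t x. ((\<lambda>t. \<phi> t x) has_vector_derivative f (\<phi> t x)) (at t)"
    using that[of "\<lambda>t x. \<phi>' x t"] by blast
  have lip': "norm (g (t, x, a) - g (t, x, b)) \<le> L * norm (a - b)" for t x a b using lip by (simp add: g_def)
  have d': "((\<lambda>t. \<phi> t x) has_vector_derivative g (t, x, \<phi> t x)) (at t)" for t x using \<phi>(2) by (simp add: g_def)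
  have "linear (\<lambda>v::'e. v)" by (rule linearI) auto
  from ode_differentiable_dependence[OF fd fd Ckg L lip' d' this] \<phi>(1)
  obtain W where W: "\<And>x v. W 0 x v = v"
    "\<And>t x v. ((\<lambda>t. W t x v) has_vector_derivative frechet_derivative g (at (t, x, \<phi> t x)) (0, v, W t x v)) (at t)"
    "\<And>t x. ((\<lambda>(t, x). \<phi> t x) has_derivative (\<lambda>(\<tau>, v). \<tau> *\<^sub>R g (t, x, \<phi> t x) + W t x v)) (at (t, x))"
    by auto
  have Dg: "frechet_derivative g (at (t, x, a)) (0, v, k) = frechet_derivative f (at a) k" for t x a v k
  proof -
    have "(f has_derivative frechet_derivative f (at a)) (at (snd (snd (t, x, a))))" using fD by simp
    from has_derivative_compose[OF bounded_linear_imp_has_derivative[OF bl] this]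
    have "(g has_derivative (\<lambda>h. frechet_derivative f (at a) (snd (snd h)))) (at (t, x, a))" by (simp add: g_def[abs_def])
    from frechet_derivative_at[OF this, symmetric] show ?thesis by simp
  qed
  \<comment> \<open>If \<phi> is of class C^n, so are the coefficients of the linearised equation
    and, by \<open>linear_ode_Ck\<close>, its solution \<open>W\<close>; thus \<phi> gains one
    derivative.\<close>
  have Ck\<phi>: "Ck_on n UNIV (\<lambda>(t, x). \<phi> t x)" for n
  proof (induction n)
    case 0
    have "continuous_on UNIV (\<phi> 0)" using \<phi>(1) by (simp add: continuous_on_id)
    from ode_continuous_dependence[OF Ck_on_imp_continuous_on[OF open_UNIV Ckg] L lip' d' this] show ?case by simp
  next
    case (Suc n)
    define A where "A z k = frechet_derivative f (at ((\<lambda>(t, x). \<phi> t x) z)) k" for z k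
    have CkW: "Ck_on n UNIV (\<lambda>(t, x). W t x v)" for v
    proof (rule linear_ode_Ck[where A = A and c = "\<lambda>_. 0", OF fd fd L])
      show "linear (A z)" for z unfolding A_def by (rule has_derivative_linear[OF fD])
      show "norm (A z a) \<le> L * norm a" for z a unfolding A_def
        by (rule norm_derivative_le[OF fD]) (use lip in \<open>simp add: mult_ac order_trans[OF lip]\<close>)
      show "Ck_on n UNIV (\<lambda>z. A z b)" for b unfolding A_def
        by (rule Ck_on_compose[OF fd open_UNIV open_UNIV UNIV_I Suc smooth_onD[OF smooth_on_frechet[OF f]]])
      show "Ck_on n UNIV (\<lambda>_. 0)" by (rule Ck_on_const)
      show "W 0 x v = v" for x by (rule W)
      show "((\<lambda>t. W t x v) has_vector_derivative A (t, x) (W t x v) + 0) (at t)" for t x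
        using W(2)[of x v t] by (simp add: Dg A_def)
    qed
    have Ckf: "Ck_on n UNIV (\<lambda>z. f ((\<lambda>(t, x). \<phi> t x) z))"
      by (rule Ck_on_compose[OF fd open_UNIV open_UNIV UNIV_I Suc smooth_onD[OF f]])
    show ?case
    proof (rule Ck_on_SucI[OF open_UNIV, where f' = "\<lambda>z h. fst h *\<^sub>R f ((\<lambda>(t, x). \<phi> t x) z) + (\<lambda>(t, x). W t x (snd h)) z"])
      show "((\<lambda>(t, x). \<phi> t x) has_derivative (\<lambda>h. fst h *\<^sub>R f ((\<lambda>(t, x). \<phi> t x) z) + (\<lambda>(t, x). W t x (snd h)) z)) (at z)" for z
        using W(3)[of "fst z" "snd z"] by (simp add: split_def g_def)
      show "Ck_on n UNIV (\<lambda>z. fst h *\<^sub>R f ((\<lambda>(t, x). \<phi> t x) z) + (\<lambda>(t, x). W t x (snd h)) z)" for h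
        by (rule Ck_on_add[OF open_UNIV Ck_on_linear_compose[OF open_UNIV bounded_linear_scaleR_right Ckf] CkW])
    qed
  qed
  then have "smooth_on UNIV (\<lambda>(t, x). \<phi> t x)" by (rule smooth_onI)
  with \<phi> show ?thesis by blast
qed

text \<open>The derivative is bounded on \<open>K\<close> by compactness and vanishes off
  \<open>K\<close>; the mean value inequality then holds on the whole, convex, space.\<close>

lemma compact_support_lipschitz:
  fixes f :: "'e::real_normed_vector \<Rightarrow> 'e"
  assumes fd: "fin_dim TYPE('e)" and f: "smooth_on UNIV f" and K: "compact K" "\<And>x. x \<notin> K \<Longrightarrow> f x = 0"
  shows "\<exists>L\<ge>0. \<forall>a b. norm (f a - f b) \<le> L * norm (a - b)"
proof -
  let ?D = "\<lambda>x. frechet_derivative f (at x)"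
  have fD: "(f has_derivative ?D x) (at x)" for x by (rule smooth_on_has_derivative[OF f UNIV_I])
  obtain C where C: "\<forall>(x::'e) b. \<bar>crd b x\<bar> \<le> C * norm x" "C > 0" using norm_equivalence[OF fd] by auto
  have "\<exists>M\<ge>0. \<forall>x\<in>K. norm (?D x b) \<le> M" for b
  proof -
    have "continuous_on UNIV (\<lambda>x. ?D x b)" by (rule smooth_on_continuous_on[OF open_UNIV smooth_on_frechet[OF f]])
    then have "bounded ((\<lambda>x. ?D x b) ` K)"
      using compact_continuous_image[OF continuous_on_subset[OF _ subset_UNIV] K(1)] compact_imp_bounded by blast
    then obtain M where "M > 0" "\<forall>y\<in>(\<lambda>x. ?D x b) ` K. norm y \<le> M" unfolding bounded_pos by blast
    then show ?thesis by (intro exI[of _ M]) auto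
  qed
  then obtain M where M: "\<And>b. M b \<ge> 0" "\<And>b x. x \<in> K \<Longrightarrow> norm (?D x b) \<le> M b" by metis
  have zero: "?D x = (\<lambda>_. 0)" if "x \<notin> K" for x
  proof -
    have "open (- K)" using K compact_imp_closed by blast
    have "((\<lambda>_. 0) has_derivative (\<lambda>_. 0)) (at x)" by (rule has_derivative_const)
    from has_derivative_transform_within_open[OF this \<open>open (- K)\<close>, of f]
    have "(f has_derivative (\<lambda>_. 0)) (at x)" using that K(2) by simp
    from frechet_derivative_at[OF this] show ?thesis by (rule sym)
  qed
  define L where "L = (\<Sum>b\<in>fbasis. C * M b)"
  have L: "L \<ge> 0" unfolding L_def using M C by (intro sum_nonneg) auto
  have "onorm (?D x) \<le> L" for x
  proof (rule onorm_bound[OF L])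
    fix v
    show "norm (?D x v) \<le> L * norm v"
    proof (cases "x \<in> K")
      case True
      have "?D x v = (\<Sum>b\<in>fbasis. crd b v *\<^sub>R ?D x b)" by (rule linear_eq_sum_basis[OF fd has_derivative_linear[OF fD]])
      also have "norm \<dots> \<le> (\<Sum>b\<in>fbasis. (C * norm v) * M b)"
      proof (rule sum_norm_le)
        show "norm (crd b v *\<^sub>R ?D x b) \<le> (C * norm v) * M b" for b
          unfolding norm_scaleR real_norm_def using C M(2)[OF True, of b] by (intro mult_mono) auto
      qed
      also have "\<dots> = L * norm v" by (simp add: L_def sum_distrib_left mult_ac)
      finally show ?thesis .
    qed (use zero L in auto)
  qed
  then have "norm (f a - f b) \<le> L * norm (a - b)" for a b
    by (intro differentiable_bound[OF convex_UNIV has_derivative_at_withinI[OF fD]]) auto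
  then show ?thesis using L by blast
qed

section \<open>Smooth maps between manifolds\<close>

text \<open>What the atlas itself contributes to \<open>smooth_manifold\<close>. Separation and
  countability are left to the type of points, so model spaces and products are treated on the same
  footing.\<close>

definition mfd :: "('p::topological_space, 'e::real_normed_vector) chart set \<Rightarrow> bool" where
  "mfd A \<longleftrightarrow> smooth_atlas A \<and> fin_dim TYPE('e)"

lemma smooth_manifold_mfd: "smooth_manifold A \<Longrightarrow> mfd A"
  by (auto simp: smooth_manifold_def mfd_def fin_dim_def)

lemma mfd_fin_dim:
  fixes A :: "('p::topological_space, 'e::real_normed_vector) chart set"
  shows "mfd A \<Longrightarrow> fin_dim TYPE('e)"
  by (simp add: mfd_def)

lemma chart:
  assumes "mfd A" "(U, \<phi>) \<in> A"
  shows chart_open: "open U" and chart_open_image: "open (\<phi> ` U)" and chart_cont: "continuous_on U \<phi>"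
    and chart_inv_cont: "continuous_on (\<phi> ` U) (inv_into U \<phi>)"
    and chart_inv: "q \<in> U \<Longrightarrow> inv_into U \<phi> (\<phi> q) = q"
    and chart_inj: "inj_on \<phi> U"
proof -
  have "is_chart (U, \<phi>)" using assms unfolding mfd_def smooth_atlas_def by blast
  then show "open U" "open (\<phi> ` U)" "continuous_on U \<phi>" "continuous_on (\<phi> ` U) (inv_into U \<phi>)"
    "q \<in> U \<Longrightarrow> inv_into U \<phi> (\<phi> q) = q" "inj_on \<phi> U"
    unfolding is_chart_def homeomorphism_def by (auto intro: inj_on_inverseI)
qed

lemma chart_cover: "mfd A \<Longrightarrow> \<exists>(U, \<phi>)\<in>A. p \<in> U"
  unfolding mfd_def smooth_atlas_def by blast

lemma chart_transition:
  "mfd A \<Longrightarrow> (U, \<phi>) \<in> A \<Longrightarrow> (V, \<psi>) \<in> A \<Longrightarrow> smooth_on (\<phi> ` (U \<inter> V)) (\<psi> \<circ> inv_into U \<phi>)"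
  unfolding mfd_def smooth_atlas_def by fastforce

lemma open_chart_image:
  assumes A: "mfd A" "(U, \<phi>) \<in> A" and W: "open W" "W \<subseteq> U"
  shows "open (\<phi> ` W)"
proof -
  have "\<phi> ` W = \<phi> ` U \<inter> inv_into U \<phi> -` W"
    using chart_inv[OF A] W(2) by (auto simp: image_iff)
  then show ?thesis
    using continuous_open_preimage[OF chart_inv_cont[OF A] chart_open_image[OF A] W(1)] by simp
qed

lemma smooth_map_on_continuous: "smooth_map_on S A B f \<Longrightarrow> continuous_on S f"
  by (simp add: smooth_map_on_def)

lemma smooth_map_onD:
  "smooth_map_on S A B f \<Longrightarrow> (U, \<phi>) \<in> A \<Longrightarrow> (V, \<psi>) \<in> B \<Longrightarrow>
    smooth_on (\<phi> ` (U \<inter> S \<inter> f -` V)) (\<psi> \<circ> f \<circ> inv_into U \<phi>)"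
  unfolding smooth_map_on_def by fastforce

lemma smooth_map_onI:
  assumes "continuous_on S f"
    "\<And>U \<phi> V \<psi>. (U, \<phi>) \<in> A \<Longrightarrow> (V, \<psi>) \<in> B \<Longrightarrow> smooth_on (\<phi> ` (U \<inter> S \<inter> f -` V)) (\<psi> \<circ> f \<circ> inv_into U \<phi>)"
  shows "smooth_map_on S A B f"
  using assms unfolding smooth_map_on_def by auto

lemma open_smooth_domain:
  assumes "mfd A" "mfd B" "(U, \<phi>) \<in> A" "open V" "open S" "continuous_on S f"
  shows "open (U \<inter> S \<inter> f -` V)"
  using continuous_open_preimage[OF assms(6,5,4)] chart_open[OF assms(1,3)] by (simp add: Int_assoc open_Int)

lemma smooth_map_on_subset:
  assumes "smooth_map_on S A B f" "T \<subseteq> S" shows "smooth_map_on T A B f"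
proof (rule smooth_map_onI)
  show "continuous_on T f" using assms smooth_map_on_continuous continuous_on_subset by blast
  fix U \<phi> V \<psi> assume "(U, \<phi>) \<in> A" "(V, \<psi>) \<in> B"
  from smooth_map_onD[OF assms(1) this] show "smooth_on (\<phi> ` (U \<inter> T \<inter> f -` V)) (\<psi> \<circ> f \<circ> inv_into U \<phi>)"
    by (rule smooth_on_subset) (use assms in auto)
qed

lemma smooth_map_on_local:
  assumes A: "mfd A" and B: "mfd B" and S: "open S"
    and loc: "\<And>p. p \<in> S \<Longrightarrow> \<exists>W. open W \<and> p \<in> W \<and> W \<subseteq> S \<and> smooth_map_on W A B f"
  shows "smooth_map_on S A B f"
proof (rule smooth_map_onI)
  obtain N where N: "\<And>p. p \<in> S \<Longrightarrow> open (N p) \<and> p \<in> N p \<and> N p \<subseteq> S \<and> smooth_map_on (N p) A B f"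
    using loc by metis
  then have "continuous_on (\<Union>p\<in>S. N p) f"
    by (intro continuous_on_open_UN) (auto intro: smooth_map_on_continuous)
  moreover have "(\<Union>p\<in>S. N p) = S" using N by blast
  ultimately show cont: "continuous_on S f" by simp
  fix U \<phi> V \<psi> assume c: "(U, \<phi>) \<in> A" "(V, \<psi>) \<in> B"
  have opV: "open V" by (rule chart_open[OF B c(2)])
  have op: "open (\<phi> ` (U \<inter> W \<inter> f -` V))" if "open W" "W \<subseteq> S" for W
    by (rule open_chart_image[OF A c(1) open_smooth_domain[OF A B c(1) opV that(1) continuous_on_subset[OF cont that(2)]]]) auto
  show "smooth_on (\<phi> ` (U \<inter> S \<inter> f -` V)) (\<psi> \<circ> f \<circ> inv_into U \<phi>)"
  proof (rule smooth_on_local[OF op[OF S order_refl]])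
    fix x assume "x \<in> \<phi> ` (U \<inter> S \<inter> f -` V)"
    then obtain p where p: "p \<in> U" "p \<in> S" "f p \<in> V" "x = \<phi> p" by auto
    obtain W where W: "open W" "p \<in> W" "W \<subseteq> S" "smooth_map_on W A B f" using loc[OF p(2)] by blast
    show "\<exists>N. open N \<and> x \<in> N \<and> smooth_on (N \<inter> \<phi> ` (U \<inter> S \<inter> f -` V)) (\<psi> \<circ> f \<circ> inv_into U \<phi>)"
      by (intro exI[of _ "\<phi> ` (U \<inter> W \<inter> f -` V)"] conjI op W smooth_on_subset[OF smooth_map_onD[OF W(4) c]]) (use p W in auto)
  qed
qed

lemma smooth_map_on_cong:
  assumes A: "mfd A" and B: "mfd B" and S: "open S" and f: "smooth_map_on S A B f" and eq: "\<And>p. p \<in> S \<Longrightarrow> f p = g p"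
  shows "smooth_map_on S A B g"
proof (rule smooth_map_onI)
  show "continuous_on S g" using smooth_map_on_continuous[OF f] eq by (metis continuous_on_cong)
  fix U \<phi> V \<psi> assume c: "(U, \<phi>) \<in> A" "(V, \<psi>) \<in> B"
  have e: "U \<inter> S \<inter> g -` V = U \<inter> S \<inter> f -` V" using eq by auto
  have op: "open (\<phi> ` (U \<inter> S \<inter> f -` V))"
    by (rule open_chart_image[OF A c(1) open_smooth_domain[OF A B c(1) chart_open[OF B c(2)] S smooth_map_on_continuous[OF f]]]) auto
  show "smooth_on (\<phi> ` (U \<inter> S \<inter> g -` V)) (\<psi> \<circ> g \<circ> inv_into U \<phi>)"
    unfolding e by (rule smooth_on_cong[OF op _ smooth_map_onD[OF f c]]) (use chart_inv[OF A c(1)] eq in auto)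
qed

text \<open>One chart of the middle manifold may fail to contain the image of a whole chart domain,
  so smoothness is checked around each point \<open>p\<close> with a chart at
  \<open>f p\<close>.\<close>

lemma smooth_map_on_compose:
  assumes A: "mfd A" and B: "mfd B" and C: "mfd C" and S: "open S" and T: "open T"
    and f: "smooth_map_on S A B f" and g: "smooth_map_on T B C g" and ST: "\<And>p. p \<in> S \<Longrightarrow> f p \<in> T"
  shows "smooth_map_on S A C (\<lambda>p. g (f p))"
proof (rule smooth_map_onI)
  note fc = smooth_map_on_continuous[OF f] and gc = smooth_map_on_continuous[OF g]
  show cont: "continuous_on S (\<lambda>p. g (f p))" by (rule continuous_on_compose2[OF gc fc]) (use ST in auto)
  fix U \<phi> V \<psi> assume c: "(U, \<phi>) \<in> A" "(V, \<psi>) \<in> C"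
  have opV: "open V" by (rule chart_open[OF C c(2)])
  show "smooth_on (\<phi> ` (U \<inter> S \<inter> (\<lambda>p. g (f p)) -` V)) (\<psi> \<circ> (\<lambda>p. g (f p)) \<circ> inv_into U \<phi>)"
  proof (rule smooth_on_local)
    show "open (\<phi> ` (U \<inter> S \<inter> (\<lambda>p. g (f p)) -` V))"
      by (rule open_chart_image[OF A c(1) open_smooth_domain[OF A C c(1) opV S cont]]) auto
    fix x assume "x \<in> \<phi> ` (U \<inter> S \<inter> (\<lambda>p. g (f p)) -` V)"
    then obtain p where p: "p \<in> U" "p \<in> S" "g (f p) \<in> V" "x = \<phi> p" by auto
    obtain W \<kappa> where w: "(W, \<kappa>) \<in> B" "f p \<in> W" using chart_cover[OF B, of "f p"] by auto
    define R where "R = W \<inter> T \<inter> g -` V"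
    have opR: "open R" unfolding R_def by (rule open_smooth_domain[OF B C w(1) opV T gc])
    define N where "N = \<phi> ` (U \<inter> S \<inter> f -` R)"
    have opN: "open N" unfolding N_def
      by (rule open_chart_image[OF A c(1) open_smooth_domain[OF A B c(1) opR S fc]]) auto
    have 1: "smooth_on N (\<kappa> \<circ> f \<circ> inv_into U \<phi>)" unfolding N_def
      by (rule smooth_on_subset[OF smooth_map_onD[OF f c(1) w(1)]]) (auto simp: R_def)
    have 2: "smooth_on (\<kappa> ` R) (\<psi> \<circ> g \<circ> inv_into W \<kappa>)" unfolding R_def by (rule smooth_map_onD[OF g w(1) c(2)])
    have op2: "open (\<kappa> ` R)" by (rule open_chart_image[OF B w(1) opR]) (auto simp: R_def)
    have "smooth_on N (\<lambda>x. (\<psi> \<circ> g \<circ> inv_into W \<kappa>) ((\<kappa> \<circ> f \<circ> inv_into U \<phi>) x))"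
      by (rule smooth_on_compose[OF mfd_fin_dim[OF B] opN op2 1 2]) (auto simp: N_def chart_inv[OF A c(1)])
    then have "smooth_on N (\<psi> \<circ> (\<lambda>p. g (f p)) \<circ> inv_into U \<phi>)"
      by (rule smooth_on_cong[OF opN, rotated]) (auto simp: N_def R_def chart_inv[OF A c(1)] chart_inv[OF B w(1)])
    then show "\<exists>N. open N \<and> x \<in> N \<and> smooth_on (N \<inter> \<phi> ` (U \<inter> S \<inter> (\<lambda>p. g (f p)) -` V)) (\<psi> \<circ> (\<lambda>p. g (f p)) \<circ> inv_into U \<phi>)"
      using p w ST opN by (intro exI[of _ N]) (auto simp: N_def R_def intro: smooth_on_subset)
  qed
qed

lemma smooth_map_on_const:
  assumes "mfd A" "open S" shows "smooth_map_on S A B (\<lambda>_. c)"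
proof (rule smooth_map_onI)
  fix U \<phi> V \<psi> assume "(U, \<phi>) \<in> A" "(V, \<psi>) \<in> B"
  have "(\<psi> \<circ> (\<lambda>_. c) \<circ> inv_into U \<phi>) = (\<lambda>_. \<psi> c)" by auto
  then show "smooth_on (\<phi> ` (U \<inter> S \<inter> (\<lambda>_. c) -` V)) (\<psi> \<circ> (\<lambda>_. c) \<circ> inv_into U \<phi>)"
    by (simp only: smooth_on_const)
qed (rule continuous_on_const)

lemma smooth_map_on_id:
  assumes "mfd A" shows "smooth_map_on S A A (\<lambda>p. p)"
proof (rule smooth_map_onI)
  fix U \<phi> V \<psi> assume c: "(U, \<phi>) \<in> A" "(V, \<psi>) \<in> A"
  have "\<psi> \<circ> (\<lambda>p. p) \<circ> inv_into U \<phi> = \<psi> \<circ> inv_into U \<phi>" by auto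
  then show "smooth_on (\<phi> ` (U \<inter> S \<inter> (\<lambda>p. p) -` V)) (\<psi> \<circ> (\<lambda>p. p) \<circ> inv_into U \<phi>)"
    by (simp only:) (rule smooth_on_subset[OF chart_transition[OF assms c]], auto)
qed (rule continuous_on_id)

section \<open>Model spaces and product manifolds\<close>

lemma mfd_model: "fin_dim TYPE('e::real_normed_vector) \<Longrightarrow> mfd (model_atlas :: ('e, 'e) chart set)"
  unfolding mfd_def smooth_atlas_def model_atlas_def is_chart_def
  by (auto simp: homeomorphism_def o_def id_def[abs_def] inv_into_def intro!: smooth_on_id continuous_on_id)

lemma smooth_map_on_model_iff: "open S \<Longrightarrow> smooth_map_on S model_atlas model_atlas f \<longleftrightarrow> smooth_on S f"
  by (auto simp: smooth_map_on_def model_atlas_def inv_id smooth_on_continuous_on)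

lemma smooth_map_on_chart:
  assumes A: "mfd A" and c: "(U, \<phi>) \<in> A"
  shows "smooth_map_on U A model_atlas \<phi>"
proof (rule smooth_map_onI[OF chart_cont[OF assms]])
  fix V \<psi> W \<kappa> assume v: "(V, \<psi>) \<in> A" and "(W, \<kappa>) \<in> (model_atlas :: ('b, 'b) chart set)"
  then have "W = UNIV" "\<kappa> = id" by (auto simp: model_atlas_def)
  then show "smooth_on (\<psi> ` (V \<inter> U \<inter> \<phi> -` W)) (\<kappa> \<circ> \<phi> \<circ> inv_into V \<psi>)"
    using chart_transition[OF A v c] by simp
qed

lemma smooth_map_on_chart_inv:
  assumes A: "mfd A" and c: "(U, \<phi>) \<in> A"
  shows "smooth_map_on (\<phi> ` U) model_atlas A (inv_into U \<phi>)"
proof (rule smooth_map_onI[OF chart_inv_cont[OF assms]])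
  fix V \<psi> W \<kappa> assume v: "(V, \<psi>) \<in> A" and "(W, \<kappa>) \<in> (model_atlas :: ('b, 'b) chart set)"
  then have w: "W = UNIV" "\<kappa> = id" by (auto simp: model_atlas_def)
  have "\<phi> ` U \<inter> inv_into U \<phi> -` V = \<phi> ` (U \<inter> V)" using chart_inv[OF assms] by auto
  then show "smooth_on (\<kappa> ` (W \<inter> \<phi> ` U \<inter> inv_into U \<phi> -` V)) (\<psi> \<circ> inv_into U \<phi> \<circ> inv_into W \<kappa>)"
    using chart_transition[OF A c v] by (simp add: w inv_id)
qed

lemma inv_into_map_prod:
  assumes "inj_on \<phi> U" "inj_on \<psi> V" "z \<in> \<phi> ` U \<times> \<psi> ` V"
  shows "inv_into (U \<times> V) (map_prod \<phi> \<psi>) z = (inv_into U \<phi> (fst z), inv_into V \<psi> (snd z))"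
proof (rule inv_into_f_eq)
  show "inj_on (map_prod \<phi> \<psi>) (U \<times> V)" using assms by (intro map_prod_inj_on)
  show "(inv_into U \<phi> (fst z), inv_into V \<psi> (snd z)) \<in> U \<times> V" using assms by (auto intro: inv_into_into)
  show "map_prod \<phi> \<psi> (inv_into U \<phi> (fst z), inv_into V \<psi> (snd z)) = z" using assms by (auto simp: f_inv_into_f)
qed

lemma prod_atlas_cases:
  assumes "(W, \<kappa>) \<in> prod_atlas A B"
  obtains U \<phi> V \<psi> where "(U, \<phi>) \<in> A" "(V, \<psi>) \<in> B" "W = U \<times> V" "\<kappa> = map_prod \<phi> \<psi>"
  using assms unfolding prod_atlas_def by auto

lemma prod_atlas_model: "prod_atlas model_atlas model_atlas = model_atlas"
  by (auto simp: prod_atlas_def model_atlas_def map_prod_def id_def split_def)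

lemma smooth_on_fst_compose:
  fixes f :: "'a::real_normed_vector \<Rightarrow> 'c::real_normed_vector"
  assumes "fin_dim TYPE('a)" "open S" "open T" "smooth_on T f" "\<And>z. z \<in> S \<Longrightarrow> fst z \<in> T"
  shows "smooth_on S (\<lambda>z. f (fst z))"
  by (rule smooth_on_compose[OF assms(1-3) smooth_on_fst[OF assms(2)] assms(4,5)])

lemma smooth_on_snd_compose:
  fixes f :: "'a::real_normed_vector \<Rightarrow> 'c::real_normed_vector"
  assumes "fin_dim TYPE('a)" "open S" "open T" "smooth_on T f" "\<And>z. z \<in> S \<Longrightarrow> snd z \<in> T"
  shows "smooth_on S (\<lambda>z. f (snd z))"
  by (rule smooth_on_compose[OF assms(1-3) smooth_on_snd[OF assms(2)] assms(4,5)])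

lemma mfd_prod:
  assumes A: "mfd A" and B: "mfd B" shows "mfd (prod_atlas A B)"
  unfolding mfd_def smooth_atlas_def
proof (intro conjI ballI)
  show "fin_dim TYPE('b \<times> 'd)" using assms by (intro fin_dim_prod mfd_fin_dim)
next
  fix c assume "c \<in> prod_atlas A B"
  then obtain U \<phi> V \<psi> where c: "(U, \<phi>) \<in> A" "(V, \<psi>) \<in> B" "c = (U \<times> V, map_prod \<phi> \<psi>)"
    unfolding prod_atlas_def by auto
  note a = chart[OF A c(1)] and b = chart[OF B c(2)]
  have im: "map_prod \<phi> \<psi> ` (U \<times> V) = \<phi> ` U \<times> \<psi> ` V" by (rule map_prod_surj_on) auto
  have "homeomorphism (U \<times> V) (map_prod \<phi> \<psi> ` (U \<times> V)) (map_prod \<phi> \<psi>) (inv_into (U \<times> V) (map_prod \<phi> \<psi>))"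
  proof (rule homeomorphismI)
    show "continuous_on (U \<times> V) (map_prod \<phi> \<psi>)" unfolding map_prod_def split_def
      by (intro continuous_on_Pair continuous_on_compose2[OF a(3)] continuous_on_compose2[OF b(3)] continuous_intros) auto
    have "continuous_on (\<phi> ` U \<times> \<psi> ` V) (\<lambda>z. (inv_into U \<phi> (fst z), inv_into V \<psi> (snd z)))"
      by (intro continuous_on_Pair continuous_on_compose2[OF a(4)] continuous_on_compose2[OF b(4)] continuous_intros) auto
    then show "continuous_on (map_prod \<phi> \<psi> ` (U \<times> V)) (inv_into (U \<times> V) (map_prod \<phi> \<psi>))"
      unfolding im by (rule continuous_on_eq) (simp add: inv_into_map_prod[OF a(6) b(6)])
    have inj: "inj_on (map_prod \<phi> \<psi>) (U \<times> V)" using a(6) b(6) by (rule map_prod_inj_on)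
    show "inv_into (U \<times> V) (map_prod \<phi> \<psi>) (map_prod \<phi> \<psi> z) = z" if "z \<in> U \<times> V" for z
      using inj that by (rule inv_into_f_f)
    show "map_prod \<phi> \<psi> (inv_into (U \<times> V) (map_prod \<phi> \<psi>) z) = z" if "z \<in> map_prod \<phi> \<psi> ` (U \<times> V)" for z
      using that by (rule f_inv_into_f)
    show "inv_into (U \<times> V) (map_prod \<phi> \<psi>) ` map_prod \<phi> \<psi> ` (U \<times> V) \<subseteq> U \<times> V"
      by (auto simp: image_comp inv_into_f_f[OF inj])
  qed auto
  moreover have "open (map_prod \<phi> \<psi> ` (U \<times> V))" unfolding im using a(2) b(2) by (rule open_Times)
  moreover have "open (U \<times> V)" using a(1) b(1) by (rule open_Times)
  ultimately show "is_chart c" by (simp add: is_chart_def c)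
next
  have "z \<in> (\<Union>(U, \<phi>)\<in>prod_atlas A B. U)" for z
  proof -
    obtain U \<phi> V \<psi> where "(U, \<phi>) \<in> A" "(V, \<psi>) \<in> B" "fst z \<in> U" "snd z \<in> V"
      using chart_cover[OF A, of "fst z"] chart_cover[OF B, of "snd z"] by auto
    then show ?thesis unfolding prod_atlas_def by (intro UN_I[of "(U \<times> V, map_prod \<phi> \<psi>)"]) (auto simp: mem_Times_iff)
  qed
  then show "(\<Union>(U, \<phi>)\<in>prod_atlas A B. U) = UNIV" by auto
next
  fix c assume "c \<in> prod_atlas A B"
  then obtain U \<phi> V \<psi> where c: "(U, \<phi>) \<in> A" "(V, \<psi>) \<in> B" "c = (U \<times> V, map_prod \<phi> \<psi>)"
    unfolding prod_atlas_def by blast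
  show "case c of (U, \<phi>) \<Rightarrow> \<forall>(V, \<psi>)\<in>prod_atlas A B. smooth_on (\<phi> ` (U \<inter> V)) (\<psi> \<circ> inv_into U \<phi>)"
    unfolding c(3) prod.case
  proof (rule ballI)
  fix d assume "d \<in> prod_atlas A B"
  then obtain U' \<phi>' V' \<psi>' where d: "(U', \<phi>') \<in> A" "(V', \<psi>') \<in> B" "d = (U' \<times> V', map_prod \<phi>' \<psi>')"
    unfolding prod_atlas_def by blast
  have S: "map_prod \<phi> \<psi> ` (U \<times> V \<inter> U' \<times> V') = \<phi> ` (U \<inter> U') \<times> \<psi> ` (V \<inter> V')"
    unfolding Times_Int_Times by (rule map_prod_surj_on) auto
  have op1: "open (\<phi> ` (U \<inter> U'))" by (rule open_chart_image[OF A c(1)]) (auto intro: open_Int chart_open[OF A] c d)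
  have op2: "open (\<psi> ` (V \<inter> V'))" by (rule open_chart_image[OF B c(2)]) (auto intro: open_Int chart_open[OF B] c d)
  have op: "open (\<phi> ` (U \<inter> U') \<times> \<psi> ` (V \<inter> V'))" by (rule open_Times[OF op1 op2])
  have "smooth_on (\<phi> ` (U \<inter> U') \<times> \<psi> ` (V \<inter> V')) (\<lambda>z. ((\<phi>' \<circ> inv_into U \<phi>) (fst z), (\<psi>' \<circ> inv_into V \<psi>) (snd z)))"
    by (rule smooth_on_Pair[OF op
          smooth_on_fst_compose[OF mfd_fin_dim[OF A] op op1 chart_transition[OF A c(1) d(1)]]
          smooth_on_snd_compose[OF mfd_fin_dim[OF B] op op2 chart_transition[OF B c(2) d(2)]]]) auto
  then have "smooth_on (map_prod \<phi> \<psi> ` (U \<times> V \<inter> U' \<times> V')) (map_prod \<phi>' \<psi>' \<circ> inv_into (U \<times> V) (map_prod \<phi> \<psi>))"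
    unfolding S
    by (rule smooth_on_cong[OF op, rotated])
       (subst comp_def, subst inv_into_map_prod[OF chart_inj[OF A c(1)] chart_inj[OF B c(2)]], auto)
  then show "case d of (W, \<psi>') \<Rightarrow> smooth_on (map_prod \<phi> \<psi> ` (U \<times> V \<inter> W)) (\<psi>' \<circ> inv_into (U \<times> V) (map_prod \<phi> \<psi>))"
    unfolding d(3) by simp
  qed
qed

lemma smooth_map_on_fst:
  assumes A: "mfd A" and B: "mfd B" and S: "open S"
  shows "smooth_map_on S (prod_atlas A B) A fst"
proof (rule smooth_map_onI)
  show cont: "continuous_on S fst" by (intro continuous_intros)
  fix W \<kappa> U' \<phi>' assume w: "(W, \<kappa>) \<in> prod_atlas A B" and c': "(U', \<phi>') \<in> A"
  then obtain U \<phi> V \<psi> where c: "(U, \<phi>) \<in> A" "(V, \<psi>) \<in> B" "W = U \<times> V" "\<kappa> = map_prod \<phi> \<psi>"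
    by (auto elim: prod_atlas_cases)
  let ?X = "\<kappa> ` (W \<inter> S \<inter> fst -` U')"
  have op: "open ?X" by (rule open_chart_image[OF mfd_prod[OF A B] w
        open_smooth_domain[OF mfd_prod[OF A B] A w chart_open[OF A c'] S cont]]) auto
  have op1: "open (\<phi> ` (U \<inter> U'))" by (rule open_chart_image[OF A c(1)]) (auto intro: open_Int chart_open[OF A] c c')
  have "smooth_on ?X (\<lambda>z. (\<phi>' \<circ> inv_into U \<phi>) (fst z))"
    by (rule smooth_on_fst_compose[OF mfd_fin_dim[OF A] op op1 chart_transition[OF A c(1) c']]) (auto simp: c)
  then show "smooth_on ?X (\<phi>' \<circ> fst \<circ> inv_into W \<kappa>)"
    by (rule smooth_on_cong[OF op, rotated])
       (subst comp_def, subst comp_def, subst c, subst c, subst inv_into_map_prod[OF chart_inj[OF A c(1)] chart_inj[OF B c(2)]], auto simp: c)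
qed

lemma smooth_map_on_snd:
  assumes A: "mfd A" and B: "mfd B" and S: "open S"
  shows "smooth_map_on S (prod_atlas A B) B snd"
proof (rule smooth_map_onI)
  show cont: "continuous_on S snd" by (intro continuous_intros)
  fix W \<kappa> U' \<phi>' assume w: "(W, \<kappa>) \<in> prod_atlas A B" and c': "(U', \<phi>') \<in> B"
  then obtain U \<phi> V \<psi> where c: "(U, \<phi>) \<in> A" "(V, \<psi>) \<in> B" "W = U \<times> V" "\<kappa> = map_prod \<phi> \<psi>"
    by (auto elim: prod_atlas_cases)
  let ?X = "\<kappa> ` (W \<inter> S \<inter> snd -` U')"
  have op: "open ?X" by (rule open_chart_image[OF mfd_prod[OF A B] w
        open_smooth_domain[OF mfd_prod[OF A B] B w chart_open[OF B c'] S cont]]) auto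
  have op1: "open (\<psi> ` (V \<inter> U'))" by (rule open_chart_image[OF B c(2)]) (auto intro: open_Int chart_open[OF B] c c')
  have "smooth_on ?X (\<lambda>z. (\<phi>' \<circ> inv_into V \<psi>) (snd z))"
    by (rule smooth_on_snd_compose[OF mfd_fin_dim[OF B] op op1 chart_transition[OF B c(2) c']]) (auto simp: c)
  then show "smooth_on ?X (\<phi>' \<circ> snd \<circ> inv_into W \<kappa>)"
    by (rule smooth_on_cong[OF op, rotated])
       (subst comp_def, subst comp_def, subst c, subst c, subst inv_into_map_prod[OF chart_inj[OF A c(1)] chart_inj[OF B c(2)]], auto simp: c)
qed

lemma smooth_map_on_Pair:
  assumes A: "mfd A" and B: "mfd B" and C: "mfd C" and S: "open S"
    and f: "smooth_map_on S C A f" and g: "smooth_map_on S C B g"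
  shows "smooth_map_on S C (prod_atlas A B) (\<lambda>p. (f p, g p))"
proof (rule smooth_map_onI)
  show cont: "continuous_on S (\<lambda>p. (f p, g p))" using smooth_map_on_continuous[OF f] smooth_map_on_continuous[OF g]
    by (rule continuous_on_Pair)
  fix U \<phi> W \<kappa> assume u: "(U, \<phi>) \<in> C" and w: "(W, \<kappa>) \<in> prod_atlas A B"
  then obtain U1 \<phi>1 V1 \<psi>1 where c: "(U1, \<phi>1) \<in> A" "(V1, \<psi>1) \<in> B" "W = U1 \<times> V1" "\<kappa> = map_prod \<phi>1 \<psi>1"
    by (auto elim: prod_atlas_cases)
  let ?X = "\<phi> ` (U \<inter> S \<inter> (\<lambda>p. (f p, g p)) -` W)"
  have op: "open ?X" by (rule open_chart_image[OF C u
        open_smooth_domain[OF C mfd_prod[OF A B] u chart_open[OF mfd_prod[OF A B] w] S cont]]) auto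
  have "smooth_on ?X (\<lambda>z. ((\<phi>1 \<circ> f \<circ> inv_into U \<phi>) z, (\<psi>1 \<circ> g \<circ> inv_into U \<phi>) z))"
    by (rule smooth_on_Pair[OF op smooth_on_subset[OF smooth_map_onD[OF f u c(1)]] smooth_on_subset[OF smooth_map_onD[OF g u c(2)]]])
       (auto simp: c)
  then show "smooth_on ?X (\<kappa> \<circ> (\<lambda>p. (f p, g p)) \<circ> inv_into U \<phi>)"
    by (simp add: c o_def)
qed

section \<open>The algebra of smooth functions\<close>

lemma smooth_map_on_model_compose:
  fixes g :: "'b::real_normed_vector \<Rightarrow> 'c::real_normed_vector"
  assumes A: "mfd A" and fb: "fin_dim TYPE('b)" and fc: "fin_dim TYPE('c)" and S: "open S" and T: "open T"
    and f: "smooth_map_on S A model_atlas f" and g: "smooth_on T g" and ST: "\<And>p. p \<in> S \<Longrightarrow> f p \<in> T"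
  shows "smooth_map_on S A model_atlas (\<lambda>p. g (f p))"
  by (rule smooth_map_on_compose[OF A mfd_model[OF fb] mfd_model[OF fc] S T f _ ST])
     (simp_all add: smooth_map_on_model_iff T g)

lemma smooth_map_on_binop:
  fixes f :: "'p::topological_space \<Rightarrow> 'b::real_normed_vector" and g :: "'p \<Rightarrow> 'c::real_normed_vector"
    and h :: "'b \<times> 'c \<Rightarrow> 'd::real_normed_vector"
  assumes A: "mfd A" and fb: "fin_dim TYPE('b)" and fc: "fin_dim TYPE('c)" and fdd: "fin_dim TYPE('d)" and S: "open S"
    and f: "smooth_map_on S A model_atlas f" and g: "smooth_map_on S A model_atlas g" and h: "smooth_on UNIV h"
  shows "smooth_map_on S A model_atlas (\<lambda>p. h (f p, g p))"
  by (rule smooth_map_on_model_compose[OF A fin_dim_prod[OF fb fc] fdd S open_UNIV _ h UNIV_I])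
     (rule smooth_map_on_Pair[OF mfd_model[OF fb] mfd_model[OF fc] A S f g, unfolded prod_atlas_model])

lemma smooth_map_on_add:
  fixes f g :: "'p::topological_space \<Rightarrow> 'b::real_normed_vector"
  assumes A: "mfd A" and fb: "fin_dim TYPE('b)" and S: "open S"
    and f: "smooth_map_on S A model_atlas f" and g: "smooth_map_on S A model_atlas g"
  shows "smooth_map_on S A model_atlas (\<lambda>p. f p + g p)"
  using smooth_map_on_binop[OF A fb fb fb S f g, of "\<lambda>z. fst z + snd z"]
  by (simp add: smooth_on_add smooth_on_fst smooth_on_snd)

lemma smooth_map_on_scaleR:
  fixes g :: "'p::topological_space \<Rightarrow> 'b::real_normed_vector"
  assumes A: "mfd A" and fb: "fin_dim TYPE('b)" and S: "open S"
    and f: "smooth_map_on S A model_atlas f" and g: "smooth_map_on S A model_atlas g"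
  shows "smooth_map_on S A model_atlas (\<lambda>p. f p *\<^sub>R g p)"
  using smooth_map_on_binop[OF A fin_dim_real fb fb S f g, of "\<lambda>z. fst z *\<^sub>R snd z"]
  by (simp add: smooth_on_scaleR smooth_on_fst smooth_on_snd)

lemma smooth_map_on_mult:
  fixes f g :: "'p::topological_space \<Rightarrow> real"
  assumes "mfd A" "open S" "smooth_map_on S A model_atlas f" "smooth_map_on S A model_atlas g"
  shows "smooth_map_on S A model_atlas (\<lambda>p. f p * g p)"
  using smooth_map_on_scaleR[OF assms(1) fin_dim_real assms(2-4)] by simp

lemma smooth_map_on_diff:
  fixes f g :: "'p::topological_space \<Rightarrow> real"
  assumes A: "mfd A" and S: "open S"
    and f: "smooth_map_on S A model_atlas f" and g: "smooth_map_on S A model_atlas g"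
  shows "smooth_map_on S A model_atlas (\<lambda>p. f p - g p)"
  using smooth_map_on_add[OF A fin_dim_real S f smooth_map_on_mult[OF A S smooth_map_on_const[OF A S, of _ "-1"] g]] by simp

lemma smooth_map_on_sum:
  fixes f :: "'i \<Rightarrow> 'p::topological_space \<Rightarrow> 'b::real_normed_vector"
  assumes A: "mfd A" and fb: "fin_dim TYPE('b)" and S: "open S" and f: "\<And>i. i \<in> I \<Longrightarrow> smooth_map_on S A model_atlas (f i)"
  shows "smooth_map_on S A model_atlas (\<lambda>p. \<Sum>i\<in>I. f i p)"
  using f by (induction I rule: infinite_finite_induct)
    (auto intro!: smooth_map_on_add[OF A fb S] smooth_map_on_const[OF A S])

lemma smooth_funI: "smooth_map_on UNIV A model_atlas f \<Longrightarrow> f \<in> smooth_fun A"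
  and smooth_funD: "f \<in> smooth_fun A \<Longrightarrow> smooth_map_on S A model_atlas f"
  by (auto simp: smooth_fun_def intro: smooth_map_on_subset)

lemma smooth_fun_const: "mfd A \<Longrightarrow> (\<lambda>_. c) \<in> smooth_fun A"
  by (rule smooth_funI, rule smooth_map_on_const) auto

lemma smooth_fun_add: "mfd A \<Longrightarrow> f \<in> smooth_fun A \<Longrightarrow> g \<in> smooth_fun A \<Longrightarrow> (\<lambda>p. f p + g p) \<in> smooth_fun A"
  by (rule smooth_funI[OF smooth_map_on_add[OF _ fin_dim_real open_UNIV smooth_funD smooth_funD]])

lemma smooth_fun_mult: "mfd A \<Longrightarrow> f \<in> smooth_fun A \<Longrightarrow> g \<in> smooth_fun A \<Longrightarrow> (\<lambda>p. f p * g p) \<in> smooth_fun A"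
  by (rule smooth_funI[OF smooth_map_on_mult[OF _ open_UNIV smooth_funD smooth_funD]])

lemma smooth_fun_diff: "mfd A \<Longrightarrow> f \<in> smooth_fun A \<Longrightarrow> g \<in> smooth_fun A \<Longrightarrow> (\<lambda>p. f p - g p) \<in> smooth_fun A"
  by (rule smooth_funI[OF smooth_map_on_diff[OF _ open_UNIV smooth_funD smooth_funD]])

lemma smooth_fun_cmult: "mfd A \<Longrightarrow> f \<in> smooth_fun A \<Longrightarrow> (\<lambda>p. c * f p) \<in> smooth_fun A"
  by (rule smooth_fun_mult[OF _ smooth_fun_const])

lemma smooth_fun_compose:
  assumes "mfd A" "mfd B" "smooth_map A B c" "f \<in> smooth_fun B"
  shows "(\<lambda>p. f (c p)) \<in> smooth_fun A"
  by (rule smooth_funI, rule smooth_map_on_compose[OF assms(1,2) mfd_model[OF fin_dim_real] open_UNIV open_UNIV assms(3)])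
     (use assms smooth_funD in auto)

lemma smooth_fun_local:
  assumes A: "mfd A" and "\<And>p. \<exists>W. open W \<and> p \<in> W \<and> smooth_map_on W A model_atlas f"
  shows "f \<in> smooth_fun A"
  by (rule smooth_funI, rule smooth_map_on_local[OF A mfd_model[OF fin_dim_real] open_UNIV]) (use assms in auto)

lemma smooth_on_param:
  assumes "mfd A" "fin_dim TYPE('x::real_normed_vector)" "fin_dim TYPE('y::real_normed_vector)" "open S" "open T"
    "smooth_map_on S model_atlas A (y :: 'x \<Rightarrow> _)" "smooth_map_on T A model_atlas (f :: _ \<Rightarrow> 'y)" "\<And>x. x \<in> S \<Longrightarrow> y x \<in> T"
  shows "smooth_on S (\<lambda>x. f (y x))"
  using smooth_map_on_compose[OF mfd_model[OF assms(2)] assms(1) mfd_model[OF assms(3)] assms(4-8)]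
  by (simp add: smooth_map_on_model_iff assms(4))

section \<open>Extension by zero and bump functions\<close>

lemma smooth_extension_by_zero:
  fixes f :: "'p::topological_space \<Rightarrow> real"
  assumes A: "mfd A" and W: "open W" and f: "smooth_map_on W A model_atlas f" and b: "b \<in> smooth_fun A"
    and K: "closed K" "K \<subseteq> W" "\<And>q. q \<notin> K \<Longrightarrow> b q = 0"
  shows "(\<lambda>q. if q \<in> W then b q * f q else 0) \<in> smooth_fun A"
proof (rule smooth_fun_local[OF A])
  fix p
  note M = mfd_model[OF fin_dim_real]
  show "\<exists>U. open U \<and> p \<in> U \<and> smooth_map_on U A model_atlas (\<lambda>q. if q \<in> W then b q * f q else 0)"
  proof (cases "p \<in> W")
    case True
    have "smooth_map_on W A model_atlas (\<lambda>q. if q \<in> W then b q * f q else 0)"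
      by (rule smooth_map_on_cong[OF A M W smooth_map_on_mult[OF A W smooth_funD[OF b] f]]) simp
    then show ?thesis using True W by blast
  next
    case False
    have "open (- K)" using K by auto
    moreover have "smooth_map_on (- K) A model_atlas (\<lambda>q. if q \<in> W then b q * f q else 0)"
      by (rule smooth_map_on_cong[OF A M _ smooth_map_on_const[OF A, of _ _ 0]]) (use K in auto)
    ultimately show ?thesis using False K by blast
  qed
qed

text \<open>The bump is transported from a chart. In a Hausdorff space its compact support region
  \<open>K\<close> is closed, so that the extension by 0 is smooth on the open complement of
  \<open>K\<close>, which together with \<open>W'\<close> covers everything.\<close>

lemma manifold_bump:
  fixes A :: "('p::t2_space, 'e::real_normed_vector) chart set"
  assumes A: "mfd A" and W: "open W" "p \<in> W"
  shows "\<exists>b\<in>smooth_fun A. \<exists>V K. (\<forall>q. 0 \<le> b q \<and> b q \<le> 1) \<and> open V \<and> p \<in> V \<and> (\<forall>q\<in>V. b q = 1)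
    \<and> V \<subseteq> K \<and> compact K \<and> K \<subseteq> W \<and> (\<forall>q. q \<notin> K \<longrightarrow> b q = 0)"
proof -
  note M = mfd_model[OF fin_dim_real]
  obtain U \<phi> where c: "(U, \<phi>) \<in> A" "p \<in> U" using chart_cover[OF A] by blast
  define W' where "W' = U \<inter> W"
  have W': "open W'" "W' \<subseteq> U" "p \<in> W'" using chart_open[OF A c(1)] W c by (auto simp: W'_def)
  have "open (\<phi> ` W')" by (rule open_chart_image[OF A c(1) W'(1,2)])
  from smooth_bump[OF mfd_fin_dim[OF A] this imageI[OF W'(3)]]
  obtain \<beta> :: "'e \<Rightarrow> real" and V0 K0 where
    bump: "smooth_on UNIV \<beta> \<and> (\<forall>z. 0 \<le> \<beta> z \<and> \<beta> z \<le> 1) \<and> open V0 \<and> \<phi> p \<in> V0 \<and> (\<forall>z\<in>V0. \<beta> z = 1)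
    \<and> V0 \<subseteq> K0 \<and> compact K0 \<and> K0 \<subseteq> \<phi> ` W' \<and> (\<forall>z. z \<notin> K0 \<longrightarrow> \<beta> z = 0)" by (elim exE)
  then have \<beta>: "smooth_on UNIV \<beta>" "\<And>z. 0 \<le> \<beta> z \<and> \<beta> z \<le> (1::real)" and V0: "open V0" "\<phi> p \<in> V0" "\<And>z. z \<in> V0 \<Longrightarrow> \<beta> z = 1"
    and K0: "V0 \<subseteq> K0" "compact K0" "K0 \<subseteq> \<phi> ` W'" "\<And>z. z \<notin> K0 \<Longrightarrow> \<beta> z = 0" by simp_all
  define b where "b q = (if q \<in> W' then \<beta> (\<phi> q) else 0)" for q
  define K where "K = inv_into U \<phi> ` K0"
  define V where "V = U \<inter> \<phi> -` V0"
  have K: "compact K" unfolding K_def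
    by (rule compact_continuous_image[OF continuous_on_subset[OF chart_inv_cont[OF A c(1)]] K0(2)]) (use K0(3) W'(2) in blast)
  have KW: "K \<subseteq> W'"
  proof
    fix q assume "q \<in> K"
    then obtain w where "w \<in> W'" "q = inv_into U \<phi> (\<phi> w)" using K0(3) unfolding K_def by blast
    then show "q \<in> W'" using chart_inv[OF A c(1), of w] W'(2) by auto
  qed
  have inK: "q \<in> K" if "q \<in> U" "\<phi> q \<in> K0" for q
    unfolding K_def using that chart_inv[OF A c(1)] by (metis imageI)
  have b0: "b q = 0" if "q \<notin> K" for q using that inK[of q] K0(4) W'(2) by (auto simp: b_def)
  have "b \<in> smooth_fun A"
  proof (rule smooth_fun_local[OF A])
    fix q
    show "\<exists>N. open N \<and> q \<in> N \<and> smooth_map_on N A model_atlas b"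
    proof (cases "q \<in> W'")
      case True
      have "smooth_map_on W' A model_atlas (\<lambda>q. \<beta> (\<phi> q))"
        by (rule smooth_map_on_model_compose[OF A mfd_fin_dim[OF A] fin_dim_real W'(1) open_UNIV
              smooth_map_on_subset[OF smooth_map_on_chart[OF A c(1)] W'(2)] \<beta>(1) UNIV_I])
      then have "smooth_map_on W' A model_atlas b"
        by (rule smooth_map_on_cong[OF A M W'(1)]) (simp add: b_def)
      then show ?thesis using True W' by blast
    next
      case False
      have op: "open (- K)" using compact_imp_closed[OF K] by auto
      have "smooth_map_on (- K) A model_atlas b"
        by (rule smooth_map_on_cong[OF A M op smooth_map_on_const[OF A op, of _ 0]]) (use b0 in auto)
      then show ?thesis using False KW op by blast
    qed
  qed
  moreover have "0 \<le> b q \<and> b q \<le> 1" for q using \<beta>(2) by (simp add: b_def)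
  moreover have "open V" unfolding V_def
    by (rule continuous_open_preimage[OF chart_cont[OF A c(1)] chart_open[OF A c(1)] V0(1)])
  moreover have "p \<in> V" using c V0 by (simp add: V_def)
  moreover have VK: "V \<subseteq> K" using inK K0(1) by (auto simp: V_def)
  moreover have "b q = 1" if "q \<in> V" for q
    using that VK KW V0(3) by (auto simp: b_def V_def)
  moreover have "K \<subseteq> W" using KW by (auto simp: W'_def)
  moreover note K b0
  ultimately show ?thesis by (intro bexI[of _ b] exI[of _ V] exI[of _ K]) auto
qed

section \<open>Tangent vectors, vector fields and one-forms in coordinates\<close>

text \<open>\<open>tv A y x w\<close> is the image of the vector \<open>w\<close> at \<open>x\<close> under the tangent map of \<open>y\<close>.\<close>

definition tv :: "('p::topological_space, 'e::real_normed_vector) chart set \<Rightarrow> ('x::real_normed_vector \<Rightarrow> 'p) \<Rightarrow> 'x \<Rightarrow> 'x \<Rightarrow> 'p tvec" where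
  "tv A y x w = (\<lambda>f. if f \<in> smooth_fun A then frechet_derivative (\<lambda>x. f (y x)) (at x) w else 0)"

lemma frechet_derivative_cong_open:
  assumes "open N" "x \<in> N" "\<And>y. y \<in> N \<Longrightarrow> f y = g y"
  shows "frechet_derivative f (at x) = frechet_derivative g (at x)"
proof -
  have "(f has_derivative D) (at x) \<longleftrightarrow> (g has_derivative D) (at x)" for D
    using has_derivative_transform_within_open[OF _ assms(1,2), of f D UNIV g]
      has_derivative_transform_within_open[OF _ assms(1,2), of g D UNIV f] assms(3) by auto
  then show ?thesis unfolding frechet_derivative_def by simp
qed

lemma frechet_derivative_eq: "(f has_derivative D) (at x) \<Longrightarrow> frechet_derivative f (at x) = D"
  using frechet_derivative_at by metis

lemma smooth_on_fun_comp:
  fixes y :: "'x::real_normed_vector \<Rightarrow> 'p::topological_space"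
  assumes "mfd A" "fin_dim TYPE('x)" "open S" "smooth_map_on S model_atlas A y" "f \<in> smooth_fun A"
  shows "smooth_on S (\<lambda>x. f (y x))"
  by (rule smooth_on_param[OF assms(1,2) fin_dim_real assms(3) open_UNIV assms(4) smooth_funD[OF assms(5)] UNIV_I])

lemma fun_comp_has_derivative:
  fixes y :: "'x::real_normed_vector \<Rightarrow> 'p::topological_space"
  assumes "mfd A" "fin_dim TYPE('x)" "open S" "smooth_map_on S model_atlas A y" "x \<in> S" "f \<in> smooth_fun A"
  shows "((\<lambda>x. f (y x)) has_derivative (\<lambda>w. tv A y x w f)) (at x)"
  using smooth_on_has_derivative[OF smooth_on_fun_comp[OF assms(1-4,6)] assms(5)] assms(6) by (simp add: tv_def)

lemma tangent_spaceD:
  assumes "v \<in> tangent_space A p"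
  shows "f \<in> smooth_fun A \<Longrightarrow> g \<in> smooth_fun A \<Longrightarrow> v (\<lambda>q. f q + g q) = v f + v g"
    and "f \<in> smooth_fun A \<Longrightarrow> v (\<lambda>q. a * f q) = a * v f"
    and "f \<in> smooth_fun A \<Longrightarrow> g \<in> smooth_fun A \<Longrightarrow> v (\<lambda>q. f q * g q) = f p * v g + g p * v f"
    and "f \<notin> smooth_fun A \<Longrightarrow> v f = 0"
  using assms by (simp_all add: tangent_space_def)

lemma tv_tangent:
  fixes y :: "'x::real_normed_vector \<Rightarrow> 'p::topological_space"
  assumes A: "mfd A" and y: "fin_dim TYPE('x)" "open S" "smooth_map_on S model_atlas A y" "x \<in> S"
  shows "tv A y x w \<in> tangent_space A (y x)"
proof -
  note d = fun_comp_has_derivative[OF A y]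
  have val: "tv A y x w f = D w" if "f \<in> smooth_fun A" "((\<lambda>x. f (y x)) has_derivative D) (at x)" for f D
    using that by (simp add: tv_def frechet_derivative_eq)
  show ?thesis unfolding tangent_space_def
  proof (intro CollectI conjI ballI allI impI)
    fix f g assume f: "f \<in> smooth_fun A" and g: "g \<in> smooth_fun A"
    show "tv A y x w (\<lambda>q. f q + g q) = tv A y x w f + tv A y x w g"
      by (rule val[OF smooth_fun_add[OF A f g] has_derivative_add[OF d[OF f] d[OF g]]])
    show "tv A y x w (\<lambda>q. f q * g q) = f (y x) * tv A y x w g + g (y x) * tv A y x w f"
      using val[OF smooth_fun_mult[OF A f g] has_derivative_mult[OF d[OF f] d[OF g]]] by (simp add: mult.commute)
  next
    fix f a assume f: "f \<in> smooth_fun A"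
    show "tv A y x w (\<lambda>q. a * f q) = a * tv A y x w f"
      by (rule val[OF smooth_fun_cmult[OF A f] has_derivative_mult_right[OF d[OF f]]])
  qed (simp add: tv_def)
qed

lemma tv_linear:
  fixes y :: "'x::real_normed_vector \<Rightarrow> 'p::topological_space"
  assumes A: "mfd A" and y: "fin_dim TYPE('x)" "open S" "smooth_map_on S model_atlas A y" "x \<in> S"
  shows "tv A y x (v + w) = (\<lambda>f. tv A y x v f + tv A y x w f)" "tv A y x (c *\<^sub>R v) = (\<lambda>f. c * tv A y x v f)"
proof -
  have lin: "linear (\<lambda>w. tv A y x w f)" if "f \<in> smooth_fun A" for f
    by (rule has_derivative_linear[OF fun_comp_has_derivative[OF A y that]])
  have z: "tv A y x w f = 0" if "f \<notin> smooth_fun A" for f w using that by (simp add: tv_def)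
  show "tv A y x (v + w) = (\<lambda>f. tv A y x v f + tv A y x w f)" "tv A y x (c *\<^sub>R v) = (\<lambda>f. c * tv A y x v f)"
    using linear_add[OF lin] linear_cmul[OF lin] z by (metis add.right_neutral, metis mult_zero_right real_scaleR_def)
qed

lemma pushforward_tv:
  assumes "mfd A" "smooth_map A A c"
  shows "pushforward A c (tv A y x w) = tv A (\<lambda>x. c (y x)) x w"
proof
  fix f
  have "(\<lambda>p. f (c p)) \<in> smooth_fun A" if "f \<in> smooth_fun A"
    using smooth_fun_compose[OF assms(1,1,2) that] .
  then show "pushforward A c (tv A y x w) f = tv A (\<lambda>x. c (y x)) x w f"
    by (auto simp: pushforward_def tv_def comp_def)
qed

lemma tv_cong:
  fixes y y' :: "'x::real_normed_vector \<Rightarrow> 'p::topological_space"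
  assumes N: "open N" "x \<in> N" "\<And>x'. x' \<in> N \<Longrightarrow> y x' = y' x'"
  shows "tv A y x w = tv A y' x w"
proof (rule ext)
  fix f :: "'p \<Rightarrow> real"
  have "frechet_derivative (\<lambda>x. f (y x)) (at x) = frechet_derivative (\<lambda>x. f (y' x)) (at x)"
    by (rule frechet_derivative_cong_open[OF N(1,2)]) (simp add: N(3))
  then show "tv A y x w f = tv A y' x w f" by (simp add: tv_def)
qed

lemma tv_chain:
  fixes y :: "'x::real_normed_vector \<Rightarrow> 'p::topological_space" and z :: "'u::real_normed_vector \<Rightarrow> 'x"
  assumes A: "mfd A" and y: "fin_dim TYPE('x)" "open S" "smooth_map_on S model_atlas A y" "z u \<in> S"
    and z: "(z has_derivative Z) (at u)"
  shows "tv A (\<lambda>u. y (z u)) u w = tv A y (z u) (Z w)"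
proof
  fix f
  have "((\<lambda>u. f (y (z u))) has_derivative (\<lambda>w. tv A y (z u) (Z w) f)) (at u)" if "f \<in> smooth_fun A"
    using has_derivative_compose[OF z fun_comp_has_derivative[OF A y that]] .
  then show "tv A (\<lambda>u. y (z u)) u w f = tv A y (z u) (Z w) f"
    by (cases "f \<in> smooth_fun A") (auto simp: tv_def frechet_derivative_eq)
qed

section \<open>Calculus in a fixed chart\<close>

locale manifold_chart =
  fixes A :: "('p::t2_space, 'e::real_normed_vector) chart set" and U \<phi>
  assumes A: "mfd A" and c: "(U, \<phi>) \<in> A"
begin

abbreviation "\<psi> \<equiv> inv_into U \<phi>"
abbreviation "\<Omega> \<equiv> \<phi> ` U"

lemma fd: "fin_dim TYPE('e)" by (rule mfd_fin_dim[OF A])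
lemma opO: "open \<Omega>" by (rule chart_open_image[OF A c])
lemma opU: "open U" by (rule chart_open[OF A c])
lemma inv: "q \<in> U \<Longrightarrow> \<psi> (\<phi> q) = q" by (rule chart_inv[OF A c])
lemma invU: "z \<in> \<Omega> \<Longrightarrow> \<psi> z \<in> U" by (auto simp: inv)
lemma inv': "z \<in> \<Omega> \<Longrightarrow> \<phi> (\<psi> z) = z" by (auto simp: inv)
lemma sm_inv: "smooth_map_on \<Omega> model_atlas A \<psi>" by (rule smooth_map_on_chart_inv[OF A c])
lemma sm: "smooth_map_on U A model_atlas \<phi>" by (rule smooth_map_on_chart[OF A c])
lemma cont: "continuous_on U \<phi>" by (rule chart_cont[OF A c])
lemma op_im: "open V \<Longrightarrow> V \<subseteq> U \<Longrightarrow> open (\<phi> ` V)" by (rule open_chart_image[OF A c])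

lemma smooth_on_coord: "f \<in> smooth_fun A \<Longrightarrow> smooth_on \<Omega> (\<lambda>z. f (\<psi> z))"
  by (rule smooth_on_fun_comp[OF A fd opO sm_inv])

lemma smooth_map_on_coord:
  fixes g :: "'e \<Rightarrow> real"
  assumes "smooth_on \<Omega> g" shows "smooth_map_on U A model_atlas (\<lambda>q. g (\<phi> q))"
  by (rule smooth_map_on_model_compose[OF A fd fin_dim_real opU opO sm assms]) auto

text \<open>The derivation with components \<open>w\<close> in the chart, at the point with
  coordinates \<open>z\<close>.\<close>

definition cv :: "'e \<Rightarrow> 'e \<Rightarrow> 'p tvec" where "cv z w = tv A \<psi> z w"

lemma cv_apply: "f \<in> smooth_fun A \<Longrightarrow> cv z w f = frechet_derivative (\<lambda>z. f (\<psi> z)) (at z) w"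
  by (simp add: cv_def tv_def)

lemma cv_tangent: "z \<in> \<Omega> \<Longrightarrow> cv z w \<in> tangent_space A (\<psi> z)"
  unfolding cv_def by (rule tv_tangent[OF A fd opO sm_inv])

lemma cv_linear: "z \<in> \<Omega> \<Longrightarrow> cv z (v + w) = (\<lambda>f. cv z v f + cv z w f)" "z \<in> \<Omega> \<Longrightarrow> cv z (k *\<^sub>R v) = (\<lambda>f. k * cv z v f)"
  unfolding cv_def by (rule tv_linear[OF A fd opO sm_inv], assumption)+

text \<open>Derivations act on globally defined functions only. Cut-off coordinates are such
  functions, and near \<open>p\<close> they still read off the components of a tangent
  vector.\<close>

lemma coordinate_functions:
  assumes p: "p \<in> U"
  shows "\<exists>V x. open V \<and> p \<in> V \<and> V \<subseteq> U \<and> (\<forall>e. x e \<in> smooth_fun A) \<and> (\<forall>e. \<forall>q\<in>V. x e q = crd e (\<phi> q)) \<and> (\<forall>e. \<forall>q\<in>V. \<forall>w. cv (\<phi> q) w (x e) = crd e w)"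
proof -
  from manifold_bump[OF A opU p] obtain b V K where b: "b \<in> smooth_fun A"
    and bVK: "(\<forall>q. 0 \<le> b q \<and> b q \<le> 1) \<and> open V \<and> p \<in> V \<and> (\<forall>q\<in>V. b q = 1)
    \<and> V \<subseteq> K \<and> compact K \<and> K \<subseteq> U \<and> (\<forall>q. q \<notin> K \<longrightarrow> b q = 0)" by (elim bexE exE)
  then have V: "open V" "p \<in> V" "V \<subseteq> U" "\<And>q. q \<in> V \<Longrightarrow> b q = 1" and K: "closed K" "K \<subseteq> U" "\<And>q. q \<notin> K \<Longrightarrow> b q = 0"
    using compact_imp_closed by auto
  define x where "x e q = (if q \<in> U then b q * crd e (\<phi> q) else 0)" for e q
  have xs: "x e \<in> smooth_fun A" for e
    unfolding x_def
    by (rule smooth_extension_by_zero[OF A opU smooth_map_on_coord[OF smooth_on_crd[OF fd opO smooth_on_id[OF opO]]] b K])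
  have "cv (\<phi> q) w (x e) = crd e w" if q: "q \<in> V" for e q w
  proof -
    have "frechet_derivative (\<lambda>z. x e (\<psi> z)) (at (\<phi> q)) = frechet_derivative (crd e) (at (\<phi> q))"
      by (rule frechet_derivative_cong_open[OF op_im[OF V(1,3)]]) (use q V inv in \<open>auto simp: x_def subset_iff\<close>)
    also have "\<dots> = crd e"
      by (rule frechet_derivative_eq[OF bounded_linear_imp_has_derivative[OF bounded_linear_crd[OF fd]]])
    finally show ?thesis by (simp add: cv_apply[OF xs])
  qed
  moreover have "x e q = crd e (\<phi> q)" if "q \<in> V" for e q using that V by (auto simp: x_def)
  ultimately show ?thesis using V xs by blast
qed

lemma cv_inj:
  assumes "z \<in> \<Omega>" "cv z v = cv z w" shows "v = w"
proof -
  obtain V x where V: "\<psi> z \<in> V" "\<And>e q w. q \<in> V \<Longrightarrow> cv (\<phi> q) w (x e) = crd e w"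
    using coordinate_functions[OF invU[OF assms(1)]] by blast
  have "crd e v = crd e w" for e
    using V(2)[OF V(1), of v e] V(2)[OF V(1), of w e] inv'[OF assms(1)] assms(2) by simp
  then have "(\<Sum>e\<in>fbasis. crd e v *\<^sub>R e) = (\<Sum>e\<in>fbasis. crd e w *\<^sub>R e)" by simp
  then show ?thesis unfolding crd_expand[OF fd] .
qed

lemma derivation_sum:
  assumes v: "v \<in> tangent_space A p" and f: "\<And>i. i \<in> I \<Longrightarrow> f i \<in> smooth_fun A"
  shows "v (\<lambda>q. \<Sum>i\<in>I. f i q) = (\<Sum>i\<in>I. v (f i)) \<and> (\<lambda>q. \<Sum>i\<in>I. f i q) \<in> smooth_fun A"
  using f
proof (induction I rule: infinite_finite_induct)
  case (insert i I)
  have fi: "f i \<in> smooth_fun A" and fI: "(\<lambda>q. \<Sum>i\<in>I. f i q) \<in> smooth_fun A" "v (\<lambda>q. \<Sum>i\<in>I. f i q) = (\<Sum>i\<in>I. v (f i))"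
    using insert by auto
  show ?case
    using insert.hyps fI(2) tangent_spaceD(1)[OF v fi fI(1)] smooth_fun_add[OF A fi fI(1)] by simp
next
  have z: "v (\<lambda>q. 0) = 0"
    using tangent_spaceD(2)[OF v smooth_fun_const[OF A], of 0 0] by simp
  { case empty show ?case using z smooth_fun_const[OF A] by simp }
  { case infinite then show ?case using z smooth_fun_const[OF A] by simp }
qed

lemma tangent_const:
  assumes v: "v \<in> tangent_space A p" shows "v (\<lambda>q. k) = 0"
proof -
  have c1: "(\<lambda>q. 1::real) \<in> smooth_fun A" by (rule smooth_fun_const[OF A])
  have "v (\<lambda>q. 1 * 1) = 1 * v (\<lambda>q. 1) + 1 * v (\<lambda>q. 1)"
    by (rule tangent_spaceD(3)[OF v c1 c1])
  then have "v (\<lambda>q. 1) = 0" by simp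
  moreover have "v (\<lambda>q. k * 1) = k * v (\<lambda>q. 1)" by (rule tangent_spaceD(2)[OF v c1])
  ultimately show ?thesis by simp
qed

text \<open>Hadamard's lemma writes \<open>f - f p\<close> near \<open>p\<close> as a combination of
  coordinates that vanish at \<open>p\<close>. The product rule then leaves only the values of the
  coefficients at \<open>p\<close>, which are the partial derivatives of \<open>f\<close>.\<close>

lemma tangent_eq_cv:
  assumes p: "p \<in> U" and v: "v \<in> tangent_space A p"
  shows "\<exists>w. v = cv (\<phi> p) w"
proof -
  define z0 where "z0 = \<phi> p"
  have z0: "z0 \<in> \<Omega>" using p by (simp add: z0_def)
  obtain r where r: "r > 0" "ball z0 r \<subseteq> \<Omega>" using opO z0 openE by blast
  define W where "W = U \<inter> \<phi> -` ball z0 r"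
  have W: "open W" "p \<in> W" "W \<subseteq> U"
    unfolding W_def using continuous_open_preimage[OF cont opU open_ball] p r(1) by (auto simp: z0_def)
  from manifold_bump[OF A W(1,2)] obtain b V K where b: "b \<in> smooth_fun A"
    and bVK: "(\<forall>q. 0 \<le> b q \<and> b q \<le> 1) \<and> open V \<and> p \<in> V \<and> (\<forall>q\<in>V. b q = 1)
    \<and> V \<subseteq> K \<and> compact K \<and> K \<subseteq> W \<and> (\<forall>q. q \<notin> K \<longrightarrow> b q = 0)" by (elim bexE exE)
  then have bp: "b p = 1" and K: "closed K" "K \<subseteq> W" "\<And>q. q \<notin> K \<Longrightarrow> b q = 0"
    using compact_imp_closed by auto
  have ext: "(\<lambda>q. if q \<in> W then b q * g (\<phi> q) else 0) \<in> smooth_fun A" if "smooth_on (ball z0 r) g" for g :: "'e \<Rightarrow> real"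
  proof (rule smooth_extension_by_zero[OF A W(1) _ b K])
    show "smooth_map_on W A model_atlas (\<lambda>q. g (\<phi> q))"
      by (rule smooth_map_on_model_compose[OF A fd fin_dim_real W(1) open_ball smooth_map_on_subset[OF sm W(3)] that])
         (simp add: W_def)
  qed
  define x where "x e q = (if q \<in> W then b q * crd e (\<phi> q - z0) else 0)" for e q
  have x: "x e \<in> smooth_fun A" for e unfolding x_def
    by (rule ext, rule smooth_on_crd[OF fd open_ball], rule smooth_on_diff[OF open_ball smooth_on_id[OF open_ball] smooth_on_const])
  have xp: "x e p = 0" for e using linear_0[OF linear_crd[OF fd]] by (simp add: x_def z0_def)
  have add: "v (\<lambda>q. f q + g q) = v f + v g" and mult: "v (\<lambda>q. f q * g q) = f p * v g + g p * v f"
    if "f \<in> smooth_fun A" "g \<in> smooth_fun A" for f g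
    using tangent_spaceD[OF v] that by simp_all
  have main: "v f = frechet_derivative (\<lambda>z. f (\<psi> z)) (at z0) (\<Sum>e\<in>fbasis. v (x e) *\<^sub>R e)" if f: "f \<in> smooth_fun A" for f
  proof -
    let ?F = "\<lambda>z. f (\<psi> z)"
    let ?D = "frechet_derivative ?F (at z0)"
    have Fs: "smooth_on \<Omega> ?F" by (rule smooth_on_coord[OF f])
    from hadamard[OF fd r(2,1) opO Fs] obtain g where
      "(\<forall>b\<in>fbasis. smooth_on (ball z0 r) (g b) \<and> g b z0 = ?D b) \<and>
       (\<forall>z\<in>ball z0 r. ?F z = ?F z0 + (\<Sum>b\<in>fbasis. crd b (z - z0) * g b z))" by (elim exE)
    then have g: "\<And>e. e \<in> fbasis \<Longrightarrow> smooth_on (ball z0 r) (g e)" "\<And>e. e \<in> fbasis \<Longrightarrow> g e z0 = ?D e"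
      "\<And>z. z \<in> ball z0 r \<Longrightarrow> ?F z = ?F z0 + (\<Sum>e\<in>fbasis. crd e (z - z0) * g e z)" by auto
    define G where "G e q = (if q \<in> W then b q * g e (\<phi> q) else 0)" for e q
    have G: "G e \<in> smooth_fun A" if "e \<in> fbasis" for e unfolding G_def by (rule ext[OF g(1)[OF that]])
    have Gp: "G e p = ?D e" if "e \<in> fbasis" for e using W bp g(2)[OF that] by (simp add: G_def z0_def)
    define h where "h q = f q + (- f p)" for q
    have h: "h \<in> smooth_fun A" unfolding h_def by (rule smooth_fun_add[OF A f smooth_fun_const[OF A]])
    have hp: "h p = 0" by (simp add: h_def)
    have "v h = v f + v (\<lambda>q. - f p)" unfolding h_def by (rule add[OF f smooth_fun_const[OF A]])
    then have vh: "v h = v f" using tangent_const[OF v] by simp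
    have bb: "(\<lambda>q. b q * b q) \<in> smooth_fun A" by (rule smooth_fun_mult[OF A b b])
    \<comment> \<open>Both factors of each Hadamard term are extended by 0, so the cutoff enters
      twice. The derivation does not notice it because \<open>b p = 1\<close> and
      \<open>h p = 0\<close>.\<close>
    have "v (\<lambda>q. (b q * b q) * h q) = v h" using mult[OF bb h] bp hp by simp
    moreover have eqn: "(b q * b q) * h q = (\<Sum>e\<in>fbasis. x e q * G e q)" for q
    proof (cases "q \<in> W")
      case True
      have "\<phi> q \<in> ball z0 r" "q \<in> U" using True by (auto simp: W_def)
      with g(3)[of "\<phi> q"] have "h q = (\<Sum>e\<in>fbasis. crd e (\<phi> q - z0) * g e (\<phi> q))"
        using inv[OF p] by (simp add: h_def inv z0_def)
      then show ?thesis using True by (simp add: x_def G_def sum_distrib_left mult_ac)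
    next
      case False
      then have "b q = 0" using K by blast
      then show ?thesis using False by (simp add: x_def)
    qed
    have "(\<lambda>q. (b q * b q) * h q) = (\<lambda>q. \<Sum>e\<in>fbasis. x e q * G e q)" by (simp only: eqn)
    moreover have "v (\<lambda>q. \<Sum>e\<in>fbasis. x e q * G e q) = (\<Sum>e\<in>fbasis. v (\<lambda>q. x e q * G e q))"
      using derivation_sum[OF v, of fbasis "\<lambda>e q. x e q * G e q"] smooth_fun_mult[OF A x G] by blast
    moreover have "\<dots> = (\<Sum>e\<in>fbasis. v (x e) * ?D e)"
      by (rule sum.cong[OF refl]) (simp add: mult[OF x G] xp Gp)
    ultimately have "v f = (\<Sum>e\<in>fbasis. v (x e) * ?D e)" using vh by simp
    also have "\<dots> = ?D (\<Sum>e\<in>fbasis. v (x e) *\<^sub>R e)"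
    proof -
      have lin: "linear ?D" by (rule has_derivative_linear[OF smooth_on_has_derivative[OF Fs z0]])
      show ?thesis by (simp add: linear_sum[OF lin] linear_cmul[OF lin])
    qed
    finally show ?thesis .
  qed
  have "v = cv z0 (\<Sum>e\<in>fbasis. v (x e) *\<^sub>R e)"
  proof
    fix f
    show "v f = cv z0 (\<Sum>e\<in>fbasis. v (x e) *\<^sub>R e) f"
    proof (cases "f \<in> smooth_fun A")
      case True then show ?thesis using main[OF True] by (simp add: cv_apply)
    next
      case False
      then show ?thesis using v by (simp add: cv_def tv_def tangent_space_def)
    qed
  qed
  then show ?thesis unfolding z0_def by blast
qed

lemma tangent_scale: "v \<in> tangent_space A p \<Longrightarrow> (\<lambda>f. k * v f) \<in> tangent_space A p"
  unfolding tangent_space_def by (auto simp: algebra_simps)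

lemma tangent_add: "v \<in> tangent_space A p \<Longrightarrow> w \<in> tangent_space A p \<Longrightarrow> (\<lambda>f. v f + w f) \<in> tangent_space A p"
  unfolding tangent_space_def by (auto simp: algebra_simps)

lemma extend_field:
  assumes p: "p \<in> U" and \<xi>: "smooth_on \<Omega> \<xi>"
  shows "\<exists>X\<in>vector_fields A. \<exists>V. open V \<and> p \<in> V \<and> V \<subseteq> U \<and> (\<forall>q\<in>V. X q = cv (\<phi> q) (\<xi> (\<phi> q)))"
proof -
  from manifold_bump[OF A opU p] obtain b V K where b: "b \<in> smooth_fun A"
    and bVK: "(\<forall>q. 0 \<le> b q \<and> b q \<le> 1) \<and> open V \<and> p \<in> V \<and> (\<forall>q\<in>V. b q = 1)
    \<and> V \<subseteq> K \<and> compact K \<and> K \<subseteq> U \<and> (\<forall>q. q \<notin> K \<longrightarrow> b q = 0)" by (elim bexE exE)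
  then have V: "open V" "p \<in> V" "V \<subseteq> U" "\<And>q. q \<in> V \<Longrightarrow> b q = 1" and K: "closed K" "K \<subseteq> U" "\<And>q. q \<notin> K \<Longrightarrow> b q = 0"
    using compact_imp_closed by auto
  define X where "X q = (if q \<in> U then (\<lambda>f. b q * cv (\<phi> q) (\<xi> (\<phi> q)) f) else (\<lambda>f. 0))" for q
  have "X \<in> vector_fields A" unfolding vector_fields_def
  proof (intro CollectI conjI allI ballI)
    fix q
    show "X q \<in> tangent_space A q"
    proof (cases "q \<in> U")
      case True
      then have "cv (\<phi> q) (\<xi> (\<phi> q)) \<in> tangent_space A q" using cv_tangent[of "\<phi> q"] inv by auto
      then show ?thesis using True tangent_scale by (simp add: X_def)
    next
      case False then show ?thesis by (simp add: X_def tangent_space_def)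
    qed
  next
    fix f assume f: "f \<in> smooth_fun A"
    have "smooth_on \<Omega> (\<lambda>z. frechet_derivative (\<lambda>z. f (\<psi> z)) (at z) (\<xi> z))"
      by (rule smooth_on_frechet_compose[OF fd opO opO smooth_on_coord[OF f] smooth_on_id[OF opO] \<xi>])
    from smooth_extension_by_zero[OF A opU smooth_map_on_coord[OF this] b K]
    show "(\<lambda>p. X p f) \<in> smooth_fun A"
      by (rule back_subst[where P = "\<lambda>g. g \<in> smooth_fun A"]) (auto simp: X_def cv_apply[OF f])
  qed
  moreover have "X q = cv (\<phi> q) (\<xi> (\<phi> q))" if "q \<in> V" for q using V that by (auto simp: X_def)
  ultimately show ?thesis using V by blast
qed

lemma extend_tangent:
  assumes p: "p \<in> U" and v: "v \<in> tangent_space A p"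
  shows "\<exists>X\<in>vector_fields A. X p = v"
proof -
  obtain w where "v = cv (\<phi> p) w" using tangent_eq_cv[OF assms] by blast
  then show ?thesis using extend_field[OF p smooth_on_const[of _ w]] by blast
qed

text \<open>Near each point the components are the values of the field on cut-off coordinate
  functions, and these values are smooth by the definition of a vector field.\<close>

lemma field_coordinates:
  assumes X: "X \<in> vector_fields A"
  shows "\<exists>\<xi>. smooth_on \<Omega> \<xi> \<and> (\<forall>q\<in>U. X q = cv (\<phi> q) (\<xi> (\<phi> q)))"
proof -
  have "\<exists>w. X (\<psi> z) = cv z w" if "z \<in> \<Omega>" for z
    using tangent_eq_cv[OF invU[OF that], of "X (\<psi> z)"] X inv'[OF that] by (auto simp: vector_fields_def)
  then obtain \<xi> where \<xi>: "\<And>z. z \<in> \<Omega> \<Longrightarrow> X (\<psi> z) = cv z (\<xi> z)" by metis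
  have "smooth_on \<Omega> \<xi>"
  proof (rule smooth_on_local[OF opO])
    fix z0 assume z0: "z0 \<in> \<Omega>"
    obtain V x where V: "open V" "\<psi> z0 \<in> V" "V \<subseteq> U" and x: "\<And>e. x e \<in> smooth_fun A"
      and xV: "\<And>e q w. q \<in> V \<Longrightarrow> cv (\<phi> q) w (x e) = crd e w"
      using coordinate_functions[OF invU[OF z0]] by blast
    have opV: "open (\<phi> ` V)" by (rule op_im[OF V(1,3)])
    have VO: "\<phi> ` V \<subseteq> \<Omega>" using V(3) by blast
    have "smooth_on (\<phi> ` V) \<xi>"
    proof (rule smooth_on_crdI[OF fd opV])
      fix e :: 'e assume "e \<in> fbasis"
      have "(\<lambda>q. X q (x e)) \<in> smooth_fun A" using X x by (auto simp: vector_fields_def)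
      from smooth_on_subset[OF smooth_on_coord[OF this] VO]
      have "smooth_on (\<phi> ` V) (\<lambda>z. X (\<psi> z) (x e))" .
      moreover have "X (\<psi> z) (x e) = crd e (\<xi> z)" if zV: "z \<in> \<phi> ` V" for z
      proof -
        obtain q where q: "q \<in> V" "z = \<phi> q" using zV by blast
        have "z \<in> \<Omega>" using zV VO by blast
        from \<xi>[OF this] xV[OF q(1), of "\<xi> z" e] show ?thesis by (simp add: q(2))
      qed
      ultimately show "smooth_on (\<phi> ` V) (\<lambda>z. crd e (\<xi> z))" by (rule smooth_on_cong[OF opV, rotated])
    qed
    moreover have "z0 \<in> \<phi> ` V" using V(2) inv'[OF z0] by (metis imageI)
    ultimately show "\<exists>N. open N \<and> z0 \<in> N \<and> smooth_on (N \<inter> \<Omega>) \<xi>"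
      using opV by (intro exI[of _ "\<phi> ` V"]) (auto intro: smooth_on_subset)
  qed
  moreover have "X q = cv (\<phi> q) (\<xi> (\<phi> q))" if "q \<in> U" for q using \<xi>[of "\<phi> q"] that inv by simp
  ultimately show ?thesis by blast
qed

lemma one_form_add:
  "\<theta> \<in> one_forms A \<Longrightarrow> v \<in> tangent_space A p \<Longrightarrow> w \<in> tangent_space A p \<Longrightarrow> \<theta> p (\<lambda>f. v f + w f) = \<theta> p v + \<theta> p w"
  and one_form_scale: "\<theta> \<in> one_forms A \<Longrightarrow> v \<in> tangent_space A p \<Longrightarrow> \<theta> p (\<lambda>f. k * v f) = k * \<theta> p v"
  unfolding one_forms_def by blast+

lemma one_form_linear:
  assumes \<theta>: "\<theta> \<in> one_forms A" and z: "z \<in> \<Omega>"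
  shows "linear (\<lambda>w. \<theta> (\<psi> z) (cv z w))"
  by (rule linearI)
     (simp_all add: cv_linear[OF z] one_form_add[OF \<theta> cv_tangent[OF z] cv_tangent[OF z]] one_form_scale[OF \<theta> cv_tangent[OF z]])

lemma one_form_coordinates:
  assumes \<theta>: "\<theta> \<in> one_forms A"
  shows "smooth_on \<Omega> (\<lambda>z. \<theta> (\<psi> z) (cv z w))"
proof (rule smooth_on_local[OF opO])
  fix z0 assume z0: "z0 \<in> \<Omega>"
  obtain X V where X: "X \<in> vector_fields A" and V: "open V" "\<psi> z0 \<in> V" "V \<subseteq> U" "\<And>q. q \<in> V \<Longrightarrow> X q = cv (\<phi> q) w"
    using extend_field[OF invU[OF z0] smooth_on_const[of _ w]] by blast
  have opV: "open (\<phi> ` V)" by (rule op_im[OF V(1,3)])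
  have VO: "\<phi> ` V \<subseteq> \<Omega>" using V(3) by blast
  have "(\<lambda>q. \<theta> q (X q)) \<in> smooth_fun A" using \<theta> X by (auto simp: one_forms_def)
  from smooth_on_subset[OF smooth_on_coord[OF this] VO]
  have "smooth_on (\<phi> ` V) (\<lambda>z. \<theta> (\<psi> z) (X (\<psi> z)))" .
  then have "smooth_on (\<phi> ` V) (\<lambda>z. \<theta> (\<psi> z) (cv z w))"
    by (rule smooth_on_cong[OF opV, rotated]) (use V(3,4) inv in \<open>auto simp: subset_iff\<close>)
  moreover have "z0 \<in> \<phi> ` V" using V(2) inv'[OF z0] by (metis imageI)
  ultimately show "\<exists>N. open N \<and> z0 \<in> N \<and> smooth_on (N \<inter> \<Omega>) (\<lambda>z. \<theta> (\<psi> z) (cv z w))"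
    using opV by (intro exI[of _ "\<phi> ` V"]) (auto intro: smooth_on_subset)
qed

lemma tv_eq_cv:
  fixes y :: "'x::real_normed_vector \<Rightarrow> 'p"
  assumes y: "fin_dim TYPE('x)" "open S" "smooth_map_on S model_atlas A y" and yU: "\<And>x. x \<in> S \<Longrightarrow> y x \<in> U" and x: "x \<in> S"
  shows "tv A y x w = cv (\<phi> (y x)) (frechet_derivative (\<lambda>x. \<phi> (y x)) (at x) w)"
proof -
  have s: "smooth_on S (\<lambda>x. \<phi> (y x))" by (rule smooth_on_param[OF A y(1) fd y(2) opU y(3) sm yU])
  have "tv A y x w = tv A (\<lambda>x. \<psi> (\<phi> (y x))) x w"
    by (rule tv_cong[OF y(2) x]) (simp add: inv yU)
  also have "\<dots> = tv A \<psi> (\<phi> (y x)) (frechet_derivative (\<lambda>x. \<phi> (y x)) (at x) w)"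
    by (rule tv_chain[OF A fd opO sm_inv _ smooth_on_has_derivative[OF s x]]) (use yU[OF x] in auto)
  finally show ?thesis by (simp add: cv_def)
qed

lemma one_form_tv:
  fixes y :: "'x::real_normed_vector \<Rightarrow> 'p"
  assumes \<theta>: "\<theta> \<in> one_forms A" and y: "fin_dim TYPE('x)" "open S" "smooth_map_on S model_atlas A y" and yU: "\<And>x. x \<in> S \<Longrightarrow> y x \<in> U"
    and x: "x \<in> S"
  shows "\<theta> (y x) (tv A y x w) = (\<Sum>e\<in>fbasis. crd e (frechet_derivative (\<lambda>x. \<phi> (y x)) (at x) w) * \<theta> (\<psi> (\<phi> (y x))) (cv (\<phi> (y x)) e))"
proof -
  have z: "\<phi> (y x) \<in> \<Omega>" using yU[OF x] by blast
  have "\<theta> (y x) (tv A y x w) = \<theta> (\<psi> (\<phi> (y x))) (cv (\<phi> (y x)) (frechet_derivative (\<lambda>x. \<phi> (y x)) (at x) w))"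
    by (simp add: tv_eq_cv[OF y yU x] inv yU[OF x])
  also have "\<dots> = (\<Sum>e\<in>fbasis. crd e (frechet_derivative (\<lambda>x. \<phi> (y x)) (at x) w) *\<^sub>R \<theta> (\<psi> (\<phi> (y x))) (cv (\<phi> (y x)) e))"
    by (rule linear_eq_sum_basis[OF fd one_form_linear[OF \<theta> z]])
  finally show ?thesis by simp
qed

end

lemma one_form_tv_smooth:
  fixes y :: "'x::real_normed_vector \<Rightarrow> 'p::t2_space"
  assumes A: "mfd A" and \<theta>: "\<theta> \<in> one_forms A" and y: "fin_dim TYPE('x)" "open S" "smooth_map_on S model_atlas A y"
  shows "smooth_on S (\<lambda>x. \<theta> (y x) (tv A y x w))"
proof (rule smooth_on_local[OF y(2)])
  fix x0 assume x0: "x0 \<in> S"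
  obtain U \<phi> where c: "(U, \<phi>) \<in> A" "y x0 \<in> U" using chart_cover[OF A] by blast
  interpret C: manifold_chart A U \<phi> by unfold_locales fact+
  define N where "N = S \<inter> y -` U"
  have N: "open N" "x0 \<in> N" "N \<subseteq> S" "\<And>x. x \<in> N \<Longrightarrow> y x \<in> U"
    unfolding N_def using continuous_open_preimage[OF smooth_map_on_continuous[OF y(3)] y(2) C.opU] x0 c by auto
  have yN: "smooth_map_on N model_atlas A y" by (rule smooth_map_on_subset[OF y(3) N(3)])
  have s: "smooth_on N (\<lambda>x. \<phi> (y x))" by (rule smooth_on_param[OF A y(1) C.fd N(1) C.opU yN C.sm N(4)])
  have "smooth_on N (\<lambda>x. \<Sum>e\<in>fbasis. crd e (frechet_derivative (\<lambda>x. \<phi> (y x)) (at x) w) * \<theta> (C.\<psi> (\<phi> (y x))) (C.cv (\<phi> (y x)) e))"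
  proof (rule smooth_on_sum[OF N(1)])
    fix e
    have "smooth_on N (\<lambda>x. \<theta> (C.\<psi> (\<phi> (y x))) (C.cv (\<phi> (y x)) e))"
      by (rule smooth_on_compose[OF C.fd N(1) C.opO s C.one_form_coordinates[OF \<theta>]]) (use N(4) in blast)
    then show "smooth_on N (\<lambda>x. crd e (frechet_derivative (\<lambda>x. \<phi> (y x)) (at x) w) * \<theta> (C.\<psi> (\<phi> (y x))) (C.cv (\<phi> (y x)) e))"
      by (rule smooth_on_mult[OF N(1) smooth_on_crd[OF C.fd N(1) smooth_on_frechet[OF s]]])
  qed
  then have "smooth_on N (\<lambda>x. \<theta> (y x) (tv A y x w))"
    by (rule smooth_on_cong[OF N(1), rotated]) (rule C.one_form_tv[OF \<theta> y(1) N(1) yN N(4), symmetric])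
  then show "\<exists>N. open N \<and> x0 \<in> N \<and> smooth_on (N \<inter> S) (\<lambda>x. \<theta> (y x) (tv A y x w))"
    using N by (intro exI[of _ N]) (auto intro: smooth_on_subset)
qed

section \<open>The exterior derivative in coordinates\<close>

lemma vector_field_tangent: "X \<in> vector_fields A \<Longrightarrow> X p \<in> tangent_space A p"
  and vector_field_smooth: "X \<in> vector_fields A \<Longrightarrow> f \<in> smooth_fun A \<Longrightarrow> (\<lambda>p. X p f) \<in> smooth_fun A"
  by (auto simp: vector_fields_def)

lemma pairing_derivative:
  fixes \<zeta> :: "'z::real_normed_vector \<Rightarrow> 'e::real_normed_vector" and \<alpha> :: "'e \<Rightarrow> 'z \<Rightarrow> real"
  assumes fd: "fin_dim TYPE('e)" and \<alpha>: "\<And>e. (\<alpha> e has_derivative \<alpha>' e) (at z)" and \<zeta>: "(\<zeta> has_derivative \<zeta>') (at z)"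
  shows "((\<lambda>z. \<Sum>e\<in>fbasis. crd e (\<zeta> z) * \<alpha> e z) has_derivative
    (\<lambda>h. (\<Sum>e\<in>fbasis. crd e (\<zeta> z) * \<alpha>' e h) + (\<Sum>e\<in>fbasis. crd e (\<zeta>' h) * \<alpha> e z))) (at z)"
proof -
  have "((\<lambda>z. \<Sum>e\<in>fbasis. crd e (\<zeta> z) * \<alpha> e z) has_derivative
    (\<lambda>h. \<Sum>e\<in>fbasis. crd e (\<zeta> z) * \<alpha>' e h + crd e (\<zeta>' h) * \<alpha> e z)) (at z)"
    by (intro has_derivative_sum has_derivative_mult \<alpha> bounded_linear.has_derivative[OF bounded_linear_crd[OF fd] \<zeta>])
  then show ?thesis by (simp add: sum.distrib)
qed

context manifold_chart
begin

text \<open>The components of \<theta> with respect to the coordinate vectors.\<close>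

definition al :: "('p \<Rightarrow> 'p tvec \<Rightarrow> real) \<Rightarrow> 'e \<Rightarrow> 'e \<Rightarrow> real" where
  "al \<theta> e z = \<theta> (\<psi> z) (cv z e)"

text \<open>The exterior derivative of \<theta> in the chart: the components of \<theta> are
  differentiated along one vector and paired with the other, and the result is
  antisymmetrised.\<close>

definition om :: "('p \<Rightarrow> 'p tvec \<Rightarrow> real) \<Rightarrow> 'e \<Rightarrow> 'e \<Rightarrow> 'e \<Rightarrow> real" where
  "om \<theta> z u w = (\<Sum>e\<in>fbasis. crd e w * frechet_derivative (al \<theta> e) (at z) u)
     - (\<Sum>e\<in>fbasis. crd e u * frechet_derivative (al \<theta> e) (at z) w)"

lemma al_smooth: "\<theta> \<in> one_forms A \<Longrightarrow> smooth_on \<Omega> (al \<theta> e)"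
  unfolding al_def[abs_def] by (rule one_form_coordinates)

lemma al_derivative: "\<theta> \<in> one_forms A \<Longrightarrow> z \<in> \<Omega> \<Longrightarrow> (al \<theta> e has_derivative frechet_derivative (al \<theta> e) (at z)) (at z)"
  by (rule smooth_on_has_derivative[OF al_smooth])

lemma one_form_cv: "\<theta> \<in> one_forms A \<Longrightarrow> z \<in> \<Omega> \<Longrightarrow> \<theta> (\<psi> z) (cv z w) = (\<Sum>e\<in>fbasis. crd e w * al \<theta> e z)"
  unfolding al_def using linear_eq_sum_basis[OF fd one_form_linear] by fastforce

lemma om_linear:
  assumes \<theta>: "\<theta> \<in> one_forms A" and z: "z \<in> \<Omega>"
  shows "linear (om \<theta> z u)" "linear (\<lambda>u. om \<theta> z u w)"
proof -
  have lD: "linear (frechet_derivative (al \<theta> e) (at z))" for e by (rule has_derivative_linear[OF al_derivative[OF \<theta> z]])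
  show "linear (om \<theta> z u)" "linear (\<lambda>u. om \<theta> z u w)"
    unfolding om_def
    by (rule linearI; simp add: linear_add[OF linear_crd[OF fd]] linear_cmul[OF linear_crd[OF fd]] linear_add[OF lD]
        linear_cmul[OF lD] algebra_simps sum.distrib sum_distrib_left)+
qed

lemma om_smooth: "\<theta> \<in> one_forms A \<Longrightarrow> smooth_on \<Omega> (\<lambda>z. om \<theta> z u w)"
  unfolding om_def
  by (intro smooth_on_diff smooth_on_sum smooth_on_mult smooth_on_const opO smooth_on_frechet al_smooth)

text \<open>The second-order parts of the two iterated derivatives are the Hessian of
  \<open>f\<close> with its arguments exchanged; by symmetry they cancel.\<close>

lemma lie_bracket_coordinates:
  assumes X: "smooth_on \<Omega> \<xi>" "\<And>q. q \<in> U \<Longrightarrow> X q = cv (\<phi> q) (\<xi> (\<phi> q))"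
    and Y: "smooth_on \<Omega> \<zeta>" "\<And>q. q \<in> U \<Longrightarrow> Y q = cv (\<phi> q) (\<zeta> (\<phi> q))"
    and XY: "X \<in> vector_fields A" "Y \<in> vector_fields A" and p: "p \<in> U"
  shows "lie_bracket X Y p = cv (\<phi> p) (frechet_derivative \<zeta> (at (\<phi> p)) (\<xi> (\<phi> p)) - frechet_derivative \<xi> (at (\<phi> p)) (\<zeta> (\<phi> p)))"
proof
  fix f
  define z where "z = \<phi> p"
  have z: "z \<in> \<Omega>" using p by (simp add: z_def)
  show "lie_bracket X Y p f = cv (\<phi> p) (frechet_derivative \<zeta> (at (\<phi> p)) (\<xi> (\<phi> p)) - frechet_derivative \<xi> (at (\<phi> p)) (\<zeta> (\<phi> p))) f"
  proof (cases "f \<in> smooth_fun A")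
    case False
    have z0: "Z q f = 0" if "Z \<in> vector_fields A" for Z q
      using that False tangent_spaceD(4)[of "Z q" A q f] by (simp add: vector_fields_def)
    have "X p (\<lambda>q. 0) = 0" "Y p (\<lambda>q. 0) = 0"
      by (rule tangent_const[OF vector_field_tangent[OF XY(1)]], rule tangent_const[OF vector_field_tangent[OF XY(2)]])
    then show ?thesis using False by (simp add: lie_bracket_def z0 XY cv_def tv_def)
  next
    case True
    define F where "F = (\<lambda>z. f (\<psi> z))"
    have Fs: "smooth_on \<Omega> F" unfolding F_def by (rule smooth_on_coord[OF True])
    let ?DF = "\<lambda>z. frechet_derivative F (at z)"
    let ?DDF = "\<lambda>e. frechet_derivative (\<lambda>z. ?DF z e) (at z)"
    have Dlin: "linear (?DF z)" if "z \<in> \<Omega>" for z by (rule has_derivative_linear[OF smooth_on_has_derivative[OF Fs that]])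
    have Z: "X' p (\<lambda>q. Y' q f) = (\<Sum>e\<in>fbasis. crd e (\<zeta>' z) * ?DDF e (\<xi>' z)) + ?DF z (frechet_derivative \<zeta>' (at z) (\<xi>' z))"
      if X': "\<And>q. q \<in> U \<Longrightarrow> X' q = cv (\<phi> q) (\<xi>' (\<phi> q))"
        and Y': "smooth_on \<Omega> \<zeta>'" "\<And>q. q \<in> U \<Longrightarrow> Y' q = cv (\<phi> q) (\<zeta>' (\<phi> q))" "Y' \<in> vector_fields A"
      for X' Y' :: "'p \<Rightarrow> 'p tvec" and \<xi>' \<zeta>'
    proof -
      have Yf: "(\<lambda>q. Y' q f) \<in> smooth_fun A" using Y'(3) True by (simp add: vector_fields_def)
      have "X' p (\<lambda>q. Y' q f) = frechet_derivative (\<lambda>z. Y' (\<psi> z) f) (at z) (\<xi>' z)"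
        by (simp add: X'[OF p] cv_apply[OF Yf] z_def)
      also have "frechet_derivative (\<lambda>z. Y' (\<psi> z) f) (at z) = frechet_derivative (\<lambda>z. \<Sum>e\<in>fbasis. crd e (\<zeta>' z) * ?DF z e) (at z)"
      proof (rule frechet_derivative_cong_open[OF opO z])
        fix y assume y: "y \<in> \<Omega>"
        have "Y' (\<psi> y) f = ?DF y (\<zeta>' y)" by (simp add: Y'(2)[OF invU[OF y]] inv'[OF y] cv_apply[OF True] F_def)
        also have "\<dots> = (\<Sum>e\<in>fbasis. crd e (\<zeta>' y) *\<^sub>R ?DF y e)" by (rule linear_eq_sum_basis[OF fd Dlin[OF y]])
        finally show "Y' (\<psi> y) f = (\<Sum>e\<in>fbasis. crd e (\<zeta>' y) * ?DF y e)" by simp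
      qed
      also have "\<dots> = (\<lambda>h. (\<Sum>e\<in>fbasis. crd e (\<zeta>' z) * ?DDF e h) + (\<Sum>e\<in>fbasis. crd e (frechet_derivative \<zeta>' (at z) h) * ?DF z e))"
        by (rule frechet_derivative_eq[OF pairing_derivative[OF fd smooth_on_has_derivative[OF smooth_on_frechet[OF Fs] z]
              smooth_on_has_derivative[OF Y'(1) z]]])
      also have "(\<Sum>e\<in>fbasis. crd e (frechet_derivative \<zeta>' (at z) (\<xi>' z)) * ?DF z e) = ?DF z (frechet_derivative \<zeta>' (at z) (\<xi>' z))"
        using linear_eq_sum_basis[OF fd Dlin[OF z], of "frechet_derivative \<zeta>' (at z) (\<xi>' z)"] by simp
      finally show ?thesis .
    qed
    have DDlin: "linear (?DDF e)" for e
      by (rule has_derivative_linear[OF smooth_on_has_derivative[OF smooth_on_frechet[OF Fs] z]])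
    have S: "(\<Sum>e\<in>fbasis. crd e v * ?DDF e u) = ?DDF u v" for u v
    proof -
      have "(\<Sum>e\<in>fbasis. crd e v * ?DDF e u) = (\<Sum>e\<in>fbasis. crd e v *\<^sub>R ?DDF u e)"
        by (simp add: second_derivative_symmetric[OF opO Fs z, of _ u])
      also have "\<dots> = ?DDF u v" by (rule linear_eq_sum_basis[OF fd DDlin, symmetric])
      finally show ?thesis .
    qed
    have "lie_bracket X Y p f = ?DF z (frechet_derivative \<zeta> (at z) (\<xi> z)) - ?DF z (frechet_derivative \<xi> (at z) (\<zeta> z))"
      unfolding lie_bracket_def Z[OF X(2) Y XY(2), simplified] Z[OF Y(2) X XY(1), simplified] S
      using second_derivative_symmetric[OF opO Fs z, of "\<xi> z" "\<zeta> z"] by simp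
    also have "\<dots> = cv z (frechet_derivative \<zeta> (at z) (\<xi> z) - frechet_derivative \<xi> (at z) (\<zeta> z)) f"
      by (simp add: cv_apply[OF True] F_def[symmetric] linear_diff[OF Dlin[OF z]])
    finally show ?thesis by (simp add: z_def)
  qed
qed

text \<open>Derivatives of the components of \<open>X\<close> and \<open>Y\<close> occur in the
  first two terms of the exterior derivative and are cancelled exactly by the bracket term; only the
  values at \<open>p\<close> remain.\<close>

lemma ext_deriv_coordinates:
  assumes \<theta>: "\<theta> \<in> one_forms A" and XY: "X \<in> vector_fields A" "Y \<in> vector_fields A" and p: "p \<in> U"
    and u: "X p = cv (\<phi> p) u" and w: "Y p = cv (\<phi> p) w"
  shows "ext_deriv \<theta> X Y p = om \<theta> (\<phi> p) u w"
proof -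
  define z where "z = \<phi> p"
  have z: "z \<in> \<Omega>" using p by (simp add: z_def)
  obtain \<xi> where \<xi>: "smooth_on \<Omega> \<xi>" "\<And>q. q \<in> U \<Longrightarrow> X q = cv (\<phi> q) (\<xi> (\<phi> q))" using field_coordinates[OF XY(1)] by blast
  obtain \<zeta> where \<zeta>: "smooth_on \<Omega> \<zeta>" "\<And>q. q \<in> U \<Longrightarrow> Y q = cv (\<phi> q) (\<zeta> (\<phi> q))" using field_coordinates[OF XY(2)] by blast
  have uw: "u = \<xi> z" "w = \<zeta> z" using cv_inj[OF z] u w \<xi>(2)[OF p] \<zeta>(2)[OF p] by (simp_all add: z_def)
  have Z: "X' p (\<lambda>q. \<theta> q (Y' q)) = (\<Sum>e\<in>fbasis. crd e (\<zeta>' z) * frechet_derivative (al \<theta> e) (at z) (\<xi>' z))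
       + (\<Sum>e\<in>fbasis. crd e (frechet_derivative \<zeta>' (at z) (\<xi>' z)) * al \<theta> e z)"
    if X': "\<And>q. q \<in> U \<Longrightarrow> X' q = cv (\<phi> q) (\<xi>' (\<phi> q))"
      and Y': "smooth_on \<Omega> \<zeta>'" "\<And>q. q \<in> U \<Longrightarrow> Y' q = cv (\<phi> q) (\<zeta>' (\<phi> q))" "Y' \<in> vector_fields A"
    for X' Y' :: "'p \<Rightarrow> 'p tvec" and \<xi>' \<zeta>'
  proof -
    have Yf: "(\<lambda>q. \<theta> q (Y' q)) \<in> smooth_fun A" using Y'(3) \<theta> by (simp add: one_forms_def)
    have "X' p (\<lambda>q. \<theta> q (Y' q)) = frechet_derivative (\<lambda>z. \<theta> (\<psi> z) (Y' (\<psi> z))) (at z) (\<xi>' z)"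
      by (simp add: X'[OF p] cv_apply[OF Yf] z_def)
    also have "frechet_derivative (\<lambda>z. \<theta> (\<psi> z) (Y' (\<psi> z))) (at z) = frechet_derivative (\<lambda>z. \<Sum>e\<in>fbasis. crd e (\<zeta>' z) * al \<theta> e z) (at z)"
      by (rule frechet_derivative_cong_open[OF opO z]) (simp only: Y'(2)[OF invU] inv' one_form_cv[OF \<theta>])
    also have "\<dots> = (\<lambda>h. (\<Sum>e\<in>fbasis. crd e (\<zeta>' z) * frechet_derivative (al \<theta> e) (at z) h)
        + (\<Sum>e\<in>fbasis. crd e (frechet_derivative \<zeta>' (at z) h) * al \<theta> e z))"
      by (rule frechet_derivative_eq[OF pairing_derivative[OF fd al_derivative[OF \<theta> z] smooth_on_has_derivative[OF Y'(1) z]]])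
    finally show ?thesis .
  qed
  have "\<theta> p (lie_bracket X Y p) = \<theta> (\<psi> z) (cv z (frechet_derivative \<zeta> (at z) (\<xi> z) - frechet_derivative \<xi> (at z) (\<zeta> z)))"
    using lie_bracket_coordinates[OF \<xi> \<zeta> XY p] by (simp add: z_def inv[OF p])
  also have "\<dots> = (\<Sum>e\<in>fbasis. crd e (frechet_derivative \<zeta> (at z) (\<xi> z) - frechet_derivative \<xi> (at z) (\<zeta> z)) * al \<theta> e z)"
    by (rule one_form_cv[OF \<theta> z])
  also have "\<dots> = (\<Sum>e\<in>fbasis. crd e (frechet_derivative \<zeta> (at z) (\<xi> z)) * al \<theta> e z)
      - (\<Sum>e\<in>fbasis. crd e (frechet_derivative \<xi> (at z) (\<zeta> z)) * al \<theta> e z)"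
    by (simp add: linear_diff[OF linear_crd[OF fd]] left_diff_distrib sum_subtractf)
  finally show ?thesis
    unfolding ext_deriv_def Z[OF \<xi>(2) \<zeta> XY(2), simplified] Z[OF \<zeta>(2) \<xi> XY(1), simplified] om_def uw z_def[symmetric]
    by simp
qed

end

text \<open>The pullback of \<open>\<^bold>d\<theta>\<close> along \<open>y\<close>, evaluated on two constant vector fields.\<close>

lemma ext_deriv_pullback:
  fixes y :: "'x::real_normed_vector \<Rightarrow> 'p::t2_space"
  assumes A: "mfd A" and \<theta>: "\<theta> \<in> one_forms A" and y: "fin_dim TYPE('x)" "open S" "smooth_map_on S model_atlas A y" and x0: "x0 \<in> S"
    and XY: "X \<in> vector_fields A" "Y \<in> vector_fields A" "X (y x0) = tv A y x0 u" "Y (y x0) = tv A y x0 w"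
  shows "frechet_derivative (\<lambda>x. \<theta> (y x) (tv A y x w)) (at x0) u - frechet_derivative (\<lambda>x. \<theta> (y x) (tv A y x u)) (at x0) w
    = ext_deriv \<theta> X Y (y x0)"
proof -
  obtain U \<phi> where c: "(U, \<phi>) \<in> A" "y x0 \<in> U" using chart_cover[OF A] by blast
  interpret C: manifold_chart A U \<phi> by unfold_locales fact+
  define N where "N = S \<inter> y -` U"
  have N: "open N" "x0 \<in> N" "N \<subseteq> S" "\<And>x. x \<in> N \<Longrightarrow> y x \<in> U"
    unfolding N_def using continuous_open_preimage[OF smooth_map_on_continuous[OF y(3)] y(2) C.opU] x0 c by auto
  have yN: "smooth_map_on N model_atlas A y" by (rule smooth_map_on_subset[OF y(3) N(3)])
  define \<eta> where "\<eta> = (\<lambda>x. \<phi> (y x))"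
  have s: "smooth_on N \<eta>" unfolding \<eta>_def by (rule smooth_on_param[OF A y(1) C.fd N(1) C.opU yN C.sm N(4)])
  let ?D = "\<lambda>x. frechet_derivative \<eta> (at x)"
  define z where "z = \<eta> x0"
  have z: "z \<in> C.\<Omega>" using c by (simp add: z_def \<eta>_def)
  have D: "frechet_derivative (\<lambda>x. \<theta> (y x) (tv A y x w)) (at x0) =
     (\<lambda>h. (\<Sum>e\<in>fbasis. crd e (?D x0 w) * frechet_derivative (C.al \<theta> e) (at z) (?D x0 h))
       + (\<Sum>e\<in>fbasis. crd e (frechet_derivative (\<lambda>x. ?D x w) (at x0) h) * C.al \<theta> e z))" for w
  proof -
    have al: "((\<lambda>x. C.al \<theta> e (\<eta> x)) has_derivative (\<lambda>h. frechet_derivative (C.al \<theta> e) (at z) (?D x0 h))) (at x0)" for e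
      using has_derivative_compose[OF smooth_on_has_derivative[OF s N(2)] C.al_derivative[OF \<theta> z, unfolded z_def]]
      by (simp add: z_def)
    have "frechet_derivative (\<lambda>x. \<theta> (y x) (tv A y x w)) (at x0) = frechet_derivative (\<lambda>x. \<Sum>e\<in>fbasis. crd e (?D x w) * C.al \<theta> e (\<eta> x)) (at x0)"
      by (rule frechet_derivative_cong_open[OF N(1,2)]) (simp add: C.one_form_tv[OF \<theta> y(1) N(1) yN N(4)] C.al_def \<eta>_def)
    also have "\<dots> = (\<lambda>h. (\<Sum>e\<in>fbasis. crd e (?D x0 w) * frechet_derivative (C.al \<theta> e) (at z) (?D x0 h))
       + (\<Sum>e\<in>fbasis. crd e (frechet_derivative (\<lambda>x. ?D x w) (at x0) h) * C.al \<theta> e z))"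
      using frechet_derivative_eq[OF pairing_derivative[OF C.fd al smooth_on_has_derivative[OF smooth_on_frechet[OF s, of w] N(2)]]]
      by (simp add: z_def)
    finally show ?thesis .
  qed
  have "X (y x0) = C.cv (\<phi> (y x0)) (?D x0 u)" "Y (y x0) = C.cv (\<phi> (y x0)) (?D x0 w)"
    using XY C.tv_eq_cv[OF y(1) N(1) yN N(4,2)] by (simp_all add: \<eta>_def)
  from C.ext_deriv_coordinates[OF \<theta> XY(1,2) c(2) this]
  have "ext_deriv \<theta> X Y (y x0) = C.om \<theta> z (?D x0 u) (?D x0 w)" by (simp add: z_def \<eta>_def)
  \<comment> \<open>The second derivatives of the coordinate expression \<eta> enter with opposite
    signs and cancel by symmetry.\<close>
  then show ?thesis
    unfolding D C.om_def using second_derivative_symmetric[OF N(1) s N(2), of u w] by simp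
qed

lemma extend_tangent_vector:
  fixes A :: "('p::t2_space, 'e::real_normed_vector) chart set"
  assumes A: "mfd A" and v: "v \<in> tangent_space A p"
  shows "\<exists>X\<in>vector_fields A. X p = v"
proof -
  obtain U \<phi> where c: "(U, \<phi>) \<in> A" "p \<in> U" using chart_cover[OF A] by blast
  interpret C: manifold_chart A U \<phi> by unfold_locales fact+
  show ?thesis by (rule C.extend_tangent[OF c(2) v])
qed

text \<open>The coordinate formula involves the fields only through their components at
  \<open>p\<close>.\<close>

lemma ext_deriv_pointwise:
  fixes A :: "('p::t2_space, 'e::real_normed_vector) chart set"
  assumes A: "mfd A" and \<theta>: "\<theta> \<in> one_forms A" and X: "X \<in> vector_fields A" "Y \<in> vector_fields A" "X' \<in> vector_fields A" "Y' \<in> vector_fields A"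
    and eq: "X p = X' p" "Y p = Y' p"
  shows "ext_deriv \<theta> X Y p = ext_deriv \<theta> X' Y' p"
proof -
  obtain U \<phi> where c: "(U, \<phi>) \<in> A" "p \<in> U" using chart_cover[OF A] by blast
  interpret C: manifold_chart A U \<phi> by unfold_locales fact+
  obtain u where u: "X p = C.cv (\<phi> p) u" using C.tangent_eq_cv[OF c(2) vector_field_tangent[OF X(1)]] by blast
  obtain w where w: "Y p = C.cv (\<phi> p) w" using C.tangent_eq_cv[OF c(2) vector_field_tangent[OF X(2)]] by blast
  have "ext_deriv \<theta> X' Y' p = C.om \<theta> (\<phi> p) u w"
    by (rule C.ext_deriv_coordinates[OF \<theta> X(3,4) c(2)]) (simp_all only: eq[symmetric] u w)
  with C.ext_deriv_coordinates[OF \<theta> X(1,2) c(2) u w] show ?thesis by (simp only:)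
qed

lemma vector_field_lincomb:
  fixes A :: "('p::t2_space, 'e::real_normed_vector) chart set"
  assumes A: "mfd A" and X: "X \<in> vector_fields A" "Y \<in> vector_fields A" and f: "f \<in> smooth_fun A" "g \<in> smooth_fun A"
  shows "(\<lambda>p k. f p * X p k + g p * Y p k) \<in> vector_fields A"
proof -
  obtain U \<phi> where c: "(U, \<phi>) \<in> A" using chart_cover[OF A] by blast
  interpret C: manifold_chart A U \<phi> by unfold_locales fact+
  show ?thesis unfolding vector_fields_def
  proof (intro CollectI conjI allI ballI)
    show "(\<lambda>k. f p * X p k + g p * Y p k) \<in> tangent_space A p" for p
      by (rule C.tangent_add[OF C.tangent_scale[OF vector_field_tangent[OF X(1)]] C.tangent_scale[OF vector_field_tangent[OF X(2)]]])
    show "(\<lambda>p. f p * X p k + g p * Y p k) \<in> smooth_fun A" if k: "k \<in> smooth_fun A" for k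
      by (rule smooth_fun_add[OF A smooth_fun_mult[OF A f(1) vector_field_smooth[OF X(1) k]]
            smooth_fun_mult[OF A f(2) vector_field_smooth[OF X(2) k]]])
  qed
qed

lemma ext_deriv_lincomb:
  fixes A :: "('p::t2_space, 'e::real_normed_vector) chart set"
  assumes A: "mfd A" and \<theta>: "\<theta> \<in> one_forms A" and X: "X \<in> vector_fields A" "X' \<in> vector_fields A" and Y: "Y \<in> vector_fields A"
    and f: "f \<in> smooth_fun A" "g \<in> smooth_fun A"
  shows "ext_deriv \<theta> (\<lambda>p k. f p * X p k + g p * X' p k) Y p = f p * ext_deriv \<theta> X Y p + g p * ext_deriv \<theta> X' Y p"
proof -
  obtain U \<phi> where c: "(U, \<phi>) \<in> A" "p \<in> U" using chart_cover[OF A] by blast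
  interpret C: manifold_chart A U \<phi> by unfold_locales fact+
  have z: "\<phi> p \<in> C.\<Omega>" using c by blast
  obtain u where u: "X p = C.cv (\<phi> p) u" using C.tangent_eq_cv[OF c(2) vector_field_tangent[OF X(1)]] by blast
  obtain u' where u': "X' p = C.cv (\<phi> p) u'" using C.tangent_eq_cv[OF c(2) vector_field_tangent[OF X(2)]] by blast
  obtain w where w: "Y p = C.cv (\<phi> p) w" using C.tangent_eq_cv[OF c(2) vector_field_tangent[OF Y]] by blast
  have "(\<lambda>k. f p * X p k + g p * X' p k) = C.cv (\<phi> p) (f p *\<^sub>R u + g p *\<^sub>R u')"
    by (simp add: C.cv_linear[OF z] u u')
  from C.ext_deriv_coordinates[OF \<theta> vector_field_lincomb[OF A X f] Y c(2) this w]
  have "ext_deriv \<theta> (\<lambda>p k. f p * X p k + g p * X' p k) Y p = C.om \<theta> (\<phi> p) (f p *\<^sub>R u + g p *\<^sub>R u') w" .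
  also have "\<dots> = f p * C.om \<theta> (\<phi> p) u w + g p * C.om \<theta> (\<phi> p) u' w"
    by (simp add: linear_add[OF C.om_linear(2)[OF \<theta> z]] linear_cmul[OF C.om_linear(2)[OF \<theta> z]])
  finally show ?thesis
    using C.ext_deriv_coordinates[OF \<theta> X(1) Y c(2) u w] C.ext_deriv_coordinates[OF \<theta> X(2) Y c(2) u' w] by simp
qed

text \<open>On a coordinate ball the expression of \<open>f\<close> has zero derivative, so
  \<open>f\<close> is locally constant, and connectedness makes it constant.\<close>

lemma zero_derivative_constant:
  fixes A :: "('p::t2_space, 'e::real_normed_vector) chart set"
  assumes A: "mfd A" and conn: "connected (UNIV :: 'p set)" and f: "f \<in> smooth_fun A"
    and zero: "\<And>p v. v \<in> tangent_space A p \<Longrightarrow> v f = 0"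
  shows "f p = f q"
proof (rule connected_local_const[OF conn UNIV_I UNIV_I])
  show "\<forall>a\<in>UNIV. \<forall>\<^sub>F b in at a within UNIV. f a = f b"
  proof
    fix a :: 'p
    obtain U \<phi> where c: "(U, \<phi>) \<in> A" "a \<in> U" using chart_cover[OF A] by blast
    interpret C: manifold_chart A U \<phi> by unfold_locales fact+
    obtain r where r: "r > 0" "ball (\<phi> a) r \<subseteq> C.\<Omega>" using C.opO c openE by blast
    have "((\<lambda>z. f (C.\<psi> z)) has_derivative (\<lambda>h. 0)) (at z within ball (\<phi> a) r)" if "z \<in> ball (\<phi> a) r" for z
    proof -
      have z: "z \<in> C.\<Omega>" using that r by blast
      have "frechet_derivative (\<lambda>z. f (C.\<psi> z)) (at z) = (\<lambda>h. 0)"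
        using zero[OF C.cv_tangent[OF z]] by (simp add: C.cv_apply[OF f] fun_eq_iff)
      then show ?thesis using smooth_on_has_derivative[OF C.smooth_on_coord[OF f] z] by (simp add: has_derivative_at_withinI)
    qed
    from has_derivative_zero_constant[OF convex_ball this]
    obtain k where k: "\<And>z. z \<in> ball (\<phi> a) r \<Longrightarrow> f (C.\<psi> z) = k" by blast
    define W where "W = U \<inter> \<phi> -` ball (\<phi> a) r"
    have W: "open W" "a \<in> W" unfolding W_def using continuous_open_preimage[OF C.cont C.opU open_ball] c r(1) by auto
    have "f q = k" if "q \<in> W" for q using k[of "\<phi> q"] that C.inv[of q] by (simp add: W_def)
    then show "\<forall>\<^sub>F b in at a within UNIV. f a = f b"
      using W unfolding eventually_at_topological by blast
  qed
qed

section \<open>Hamiltonian vector fields\<close>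

lemma exact_symplecticD:
  assumes "exact_symplectic A \<theta>"
  shows "mfd A" "\<theta> \<in> one_forms A"
    "X \<in> vector_fields A \<Longrightarrow> (\<And>Y. Y \<in> vector_fields A \<Longrightarrow> symp \<theta> X Y p = 0) \<Longrightarrow> X p = (\<lambda>f. 0)"
  using assms smooth_manifold_mfd unfolding exact_symplectic_def by blast+

lemma symp_nondegenerate:
  fixes A :: "('p::{t2_space, second_countable_topology}, 'e::real_normed_vector) chart set"
  assumes es: "exact_symplectic A \<theta>" and X: "X \<in> vector_fields A" "X' \<in> vector_fields A"
    and eq: "\<And>Y. Y \<in> vector_fields A \<Longrightarrow> symp \<theta> X Y p = symp \<theta> X' Y p"
  shows "X p = X' p"
proof -
  note E = exact_symplecticD[OF es]
  note k = smooth_fun_const[OF E(1)]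
  have "(\<lambda>p k. 1 * X p k + (-1) * X' p k) p = (\<lambda>f. 0)"
  proof (rule E(3)[OF vector_field_lincomb[OF E(1) X k k]])
    fix Y assume Y: "Y \<in> vector_fields A"
    show "symp \<theta> (\<lambda>p k. 1 * X p k + - 1 * X' p k) Y p = 0"
      unfolding symp_def ext_deriv_lincomb[OF E(1,2) X Y k k] using eq[OF Y] by (simp add: symp_def)
  qed
  then show ?thesis by (simp add: fun_eq_iff)
qed

lemma ham_vf_unique:
  fixes A :: "('p::{t2_space, second_countable_topology}, 'e::real_normed_vector) chart set"
  assumes "exact_symplectic A \<theta>" "is_ham_vf A \<theta> h X" "is_ham_vf A \<theta> h X'"
  shows "X = X'"
  by (rule ext, rule symp_nondegenerate[OF assms(1)]) (use assms(2,3) in \<open>auto simp: is_ham_vf_def\<close>)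

lemma ham_vf_lincomb:
  fixes A :: "('p::t2_space, 'e::real_normed_vector) chart set"
  assumes A: "mfd A" and \<theta>: "\<theta> \<in> one_forms A" and h: "h \<in> smooth_fun A" "h' \<in> smooth_fun A"
    and X: "is_ham_vf A \<theta> h X" "is_ham_vf A \<theta> h' X'"
  shows "is_ham_vf A \<theta> (\<lambda>p. a * h p + b * h' p) (\<lambda>p k. a * X p k + b * X' p k)"
proof -
  have XX: "X \<in> vector_fields A" "X' \<in> vector_fields A" using X by (auto simp: is_ham_vf_def)
  note k = smooth_fun_const[OF A]
  show ?thesis unfolding is_ham_vf_def
  proof (intro conjI ballI allI vector_field_lincomb[OF A XX k k])
    fix Y p assume Y: "Y \<in> vector_fields A"
    note T = tangent_spaceD[OF vector_field_tangent[OF Y]]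
    have "Y p (\<lambda>p. a * h p + b * h' p) = a * Y p h + b * Y p h'"
      using T(1)[OF smooth_fun_cmult[OF A h(1)] smooth_fun_cmult[OF A h(2)]] T(2)[OF h(1)] T(2)[OF h(2)] by simp
    moreover have "ext_deriv \<theta> X Y p = - Y p h" "ext_deriv \<theta> X' Y p = - Y p h'"
      using X Y by (simp_all add: is_ham_vf_def symp_def differential_def minus_equation_iff)
    ultimately show "symp \<theta> (\<lambda>p k. a * X p k + b * X' p k) Y p = differential (\<lambda>p. a * h p + b * h' p) p (Y p)"
      unfolding symp_def ext_deriv_lincomb[OF A \<theta> XX Y k k]
      by (simp add: differential_def)
  qed
qed

text \<open>In a chart the equation is a linear system whose matrix depends smoothly on the point
  and is invertible by nondegeneracy, so its solution is smooth. Local solutions fit together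
  because nondegeneracy makes them unique at each point.\<close>

lemma ham_vf_exists:
  fixes A :: "('p::{t2_space, second_countable_topology}, 'e::real_normed_vector) chart set"
  assumes es: "exact_symplectic A \<theta>" and h: "h \<in> smooth_fun A"
  shows "\<exists>X. is_ham_vf A \<theta> h X"
proof -
  note E = exact_symplecticD[OF es]
  have loc: "\<exists>X V. X \<in> vector_fields A \<and> open V \<and> p \<in> V \<and> (\<forall>q\<in>V. \<forall>Y\<in>vector_fields A. symp \<theta> X Y q = Y q h)" for p
  proof -
    obtain U \<phi> where c: "(U, \<phi>) \<in> A" "p \<in> U" using chart_cover[OF E(1)] by blast
    interpret C: manifold_chart A U \<phi> by unfold_locales (rule E(1), rule c(1))
    let ?D = "\<lambda>z. frechet_derivative (\<lambda>z. h (C.\<psi> z)) (at z)"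
    \<comment> \<open>Pairing with the basis vectors turns the form into an endomorphism; the sign
      reflects that \<open>symp\<close> is minus the exterior derivative.\<close>
    define B where "B z u = (\<Sum>b\<in>fbasis. (- C.om \<theta> z u b) *\<^sub>R b)" for z u
    define k where "k z = (\<Sum>b\<in>fbasis. ?D z b *\<^sub>R b)" for z
    have comp: "crd e (\<Sum>b\<in>fbasis. g b *\<^sub>R b) = g e" if "e \<in> fbasis" for g :: "'e \<Rightarrow> real" and e
    proof -
      have "crd e (\<Sum>b\<in>fbasis. g b *\<^sub>R b) = (\<Sum>b\<in>fbasis. g b * (if e = b then 1 else 0))"
        by (simp add: linear_sum[OF linear_crd[OF C.fd]] linear_cmul[OF linear_crd[OF C.fd]] crd_basis[OF C.fd])
      then show ?thesis using that fbasis(1)[OF C.fd] by (simp add: if_distrib cong: if_cong)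
    qed
    have Blin: "linear (B z)" if z: "z \<in> C.\<Omega>" for z
      unfolding B_def
      by (rule linearI) (simp_all add: linear_add[OF C.om_linear(2)[OF E(2) z]] linear_cmul[OF C.om_linear(2)[OF E(2) z]]
          sum.distrib[symmetric] algebra_simps scaleR_sum_right)
    have Binj: "inj (B z)" if z: "z \<in> C.\<Omega>" for z
      unfolding linear_injective_0[OF Blin[OF z]]
    proof (intro allI impI)
      fix u assume "B z u = 0"
      then have "crd e (B z u) = 0" for e by (simp add: linear_0[OF linear_crd[OF C.fd]])
      then have "C.om \<theta> z u b = 0" if "b \<in> fbasis" for b using comp[OF that, of "\<lambda>b. - C.om \<theta> z u b"] unfolding B_def by simp
      then have om0: "C.om \<theta> z u w = 0" for w
        by (subst linear_eq_sum_basis[OF C.fd C.om_linear(1)[OF E(2) z]]) simp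
      obtain X where X: "X \<in> vector_fields A" "X (C.\<psi> z) = C.cv z u"
        using extend_tangent_vector[OF E(1) C.cv_tangent[OF z]] by blast
      have "X (C.\<psi> z) = (\<lambda>f. 0)"
      proof (rule E(3)[OF X(1)])
        fix Y assume Y: "Y \<in> vector_fields A"
        obtain w where w: "Y (C.\<psi> z) = C.cv (\<phi> (C.\<psi> z)) w"
          using C.tangent_eq_cv[OF C.invU[OF z] vector_field_tangent[OF Y]] by blast
        have "ext_deriv \<theta> X Y (C.\<psi> z) = C.om \<theta> (\<phi> (C.\<psi> z)) u w"
          by (rule C.ext_deriv_coordinates[OF E(2) X(1) Y C.invU[OF z] _ w]) (simp add: X(2) C.inv'[OF z])
        then show "symp \<theta> X Y (C.\<psi> z) = 0" by (simp add: symp_def C.inv'[OF z] om0)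
      qed
      then have "C.cv z u = (\<lambda>f. 0 * C.cv z 0 f)" using X(2) by simp
      also have "\<dots> = C.cv z 0" using C.cv_linear(2)[OF z, of 0 0] by simp
      finally show "u = 0" by (rule C.cv_inj[OF z])
    qed
    have "\<exists>u. B z u = k z" if z: "z \<in> C.\<Omega>" for z
      using linear_injective_inverse[OF C.fd Blin[OF z] Binj[OF z]] by blast
    then obtain \<xi> where \<xi>: "\<And>z. z \<in> C.\<Omega> \<Longrightarrow> B z (\<xi> z) = k z" by metis
    have Bs: "smooth_on C.\<Omega> (\<lambda>z. B z b)" for b
    proof -
      have "smooth_on C.\<Omega> (\<lambda>z. \<Sum>b'\<in>fbasis. (0 - C.om \<theta> z b b') *\<^sub>R b')"
        by (intro smooth_on_sum smooth_on_scaleR smooth_on_diff smooth_on_const C.om_smooth[OF E(2)] C.opO)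
      then show ?thesis by (simp add: B_def)
    qed
    have ks: "smooth_on C.\<Omega> k" unfolding k_def
      by (intro smooth_on_sum smooth_on_scaleR smooth_on_const smooth_on_frechet C.smooth_on_coord[OF h] C.opO)
    have \<xi>s: "smooth_on C.\<Omega> \<xi>"
      by (rule smooth_on_linear_solution[where A = B and k = k, OF C.fd C.opO Blin Binj Bs ks \<xi>])
    obtain X V where X: "X \<in> vector_fields A" and V: "open V" "p \<in> V" "V \<subseteq> U" "\<And>q. q \<in> V \<Longrightarrow> X q = C.cv (\<phi> q) (\<xi> (\<phi> q))"
      using C.extend_field[OF c(2) \<xi>s] by blast
    have "symp \<theta> X Y q = Y q h" if q: "q \<in> V" and Y: "Y \<in> vector_fields A" for q Y
    proof -
      have qU: "q \<in> U" and z: "\<phi> q \<in> C.\<Omega>" using q V by auto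
      obtain w where w: "Y q = C.cv (\<phi> q) w" using C.tangent_eq_cv[OF qU vector_field_tangent[OF Y]] by blast
      have eb: "- C.om \<theta> (\<phi> q) (\<xi> (\<phi> q)) b = ?D (\<phi> q) b" if "b \<in> fbasis" for b
        using \<xi>[OF z] comp[OF that, of "\<lambda>b. - C.om \<theta> (\<phi> q) (\<xi> (\<phi> q)) b"] comp[OF that, of "?D (\<phi> q)"] by (simp add: B_def k_def)
      have Dlin: "linear (?D (\<phi> q))" by (rule has_derivative_linear[OF smooth_on_has_derivative[OF C.smooth_on_coord[OF h] z]])
      have "symp \<theta> X Y q = - C.om \<theta> (\<phi> q) (\<xi> (\<phi> q)) w"
        unfolding symp_def using C.ext_deriv_coordinates[OF E(2) X Y qU V(4)[OF q] w] by simp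
      also have "\<dots> = - (\<Sum>b\<in>fbasis. crd b w *\<^sub>R C.om \<theta> (\<phi> q) (\<xi> (\<phi> q)) b)"
        by (subst linear_eq_sum_basis[OF C.fd C.om_linear(1)[OF E(2) z]]) simp
      also have "\<dots> = (\<Sum>b\<in>fbasis. crd b w *\<^sub>R ?D (\<phi> q) b)"
        by (simp add: sum_negf[symmetric] eb[symmetric])
      also have "\<dots> = ?D (\<phi> q) w" by (rule linear_eq_sum_basis[OF C.fd Dlin, symmetric])
      also have "\<dots> = Y q h" by (simp add: w C.cv_apply[OF h])
      finally show ?thesis .
    qed
    then show ?thesis using X V by (intro exI[of _ X] exI[of _ V]) simp
  qed
  then obtain Z V where Z: "\<And>p. Z p \<in> vector_fields A" and V: "\<And>p. open (V p)" "\<And>p. p \<in> V p"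
    and ZV: "\<And>p q Y. q \<in> V p \<Longrightarrow> Y \<in> vector_fields A \<Longrightarrow> symp \<theta> (Z p) Y q = Y q h"
    by metis
  \<comment> \<open>The diagonal of the family of local solutions. By pointwise uniqueness it agrees
    with \<open>Z p\<close> on all of \<open>V p\<close> and is therefore smooth.\<close>
  define X where "X p = Z p p" for p
  have loc_eq: "X q = Z p q" if q: "q \<in> V p" for p q
    unfolding X_def by (rule symp_nondegenerate[OF es Z Z]) (simp add: ZV[OF q] ZV[OF V(2)])
  have XV: "X \<in> vector_fields A" unfolding vector_fields_def
  proof (intro CollectI conjI allI ballI)
    show "X p \<in> tangent_space A p" for p unfolding X_def by (rule vector_field_tangent[OF Z])
    fix f assume f: "f \<in> smooth_fun A"
    show "(\<lambda>p. X p f) \<in> smooth_fun A"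
    proof (rule smooth_fun_local[OF E(1)])
      fix p
      have "smooth_map_on (V p) A model_atlas (\<lambda>q. X q f)"
        by (rule smooth_map_on_cong[OF E(1) mfd_model[OF fin_dim_real] V(1) smooth_funD[OF vector_field_smooth[OF Z[of p] f]]])
           (simp add: loc_eq)
      then show "\<exists>W. open W \<and> p \<in> W \<and> smooth_map_on W A model_atlas (\<lambda>p. X p f)"
        by (intro exI[of _ "V p"] conjI V)
    qed
  qed
  have "symp \<theta> X Y p = Y p h" if Y: "Y \<in> vector_fields A" for Y p
  proof -
    have "symp \<theta> X Y p = symp \<theta> (Z p) Y p"
      unfolding symp_def using ext_deriv_pointwise[OF E(1,2) XV Y Z Y, of p p] by (simp add: X_def)
    then show ?thesis using ZV[OF V(2) Y] by simp
  qed
  then show ?thesis using XV by (auto simp: is_ham_vf_def differential_def)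
qed

lemma smooth_map_pushforward:
  fixes A :: "('p::t2_space, 'e::real_normed_vector) chart set"
  assumes A: "mfd A" and c: "smooth_map A A c" and v: "v \<in> tangent_space A p"
  shows "pushforward A c v \<in> tangent_space A (c p)"
proof -
  note comp = smooth_fun_compose[OF A A c]
  note T = tangent_spaceD[OF v]
  show ?thesis unfolding tangent_space_def
    using T(1)[OF comp comp] T(2)[OF comp] T(3)[OF comp comp]
    by (auto simp: pushforward_def comp_def smooth_fun_add[OF A] smooth_fun_mult[OF A] smooth_fun_cmult[OF A])
qed

lemma pushforward_apply: "f \<in> smooth_fun A \<Longrightarrow> pushforward A c v f = v (\<lambda>p. f (c p))"
  by (simp add: pushforward_def comp_def)

locale theta_symmetry =
  fixes A :: "('p::t2_space, 'e::real_normed_vector) chart set" and \<theta> c c'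
  assumes A: "mfd A" and \<theta>: "\<theta> \<in> one_forms A" and c: "smooth_map A A c" "smooth_map A A c'"
    and inv: "\<And>p. c' (c p) = p" "\<And>p. c (c' p) = p"
    and pres: "\<And>p v. v \<in> tangent_space A p \<Longrightarrow> \<theta> (c p) (pushforward A c v) = \<theta> p v"
begin

definition push :: "('p \<Rightarrow> 'p tvec) \<Rightarrow> 'p \<Rightarrow> 'p tvec" where "push X p = pushforward A c (X (c' p))"

lemma push_field: "X \<in> vector_fields A \<Longrightarrow> push X \<in> vector_fields A"
proof -
  assume X: "X \<in> vector_fields A"
  show ?thesis unfolding vector_fields_def
  proof (intro CollectI conjI allI ballI)
    show "push X p \<in> tangent_space A p" for p
      using smooth_map_pushforward[OF A c(1) vector_field_tangent[OF X, of "c' p"]] by (simp add: push_def inv)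
    fix f assume f: "f \<in> smooth_fun A"
    have "(\<lambda>p. X p (\<lambda>q. f (c q))) \<in> smooth_fun A" by (rule vector_field_smooth[OF X smooth_fun_compose[OF A A c(1) f]])
    from smooth_fun_compose[OF A A c(2) this]
    show "(\<lambda>p. push X p f) \<in> smooth_fun A" by (simp add: push_def pushforward_apply[OF f])
  qed
qed

lemma push_apply: "f \<in> smooth_fun A \<Longrightarrow> push X p f = X (c' p) (\<lambda>q. f (c q))"
  by (simp add: push_def pushforward_apply)

text \<open>Each of the three terms is transported separately: push-forward is compatible with
  applying fields to functions and with the bracket, and it preserves the values of
  \<theta>.\<close>

lemma ext_deriv_push:
  assumes X: "X \<in> vector_fields A" and Y: "Y \<in> vector_fields A"
  shows "ext_deriv \<theta> (push X) (push Y) (c p) = ext_deriv \<theta> X Y p"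
proof -
  have th: "\<theta> (c q) (push Z (c q)) = \<theta> q (Z q)" if "Z \<in> vector_fields A" for Z q
    using pres[OF vector_field_tangent[OF that]] by (simp add: push_def inv)
  have 1: "push Z (c p) (\<lambda>q. \<theta> q (push W q)) = Z p (\<lambda>q. \<theta> q (W q))" if "Z \<in> vector_fields A" "W \<in> vector_fields A" for Z W
  proof -
    have "(\<lambda>q. \<theta> q (push W q)) \<in> smooth_fun A" using \<theta> push_field[OF that(2)] by (simp add: one_forms_def)
    from push_apply[OF this] show ?thesis by (simp add: inv th[OF that(2)])
  qed
  have 2: "push Z (c p) (\<lambda>q. push W q f) = Z p (\<lambda>q. W q (\<lambda>q. f (c q)))"
    if "Z \<in> vector_fields A" "W \<in> vector_fields A" "f \<in> smooth_fun A" for Z W f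
    using push_apply[OF vector_field_smooth[OF push_field[OF that(2)] that(3)]]
    by (simp add: inv push_apply[OF that(3)])
  have zero: "Z p (\<lambda>q. 0) = 0" if "Z \<in> vector_fields A" for Z p
    using tangent_spaceD(2)[OF vector_field_tangent[OF that, of p] smooth_fun_const[OF A, of 0], of 0] by simp
  have 3: "lie_bracket (push X) (push Y) (c p) = pushforward A c (lie_bracket X Y p)"
  proof
    fix f
    show "lie_bracket (push X) (push Y) (c p) f = pushforward A c (lie_bracket X Y p) f"
    proof (cases "f \<in> smooth_fun A")
      case True
      then show ?thesis using 2[OF X Y] 2[OF Y X] by (simp add: lie_bracket_def pushforward_apply)
    next
      case False
      then have "push Z q f = 0" for Z q by (simp add: push_def pushforward_def)
      then show ?thesis using False zero[OF push_field[OF X]] zero[OF push_field[OF Y]] by (simp add: lie_bracket_def pushforward_def)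
    qed
  qed
  \<comment> \<open>The invariance \<open>pres\<close> speaks of tangent vectors, so the bracket
    must first be recognised as one.\<close>
  have "lie_bracket X Y p \<in> tangent_space A p"
  proof -
    obtain U \<phi> where u: "(U, \<phi>) \<in> A" "p \<in> U" using chart_cover[OF A] by blast
    interpret C: manifold_chart A U \<phi> by unfold_locales (rule A, rule u(1))
    obtain \<xi> where \<xi>: "smooth_on C.\<Omega> \<xi>" "\<And>q. q \<in> U \<Longrightarrow> X q = C.cv (\<phi> q) (\<xi> (\<phi> q))" using C.field_coordinates[OF X] by blast
    obtain \<zeta> where \<zeta>: "smooth_on C.\<Omega> \<zeta>" "\<And>q. q \<in> U \<Longrightarrow> Y q = C.cv (\<phi> q) (\<zeta> (\<phi> q))" using C.field_coordinates[OF Y] by blast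
    have "C.cv (\<phi> p) w \<in> tangent_space A p" for w using C.cv_tangent[of "\<phi> p" w] u(2) C.inv[OF u(2)] by simp
    moreover have "lie_bracket X Y p = C.cv (\<phi> p) (frechet_derivative \<zeta> (at (\<phi> p)) (\<xi> (\<phi> p)) - frechet_derivative \<xi> (at (\<phi> p)) (\<zeta> (\<phi> p)))"
      by (rule C.lie_bracket_coordinates[OF \<xi> \<zeta> X Y u(2)])
    ultimately show ?thesis by (simp only:)
  qed
  from pres[OF this] show ?thesis
    unfolding ext_deriv_def 1[OF X Y] 1[OF Y X] 3 by simp
qed

lemma symp_push:
  assumes "X \<in> vector_fields A" "Y \<in> vector_fields A"
  shows "symp \<theta> (push X) (push Y) (c p) = symp \<theta> X Y p"
  by (simp add: symp_def ext_deriv_push[OF assms])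

end

section \<open>Smooth families of maps\<close>

lemma linear_real_eq_times: "linear (f :: real \<Rightarrow> real) \<Longrightarrow> f = (*) (f 1)"
proof
  fix u assume "linear f"
  from linear_cmul[OF this, of u 1] show "f u = f 1 * u" by simp
qed

lemma linear_Pair_scale:
  fixes f :: "real \<times> 'a::real_normed_vector \<Rightarrow> 'b::real_normed_vector"
  assumes "linear f" shows "(\<lambda>u. f (u, 0)) = (\<lambda>u. u *\<^sub>R f (1, 0))"
proof
  fix u
  from linear_cmul[OF assms, of u "(1, 0)"] show "f (u, 0) = u *\<^sub>R f (1, 0)" by simp
qed

lemma smooth_familyI: "smooth_map (prod_atlas model_atlas A) B (\<lambda>z. c (fst z) (snd z)) \<Longrightarrow> smooth_family A B c"
  and smooth_familyD: "smooth_family A B c \<Longrightarrow> smooth_map (prod_atlas model_atlas A) B (\<lambda>z. c (fst z) (snd z))"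
  by (simp_all add: smooth_family_def split_def)

lemma mfd_real: "mfd (model_atlas :: (real, real) chart set)"
  by (rule mfd_model[OF fin_dim_real])

lemma smooth_family_compose:
  fixes \<tau> :: "_ \<Rightarrow> real"
  assumes A: "mfd A" and B: "mfd B" and D: "mfd D" and S: "open S"
    and c: "smooth_family A B c" and \<tau>: "smooth_map_on S D model_atlas \<tau>" and m: "smooth_map_on S D A m"
  shows "smooth_map_on S D B (\<lambda>x. c (\<tau> x) (m x))"
  using smooth_map_on_compose[OF D mfd_prod[OF mfd_real A] B S open_UNIV smooth_map_on_Pair[OF mfd_real A D S \<tau> m] smooth_familyD[OF c] UNIV_I]
  by simp

lemma smooth_family_slice:
  assumes "mfd A" "mfd B" "smooth_family A B c" shows "smooth_map A B (c t)"
  using smooth_family_compose[OF assms(1,2,1) open_UNIV assms(3) smooth_map_on_const[OF assms(1) open_UNIV] smooth_map_on_id[OF assms(1)]] .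

lemma smooth_map_compose:
  assumes "mfd A" "mfd B" "mfd C" "smooth_map A B f" "smooth_map B C g" shows "smooth_map A C (\<lambda>p. g (f p))"
  by (rule smooth_map_on_compose[OF assms(1-3) open_UNIV open_UNIV assms(4,5)]) simp

lemma smooth_family_comp2:
  fixes \<sigma> \<tau> :: "real \<Rightarrow> real"
  assumes A: "mfd A" and B: "mfd B" and C: "mfd C" and c: "smooth_family B C c" and d: "smooth_family A B d"
    and \<sigma>: "smooth_on UNIV \<sigma>" and \<tau>: "smooth_on UNIV \<tau>"
  shows "smooth_family A C (\<lambda>t p. c (\<sigma> t) (d (\<tau> t) p))"
proof (rule smooth_familyI)
  note Q = mfd_prod[OF mfd_real A]
  have t: "smooth_map (prod_atlas model_atlas A) model_atlas (\<lambda>z. \<rho> (fst z))" if "smooth_on UNIV \<rho>" for \<rho> :: "real \<Rightarrow> real"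
    by (rule smooth_map_on_model_compose[OF Q fin_dim_real fin_dim_real open_UNIV open_UNIV smooth_map_on_fst[OF mfd_real A open_UNIV] that UNIV_I])
  show "smooth_map (prod_atlas model_atlas A) C (\<lambda>z. c (\<sigma> (fst z)) (d (\<tau> (fst z)) (snd z)))"
    by (rule smooth_family_compose[OF B C Q open_UNIV c t[OF \<sigma>]
          smooth_family_compose[OF A B Q open_UNIV d t[OF \<tau>] smooth_map_on_snd[OF mfd_real A open_UNIV]]])
qed

lemma smooth_family_const: "mfd A \<Longrightarrow> mfd B \<Longrightarrow> smooth_map A B m \<Longrightarrow> smooth_family A B (\<lambda>t. m)"
  by (rule smooth_familyI, rule smooth_map_on_compose[OF mfd_prod[OF mfd_real] _ _ open_UNIV open_UNIV smooth_map_on_snd[OF mfd_real _ open_UNIV]]) auto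

lemma pushforward_compose:
  assumes "mfd A" "smooth_map A A c" "smooth_map A A d"
  shows "pushforward A c (pushforward A d v) = pushforward A (\<lambda>p. c (d p)) v"
proof
  fix f
  show "pushforward A c (pushforward A d v) f = pushforward A (\<lambda>p. c (d p)) v f"
    using smooth_fun_compose[OF assms(1,1,2), of f] by (simp add: pushforward_def comp_def)
qed

definition velocity :: "('p::topological_space, 'e::real_normed_vector) chart set \<Rightarrow> (real \<Rightarrow> 'p \<Rightarrow> 'p) \<Rightarrow> real \<Rightarrow> 'p \<Rightarrow> 'p tvec" where
  "velocity A c t p = tv A (\<lambda>s. c s p) t 1"

context
  fixes A :: "('p::t2_space, 'e::real_normed_vector) chart set" and c :: "real \<Rightarrow> 'p \<Rightarrow> 'p"
  assumes A: "mfd A" and c: "smooth_family A A c"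
begin

lemma curve_smooth: "smooth_map model_atlas A (\<lambda>s. c s p)"
  using smooth_family_compose[OF A A mfd_real open_UNIV c smooth_map_on_id[OF mfd_real] smooth_map_on_const[OF mfd_real open_UNIV]] .

lemma velocity_derivative:
  assumes f: "f \<in> smooth_fun A"
  shows "((\<lambda>s. f (c s p)) has_real_derivative velocity A c t p f) (at t)"
proof -
  have d: "((\<lambda>s. f (c s p)) has_derivative (\<lambda>w. tv A (\<lambda>s. c s p) t w f)) (at t)"
    by (rule fun_comp_has_derivative[OF A fin_dim_real open_UNIV curve_smooth UNIV_I f])
  have "(\<lambda>w. tv A (\<lambda>s. c s p) t w f) = (*) (velocity A c t p f)"
    using linear_real_eq_times[OF has_derivative_linear[OF d]] by (simp only: velocity_def)
  with d show ?thesis by (simp add: has_field_derivative_def)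
qed

lemma velocity_tangent: "velocity A c t p \<in> tangent_space A (c t p)"
  unfolding velocity_def by (rule tv_tangent[OF A fin_dim_real open_UNIV curve_smooth UNIV_I])

text \<open>A tangent vector is determined by its values on smooth functions, since all of them
  vanish elsewhere by convention.\<close>

lemma velocity_eqI:
  assumes v: "v \<in> tangent_space A (c t p)" and d: "\<And>f. f \<in> smooth_fun A \<Longrightarrow> ((\<lambda>s. f (c s p)) has_real_derivative v f) (at t)"
  shows "v = velocity A c t p"
proof
  fix f
  show "v f = velocity A c t p f"
  proof (cases "f \<in> smooth_fun A")
    case True
    from DERIV_unique[OF d[OF True] velocity_derivative[OF True]] show ?thesis .
  next
    case False then show ?thesis using tangent_spaceD(4)[OF v False] tangent_spaceD(4)[OF velocity_tangent False] by simp
  qed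
qed

end

section \<open>A family of maps in a chart of its source\<close>

context manifold_chart
begin

context
  fixes c :: "real \<Rightarrow> 'p \<Rightarrow> 'p"
  assumes c: "smooth_family A A c"
begin

abbreviation "y z \<equiv> c (fst z) (\<psi> (snd z))"
abbreviation "S \<equiv> (UNIV :: real set) \<times> \<Omega>"

lemma fd2: "fin_dim TYPE(real \<times> 'e)" by (rule fin_dim_prod[OF fin_dim_real fd])

lemma opS: "open S" by (rule open_Times[OF open_UNIV opO])

lemma sm_time: "smooth_map_on S model_atlas (model_atlas :: (real, real) chart set) fst"
  and sm_space: "smooth_map_on S model_atlas A (\<lambda>z. \<psi> (snd z))"
proof -
  show "smooth_map_on S model_atlas (model_atlas :: (real, real) chart set) fst"
    by (simp add: smooth_map_on_model_iff opS smooth_on_fst)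
  have "smooth_map_on S model_atlas (model_atlas :: ('e, 'e) chart set) snd"
    by (simp add: smooth_map_on_model_iff opS smooth_on_snd)
  from smooth_map_on_compose[OF mfd_model[OF fd2] mfd_model[OF fd] A opS opO this sm_inv]
  show "smooth_map_on S model_atlas A (\<lambda>z. \<psi> (snd z))" by auto
qed

lemma sm_y: "smooth_map_on S model_atlas A y"
  by (rule smooth_family_compose[OF A A mfd_model[OF fd2] opS c sm_time sm_space])

lemma tv_y_space: "z \<in> \<Omega> \<Longrightarrow> tv A y (t, z) (0, w) = pushforward A (c t) (cv z w)"
proof -
  assume z: "z \<in> \<Omega>"
  have "((\<lambda>x::'e. (t, x)) has_derivative (\<lambda>h. (0, h))) (at z)"
    by (intro has_derivative_Pair has_derivative_const has_derivative_ident)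
  from tv_chain[OF A fd2 opS sm_y _ this, of w] z
  have "tv A (\<lambda>x. c t (\<psi> x)) z w = tv A y (t, z) (0, w)" by simp
  then show ?thesis unfolding cv_def pushforward_tv[OF A smooth_family_slice[OF A A c]] by simp
qed

lemma tv_y_time: "z \<in> \<Omega> \<Longrightarrow> tv A y (t, z) (1, 0) = velocity A c t (\<psi> z)"
proof -
  assume z: "z \<in> \<Omega>"
  have "((\<lambda>s::real. (s, z)) has_derivative (\<lambda>h. (h, 0))) (at t)"
    by (intro has_derivative_Pair has_derivative_const has_derivative_ident)
  from tv_chain[OF A fd2 opS sm_y _ this, of 1] z
  show ?thesis by (simp add: velocity_def)
qed

lemma velocity_form_smooth:
  assumes \<theta>: "\<theta> \<in> one_forms A"
  shows "smooth_on S (\<lambda>z. \<theta> (y z) (velocity A c (fst z) (\<psi> (snd z))))"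
  by (rule smooth_on_cong[OF opS _ one_form_tv_smooth[OF A \<theta> fd2 opS sm_y, of "(1, 0)"]])
     (use tv_y_time in auto)

lemma pushforward_form_smooth:
  assumes \<theta>: "\<theta> \<in> one_forms A"
  shows "smooth_on S (\<lambda>z. \<theta> (y z) (pushforward A (c (fst z)) (cv (snd z) w)))"
  by (rule smooth_on_cong[OF opS _ one_form_tv_smooth[OF A \<theta> fd2 opS sm_y, of "(0, w)"]])
     (use tv_y_space in auto)

text \<open>Cartan's formula for the derivative of \<open>c\<^sub>t\<^sup>*\<theta>\<close> when the velocity is Hamiltonian.\<close>

lemma cartan_formula:
  assumes \<theta>: "\<theta> \<in> one_forms A" and X: "is_ham_vf A \<theta> h X" and vel: "X (c t (\<psi> z)) = velocity A c t (\<psi> z)" and z: "z \<in> \<Omega>"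
  shows "frechet_derivative (\<lambda>z. \<theta> (y z) (pushforward A (c (fst z)) (cv (snd z) w))) (at (t, z)) (1, 0)
    = frechet_derivative (\<lambda>z. \<theta> (y z) (velocity A c (fst z) (\<psi> (snd z)))) (at (t, z)) (0, w) - pushforward A (c t) (cv z w) h"
proof -
  have tz: "(t, z) \<in> S" using z by simp
  have XV: "X \<in> vector_fields A" using X by (simp add: is_ham_vf_def)
  obtain Y where Y: "Y \<in> vector_fields A" "Y (c t (\<psi> z)) = pushforward A (c t) (cv z w)"
    using extend_tangent_vector[OF A smooth_map_pushforward[OF A smooth_family_slice[OF A A c] cv_tangent[OF z]]] by blast
  have Xy: "X (y (t, z)) = tv A y (t, z) (1, 0)" using vel by (simp add: tv_y_time[OF z])
  have Yy: "Y (y (t, z)) = tv A y (t, z) (0, w)" using Y(2) by (simp add: tv_y_space[OF z])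
  have 1: "frechet_derivative (\<lambda>x. \<theta> (y x) (tv A y x (0, w))) (at (t, z)) = frechet_derivative (\<lambda>z. \<theta> (y z) (pushforward A (c (fst z)) (cv (snd z) w))) (at (t, z))"
    by (rule frechet_derivative_cong_open[OF opS tz]) (use tv_y_space in auto)
  have 2: "frechet_derivative (\<lambda>x. \<theta> (y x) (tv A y x (1, 0))) (at (t, z)) = frechet_derivative (\<lambda>z. \<theta> (y z) (velocity A c (fst z) (\<psi> (snd z)))) (at (t, z))"
    by (rule frechet_derivative_cong_open[OF opS tz]) (use tv_y_time in auto)
  \<comment> \<open>The time and space directions serve as the two constant fields of
    \<open>ext_deriv_pullback\<close>; the Hamiltonian equation evaluates the exterior derivative on
    them.\<close>
  have "ext_deriv \<theta> X Y (y (t, z)) = - pushforward A (c t) (cv z w) h"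
  proof -
    have "- ext_deriv \<theta> X Y (y (t, z)) = Y (y (t, z)) h"
      using X Y(1) by (simp add: is_ham_vf_def symp_def differential_def)
    then show ?thesis using Y(2) by simp
  qed
  with ext_deriv_pullback[OF A \<theta> fd2 opS sm_y tz XV Y(1) Xy Yy]
  show ?thesis unfolding 1 2 by simp
qed

end

lemma fun_of_coord_smooth:
  fixes F :: "'p \<Rightarrow> real"
  assumes "smooth_on \<Omega> (\<lambda>z. F (\<psi> z))" shows "smooth_map_on U A model_atlas F"
  using smooth_map_on_cong[OF A mfd_real opU smooth_map_on_coord[OF assms]] by (simp add: inv)

end

section \<open>Primitives of \<open>\<phi>\<^sup>*\<theta> - \<theta>\<close>\<close>

text \<open>The contraction of \<open>X t\<close> with the exterior derivative of \<theta> is minus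
  the differential of \<open>h t\<close>. By Cartan's formula the time derivative of the pulled-back
  form is thus the differential of \<open>k t\<close>, which is integrated over the isotopy.\<close>

lemma isotopy_primitive:
  fixes A :: "('p::{t2_space, second_countable_topology}, 'e::real_normed_vector) chart set"
  assumes es: "exact_symplectic A \<theta>" and \<phi>: "\<phi> \<in> Diff_ham A \<theta>"
  shows "\<exists>F. primitive A \<theta> \<phi> F"
proof -
  note E = exact_symplecticD[OF es]
  note A = E(1) and \<theta> = E(2)
  obtain c h X where c: "smooth_family A A c" and c01: "c 0 = id" "c 1 = \<phi>" and h: "smooth_family A (model_atlas :: (real, real) chart set) h"
    and X: "\<And>t. is_ham_vf A \<theta> (h t) (X t)"
    and d: "\<And>t p f. f \<in> smooth_fun A \<Longrightarrow> ((\<lambda>s. f (c s p)) has_real_derivative X t (c t p) f) (at t)"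
    using \<phi> unfolding Diff_ham_def by blast
  have XV: "X t \<in> vector_fields A" for t using X[of t] by (simp add: is_ham_vf_def)
  have ht: "h t \<in> smooth_fun A" for t using smooth_family_slice[OF A mfd_real h] by (rule smooth_funI)
  have vel: "X t (c t p) = velocity A c t p" for t p
    by (rule velocity_eqI[OF A c vector_field_tangent[OF XV] d])
  define k where "k t p = \<theta> (c t p) (velocity A c t p) - h t (c t p)" for t p
  define F where "F p = integral {0..1} (\<lambda>t. k t p)" for p
  \<comment> \<open>The formula for \<open>v F\<close> presupposes that \<open>F\<close> is globally
    smooth. Smoothness is shown chart by chart and is complete only after all charts, so here it
    appears as a premise.\<close>
  have main: "smooth_map_on U A model_atlas F \<and>
    (\<forall>p\<in>U. \<forall>v\<in>tangent_space A p. F \<in> smooth_fun A \<longrightarrow> v F = \<theta> (\<phi> p) (pushforward A \<phi> v) - \<theta> p v)"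
    if u: "(U, \<chi>') \<in> A" for U \<chi>'
  proof -
    interpret C: manifold_chart A U \<chi>' by unfold_locales (rule A, rule u)
    let ?y = "\<lambda>z. c (fst z) (C.\<psi> (snd z))"
    let ?S = "(UNIV :: real set) \<times> C.\<Omega>"
    let ?T = "\<lambda>z. \<theta> (?y z) (velocity A c (fst z) (C.\<psi> (snd z)))"
    let ?H = "\<lambda>z. h (fst z) (?y z)"
    note opS = C.opS[OF c] and fd2 = C.fd2[OF c]
    have Ts: "smooth_on ?S ?T" by (rule C.velocity_form_smooth[OF c \<theta>])
    have "smooth_map_on ?S model_atlas model_atlas ?H"
      by (rule smooth_family_compose[OF A mfd_real mfd_model[OF fd2] opS h C.sm_time[OF c] C.sm_y[OF c]])
    then have Hs: "smooth_on ?S ?H" by (simp add: smooth_map_on_model_iff opS)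
    define K where "K = (\<lambda>z. ?T z - ?H z)"
    have Ks: "smooth_on ?S K" unfolding K_def by (rule smooth_on_diff[OF opS Ts Hs])
    have K: "K (t, z) = k t (C.\<psi> z)" for t z by (simp add: K_def k_def)
    have sub: "{0..1} \<times> C.\<Omega> \<subseteq> ?S" by auto
    have Fz: "(\<lambda>z. F (C.\<psi> z)) = (\<lambda>z. integral {0..1} (\<lambda>t. K (t, z)))" by (simp add: F_def K)
    have Fs: "smooth_on C.\<Omega> (\<lambda>z. F (C.\<psi> z))"
      unfolding Fz by (rule smooth_on_integral_param[OF C.fd opS sub C.opO Ks])
    have "v F = \<theta> (\<phi> p) (pushforward A \<phi> v) - \<theta> p v"
      if p: "p \<in> U" and v: "v \<in> tangent_space A p" and FA: "F \<in> smooth_fun A" for p v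
    proof -
      define z where "z = \<chi>' p"
      have z: "z \<in> C.\<Omega>" and pz: "C.\<psi> z = p" using p by (simp_all add: z_def C.inv)
      obtain w where w: "v = C.cv z w" using C.tangent_eq_cv[OF p v] by (auto simp: z_def)
      let ?m = "\<lambda>z. \<theta> (?y z) (pushforward A (c (fst z)) (C.cv (snd z) w))"
      have ms: "smooth_on ?S ?m" by (rule C.pushforward_form_smooth[OF c \<theta>])
      have DK: "frechet_derivative K (at (t, z)) (0, w) = frechet_derivative ?m (at (t, z)) (1, 0)" for t
      proof -
        have tz: "(t, z) \<in> ?S" using z by simp
        have "frechet_derivative K (at (t, z)) = (\<lambda>u. frechet_derivative ?T (at (t, z)) u - frechet_derivative ?H (at (t, z)) u)"
          unfolding K_def
          by (rule frechet_derivative_eq[OF has_derivative_diff[OF smooth_on_has_derivative[OF Ts tz] smooth_on_has_derivative[OF Hs tz]]])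
        moreover have "frechet_derivative ?H (at (t, z)) (0, w) = pushforward A (c t) (C.cv z w) (h t)"
        proof -
          have e: "((\<lambda>x::'e. (t, x)) has_derivative (\<lambda>h. (0, h))) (at z)"
            by (intro has_derivative_Pair has_derivative_const has_derivative_ident)
          from has_derivative_compose[OF this smooth_on_has_derivative[OF Hs tz]]
          have "((\<lambda>x. h t (c t (C.\<psi> x))) has_derivative (\<lambda>u. frechet_derivative ?H (at (t, z)) (0, u))) (at z)" by simp
          moreover have "(\<lambda>p. h t (c t p)) \<in> smooth_fun A"
            by (rule smooth_fun_compose[OF A A smooth_family_slice[OF A A c] ht])
          from C.cv_apply[OF this] have "C.cv z w (\<lambda>p. h t (c t p)) = frechet_derivative (\<lambda>x. h t (c t (C.\<psi> x))) (at z) w" .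
          moreover note D = calculation
          show ?thesis unfolding pushforward_apply[OF ht] D(2) frechet_derivative_eq[OF D(1)] ..
        qed
        ultimately show ?thesis using C.cartan_formula[OF c \<theta> X[of t] vel z, of w] by simp
      qed
      have "((\<lambda>z. F (C.\<psi> z)) has_derivative (\<lambda>u. integral {0..1} (\<lambda>t. frechet_derivative K (at (t, z)) (0, u)))) (at z)"
        unfolding Fz by (rule has_derivative_integral_param[OF C.fd opS sub smooth_onD[OF Ks] z])
      from frechet_derivative_eq[OF this]
      have "v F = integral {0..1} (\<lambda>t. frechet_derivative ?m (at (t, z)) (1, 0))"
        by (simp only: w C.cv_apply[OF FA] DK)
      \<comment> \<open>By Cartan's formula the integrand is a time derivative.\<close>
      also have "\<dots> = ?m (1, z) - ?m (0, z)"
      proof (rule integral_unique, rule fundamental_theorem_of_calculus)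
        fix t :: real assume "t \<in> {0..1}"
        have e: "((\<lambda>s::real. (s, z)) has_derivative (\<lambda>h. (h, 0))) (at t within {0..1})"
          by (intro has_derivative_Pair has_derivative_const has_derivative_ident)
        have "(t, z) \<in> ?S" using z by simp
        note D = smooth_on_has_derivative[OF ms this]
        have "(\<lambda>u. frechet_derivative ?m (at (t, z)) (u, 0)) = (\<lambda>u. u *\<^sub>R frechet_derivative ?m (at (t, z)) (1, 0))"
          by (rule linear_Pair_scale[OF has_derivative_linear[OF D]])
        with has_derivative_compose[OF e D]
        show "((\<lambda>t. ?m (t, z)) has_vector_derivative frechet_derivative ?m (at (t, z)) (1, 0)) (at t within {0..1})"
          unfolding has_vector_derivative_def by simp
      qed simp
      also have "?m (1, z) = \<theta> (\<phi> p) (pushforward A \<phi> v)" by (simp add: c01 pz w)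
      also have "?m (0, z) = \<theta> p v"
      proof -
        have "pushforward A id v = v" using tangent_spaceD(4)[OF v] by (auto simp: pushforward_def fun_eq_iff)
        then show ?thesis by (simp add: c01 pz w)
      qed
      finally show ?thesis .
    qed
    then show ?thesis using C.fun_of_coord_smooth[OF Fs] by blast
  qed
  have FA: "F \<in> smooth_fun A"
  proof (rule smooth_fun_local[OF A])
    fix p
    obtain U \<chi>' where u: "(U, \<chi>') \<in> A" "p \<in> U" using chart_cover[OF A] by blast
    then show "\<exists>W. open W \<and> p \<in> W \<and> smooth_map_on W A model_atlas F"
      using main[OF u(1)] chart_open[OF A u(1)] by blast
  qed
  have "differential F p v = pullback A \<phi> \<theta> p v - \<theta> p v" if v: "v \<in> tangent_space A p" for p v
  proof -
    obtain U \<chi>' where u: "(U, \<chi>') \<in> A" "p \<in> U" using chart_cover[OF A] by blast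
    then show ?thesis using main[OF u(1)] FA v by (auto simp: differential_def pullback_def)
  qed
  then show ?thesis using FA by (auto simp: primitive_def)
qed

text \<open>For a curve of symplectic maps through the identity with Hamiltonian velocity, differences of primitives are
  differentiable at time 0: the statement is local, and along a segment the derivative is taken under the integral.\<close>

lemma primitive_curve_derivative:
  fixes A :: "('p::{t2_space, second_countable_topology}, 'e::real_normed_vector) chart set"
  assumes es: "exact_symplectic A \<theta>" and conn: "connected (UNIV :: 'p set)"
    and c: "smooth_family A A c" "c 0 = id" and F: "\<And>t. primitive A \<theta> (c t) (F t)"
    and X: "is_ham_vf A \<theta> h X" and h: "h \<in> smooth_fun A" and vel: "\<And>p. X p = velocity A c 0 p"
  shows "((\<lambda>t. F t b - F t a) has_real_derivative ((\<theta> b (X b) - h b) - (\<theta> a (X a) - h a))) (at 0)"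
proof -
  note E = exact_symplecticD[OF es]
  note A = E(1) and \<theta> = E(2)
  have XV: "X \<in> vector_fields A" using X by (simp add: is_ham_vf_def)
  define k where "k p = \<theta> p (X p) - h p" for p
  have kA: "k \<in> smooth_fun A" unfolding k_def
    by (rule smooth_fun_diff[OF A _ h]) (use \<theta> XV in \<open>simp add: one_forms_def\<close>)
  \<comment> \<open>The asserted derivative for one pair of points. It is an equivalence relation,
    so by connectedness it suffices to relate a point to its neighbours in a chart.\<close>
  define R where "R a b \<longleftrightarrow> ((\<lambda>t. F t b - F t a) has_real_derivative (k b - k a)) (at 0)" for a b
  have "R a b"
  proof (rule connected_equivalence_relation[OF conn UNIV_I UNIV_I])
    fix x y assume "R x y"
    from DERIV_minus[OF this[unfolded R_def]] show "R y x" by (simp add: R_def)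
  next
    fix x y z assume "R x y" "R y z"
    from DERIV_add[OF this[unfolded R_def]] show "R x z" by (simp add: R_def)
  next
    fix a
    obtain U \<chi>' where u: "(U, \<chi>') \<in> A" "a \<in> U" using chart_cover[OF A] by blast
    interpret C: manifold_chart A U \<chi>' by unfold_locales (rule A, rule u(1))
    define z0 where "z0 = \<chi>' a"
    obtain r where r: "r > 0" "ball z0 r \<subseteq> C.\<Omega>" using C.opO u(2) openE unfolding z0_def by blast
    define W where "W = U \<inter> \<chi>' -` ball z0 r"
    have W: "open W" "a \<in> W" unfolding W_def using continuous_open_preimage[OF C.cont C.opU open_ball] u r(1) by (auto simp: z0_def)
    have "R a b" if b: "b \<in> W" for b
    proof -
      define w where "w = \<chi>' b - z0"
      have wr: "norm w < r" and bU: "b \<in> U" using b by (auto simp: W_def w_def dist_norm norm_minus_commute)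
      let ?z = "\<lambda>s. z0 + s *\<^sub>R w"
      have zin: "?z s \<in> C.\<Omega>" if "s \<in> {0..1}" for s
      proof -
        have "norm (s *\<^sub>R w) \<le> 1 * norm w" unfolding norm_scaleR using that by (intro mult_right_mono) auto
        then show ?thesis using wr r(2) by (auto simp: dist_norm subset_iff)
      qed
      have z01: "C.\<psi> (?z 1) = b" "C.\<psi> (?z 0) = a" using C.inv[OF bU] C.inv[OF u(2)] by (simp_all add: w_def z0_def)
      let ?m = "\<lambda>z. \<theta> (c (fst z) (C.\<psi> (snd z))) (pushforward A (c (fst z)) (C.cv (snd z) w))"
      let ?S = "(UNIV :: real set) \<times> C.\<Omega>"
      have ms: "smooth_on ?S ?m" by (rule C.pushforward_form_smooth[OF c(1) \<theta>])
      have seg: "f b - f a = integral {0..1} (\<lambda>s. C.cv (?z s) w f)" if f: "f \<in> smooth_fun A" for f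
      proof -
        have "((\<lambda>s. C.cv (?z s) w f) has_integral (f (C.\<psi> (?z 1)) - f (C.\<psi> (?z 0)))) {0..1}"
        proof (rule fundamental_theorem_of_calculus)
          fix s :: real assume s: "s \<in> {0..1}"
          have D: "((\<lambda>z. f (C.\<psi> z)) has_derivative (\<lambda>w. C.cv (?z s) w f)) (at (?z s))"
            using smooth_on_has_derivative[OF C.smooth_on_coord[OF f] zin[OF s]] by (simp add: C.cv_apply[OF f])
          have "((\<lambda>s. ?z s) has_derivative (\<lambda>h. h *\<^sub>R w)) (at s within {0..1})" by (auto intro!: derivative_eq_intros)
          from has_derivative_compose[OF this D]
          show "((\<lambda>s. f (C.\<psi> (?z s))) has_vector_derivative C.cv (?z s) w f) (at s within {0..1})"
            unfolding has_vector_derivative_def by (simp add: C.cv_linear(2)[OF zin[OF s]])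
        qed simp
        then show ?thesis unfolding z01 by (simp add: integral_unique)
      qed
      \<comment> \<open>Each \<open>F t\<close> is an arbitrary primitive. Expressed through its
        differential along a segment, the difference becomes an integral that depends smoothly on
        \<open>t\<close>.\<close>
      have Fdiff: "F t b - F t a = integral {0..1} (\<lambda>s. ?m (t, ?z s) - ?m (0, ?z s))" for t
      proof -
        have FA: "F t \<in> smooth_fun A" using F[of t] by (simp add: primitive_def)
        have "C.cv (?z s) w (F t) = ?m (t, ?z s) - ?m (0, ?z s)" if s: "s \<in> {0..1}" for s
        proof -
          note v = C.cv_tangent[OF zin[OF s], of w]
          have "pushforward A id (C.cv (?z s) w) = C.cv (?z s) w" using tangent_spaceD(4)[OF v] by (auto simp: pushforward_def fun_eq_iff)
          then show ?thesis using F[of t] v by (simp add: primitive_def differential_def pullback_def c(2))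
        qed
        then show ?thesis unfolding seg[OF FA] by (intro integral_cong) auto
      qed
      define V where "V = {z :: real \<times> real. ?z (fst z) \<in> C.\<Omega>}"
      have V: "open V"
      proof -
        have "V = (\<lambda>z. ?z (fst z)) -` C.\<Omega>" by (auto simp: V_def)
        moreover have "open ((\<lambda>z::real \<times> real. ?z (fst z)) -` C.\<Omega>)"
          by (rule open_vimage[OF C.opO]) (intro continuous_intros)
        ultimately show ?thesis by simp
      qed
      have sub: "{0..1} \<times> UNIV \<subseteq> V" using zin by (auto simp: V_def)
      define g where "g z = ?m (snd z, ?z (fst z)) - ?m (0, ?z (fst z))" for z :: "real \<times> real"
      have aff: "smooth_on V (\<lambda>z::real \<times> real. ?z (fst z))"
        by (intro smooth_on_add smooth_on_scaleR smooth_on_const smooth_on_fst V)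
      have gs: "smooth_on V g" unfolding g_def
      proof (rule smooth_on_diff[OF V])
        show "smooth_on V (\<lambda>z. ?m (snd z, ?z (fst z)))"
          by (rule smooth_on_compose[OF C.fd2[OF c(1)] V C.opS[OF c(1)] smooth_on_Pair[OF V smooth_on_snd[OF V] aff] ms]) (simp add: V_def)
        show "smooth_on V (\<lambda>z. ?m (0, ?z (fst z)))"
          by (rule smooth_on_compose[OF C.fd2[OF c(1)] V C.opS[OF c(1)] smooth_on_Pair[OF V smooth_on_const aff] ms]) (simp add: V_def)
      qed
      \<comment> \<open>Cartan's formula is applied at time 0, where the velocity is
        \<open>X\<close>; the later velocities of the curve do not enter.\<close>
      have Dg: "frechet_derivative g (at (s, 0)) (0, 1) = C.cv (?z s) w k" if s: "s \<in> {0..1}" for s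
      proof -
        have sV: "(s, 0) \<in> V" using sub s by auto
        have "((\<lambda>t::real. (s, t)) has_derivative (\<lambda>h. (0, h))) (at 0)"
          by (intro has_derivative_Pair has_derivative_const has_derivative_ident)
        from has_derivative_compose[OF this smooth_on_has_derivative[OF gs sV]]
        have 1: "((\<lambda>t. ?m (t, ?z s) - ?m (0, ?z s)) has_derivative (\<lambda>h. frechet_derivative g (at (s, 0)) (0, h))) (at 0)" by (simp add: g_def)
        have "((\<lambda>t::real. (t, ?z s)) has_derivative (\<lambda>h. (h, 0))) (at 0)"
          by (intro has_derivative_Pair has_derivative_const has_derivative_ident)
        moreover have sz: "(0, ?z s) \<in> ?S" using zin[OF s] by simp
        ultimately have "((\<lambda>t. ?m (t, ?z s)) has_derivative (\<lambda>h. frechet_derivative ?m (at (0, ?z s)) (h, 0))) (at 0)"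
          using has_derivative_compose[OF _ smooth_on_has_derivative[OF ms]] by fastforce
        from has_derivative_diff[OF this has_derivative_const, of "?m (0, ?z s)"]
        have 2: "((\<lambda>t. ?m (t, ?z s) - ?m (0, ?z s)) has_derivative (\<lambda>h. frechet_derivative ?m (at (0, ?z s)) (h, 0))) (at 0)" by simp
        have "frechet_derivative g (at (s, 0)) (0, 1) = frechet_derivative ?m (at (0, ?z s)) (1, 0)"
          using has_derivative_unique[OF 1 2] by metis
        also have "\<dots> = frechet_derivative (\<lambda>z. \<theta> (c (fst z) (C.\<psi> (snd z))) (velocity A c (fst z) (C.\<psi> (snd z)))) (at (0, ?z s)) (0, w)
            - pushforward A (c 0) (C.cv (?z s) w) h"
          by (rule C.cartan_formula[OF c(1) \<theta> X _ zin[OF s]]) (simp add: c(2) vel)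
        also have "pushforward A (c 0) (C.cv (?z s) w) h = C.cv (?z s) w h" by (simp add: pushforward_apply[OF h] c(2))
        also have "frechet_derivative (\<lambda>z. \<theta> (c (fst z) (C.\<psi> (snd z))) (velocity A c (fst z) (C.\<psi> (snd z)))) (at (0, ?z s)) (0, w)
            = C.cv (?z s) w (\<lambda>p. \<theta> p (X p))"
        proof -
          have TA: "(\<lambda>p. \<theta> p (X p)) \<in> smooth_fun A" using \<theta> XV by (simp add: one_forms_def)
          have "((\<lambda>x::'e. (0::real, x)) has_derivative (\<lambda>h. (0, h))) (at (?z s))"
            by (intro has_derivative_Pair has_derivative_const has_derivative_ident)
          from has_derivative_compose[OF this smooth_on_has_derivative[OF C.velocity_form_smooth[OF c(1) \<theta>] sz]]
          have "((\<lambda>x. \<theta> (C.\<psi> x) (X (C.\<psi> x))) has_derivative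
             (\<lambda>h. frechet_derivative (\<lambda>z. \<theta> (c (fst z) (C.\<psi> (snd z))) (velocity A c (fst z) (C.\<psi> (snd z)))) (at (0, ?z s)) (0, h))) (at (?z s))"
            by (simp add: c(2) vel)
          from frechet_derivative_eq[OF this] show ?thesis by (simp only: C.cv_apply[OF TA])
        qed
        also have "C.cv (?z s) w (\<lambda>p. \<theta> p (X p)) - C.cv (?z s) w h = C.cv (?z s) w k"
        proof -
          have TA: "(\<lambda>p. \<theta> p (X p)) \<in> smooth_fun A" using \<theta> XV by (simp add: one_forms_def)
          note T = tangent_spaceD[OF C.cv_tangent[OF zin[OF s], of w]]
          show ?thesis using T(1)[OF TA smooth_fun_cmult[OF A h, of "-1"]] T(2)[OF h, of "-1"] by (simp add: k_def[abs_def])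
        qed
        finally show ?thesis .
      qed
      have "((\<lambda>t. integral {0..1} (\<lambda>s. g (s, t))) has_derivative (\<lambda>u. integral {0..1} (\<lambda>s. frechet_derivative g (at (s, 0)) (0, u)))) (at 0)"
        by (rule has_derivative_integral_param[OF fin_dim_real V sub smooth_onD[OF gs] UNIV_I])
      moreover have "(\<lambda>t. integral {0..1} (\<lambda>s. g (s, t))) = (\<lambda>t. F t b - F t a)" by (simp add: Fdiff g_def)
      ultimately have D: "((\<lambda>t. F t b - F t a) has_derivative (\<lambda>u. integral {0..1} (\<lambda>s. frechet_derivative g (at (s, 0)) (0, u)))) (at 0)"
        by simp
      have "integral {0..1} (\<lambda>s. frechet_derivative g (at (s, 0)) (0, 1)) = k b - k a"
        unfolding seg[OF kA] by (rule integral_cong) (simp add: Dg)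
      then have "(\<lambda>u. integral {0..1} (\<lambda>s. frechet_derivative g (at (s, 0)) (0, u))) = (*) (k b - k a)"
        using linear_real_eq_times[OF has_derivative_linear[OF D]] by (simp only:)
      with D show ?thesis by (simp add: R_def has_field_derivative_def)
    qed
    then show "\<exists>T. openin (top_of_set UNIV) T \<and> a \<in> T \<and> (\<forall>x\<in>T. R a x)" using W by (intro exI[of _ W]) simp
  qed
  then show ?thesis by (simp add: R_def k_def)
qed

section \<open>The group of Hamiltonian diffeomorphisms\<close>

definition dstep :: "real \<Rightarrow> real" where "dstep x = frechet_derivative step (at x) 1"

lemma smooth_on_dstep: "smooth_on UNIV dstep"
  unfolding dstep_def[abs_def] by (rule smooth_on_frechet[OF smooth_on_step])

lemma step_has_derivative: "(step has_real_derivative dstep x) (at x)"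
proof -
  have D: "(step has_derivative frechet_derivative step (at x)) (at x)"
    by (rule smooth_on_has_derivative[OF smooth_on_step UNIV_I])
  then show ?thesis
    using linear_real_eq_times[OF has_derivative_linear[OF D]] by (simp add: has_field_derivative_def dstep_def)
qed

lemma dstep_eq_0: "x > 1 \<Longrightarrow> dstep x = 0"
proof -
  assume x: "x > 1"
  have "((\<lambda>_. 1) has_derivative (\<lambda>_. 0)) (at x)" by (rule has_derivative_const)
  from has_derivative_transform_within_open[OF this open_greaterThan[of 1], of step] x step_eq_1
  have "(step has_derivative (\<lambda>_. 0)) (at x)" by simp
  from frechet_derivative_eq[OF this] show ?thesis by (simp add: dstep_def)
qed

lemma diffeomorphism_id: "mfd A \<Longrightarrow> diffeomorphism A id"
  using smooth_map_on_id[of A UNIV] by (simp add: diffeomorphism_def id_def inv_id[unfolded id_def] bij_id[unfolded id_def])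

lemma diffeomorphism_comp:
  assumes A: "mfd A" and f: "diffeomorphism A f" and g: "diffeomorphism A g" shows "diffeomorphism A (f \<circ> g)"
proof -
  have "inv_into UNIV (f \<circ> g) = (\<lambda>p. inv_into UNIV g (inv_into UNIV f p))"
    unfolding o_inv_distrib[OF f[unfolded diffeomorphism_def, THEN conjunct1] g[unfolded diffeomorphism_def, THEN conjunct1]] by (simp add: o_def)
  then show ?thesis
    using f g smooth_map_compose[OF A A A, of g f] smooth_map_compose[OF A A A, of "inv_into UNIV f" "inv_into UNIV g"]
    bij_comp[of g f] by (simp add: diffeomorphism_def o_def)
qed

lemma diffeomorphism_inv: "diffeomorphism A f \<Longrightarrow> diffeomorphism A (inv_into UNIV f)"
  by (simp add: diffeomorphism_def bij_imp_bij_inv inv_inv_eq)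

lemma diffeomorphismD:
  assumes "diffeomorphism A f"
  shows "smooth_map A A f" "smooth_map A A (inv_into UNIV f)" "inv_into UNIV f (f p) = p" "f (inv_into UNIV f p) = p"
  using assms by (auto simp: diffeomorphism_def bij_is_inj bij_is_surj surj_f_inv_f)

lemma smooth_family_fun_reparam:
  fixes h :: "real \<Rightarrow> 'p::topological_space \<Rightarrow> real"
  assumes A: "mfd A" and h: "smooth_family A model_atlas h" and \<sigma>: "smooth_on UNIV \<sigma>" and s: "smooth_on UNIV s"
  shows "smooth_map (prod_atlas (model_atlas :: (real, real) chart set) A) model_atlas (\<lambda>z. s (fst z) * h (\<sigma> (fst z)) (snd z))"
proof -
  note Q = mfd_prod[OF mfd_real A]
  have t: "smooth_map (prod_atlas (model_atlas :: (real, real) chart set) A) model_atlas (\<lambda>z. \<rho> (fst z))" if "smooth_on UNIV \<rho>" for \<rho> :: "real \<Rightarrow> real"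
    by (rule smooth_map_on_model_compose[OF Q fin_dim_real fin_dim_real open_UNIV open_UNIV smooth_map_on_fst[OF mfd_real A open_UNIV] that UNIV_I])
  show ?thesis
    by (rule smooth_map_on_mult[OF Q open_UNIV t[OF s]
          smooth_family_compose[OF A mfd_real Q open_UNIV h t[OF \<sigma>] smooth_map_on_snd[OF mfd_real A open_UNIV]]])
qed

text \<open>The chain rule for two clocks \<sigma> and \<tau>. The disjunction serves the
  concatenation of isotopies: the derivative along the second clock is known until the first clock
  starts, and from then on the second clock stands still.\<close>

lemma two_parameter_derivative:
  fixes \<Gamma> :: "real \<times> real \<Rightarrow> real"
  assumes G: "smooth_on UNIV \<Gamma>" and \<sigma>: "(\<sigma> has_real_derivative \<sigma>') (at t)" and \<tau>: "(\<tau> has_real_derivative \<tau>') (at t)"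
    and a: "((\<lambda>s. \<Gamma> (s, \<tau> t)) has_real_derivative a) (at (\<sigma> t))"
    and b: "\<tau>' = 0 \<or> ((\<lambda>s. \<Gamma> (\<sigma> t, s)) has_real_derivative b) (at (\<tau> t))"
  shows "((\<lambda>s. \<Gamma> (\<sigma> s, \<tau> s)) has_real_derivative \<sigma>' * a + \<tau>' * b) (at t)"
proof -
  let ?D = "frechet_derivative \<Gamma> (at (\<sigma> t, \<tau> t))"
  have D: "(\<Gamma> has_derivative ?D) (at (\<sigma> t, \<tau> t))" by (rule smooth_on_has_derivative[OF G UNIV_I])
  have lin: "linear ?D" by (rule has_derivative_linear[OF D])
  have "((\<lambda>s. (s, \<tau> t)) has_derivative (\<lambda>u. (u, 0))) (at (\<sigma> t))"
    by (intro has_derivative_Pair has_derivative_const has_derivative_ident)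
  from has_derivative_unique[OF has_derivative_compose[OF this D]] a
  have "(\<lambda>u. ?D (u, 0)) = (*) a" by (simp add: has_field_derivative_def)
  from fun_cong[OF this, of 1] have D1: "?D (1, 0) = a" by simp
  have D2: "\<tau>' * ?D (0, 1) = \<tau>' * b"
  proof (cases "\<tau>' = 0")
    case False
    have "((\<lambda>s. (\<sigma> t, s)) has_derivative (\<lambda>u. (0, u))) (at (\<tau> t))"
      by (intro has_derivative_Pair has_derivative_const has_derivative_ident)
    from has_derivative_unique[OF has_derivative_compose[OF this D]] b False
    have "(\<lambda>u. ?D (0, u)) = (*) b" by (simp add: has_field_derivative_def)
    from fun_cong[OF this, of 1] show ?thesis by simp
  qed simp
  have "((\<lambda>s. (\<sigma> s, \<tau> s)) has_derivative (\<lambda>u. (\<sigma>' * u, \<tau>' * u))) (at t)"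
    using \<sigma> \<tau> by (auto intro!: has_derivative_Pair simp: has_field_derivative_def)
  from has_derivative_compose[OF this D]
  have "((\<lambda>s. \<Gamma> (\<sigma> s, \<tau> s)) has_derivative (\<lambda>u. ?D (\<sigma>' * u, \<tau>' * u))) (at t)" .
  moreover have "(\<lambda>u. ?D (\<sigma>' * u, \<tau>' * u)) = (*) (\<sigma>' * a + \<tau>' * b)"
  proof
    fix u
    have "?D (\<sigma>' * u, \<tau>' * u) = ?D ((\<sigma>' * u) *\<^sub>R (1, 0) + (\<tau>' * u) *\<^sub>R (0, 1))" by simp
    also have "\<dots> = (\<sigma>' * u) *\<^sub>R ?D (1, 0) + (\<tau>' * u) *\<^sub>R ?D (0, 1)"
      by (simp only: linear_add[OF lin] linear_cmul[OF lin])
    also have "\<dots> = (\<sigma>' * a + \<tau>' * ?D (0, 1)) * u" by (simp add: algebra_simps D1)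
    finally show "?D (\<sigma>' * u, \<tau>' * u) = (\<sigma>' * a + \<tau>' * b) * u" by (simp only: D2)
  qed
  ultimately show ?thesis by (simp add: has_field_derivative_def)
qed

lemma composed_families_smooth:
  fixes c d :: "real \<Rightarrow> 'p::topological_space \<Rightarrow> 'p"
  assumes A: "mfd A" and c: "smooth_family A A c" and d: "smooth_family A A d" and f: "f \<in> smooth_fun A"
  shows "smooth_on UNIV (\<lambda>z. f (c (fst z) (d (snd z) p)))"
proof -
  have fd2: "fin_dim TYPE(real \<times> real)" by (rule fin_dim_prod[OF fin_dim_real fin_dim_real])
  have f1: "smooth_map model_atlas model_atlas (fst :: real \<times> real \<Rightarrow> real)" and f2: "smooth_map model_atlas model_atlas (snd :: real \<times> real \<Rightarrow> real)"
    by (simp_all add: smooth_map_on_model_iff smooth_on_fst smooth_on_snd)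
  have "smooth_map model_atlas A (\<lambda>z::real \<times> real. c (fst z) (d (snd z) p))"
    by (rule smooth_family_compose[OF A A mfd_model[OF fd2] open_UNIV c f1
          smooth_family_compose[OF A A mfd_model[OF fd2] open_UNIV d f2 smooth_map_on_const[OF mfd_model[OF fd2] open_UNIV]]])
  from smooth_on_fun_comp[OF A fd2 open_UNIV this f] show ?thesis .
qed

context
  fixes A :: "('p::{t2_space, second_countable_topology}, 'e::real_normed_vector) chart set" and \<theta>
  assumes es: "exact_symplectic A \<theta>"
begin

lemmas mA = exact_symplecticD(1)[OF es] and thA = exact_symplecticD(2)[OF es]

lemma Diff_ham_id: "id \<in> Diff_ham A \<theta>"
proof -
  note z = smooth_fun_const[OF mA, of 0]
  obtain X where X: "is_ham_vf A \<theta> (\<lambda>_. 0) X" using ham_vf_exists[OF es z] by blast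
  \<comment> \<open>The zero field arises as a combination of Hamiltonian vector fields with
    coefficients 0.\<close>
  have ham: "is_ham_vf A \<theta> (\<lambda>_. 0) (\<lambda>p k. 0)" using ham_vf_lincomb[OF mA thA z z X X, of 0 0] by simp
  have i: "smooth_map A A id" using smooth_map_on_id[OF mA, of UNIV] by (simp add: id_def)
  show ?thesis unfolding Diff_ham_def
  proof (intro CollectI exI[of _ "\<lambda>t. id"] exI[of _ "\<lambda>t p. 0"] exI[of _ "\<lambda>t p k. 0"] conjI allI ballI)
    show "smooth_family A A (\<lambda>t. id)" by (rule smooth_family_const[OF mA mA i])
    show "smooth_family A (model_atlas :: (real, real) chart set) (\<lambda>t p. 0)"
      by (rule smooth_family_const[OF mA mfd_real smooth_map_on_const[OF mA open_UNIV]])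
  qed (use ham diffeomorphism_id[OF mA] in auto)
qed

text \<open>The isotopy is run backwards, after the inverse map so that it starts at the identity;
  the reversed clock changes the sign of the Hamiltonian.\<close>

lemma Diff_ham_inv:
  assumes "\<phi> \<in> Diff_ham A \<theta>" shows "inv_into UNIV \<phi> \<in> Diff_ham A \<theta>"
proof -
  obtain c h X where c: "smooth_family A A c" "\<And>t. diffeomorphism A (c t)" and c01: "c 0 = id" "c 1 = \<phi>"
    and h: "smooth_family A (model_atlas :: (real, real) chart set) h" and X: "\<And>t. is_ham_vf A \<theta> (h t) (X t)"
    and d: "\<And>t p f. f \<in> smooth_fun A \<Longrightarrow> ((\<lambda>s. f (c s p)) has_real_derivative X t (c t p) f) (at t)"
    using assms unfolding Diff_ham_def by blast
  have \<phi>: "diffeomorphism A \<phi>" using c(2)[of 1] by (simp add: c01)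
  note D = diffeomorphismD[OF \<phi>]
  have ht: "h t \<in> smooth_fun A" for t using smooth_family_slice[OF mA mfd_real h] by (rule smooth_funI)
  have sm: "smooth_on UNIV (\<lambda>t::real. 1 - t)" by (intro smooth_on_diff smooth_on_const smooth_on_id open_UNIV)
  show ?thesis unfolding Diff_ham_def
  proof (intro CollectI exI[of _ "\<lambda>t p. c (1 - t) (inv_into UNIV \<phi> p)"] exI[of _ "\<lambda>t p. - h (1 - t) p"] exI[of _ "\<lambda>t p k. - X (1 - t) p k"] conjI allI ballI)
    show "smooth_family A A (\<lambda>t p. c (1 - t) (inv_into UNIV \<phi> p))"
      by (rule smooth_family_comp2[OF mA mA mA c(1) smooth_family_const[OF mA mA D(2)] sm sm])
    show "diffeomorphism A (\<lambda>p. c (1 - t) (inv_into UNIV \<phi> p))" for t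
      using diffeomorphism_comp[OF mA c(2) diffeomorphism_inv[OF \<phi>]] by (simp add: o_def)
    show "(\<lambda>p. c (1 - 0) (inv_into UNIV \<phi> p)) = id" by (simp add: c01 D(4) id_def)
    show "(\<lambda>p. c (1 - 1) (inv_into UNIV \<phi> p)) = inv_into UNIV \<phi>" by (simp add: c01)
    show "smooth_family A (model_atlas :: (real, real) chart set) (\<lambda>t p. - h (1 - t) p)"
      using smooth_family_fun_reparam[OF mA h sm smooth_on_const[of _ "-1"]] by (intro smooth_familyI) simp
    show "is_ham_vf A \<theta> (\<lambda>p. - h (1 - t) p) (\<lambda>p k. - X (1 - t) p k)" for t
      using ham_vf_lincomb[OF mA thA ht ht X X, of "-1" "1 - t" 0 "1 - t"] by simp
    fix t p f assume f: "f \<in> smooth_fun A"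
    have "((\<lambda>s::real. 1 - s) has_real_derivative - 1) (at t)" by (auto intro!: derivative_eq_intros)
    from DERIV_chain2[OF d[OF f, of "inv_into UNIV \<phi> p" "1 - t"] this]
    show "((\<lambda>s. f (c (1 - s) (inv_into UNIV \<phi> p))) has_real_derivative - X (1 - t) (c (1 - t) (inv_into UNIV \<phi> p)) f) (at t)" by simp
  qed
qed

text \<open>The two isotopies are run one after the other, slowed down so that the concatenation is smooth.\<close>

lemma Diff_ham_comp:
  assumes "\<phi> \<in> Diff_ham A \<theta>" "\<psi> \<in> Diff_ham A \<theta>" shows "\<phi> \<circ> \<psi> \<in> Diff_ham A \<theta>"
proof -
  obtain c h X where c: "smooth_family A A c" "\<And>t. diffeomorphism A (c t)" and c01: "c 0 = id" "c 1 = \<phi>"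
    and h: "smooth_family A (model_atlas :: (real, real) chart set) h" and X: "\<And>t. is_ham_vf A \<theta> (h t) (X t)"
    and dc: "\<And>t p f. f \<in> smooth_fun A \<Longrightarrow> ((\<lambda>s. f (c s p)) has_real_derivative X t (c t p) f) (at t)"
    using assms(1) unfolding Diff_ham_def by blast
  obtain d k Y where d: "smooth_family A A d" "\<And>t. diffeomorphism A (d t)" and d01: "d 0 = id" "d 1 = \<psi>"
    and k: "smooth_family A (model_atlas :: (real, real) chart set) k" and Y: "\<And>t. is_ham_vf A \<theta> (k t) (Y t)"
    and dd: "\<And>t p f. f \<in> smooth_fun A \<Longrightarrow> ((\<lambda>s. f (d s p)) has_real_derivative Y t (d t p) f) (at t)"
    using assms(2) unfolding Diff_ham_def by blast
  have ht: "h t \<in> smooth_fun A" for t using smooth_family_slice[OF mA mfd_real h] by (rule smooth_funI)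
  have kt: "k t \<in> smooth_fun A" for t using smooth_family_slice[OF mA mfd_real k] by (rule smooth_funI)
  \<comment> \<open>The clock \<tau> runs from 0 to 1 in the first quarter of the unit interval and
    \<sigma> in the third quarter, so at each time at most one of the two isotopies moves.\<close>
  define \<sigma> where "\<sigma> t = step (4 * t - 2)" for t
  define \<tau> where "\<tau> t = step (4 * t)" for t
  define \<sigma>' where "\<sigma>' t = 4 * dstep (4 * t - 2)" for t
  define \<tau>' where "\<tau>' t = 4 * dstep (4 * t)" for t
  have l1: "smooth_on UNIV (\<lambda>t::real. 4 * t - 2)" and l2: "smooth_on UNIV (\<lambda>t::real. 4 * t)"
    by (intro smooth_on_diff smooth_on_mult smooth_on_const smooth_on_id open_UNIV)+
  note comp = smooth_on_compose[OF fin_dim_real open_UNIV open_UNIV _ _ UNIV_I]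
  have sm: "smooth_on UNIV \<sigma>" "smooth_on UNIV \<tau>" unfolding \<sigma>_def \<tau>_def by (rule comp[OF l1 smooth_on_step], rule comp[OF l2 smooth_on_step])
  have sm': "smooth_on UNIV \<sigma>'" "smooth_on UNIV \<tau>'" unfolding \<sigma>'_def \<tau>'_def
    by (rule smooth_on_mult[OF open_UNIV smooth_on_const comp[OF l1 smooth_on_dstep]], rule smooth_on_mult[OF open_UNIV smooth_on_const comp[OF l2 smooth_on_dstep]])
  have der: "(\<sigma> has_real_derivative \<sigma>' t) (at t)" "(\<tau> has_real_derivative \<tau>' t) (at t)" for t
    unfolding \<sigma>_def \<tau>_def \<sigma>'_def \<tau>'_def
    by (rule DERIV_cong[OF DERIV_chain2[OF step_has_derivative]], (auto intro!: derivative_eq_intros)[2])+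
  define H where "H t p = \<sigma>' t * h (\<sigma> t) p + \<tau>' t * k (\<tau> t) p" for t p
  define Z where "Z t p f = \<sigma>' t * X (\<sigma> t) p f + \<tau>' t * Y (\<tau> t) p f" for t p f
  show ?thesis unfolding Diff_ham_def
  proof (intro CollectI exI[of _ "\<lambda>t p. c (\<sigma> t) (d (\<tau> t) p)"] exI[of _ H] exI[of _ Z] conjI allI ballI)
    show "smooth_family A A (\<lambda>t p. c (\<sigma> t) (d (\<tau> t) p))" by (rule smooth_family_comp2[OF mA mA mA c(1) d(1) sm])
    show "diffeomorphism A (\<lambda>p. c (\<sigma> t) (d (\<tau> t) p))" for t
      using diffeomorphism_comp[OF mA c(2) d(2)] by (simp add: o_def)
    show "(\<lambda>p. c (\<sigma> 0) (d (\<tau> 0) p)) = id" by (simp add: \<sigma>_def \<tau>_def step_eq_0 c01 d01 id_def)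
    show "(\<lambda>p. c (\<sigma> 1) (d (\<tau> 1) p)) = \<phi> \<circ> \<psi>" by (simp add: \<sigma>_def \<tau>_def step_eq_1 c01 d01 o_def)
    show "smooth_family A (model_atlas :: (real, real) chart set) H"
      unfolding H_def
      by (rule smooth_familyI, rule smooth_map_on_add[OF mfd_prod[OF mfd_real mA] fin_dim_real open_UNIV
            smooth_family_fun_reparam[OF mA h sm(1) sm'(1)] smooth_family_fun_reparam[OF mA k sm(2) sm'(2)]])
    show "is_ham_vf A \<theta> (H t) (Z t)" for t
      unfolding H_def[abs_def] Z_def[abs_def] by (rule ham_vf_lincomb[OF mA thA ht kt X Y])
    fix t p f assume f: "f \<in> smooth_fun A"
    \<comment> \<open>Before time 1/2 the outer isotopy is still the identity; afterwards the inner
      one has come to rest.\<close>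
    have "\<tau>' t = 0 \<or> ((\<lambda>s. f (c (\<sigma> t) (d s p))) has_real_derivative Y (\<tau> t) (c (\<sigma> t) (d (\<tau> t) p)) f) (at (\<tau> t))"
    proof (cases "t < 1/2")
      case True
      then have "\<sigma> t = 0" by (simp add: \<sigma>_def step_eq_0)
      then show ?thesis using dd[OF f, of p "\<tau> t"] by (simp add: c01)
    next
      case False
      then show ?thesis by (simp add: \<tau>'_def dstep_eq_0)
    qed
    then show "((\<lambda>s. f (c (\<sigma> s) (d (\<tau> s) p))) has_real_derivative Z t (c (\<sigma> t) (d (\<tau> t) p)) f) (at t)"
      using two_parameter_derivative[OF composed_families_smooth[OF mA c(1) d(1) f, of p] der(1)[of t] der(2)[of t]]
        dc[OF f, of "d (\<tau> t) p" "\<sigma> t"] by (simp add: Z_def)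
  qed
qed

end

section \<open>The homomorphism \<open>\<Psi>\<close> and its derivative\<close>

text \<open>Pulling the test field back along \<open>c\<close> reduces the equation at
  \<open>q\<close> to the one at \<open>c' q\<close>, where the invariance of \<open>h\<close>
  yields the same right-hand side.\<close>

lemma (in theta_symmetry) ham_push:
  assumes X: "is_ham_vf A \<theta> h X" and h: "h \<in> smooth_fun A" "\<And>p. h (c p) = h p"
    and sym: "theta_symmetry A \<theta> c' c"
  shows "is_ham_vf A \<theta> h (push X)"
proof -
  interpret I: theta_symmetry A \<theta> c' c by (rule sym)
  have XV: "X \<in> vector_fields A" using X by (simp add: is_ham_vf_def)
  have hc': "h (c' p) = h p" for p using h(2)[of "c' p"] by (simp add: inv)
  show ?thesis unfolding is_ham_vf_def
  proof (intro conjI ballI allI push_field[OF XV])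
    fix Y q assume Y: "Y \<in> vector_fields A"
    have YI: "I.push Y \<in> vector_fields A" by (rule I.push_field[OF Y])
    have bk: "push (I.push Y) = Y"
    proof (rule ext, rule ext)
      fix p f
      show "push (I.push Y) p f = Y p f"
      proof (cases "f \<in> smooth_fun A")
        case True
        from I.push_apply[OF smooth_fun_compose[OF A A c(1) True], of Y "c' p"]
        show ?thesis by (simp add: push_apply[OF True] inv)
      next
        case False
        then show ?thesis using tangent_spaceD(4)[OF vector_field_tangent[OF Y] False] by (simp add: push_def pushforward_def)
      qed
    qed
    have "symp \<theta> (push X) Y q = symp \<theta> (push X) (push (I.push Y)) (c (c' q))" by (simp add: bk inv)
    also have "\<dots> = symp \<theta> X (I.push Y) (c' q)" by (rule symp_push[OF XV YI])
    also have "\<dots> = I.push Y (c' q) h" using X YI by (simp add: is_ham_vf_def differential_def)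
    also have "\<dots> = Y q h" by (simp add: I.push_apply[OF h(1)] inv hc')
    finally show "symp \<theta> (push X) Y q = differential h q (Y q)" by (simp add: differential_def)
  qed
qed

locale exact_bundle =
  fixes P :: "('p::{t2_space, second_countable_topology}, 'e::real_normed_vector) chart set"
    and M :: "('m::{t2_space, second_countable_topology}, 'b::real_normed_vector) chart set"
    and L :: "('g::{t2_space, second_countable_topology}, 'l::real_normed_vector) chart set"
    and G :: "'g monoid"
    and \<pi> :: "'p \<Rightarrow> 'm"
    and \<Phi> :: "'g \<Rightarrow> 'p \<Rightarrow> 'p"
    and \<theta> :: "'p \<Rightarrow> 'p tvec \<Rightarrow> real"
  assumes conn: "connected (UNIV :: 'p set)"
    and pb: "principal_bundle P M L G \<pi> \<Phi>"
    and es: "exact_symplectic P \<theta>"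
    and inv: "\<theta> \<in> invariant_one_forms P \<Phi>"
begin

lemmas mP = exact_symplecticD(1)[OF es] and th = exact_symplecticD(2)[OF es]

lemma mM: "mfd M" and mL: "mfd L" and grp: "group G" and car: "carrier G = UNIV"
  and action: "smooth_right_action P L G \<Phi>"
  using pb by (auto simp: principal_bundle_def lie_group_def smooth_manifold_mfd)

lemma act_one: "\<Phi> \<one>\<^bsub>G\<^esub> = id" and act_mult: "\<Phi> (a \<otimes>\<^bsub>G\<^esub> b) p = \<Phi> b (\<Phi> a p)"
  using action by (auto simp: smooth_right_action_def)

lemma act_smooth: "smooth_map P P (\<Phi> g)"
proof -
  have "smooth_map (prod_atlas P L) P (\<lambda>z. \<Phi> (snd z) (fst z))" using action by (simp add: smooth_right_action_def split_def)
  from smooth_map_on_compose[OF mP mfd_prod[OF mP mL] mP open_UNIV open_UNIV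
      smooth_map_on_Pair[OF mP mL mP open_UNIV smooth_map_on_id[OF mP] smooth_map_on_const[OF mP open_UNIV]] this UNIV_I]
  show ?thesis by simp
qed

lemma act_inv: "\<Phi> (inv\<^bsub>G\<^esub> g) (\<Phi> g p) = p" "\<Phi> g (\<Phi> (inv\<^bsub>G\<^esub> g) p) = p"
proof -
  interpret group G by (rule grp)
  show "\<Phi> (inv\<^bsub>G\<^esub> g) (\<Phi> g p) = p" "\<Phi> g (\<Phi> (inv\<^bsub>G\<^esub> g) p) = p"
    using act_mult[of g "inv\<^bsub>G\<^esub> g" p] act_mult[of "inv\<^bsub>G\<^esub> g" g p] act_one r_inv[of g] l_inv[of g] car by auto
qed

lemma theta_inv: "v \<in> tangent_space P p \<Longrightarrow> \<theta> (\<Phi> g p) (pushforward P (\<Phi> g) v) = \<theta> p v"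
  using inv by (simp add: invariant_one_forms_def pullback_def)

lemma symmetry: "theta_symmetry P \<theta> (\<Phi> g) (\<Phi> (inv\<^bsub>G\<^esub> g))"
  and symmetry': "theta_symmetry P \<theta> (\<Phi> (inv\<^bsub>G\<^esub> g)) (\<Phi> g)"
  by unfold_locales (use mP th act_smooth act_inv theta_inv in auto)

section \<open>Well-definedness and the homomorphism property\<close>

lemma primitiveD:
  assumes "primitive P \<theta> \<phi> F"
  shows "F \<in> smooth_fun P" "v \<in> tangent_space P p \<Longrightarrow> v F = \<theta> (\<phi> p) (pushforward P \<phi> v) - \<theta> p v"
  using assms by (auto simp: primitive_def differential_def pullback_def)

text \<open>Comparing two primitives at two base points covers independence of the choice and
  constancy at once. Two primitives differ by a constant, and the invariance of \<theta> with the
  equivariance of \<phi> makes \<open>F' \<circ> \<Phi> g\<close> a primitive as well.\<close>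

lemma primitive_difference:
  assumes sm: "smooth_map P P \<phi>" and eq: "\<And>p. \<phi> (\<Phi> g p) = \<Phi> g (\<phi> p)"
    and F: "primitive P \<theta> \<phi> F" "primitive P \<theta> \<phi> F'"
  shows "F p - F (\<Phi> g p) = F' q - F' (\<Phi> g q)"
proof -
  note F1 = primitiveD[OF F(1)] and F2 = primitiveD[OF F(2)]
  have FF: "v (\<lambda>p. F p - F' p) = 0" if v: "v \<in> tangent_space P p" for v p
  proof -
    note T = tangent_spaceD[OF v]
    show ?thesis using T(1)[OF F1(1) smooth_fun_cmult[OF mP F2(1), of "-1"]] T(2)[OF F2(1), of "-1"] F1(2)[OF v] F2(2)[OF v] by simp
  qed
  have "(\<lambda>p. F p - F' p) p = (\<lambda>p. F p - F' p) (\<Phi> g p)"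
    by (rule zero_derivative_constant[where f = "\<lambda>p. F p - F' p", OF mP conn smooth_fun_diff[OF mP F1(1) F2(1)]]) (rule FF)
  moreover have "(\<lambda>p. F' p - F' (\<Phi> g p)) p = (\<lambda>p. F' p - F' (\<Phi> g p)) q"
  proof (rule zero_derivative_constant[where f = "\<lambda>p. F' p - F' (\<Phi> g p)", OF mP conn])
    have FP: "(\<lambda>p. F' (\<Phi> g p)) \<in> smooth_fun P" by (rule smooth_fun_compose[OF mP mP act_smooth F2(1)])
    show "(\<lambda>p. F' p - F' (\<Phi> g p)) \<in> smooth_fun P" by (rule smooth_fun_diff[OF mP F2(1) FP])
    fix p v assume v: "v \<in> tangent_space P p"
    note T = tangent_spaceD[OF v]
    have vP: "pushforward P (\<Phi> g) v \<in> tangent_space P (\<Phi> g p)" by (rule smooth_map_pushforward[OF mP act_smooth v])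
    have v\<phi>: "pushforward P \<phi> v \<in> tangent_space P (\<phi> p)" by (rule smooth_map_pushforward[OF mP sm v])
    have comm: "pushforward P \<phi> (pushforward P (\<Phi> g) v) = pushforward P (\<Phi> g) (pushforward P \<phi> v)"
      by (simp add: pushforward_compose[OF mP sm act_smooth] pushforward_compose[OF mP act_smooth sm] eq)
    have "v (\<lambda>p. F' (\<Phi> g p)) = pushforward P (\<Phi> g) v F'" by (simp add: pushforward_apply[OF F2(1)])
    also have "\<dots> = \<theta> (\<phi> p) (pushforward P \<phi> v) - \<theta> p v"
      unfolding F2(2)[OF vP] comm eq theta_inv[OF v\<phi>] theta_inv[OF v] ..
    also have "\<dots> = v F'" by (rule F2(2)[OF v, symmetric])
    finally show "v (\<lambda>p. F' p - F' (\<Phi> g p)) = 0"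
      using T(1)[OF F2(1) smooth_fun_cmult[OF mP FP, of "-1"]] T(2)[OF FP, of "-1"] by simp
  qed
  ultimately show ?thesis by simp
qed

lemma Aut_hamD:
  assumes "\<phi> \<in> carrier (Aut_ham P \<theta> \<Phi>)"
  shows "\<phi> \<in> Diff_ham P \<theta>" "diffeomorphism P \<phi>" "smooth_map P P \<phi>" "\<phi> (\<Phi> g p) = \<Phi> g (\<phi> p)"
  using assms by (auto simp: Aut_ham_def Aut_def diffeomorphism_def fun_eq_iff)

lemma primitive_exists: "\<phi> \<in> carrier (Aut_ham P \<theta> \<Phi>) \<Longrightarrow> \<exists>F. primitive P \<theta> \<phi> F"
  by (rule isotopy_primitive[OF es Aut_hamD(1)])

lemma Psi_eq:
  assumes \<phi>: "\<phi> \<in> carrier (Aut_ham P \<theta> \<Phi>)" and F: "primitive P \<theta> \<phi> F"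
  shows "F p - F (\<Phi> g p) = Psi P \<theta> \<Phi> \<phi> g"
proof -
  have "Psi P \<theta> \<Phi> \<phi> g = F p - F (\<Phi> g p)" unfolding Psi_def
  proof (rule the_equality)
    show "\<forall>F'. primitive P \<theta> \<phi> F' \<longrightarrow> (\<forall>q. F' q - F' (\<Phi> g q) = F p - F (\<Phi> g p))"
      using primitive_difference[OF Aut_hamD(3,4)[OF \<phi>] _ F] by blast
  qed (use F in auto)
  then show ?thesis by simp
qed

lemma Psi_hom: "\<phi> \<in> carrier (Aut_ham P \<theta> \<Phi>) \<Longrightarrow> Psi P \<theta> \<Phi> \<phi> \<in> hom G real_add_group"
proof -
  assume \<phi>: "\<phi> \<in> carrier (Aut_ham P \<theta> \<Phi>)"
  obtain F where F: "primitive P \<theta> \<phi> F" using primitive_exists[OF \<phi>] by blast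
  \<comment> \<open>The base point is arbitrary; the choice \<open>\<Phi> a undefined\<close> for
    the factor \<open>b\<close> makes the differences telescope.\<close>
  have "Psi P \<theta> \<Phi> \<phi> (a \<otimes>\<^bsub>G\<^esub> b) = Psi P \<theta> \<Phi> \<phi> a + Psi P \<theta> \<Phi> \<phi> b" for a b
    using Psi_eq[OF \<phi> F, of undefined "a \<otimes>\<^bsub>G\<^esub> b"] Psi_eq[OF \<phi> F, of undefined a] Psi_eq[OF \<phi> F, of "\<Phi> a undefined" b]
    by (simp add: act_mult)
  then show ?thesis by (auto simp: hom_def real_add_group_def)
qed

lemma Psi_comp:
  assumes \<phi>: "\<phi> \<in> carrier (Aut_ham P \<theta> \<Phi>)" and \<psi>: "\<psi> \<in> carrier (Aut_ham P \<theta> \<Phi>)" and \<phi>\<psi>: "\<phi> \<circ> \<psi> \<in> carrier (Aut_ham P \<theta> \<Phi>)"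
  shows "Psi P \<theta> \<Phi> (\<phi> \<circ> \<psi>) g = Psi P \<theta> \<Phi> \<phi> g + Psi P \<theta> \<Phi> \<psi> g"
proof -
  obtain F where F: "primitive P \<theta> \<phi> F" using primitive_exists[OF \<phi>] by blast
  obtain F' where F': "primitive P \<theta> \<psi> F'" using primitive_exists[OF \<psi>] by blast
  note F1 = primitiveD[OF F] and F2 = primitiveD[OF F']
  note s = Aut_hamD(3)[OF \<phi>] and s' = Aut_hamD(3)[OF \<psi>]
  have FP: "(\<lambda>p. F (\<psi> p)) \<in> smooth_fun P" by (rule smooth_fun_compose[OF mP mP s' F1(1)])
  have "primitive P \<theta> (\<phi> \<circ> \<psi>) (\<lambda>p. F (\<psi> p) + F' p)"
    unfolding primitive_def
  proof (intro conjI allI ballI smooth_fun_add[OF mP FP F2(1)])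
    fix p v assume v: "v \<in> tangent_space P p"
    have "v (\<lambda>p. F (\<psi> p) + F' p) = pushforward P \<psi> v F + v F'"
      by (simp add: tangent_spaceD(1)[OF v FP F2(1)] pushforward_apply[OF F1(1)])
    also have "\<dots> = \<theta> (\<phi> (\<psi> p)) (pushforward P (\<lambda>p. \<phi> (\<psi> p)) v) - \<theta> p v"
      using F1(2)[OF smooth_map_pushforward[OF mP s' v]] F2(2)[OF v] by (simp add: pushforward_compose[OF mP s s'])
    finally show "differential (\<lambda>p. F (\<psi> p) + F' p) p v = pullback P (\<phi> \<circ> \<psi>) \<theta> p v - \<theta> p v"
      by (simp add: differential_def pullback_def o_def)
  qed
  \<comment> \<open>Equivariance of \<psi> turns the part coming from \<open>F\<close> into its
    difference at the base point \<open>\<psi> undefined\<close>.\<close>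
  from Psi_eq[OF \<phi>\<psi> this, of undefined g] Psi_eq[OF \<phi> F, of "\<psi> undefined" g] Psi_eq[OF \<psi> F', of undefined g]
  show ?thesis by (simp add: Aut_hamD(4)[OF \<psi>])
qed

lemma Aut_ham_group: "group (Aut_ham P \<theta> \<Phi>)"
proof (rule groupI)
  fix x y assume x: "x \<in> carrier (Aut_ham P \<theta> \<Phi>)" and y: "y \<in> carrier (Aut_ham P \<theta> \<Phi>)"
  show "x \<otimes>\<^bsub>Aut_ham P \<theta> \<Phi>\<^esub> y \<in> carrier (Aut_ham P \<theta> \<Phi>)"
    using x y Diff_ham_comp[OF es] diffeomorphism_comp[OF mP] by (auto simp: Aut_ham_def Aut_def fun_eq_iff)
next
  show "\<one>\<^bsub>Aut_ham P \<theta> \<Phi>\<^esub> \<in> carrier (Aut_ham P \<theta> \<Phi>)"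
    using Diff_ham_id[OF es] diffeomorphism_id[OF mP] by (auto simp: Aut_ham_def Aut_def)
next
  fix x assume x: "x \<in> carrier (Aut_ham P \<theta> \<Phi>)"
  note D = diffeomorphismD[OF Aut_hamD(2)[OF x]]
  have "inv_into UNIV x (\<Phi> g p) = \<Phi> g (inv_into UNIV x p)" for g p
    using Aut_hamD(4)[OF x, of g "inv_into UNIV x p"] D(3,4) by metis
  then have "inv_into UNIV x \<in> carrier (Aut_ham P \<theta> \<Phi>)"
    using Diff_ham_inv[OF es Aut_hamD(1)[OF x]] diffeomorphism_inv[OF Aut_hamD(2)[OF x]]
    by (auto simp: Aut_ham_def Aut_def fun_eq_iff)
  moreover have "inv_into UNIV x \<circ> x = id" using D(3) by auto
  ultimately show "\<exists>y\<in>carrier (Aut_ham P \<theta> \<Phi>). y \<otimes>\<^bsub>Aut_ham P \<theta> \<Phi>\<^esub> x = \<one>\<^bsub>Aut_ham P \<theta> \<Phi>\<^esub>"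
    by (auto simp: Aut_ham_def)
qed (auto simp: Aut_ham_def o_assoc)

lemma Hom_real_group: "group (Hom_real G)"
proof (rule groupI)
  fix x assume "x \<in> carrier (Hom_real G)"
  then have "(\<lambda>g. - x g) \<in> carrier (Hom_real G)" by (auto simp: Hom_real_def hom_def real_add_group_def)
  then show "\<exists>y\<in>carrier (Hom_real G). y \<otimes>\<^bsub>Hom_real G\<^esub> x = \<one>\<^bsub>Hom_real G\<^esub>"
    by (intro bexI[of _ "\<lambda>g. - x g"]) (auto simp: Hom_real_def)
qed (auto simp: Hom_real_def hom_def real_add_group_def add.assoc)

lemma Psi_group_hom: "group_hom (Aut_ham P \<theta> \<Phi>) (Hom_real G) (Psi P \<theta> \<Phi>)"
proof (rule group_hom.intro[OF Aut_ham_group Hom_real_group], unfold_locales)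
  show "Psi P \<theta> \<Phi> \<in> hom (Aut_ham P \<theta> \<Phi>) (Hom_real G)"
    unfolding hom_def
  proof (intro CollectI conjI ballI)
    show "Psi P \<theta> \<Phi> \<in> carrier (Aut_ham P \<theta> \<Phi>) \<rightarrow> carrier (Hom_real G)" using Psi_hom by (auto simp: Hom_real_def)
    fix x y assume x: "x \<in> carrier (Aut_ham P \<theta> \<Phi>)" and y: "y \<in> carrier (Aut_ham P \<theta> \<Phi>)"
    have xy: "x \<otimes>\<^bsub>Aut_ham P \<theta> \<Phi>\<^esub> y = x \<circ> y" by (simp add: Aut_ham_def)
    have "x \<circ> y \<in> carrier (Aut_ham P \<theta> \<Phi>)"
      using monoid.m_closed[OF group.is_monoid[OF Aut_ham_group] x y] by (simp add: xy)
    from Psi_comp[OF x y this]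
    show "Psi P \<theta> \<Phi> (x \<otimes>\<^bsub>Aut_ham P \<theta> \<Phi>\<^esub> y) = Psi P \<theta> \<Phi> x \<otimes>\<^bsub>Hom_real G\<^esub> Psi P \<theta> \<Phi> y"
      by (simp add: xy Hom_real_def fun_eq_iff)
  qed
qed

section \<open>The derivative \<beta> of \<Psi>\<close>

lemma Psi_curve_derivative:
  assumes X: "is_ham_vf P \<theta> h X" and h: "h \<in> smooth_fun P" and eqv: "\<And>g p. pushforward P (\<Phi> g) (X p) = X (\<Phi> g p)"
    and c: "Aut_ham_curve P \<theta> \<Phi> X c"
  shows "((\<lambda>t. Psi P \<theta> \<Phi> (c t) g) has_real_derivative h (\<Phi> g p) - h p) (at 0)"
proof -
  have cs: "smooth_family P P c" "c 0 = id" and cA: "\<And>t. c t \<in> carrier (Aut_ham P \<theta> \<Phi>)"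
    and cd: "\<And>p f. f \<in> smooth_fun P \<Longrightarrow> ((\<lambda>t. f (c t p)) has_real_derivative X p f) (at 0)"
    using c by (auto simp: Aut_ham_curve_def)
  have XV: "X \<in> vector_fields P" using X by (simp add: is_ham_vf_def)
  have vel: "X p = velocity P c 0 p" for p
    by (rule velocity_eqI[OF mP cs(1) _ cd]) (simp add: cs(2) vector_field_tangent[OF XV])
  obtain F where F: "\<And>t. primitive P \<theta> (c t) (F t)" using primitive_exists[OF cA] by metis
  \<comment> \<open>The contributions of \<theta> at the two points cancel, so only the values of
    \<open>h\<close> remain in the derivative.\<close>
  have "\<theta> (\<Phi> g p) (X (\<Phi> g p)) = \<theta> p (X p)" using theta_inv[OF vector_field_tangent[OF XV], of g p] by (simp add: eqv)
  with primitive_curve_derivative[OF es conn cs F X h vel, of p "\<Phi> g p"]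
  have "((\<lambda>t. F t p - F t (\<Phi> g p)) has_real_derivative h (\<Phi> g p) - h p) (at 0)" by simp
  then show ?thesis by (simp add: Psi_eq[OF cA F])
qed

text \<open>The given curve is what makes the description of \<beta> determine a number: if no curve
  had velocity \<open>X\<close>, every \<open>b\<close> would satisfy it.\<close>

lemma beta_eq:
  assumes X: "is_ham_vf P \<theta> h X" and h: "h \<in> smooth_fun P" and eqv: "\<And>g p. pushforward P (\<Phi> g) (X p) = X (\<Phi> g p)"
    and c: "Aut_ham_curve P \<theta> \<Phi> X c"
  shows "beta P \<theta> \<Phi> X g = h (\<Phi> g p) - h p"
  unfolding beta_def
proof (rule the_equality)
  show "\<forall>c. Aut_ham_curve P \<theta> \<Phi> X c \<longrightarrow> ((\<lambda>t. Psi P \<theta> \<Phi> (c t) g) has_real_derivative h (\<Phi> g p) - h p) (at 0)"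
    using Psi_curve_derivative[OF X h eqv] by blast
next
  fix b assume "\<forall>c. Aut_ham_curve P \<theta> \<Phi> X c \<longrightarrow> ((\<lambda>t. Psi P \<theta> \<Phi> (c t) g) has_real_derivative b) (at 0)"
  then have "((\<lambda>t. Psi P \<theta> \<Phi> (c t) g) has_real_derivative b) (at 0)" using c by blast
  from DERIV_unique[OF this Psi_curve_derivative[OF X h eqv c]] show "b = h (\<Phi> g p) - h p" .
qed

lemma beta_well_defined:
  assumes X: "X \<in> aut_ham P \<theta> \<Phi>" and c: "Aut_ham_curve P \<theta> \<Phi> X c"
  shows "beta P \<theta> \<Phi> X \<in> hom G real_add_group"
    and "((\<lambda>t. Psi P \<theta> \<Phi> (c t) g) has_real_derivative beta P \<theta> \<Phi> X g) (at 0)"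
proof -
  obtain h where h: "h \<in> smooth_fun P" "is_ham_vf P \<theta> h X" and eqv: "\<And>g p. pushforward P (\<Phi> g) (X p) = X (\<Phi> g p)"
    using X by (auto simp: aut_ham_def)
  note B = beta_eq[OF h(2,1) eqv c]
  \<comment> \<open>Again the base point \<open>\<Phi> a undefined\<close> makes the increments of
    \<open>h\<close> telescope.\<close>
  have "beta P \<theta> \<Phi> X (a \<otimes>\<^bsub>G\<^esub> b) = beta P \<theta> \<Phi> X a + beta P \<theta> \<Phi> X b" for a b
    using B[of "a \<otimes>\<^bsub>G\<^esub> b" undefined] B[of a undefined] B[of b "\<Phi> a undefined"] by (simp add: act_mult)
  then show "beta P \<theta> \<Phi> X \<in> hom G real_add_group" by (auto simp: hom_def real_add_group_def)
  show "((\<lambda>t. Psi P \<theta> \<Phi> (c t) g) has_real_derivative beta P \<theta> \<Phi> X g) (at 0)"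
    unfolding B[of g undefined] by (rule Psi_curve_derivative[OF h(2,1) eqv c])
qed

lemma kernel_subset_invariant:
  assumes X: "X \<in> formal_lie_algebra_ker_Psi P \<theta> \<Phi>"
  shows "\<exists>h\<in>invariant_fun P \<Phi>. is_ham_vf P \<theta> h X"
proof -
  obtain c where c: "Aut_ham_curve P \<theta> \<Phi> X c" and Xa: "X \<in> aut_ham P \<theta> \<Phi>" and b: "beta P \<theta> \<Phi> X = (\<lambda>g. 0)"
    using X by (auto simp: formal_lie_algebra_ker_Psi_def)
  obtain h where h: "h \<in> smooth_fun P" "is_ham_vf P \<theta> h X" and eqv: "\<And>g p. pushforward P (\<Phi> g) (X p) = X (\<Phi> g p)"
    using Xa by (auto simp: aut_ham_def)
  have "h (\<Phi> g p) = h p" for g p using beta_eq[OF h(2,1) eqv c, of g p] b by simp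
  then show ?thesis using h by (intro bexI[of _ h]) (auto simp: invariant_fun_def)
qed

text \<open>The pushed field is Hamiltonian for the same function, and the Hamiltonian vector field
  of a function is unique.\<close>

lemma invariant_ham_equivariant:
  assumes h: "h \<in> smooth_fun P" "\<And>g p. h (\<Phi> g p) = h p" and X: "is_ham_vf P \<theta> h X"
  shows "pushforward P (\<Phi> g) (X p) = X (\<Phi> g p)"
proof -
  interpret S: theta_symmetry P \<theta> "\<Phi> g" "\<Phi> (inv\<^bsub>G\<^esub> g)" by (rule symmetry)
  have "is_ham_vf P \<theta> h (S.push X)" by (rule S.ham_push[OF X h(1) h(2) symmetry'])
  from ham_vf_unique[OF es this X] have "S.push X (\<Phi> g p) = X (\<Phi> g p)" by simp
  then show ?thesis by (simp add: S.push_def act_inv)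
qed

lemma invariant_subset_kernel:
  assumes h: "h \<in> invariant_fun P \<Phi>" and X: "is_ham_vf P \<theta> h X" and c: "Aut_ham_curve P \<theta> \<Phi> X c"
  shows "X \<in> formal_lie_algebra_ker_Psi P \<theta> \<Phi>"
proof -
  have hs: "h \<in> smooth_fun P" and hi: "\<And>g p. h (\<Phi> g p) = h p" using h by (auto simp: invariant_fun_def fun_eq_iff)
  note eqv = invariant_ham_equivariant[OF hs hi X]
  have "X \<in> aut_ham P \<theta> \<Phi>" using hs X eqv by (auto simp: aut_ham_def)
  moreover have "beta P \<theta> \<Phi> X = (\<lambda>g. 0)" using beta_eq[OF X hs eqv c, of _ undefined] hi by auto
  ultimately show ?thesis using c by (auto simp: formal_lie_algebra_ker_Psi_def)
qed

end

section \<open>Integral curves and flows\<close>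

text \<open>Curves are tested against smooth functions, as tangent vectors are derivations; bump
  functions then yield continuity. The derivative is two-sided, whence the open time intervals
  below.\<close>

definition icurve :: "('p::topological_space, 'e::real_normed_vector) chart set \<Rightarrow> ('p \<Rightarrow> 'p tvec) \<Rightarrow> real set \<Rightarrow> (real \<Rightarrow> 'p) \<Rightarrow> bool" where
  "icurve A X I \<gamma> \<longleftrightarrow> (\<forall>t\<in>I. \<forall>f\<in>smooth_fun A. ((\<lambda>s. f (\<gamma> s)) has_real_derivative X (\<gamma> t) f) (at t))"

lemma icurveD:
  "icurve A X I \<gamma> \<Longrightarrow> t \<in> I \<Longrightarrow> f \<in> smooth_fun A \<Longrightarrow> ((\<lambda>s. f (\<gamma> s)) has_real_derivative X (\<gamma> t) f) (at t)"
  by (simp add: icurve_def)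

lemma icurve_subset: "icurve A X I \<gamma> \<Longrightarrow> J \<subseteq> I \<Longrightarrow> icurve A X J \<gamma>"
  by (auto simp: icurve_def)

lemma icurve_shift:
  assumes "icurve A X I \<gamma>" "\<And>t. t \<in> J \<Longrightarrow> t + a \<in> I" shows "icurve A X J (\<lambda>t. \<gamma> (t + a))"
  unfolding icurve_def
proof (intro ballI)
  fix t f assume "t \<in> J" "f \<in> smooth_fun A"
  from icurveD[OF assms(1) assms(2)[OF this(1)] this(2)]
  show "((\<lambda>s. f (\<gamma> (s + a))) has_real_derivative X (\<gamma> (t + a)) f) (at t)" by (simp add: DERIV_shift)
qed

lemma icurve_cong_at:
  assumes g: "icurve A X I \<gamma>" and t: "t \<in> I" and f: "f \<in> smooth_fun A" and N: "open N" "t \<in> N" "\<And>s. s \<in> N \<Longrightarrow> \<gamma> s = \<delta> s"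
  shows "((\<lambda>s. f (\<delta> s)) has_real_derivative X (\<delta> t) f) (at t)"
proof -
  have "((\<lambda>s. f (\<delta> s)) has_real_derivative X (\<gamma> t) f) (at t)"
    by (rule has_field_derivative_transform_within_open[OF icurveD[OF g t f] N(1,2)]) (simp add: N(3))
  then show ?thesis by (simp add: N(3)[OF N(2)])
qed

lemma icurve_image:
  assumes A: "mfd A" and c: "smooth_map A A c" and X: "\<And>p. pushforward A c (X p) = X (c p)" and g: "icurve A X I \<gamma>"
  shows "icurve A X I (\<lambda>t. c (\<gamma> t))"
  unfolding icurve_def
proof (intro ballI)
  fix t f assume t: "t \<in> I" and f: "f \<in> smooth_fun A"
  from icurveD[OF g t smooth_fun_compose[OF A A c f]]
  show "((\<lambda>s. f (c (\<gamma> s))) has_real_derivative X (c (\<gamma> t)) f) (at t)"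
    by (simp add: X[symmetric] pushforward_apply[OF f])
qed

text \<open>A bump function with value 1 at \<open>\<gamma> t\<close> varies continuously along the
  curve, so it is nonzero for nearby times, which forces the curve into \<open>W\<close>.\<close>

lemma icurve_near:
  fixes A :: "('p::t2_space, 'e::real_normed_vector) chart set"
  assumes A: "mfd A" and g: "icurve A X I \<gamma>" and t: "t \<in> I" and W: "open W" "\<gamma> t \<in> W"
  shows "\<exists>d>0. \<forall>s. \<bar>s - t\<bar> < d \<longrightarrow> \<gamma> s \<in> W"
proof -
  from manifold_bump[OF A W] obtain b V K where b: "b \<in> smooth_fun A"
    and bVK: "(\<forall>q. 0 \<le> b q \<and> b q \<le> 1) \<and> open V \<and> \<gamma> t \<in> V \<and> (\<forall>q\<in>V. b q = 1)
    \<and> V \<subseteq> K \<and> compact K \<and> K \<subseteq> W \<and> (\<forall>q. q \<notin> K \<longrightarrow> b q = 0)" by (elim bexE exE)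
  then have b1: "b (\<gamma> t) = 1" and K: "K \<subseteq> W" "\<And>q. q \<notin> K \<Longrightarrow> b q = 0" by auto
  have "isCont (\<lambda>s. b (\<gamma> s)) t" by (rule DERIV_isCont[OF icurveD[OF g t b]])
  then obtain d where d: "d > 0" "\<And>s. dist s t < d \<Longrightarrow> dist (b (\<gamma> s)) (b (\<gamma> t)) < 1"
    unfolding continuous_at_eps_delta using zero_less_one by blast
  have "\<gamma> s \<in> W" if "\<bar>s - t\<bar> < d" for s
  proof -
    have "b (\<gamma> s) \<noteq> 0" using d(2)[of s] that b1 by (auto simp: dist_real_def)
    then show ?thesis using K by blast
  qed
  then show ?thesis using d(1) by blast
qed

lemma icurve_continuous:
  fixes A :: "('p::t2_space, 'e::real_normed_vector) chart set"
  assumes A: "mfd A" and g: "icurve A X I \<gamma>" shows "continuous_on I \<gamma>"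
  unfolding continuous_on_topological
proof (intro ballI allI impI)
  fix t B assume t: "t \<in> I" "open B" "\<gamma> t \<in> B"
  obtain d where "d > 0" "\<And>s. \<bar>s - t\<bar> < d \<Longrightarrow> \<gamma> s \<in> B" using icurve_near[OF A g t] by blast
  then show "\<exists>C. open C \<and> t \<in> C \<and> (\<forall>s\<in>I. s \<in> C \<longrightarrow> \<gamma> s \<in> B)"
    by (intro exI[of _ "ball t d"]) (auto simp: dist_real_def abs_minus_commute)
qed

context manifold_chart
begin

lemma icurve_coordinates:
  assumes u: "(u has_vector_derivative w) (at t)" and ut: "u t \<in> \<Omega>" and f: "f \<in> smooth_fun A"
  shows "((\<lambda>s. f (\<psi> (u s))) has_real_derivative cv (u t) w f) (at t)"
proof -
  have D: "((\<lambda>z. f (\<psi> z)) has_derivative (\<lambda>w. cv (u t) w f)) (at (u t))"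
    using smooth_on_has_derivative[OF smooth_on_coord[OF f] ut] by (simp add: cv_apply[OF f])
  from has_derivative_compose[OF u[unfolded has_vector_derivative_def] D]
  have "((\<lambda>s. f (\<psi> (u s))) has_derivative (\<lambda>s. cv (u t) (s *\<^sub>R w) f)) (at t)" .
  moreover have "(\<lambda>s. cv (u t) (s *\<^sub>R w) f) = (*) (cv (u t) w f)" by (rule ext) (simp add: cv_linear(2)[OF ut])
  ultimately show ?thesis by (simp add: has_field_derivative_def)
qed

text \<open>Cutting off the coordinate expression of the field makes it compactly supported, hence
  globally Lipschitz, so the theory on the whole model space applies. Over \<open>V\<close> the
  field is unchanged.\<close>

lemma lipschitz_field:
  assumes X: "X \<in> vector_fields A" and p: "p \<in> U"
  shows "\<exists>f V. \<exists>L\<ge>0. smooth_on UNIV f \<and> (\<forall>a b. norm (f a - f b) \<le> L * norm (a - b)) \<and> open V \<and> p \<in> V \<and> V \<subseteq> U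
    \<and> (\<forall>q\<in>V. X q = cv (\<phi> q) (f (\<phi> q)))
    \<and> (\<forall>I \<gamma>. icurve A X I \<gamma> \<longrightarrow> (\<forall>t\<in>I. \<gamma> t \<in> V \<longrightarrow> ((\<lambda>s. \<phi> (\<gamma> s)) has_vector_derivative f (\<phi> (\<gamma> t))) (at t)))"
proof -
  obtain \<xi> where \<xi>: "smooth_on \<Omega> \<xi>" "\<And>q. q \<in> U \<Longrightarrow> X q = cv (\<phi> q) (\<xi> (\<phi> q))" using field_coordinates[OF X] by blast
  obtain V1 x where V1: "open V1" "p \<in> V1" "V1 \<subseteq> U" and x: "\<And>e. x e \<in> smooth_fun A"
    and xc: "\<And>e q. q \<in> V1 \<Longrightarrow> x e q = crd e (\<phi> q)" and xV: "\<And>e q w. q \<in> V1 \<Longrightarrow> cv (\<phi> q) w (x e) = crd e w"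
    using coordinate_functions[OF p] by metis
  have "\<phi> p \<in> \<Omega>" using p by simp
  from smooth_bump[OF fd opO this] obtain \<beta> :: "'e \<Rightarrow> real" and V0 K where
    "smooth_on UNIV \<beta> \<and> (\<forall>z. 0 \<le> \<beta> z \<and> \<beta> z \<le> 1) \<and> open V0 \<and> \<phi> p \<in> V0 \<and> (\<forall>z\<in>V0. \<beta> z = 1)
    \<and> V0 \<subseteq> K \<and> compact K \<and> K \<subseteq> \<Omega> \<and> (\<forall>z. z \<notin> K \<longrightarrow> \<beta> z = 0)" by (elim exE)
  then have \<beta>: "smooth_on UNIV \<beta>" and V0: "open V0" "\<phi> p \<in> V0" "\<And>z. z \<in> V0 \<Longrightarrow> \<beta> z = 1"
    and K: "compact K" "K \<subseteq> \<Omega>" "\<And>z. z \<notin> K \<Longrightarrow> \<beta> z = 0" by auto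
  define f where "f z = (if z \<in> \<Omega> then \<beta> z *\<^sub>R \<xi> z else 0)" for z
  have f0: "f z = 0" if "z \<notin> K" for z using K(3)[OF that] by (simp add: f_def)
  have fs: "smooth_on UNIV f"
  proof (rule smooth_on_local[OF open_UNIV])
    fix z
    show "\<exists>N. open N \<and> z \<in> N \<and> smooth_on (N \<inter> UNIV) f"
    proof (cases "z \<in> \<Omega>")
      case True
      have "smooth_on \<Omega> (\<lambda>z. \<beta> z *\<^sub>R \<xi> z)" by (rule smooth_on_scaleR[OF opO smooth_on_subset[OF \<beta> subset_UNIV] \<xi>(1)])
      then have "smooth_on \<Omega> f" by (rule smooth_on_cong[OF opO, rotated]) (simp add: f_def)
      then show ?thesis using True opO by (intro exI[of _ \<Omega>]) simp
    next
      case False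
      have opK: "open (- K)" using K(1) by (simp add: compact_imp_closed open_Compl)
      have "smooth_on (- K) f" by (rule smooth_on_cong[OF opK _ smooth_on_const[of _ 0]]) (simp add: f0)
      then show ?thesis using False K(2) opK by (intro exI[of _ "- K"]) auto
    qed
  qed
  obtain L where L: "L \<ge> 0" "\<And>a b. norm (f a - f b) \<le> L * norm (a - b)"
    using compact_support_lipschitz[OF fd fs K(1) f0] by blast
  define V where "V = V1 \<inter> (U \<inter> \<phi> -` V0)"
  have V: "open V" "p \<in> V" "V \<subseteq> U" "V \<subseteq> V1"
    unfolding V_def using open_Int[OF V1(1) continuous_open_preimage[OF cont opU V0(1)]] V1 V0 p by auto
  have XV: "X q = cv (\<phi> q) (f (\<phi> q))" if "q \<in> V" for q
    using that \<xi>(2)[of q] V0(3)[of "\<phi> q"] by (auto simp: V_def f_def)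
  have "((\<lambda>s. \<phi> (\<gamma> s)) has_vector_derivative f (\<phi> (\<gamma> t))) (at t)" if g: "icurve A X I \<gamma>" and t: "t \<in> I" "\<gamma> t \<in> V" for I \<gamma> t
  proof -
    obtain d where d: "d > 0" "\<And>s. \<bar>s - t\<bar> < d \<Longrightarrow> \<gamma> s \<in> V" using icurve_near[OF A g t(1) V(1) t(2)] by blast
    \<comment> \<open>The coordinates are replaced by global functions that agree with them on
      \<open>V1\<close>, so that the defining property of an integral curve differentiates
      them.\<close>
    have "((\<lambda>s. \<Sum>e\<in>fbasis. x e (\<gamma> s) *\<^sub>R e) has_vector_derivative (\<Sum>e\<in>fbasis. X (\<gamma> t) (x e) *\<^sub>R e)) (at t)"
    proof (rule has_vector_derivative_sum)
      fix e
      show "((\<lambda>s. x e (\<gamma> s) *\<^sub>R e) has_vector_derivative X (\<gamma> t) (x e) *\<^sub>R e) (at t)"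
        using icurveD[OF g t(1) x[of e]] unfolding has_real_derivative_iff_has_vector_derivative has_vector_derivative_def
        using has_derivative_scaleR_left by fastforce
    qed
    moreover have "(\<Sum>e\<in>fbasis. X (\<gamma> t) (x e) *\<^sub>R e) = f (\<phi> (\<gamma> t))"
      using V(4) t(2) xV[of "\<gamma> t" "f (\<phi> (\<gamma> t))"] crd_expand[OF fd, of "f (\<phi> (\<gamma> t))"] by (auto simp: XV subset_iff)
    moreover have "(\<Sum>e\<in>fbasis. x e (\<gamma> s) *\<^sub>R e) = \<phi> (\<gamma> s)" if "s \<in> ball t d" for s
    proof -
      have "\<gamma> s \<in> V1" using d(2)[of s] that V(4) by (auto simp: dist_real_def abs_minus_commute)
      then show ?thesis using crd_expand[OF fd, of "\<phi> (\<gamma> s)"] by (simp add: xc)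
    qed
    ultimately show ?thesis using has_vector_derivative_transform_within_open[OF _ open_ball centre_in_ball[THEN iffD2, OF d(1)]] by (metis (no_types, lifting))
  qed
  then show ?thesis using fs L V XV by (intro exI[of _ f] exI[of _ V] exI[of _ L]) auto
qed

end

section \<open>Uniqueness of integral curves and local flows\<close>

lemma icurve_unique_local:
  fixes A :: "('p::t2_space, 'e::real_normed_vector) chart set"
  assumes A: "mfd A" and X: "X \<in> vector_fields A" and I: "open I" "t0 \<in> I"
    and g: "icurve A X I \<gamma>" and d: "icurve A X I \<delta>" and eq: "\<gamma> t0 = \<delta> t0"
  shows "\<exists>r>0. \<forall>s. \<bar>s - t0\<bar> < r \<longrightarrow> s \<in> I \<and> \<gamma> s = \<delta> s"
proof -
  obtain U \<phi> where c: "(U, \<phi>) \<in> A" "\<gamma> t0 \<in> U" using chart_cover[OF A] by blast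
  interpret C: manifold_chart A U \<phi> by unfold_locales (rule A, rule c(1))
  from C.lipschitz_field[OF X c(2)] obtain f V L where "L \<ge> 0 \<and> smooth_on UNIV f \<and> (\<forall>a b. norm (f a - f b) \<le> L * norm (a - b)) \<and> open V \<and> \<gamma> t0 \<in> V \<and> V \<subseteq> U
    \<and> (\<forall>q\<in>V. X q = C.cv (\<phi> q) (f (\<phi> q)))
    \<and> (\<forall>I \<gamma>. icurve A X I \<gamma> \<longrightarrow> (\<forall>t\<in>I. \<gamma> t \<in> V \<longrightarrow> ((\<lambda>s. \<phi> (\<gamma> s)) has_vector_derivative f (\<phi> (\<gamma> t))) (at t)))"
    by (elim exE)
  then have L: "L \<ge> 0" "\<And>a b. norm (f a - f b) \<le> L * norm (a - b)" and V: "open V" "\<gamma> t0 \<in> V" "\<delta> t0 \<in> V" "V \<subseteq> U"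
    and der: "\<And>I \<gamma> t. icurve A X I \<gamma> \<Longrightarrow> t \<in> I \<Longrightarrow> \<gamma> t \<in> V \<Longrightarrow> ((\<lambda>s. \<phi> (\<gamma> s)) has_vector_derivative f (\<phi> (\<gamma> t))) (at t)"
    by (auto simp: eq)
  obtain d1 where d1: "d1 > 0" "\<And>s. \<bar>s - t0\<bar> < d1 \<Longrightarrow> \<gamma> s \<in> V" using icurve_near[OF A g I(2) V(1,2)] by blast
  obtain d2 where d2: "d2 > 0" "\<And>s. \<bar>s - t0\<bar> < d2 \<Longrightarrow> \<delta> s \<in> V" using icurve_near[OF A d I(2) V(1,3)] by blast
  obtain d3 where d3: "d3 > 0" "ball t0 d3 \<subseteq> I" using I openE by blast
  define r where "r = min d1 (min d2 d3) / 2"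
  have r: "r > 0" using d1(1) d2(1) d3(1) by (simp add: r_def)
  have in_I: "s \<in> I" "\<gamma> s \<in> V" "\<delta> s \<in> V" if "\<bar>s - t0\<bar> \<le> r" for s
    using that r d1(2)[of s] d2(2)[of s] d3(2) by (auto simp: r_def subset_iff dist_real_def abs_minus_commute)
  have "\<gamma> s = \<delta> s" if s: "\<bar>s - t0\<bar> \<le> r" for s
  proof -
    define u where "u \<tau> = \<phi> (\<gamma> (\<tau> + t0)) - \<phi> (\<delta> (\<tau> + t0))" for \<tau>
    have "norm (u (s - t0)) \<le> (norm (u 0) + 0 * r) * exp (L * r)"
    proof (rule gronwall[OF _ _ L(1) order_refl s])
      fix \<tau> :: real assume \<tau>: "\<bar>\<tau>\<bar> \<le> r"
      then have \<tau>': "\<bar>\<tau> + t0 - t0\<bar> \<le> r" by simp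
      have sh: "((\<lambda>\<tau>. \<tau> + t0) has_real_derivative 1) (at \<tau>)" by (auto intro!: derivative_eq_intros)
      have "((\<lambda>\<tau>. \<phi> (\<eta> (\<tau> + t0))) has_vector_derivative f (\<phi> (\<eta> (\<tau> + t0)))) (at \<tau>)"
        if "icurve A X I \<eta>" "\<eta> (\<tau> + t0) \<in> V" for \<eta>
        using vector_diff_chain_at[OF sh[unfolded has_real_derivative_iff_has_vector_derivative] der[OF that(1) in_I(1)[OF \<tau>'] that(2)]] by (simp add: o_def)
      from has_vector_derivative_diff[OF this[OF g in_I(2)[OF \<tau>']] this[OF d in_I(3)[OF \<tau>']]]
      show "(u has_vector_derivative f (\<phi> (\<gamma> (\<tau> + t0))) - f (\<phi> (\<delta> (\<tau> + t0)))) (at \<tau>)" by (simp add: u_def[abs_def])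
      show "norm (f (\<phi> (\<gamma> (\<tau> + t0))) - f (\<phi> (\<delta> (\<tau> + t0)))) \<le> L * norm (u \<tau>) + 0" using L(2) by (simp add: u_def)
    qed
    then have "\<phi> (\<gamma> s) = \<phi> (\<delta> s)" by (simp add: u_def eq)
    then have "C.\<psi> (\<phi> (\<gamma> s)) = C.\<psi> (\<phi> (\<delta> s))" by simp
    then show ?thesis using in_I[OF s] V(4) by (simp add: C.inv subset_iff)
  qed
  then show ?thesis using r in_I(1) by (intro exI[of _ r]) auto
qed

text \<open>Gronwall's inequality in a chart makes the set of agreement open, and the Hausdorff
  property does the same for its complement in \<open>I\<close>; the interval is connected.\<close>

lemma icurve_unique:
  fixes A :: "('p::t2_space, 'e::real_normed_vector) chart set"
  assumes A: "mfd A" and X: "X \<in> vector_fields A" and I: "open I" "connected I" "t0 \<in> I"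
    and g: "icurve A X I \<gamma>" and d: "icurve A X I \<delta>" and eq: "\<gamma> t0 = \<delta> t0" and t: "t \<in> I"
  shows "\<gamma> t = \<delta> t"
proof (rule ccontr)
  assume ne: "\<gamma> t \<noteq> \<delta> t"
  define E where "E = {s \<in> I. \<gamma> s = \<delta> s}"
  define N where "N = {s \<in> I. \<gamma> s \<noteq> \<delta> s}"
  have "open E"
  proof (rule openI)
    fix s assume "s \<in> E"
    then obtain r where "r > 0" "\<And>s'. \<bar>s' - s\<bar> < r \<Longrightarrow> s' \<in> I \<and> \<gamma> s' = \<delta> s'"
      using icurve_unique_local[OF A X I(1) _ g d, of s] by (auto simp: E_def)
    then show "\<exists>r>0. ball s r \<subseteq> E"
      by (intro exI[of _ r]) (auto simp: E_def dist_real_def abs_minus_commute)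
  qed
  moreover have "open N"
  proof (rule openI)
    fix s assume "s \<in> N"
    then have s: "s \<in> I" "\<gamma> s \<noteq> \<delta> s" by (auto simp: N_def)
    obtain B C where BC: "open B" "open C" "\<gamma> s \<in> B" "\<delta> s \<in> C" "B \<inter> C = {}" using hausdorff[OF s(2)] by blast
    obtain d1 where d1: "d1 > 0" "\<And>s'. \<bar>s' - s\<bar> < d1 \<Longrightarrow> \<gamma> s' \<in> B" using icurve_near[OF A g s(1) BC(1,3)] by blast
    obtain d2 where d2: "d2 > 0" "\<And>s'. \<bar>s' - s\<bar> < d2 \<Longrightarrow> \<delta> s' \<in> C" using icurve_near[OF A d s(1) BC(2,4)] by blast
    obtain d3 where d3: "d3 > 0" "ball s d3 \<subseteq> I" using I(1) s(1) openE by blast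
    have "ball s (min d1 (min d2 d3)) \<subseteq> N"
    proof
      fix s' assume "s' \<in> ball s (min d1 (min d2 d3))"
      then have "\<gamma> s' \<in> B" "\<delta> s' \<in> C" "s' \<in> I" using d1(2)[of s'] d2(2)[of s'] d3(2) by (auto simp: dist_real_def abs_minus_commute)
      then show "s' \<in> N" using BC(5) by (auto simp: N_def)
    qed
    then show "\<exists>r>0. ball s r \<subseteq> N" using d1(1) d2(1) d3(1) by (intro exI[of _ "min d1 (min d2 d3)"]) simp
  qed
  ultimately have "E \<inter> I = {} \<or> N \<inter> I = {}"
    using I(2) by (intro connectedD) (auto simp: E_def N_def)
  then show False using I(3) eq t ne by (auto simp: E_def N_def)
qed

text \<open>The cut-off field has a smooth flow for all times. It solves the original equation while
  it stays over \<open>V\<close>, which by continuity holds for a common short time on a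
  neighbourhood of \<open>p\<close>.\<close>

lemma flow_box:
  fixes A :: "('p::t2_space, 'e::real_normed_vector) chart set"
  assumes A: "mfd A" and X: "X \<in> vector_fields A"
  shows "\<exists>\<epsilon> W F. \<epsilon> > 0 \<and> open W \<and> p \<in> W \<and>
    smooth_map_on ({-\<epsilon><..<\<epsilon>} \<times> W) (prod_atlas (model_atlas :: (real, real) chart set) A) A (\<lambda>z. F (fst z) (snd z)) \<and>
    (\<forall>q\<in>W. F 0 q = q \<and> icurve A X {-\<epsilon><..<\<epsilon>} (\<lambda>t. F t q))"
proof -
  obtain U \<phi> where c: "(U, \<phi>) \<in> A" "p \<in> U" using chart_cover[OF A] by blast
  interpret C: manifold_chart A U \<phi> by unfold_locales (rule A, rule c(1))
  from C.lipschitz_field[OF X c(2)] obtain f V L where "L \<ge> 0 \<and> smooth_on UNIV f \<and> (\<forall>a b. norm (f a - f b) \<le> L * norm (a - b)) \<and> open V \<and> p \<in> V \<and> V \<subseteq> U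
    \<and> (\<forall>q\<in>V. X q = C.cv (\<phi> q) (f (\<phi> q)))
    \<and> (\<forall>I \<gamma>. icurve A X I \<gamma> \<longrightarrow> (\<forall>t\<in>I. \<gamma> t \<in> V \<longrightarrow> ((\<lambda>s. \<phi> (\<gamma> s)) has_vector_derivative f (\<phi> (\<gamma> t))) (at t)))"
    by (elim exE)
  then have L: "L \<ge> 0" "\<And>a b. norm (f a - f b) \<le> L * norm (a - b)" and f: "smooth_on UNIV f" and V: "open V" "p \<in> V" "V \<subseteq> U"
    and XV: "\<And>q. q \<in> V \<Longrightarrow> X q = C.cv (\<phi> q) (f (\<phi> q))" by auto
  obtain y where "smooth_on UNIV (\<lambda>(t, x). y t x) \<and> (\<forall>x. y 0 x = x) \<and>
    (\<forall>t x. ((\<lambda>t. y t x) has_vector_derivative f (y t x)) (at t))"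
    using smooth_flow[OF C.fd f L] by (elim exE)
  then have y: "smooth_on UNIV (\<lambda>z. y (fst z) (snd z))" "\<And>x. y 0 x = x" "\<And>t x. ((\<lambda>t. y t x) has_vector_derivative f (y t x)) (at t)"
    by (auto simp: split_def)
  have opV: "open (\<phi> ` V)" by (rule C.op_im[OF V(1,3)])
  have fd2: "fin_dim TYPE(real \<times> 'e)" by (rule fin_dim_prod[OF fin_dim_real C.fd])
  have "open ((\<lambda>z. y (fst z) (snd z)) -` (\<phi> ` V))"
    using continuous_open_preimage[OF smooth_on_continuous_on[OF open_UNIV y(1)] open_UNIV opV] by simp
  moreover have "(0, \<phi> p) \<in> (\<lambda>z. y (fst z) (snd z)) -` (\<phi> ` V)" using V(2) y(2) by simp
  ultimately obtain T B where TB: "open T" "open B" "(0, \<phi> p) \<in> T \<times> B" "T \<times> B \<subseteq> (\<lambda>z. y (fst z) (snd z)) -` (\<phi> ` V)"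
    by (rule open_prod_elim)
  obtain \<epsilon> where \<epsilon>: "\<epsilon> > 0" "ball 0 \<epsilon> \<subseteq> T" using TB(1,3) openE by blast
  define W where "W = U \<inter> \<phi> -` B"
  have W: "open W" "p \<in> W" "W \<subseteq> U"
    unfolding W_def using continuous_open_preimage[OF C.cont C.opU TB(2)] TB(3) c(2) by auto
  define F where "F t q = C.\<psi> (y t (\<phi> q))" for t q
  have in_V: "y t (\<phi> q) \<in> \<phi> ` V" if "t \<in> {-\<epsilon><..<\<epsilon>}" "q \<in> W" for t q
  proof -
    have "t \<in> T" using \<epsilon>(2) that(1) by (auto simp: dist_real_def subset_iff)
    then have "(t, \<phi> q) \<in> T \<times> B" using that(2) by (simp add: W_def)
    then show ?thesis using TB(4) by auto
  qed
  have VO: "\<phi> ` V \<subseteq> C.\<Omega>" using V(3) by blast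
  let ?Q = "prod_atlas (model_atlas :: (real, real) chart set) A"
  let ?S = "{-\<epsilon><..<\<epsilon>} \<times> W"
  have Q: "mfd ?Q" by (rule mfd_prod[OF mfd_real A])
  have opS: "open ?S" by (rule open_Times[OF open_greaterThanLessThan W(1)])
  have \<phi>: "smooth_map_on ?S ?Q model_atlas (\<lambda>z. \<phi> (snd z))"
    by (rule smooth_map_on_compose[OF Q A mfd_model[OF C.fd] opS C.opU smooth_map_on_snd[OF mfd_real A opS] C.sm]) (use W in auto)
  have "smooth_map_on ?S ?Q model_atlas (\<lambda>z. (fst z, \<phi> (snd z)))"
    using smooth_map_on_Pair[OF mfd_real mfd_model[OF C.fd] Q opS smooth_map_on_fst[OF mfd_real A opS] \<phi>] by (simp only: prod_atlas_model)
  note smooth_map_on_model_compose[OF Q fd2 C.fd opS open_UNIV this y(1) UNIV_I]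
  then have ys: "smooth_map_on ?S ?Q model_atlas (\<lambda>z. y (fst z) (\<phi> (snd z)))" by simp
  have "y (fst z) (\<phi> (snd z)) \<in> C.\<Omega>" if "z \<in> ?S" for z using in_V[of "fst z" "snd z"] that VO by auto
  from smooth_map_on_compose[OF Q mfd_model[OF C.fd] A opS C.opO ys C.sm_inv this]
  have "smooth_map_on ?S ?Q A (\<lambda>z. F (fst z) (snd z))" unfolding F_def .
  moreover have "F 0 q = q" if "q \<in> W" for q using that W(3) by (auto simp: F_def y(2) C.inv)
  moreover have "icurve A X {-\<epsilon><..<\<epsilon>} (\<lambda>t. F t q)" if q: "q \<in> W" for q
    unfolding icurve_def
  proof (intro ballI)
    fix t g assume t: "t \<in> {-\<epsilon><..<\<epsilon>}" and g: "g \<in> smooth_fun A"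
    obtain q' where q': "q' \<in> V" "y t (\<phi> q) = \<phi> q'" using in_V[OF t q] by blast
    have F': "F t q = q'" using q' V(3) by (auto simp: F_def C.inv)
    have "y t (\<phi> q) \<in> C.\<Omega>" using in_V[OF t q] VO by blast
    from C.icurve_coordinates[OF y(3) this g]
    show "((\<lambda>s. g (F s q)) has_real_derivative X (F t q) g) (at t)"
      unfolding F' XV[OF q'(1)] by (simp add: F_def q'(2))
  qed
  ultimately show ?thesis using \<epsilon>(1) W by blast
qed

section \<open>Completeness and global flows\<close>

lemma connected_symmetric_interval: "connected {-\<delta><..<\<delta>::real}"
  by (simp add: is_interval_connected_1 is_interval_oo)

text \<open>A common life time on an invariant set can be doubled: follow the curve for half of the
  time and restart from the point reached.\<close>

lemma icurve_extend:
  fixes A :: "('p::t2_space, 'e::real_normed_vector) chart set"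
  assumes A: "mfd A" and X: "X \<in> vector_fields A" and \<delta>: "\<delta> > 0"
    and F: "\<And>q. q \<in> D \<Longrightarrow> F q 0 = q" "\<And>q. q \<in> D \<Longrightarrow> icurve A X {-\<delta><..<\<delta>} (F q)" "\<And>q t. q \<in> D \<Longrightarrow> t \<in> {-\<delta><..<\<delta>} \<Longrightarrow> F q t \<in> D"
  shows "\<exists>G. \<forall>q\<in>D. G q 0 = q \<and> icurve A X {-(2*\<delta>)<..<2*\<delta>} (G q) \<and> (\<forall>t\<in>{-(2*\<delta>)<..<2*\<delta>}. G q t \<in> D)"
proof -
  have grp: "F (F q b) a = F q (a + b)" if q: "q \<in> D" and ab: "\<bar>a\<bar> < \<delta>" "\<bar>b\<bar> < \<delta>" "\<bar>a + b\<bar> < \<delta>" for q a b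
  proof -
    let ?I = "{-\<delta><..<\<delta>} \<inter> {-\<delta>-b<..<\<delta>-b}"
    have b: "b \<in> {-\<delta><..<\<delta>}" using ab by auto
    have I: "open ?I" by (intro open_Int open_greaterThanLessThan)
    have cI: "connected ?I"
      by (intro iffD1[OF is_interval_connected_1] is_interval_Int is_interval_oo)
    have 1: "icurve A X ?I (F (F q b))" by (rule icurve_subset[OF F(2)[OF F(3)[OF q b]]]) auto
    have 2: "icurve A X ?I (\<lambda>a. F q (a + b))" by (rule icurve_shift[OF F(2)[OF q]]) auto
    show ?thesis
      by (rule icurve_unique[OF A X I cI _ 1 2, of 0]) (use ab b \<delta> F(1)[OF F(3)[OF q b]] in auto)
  qed
  define G where "G q t = F (F q (t / 2)) (t / 2)" for q t
  have "G q 0 = q" if "q \<in> D" for q using F(1) that by (simp add: G_def)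
  moreover have "G q t \<in> D" if "q \<in> D" "t \<in> {-(2*\<delta>)<..<2*\<delta>}" for q t
    unfolding G_def using that by (intro F(3)) auto
  moreover have "icurve A X {-(2*\<delta>)<..<2*\<delta>} (G q)" if q: "q \<in> D" for q
    unfolding icurve_def
  proof (intro ballI)
    fix t0 f assume t0: "t0 \<in> {-(2*\<delta>)<..<2*\<delta>}" and f: "f \<in> smooth_fun A"
    define y where "y = F q (t0 / 2)"
    have y: "y \<in> D" unfolding y_def by (rule F(3)[OF q]) (use t0 in auto)
    \<comment> \<open>Near \<open>t0\<close> the two halves merge into one integral curve started at
      \<open>y\<close>. The three intervals keep the times \<open>t/2\<close>,
      \<open>t - t0/2\<close> and \<open>t/2 - t0/2\<close> within the reach of
      \<open>grp\<close>.\<close>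
    let ?N = "{-(2*\<delta>)<..<2*\<delta>} \<inter> {t0/2-\<delta><..<t0/2+\<delta>} \<inter> {t0-2*\<delta><..<t0+2*\<delta>}"
    have N: "open ?N" "t0 \<in> ?N" using t0 \<delta> by (auto intro!: open_Int)
    have eq: "F y (t + (- t0/2)) = G q t" if t: "t \<in> ?N" for t
    proof -
      have "F q (t / 2) = F y (t / 2 - t0 / 2)"
        unfolding y_def using grp[OF q, of "t/2 - t0/2" "t0/2"] t t0 by (simp add: abs_less_iff)
      moreover have "F (F y (t / 2 - t0 / 2)) (t / 2) = F y (t - t0 / 2)"
        using grp[OF y, of "t/2" "t/2 - t0/2"] t t0 by (simp add: abs_less_iff field_simps)
      ultimately show ?thesis by (simp add: G_def)
    qed
    have "icurve A X {t0} (\<lambda>t. F y (t + (- t0/2)))" by (rule icurve_shift[OF F(2)[OF y]]) (use t0 in auto)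
    from icurve_cong_at[OF this _ f N eq]
    show "((\<lambda>s. f (G q s)) has_real_derivative X (G q t0) f) (at t0)" by simp
  qed
  ultimately show ?thesis by blast
qed

lemma icurve_complete:
  fixes A :: "('p::t2_space, 'e::real_normed_vector) chart set"
  assumes A: "mfd A" and X: "X \<in> vector_fields A" and \<delta>: "\<delta> > 0"
    and D: "\<And>q. q \<in> D \<Longrightarrow> \<exists>\<gamma>. \<gamma> 0 = q \<and> icurve A X {-\<delta><..<\<delta>} \<gamma> \<and> (\<forall>t\<in>{-\<delta><..<\<delta>}. \<gamma> t \<in> D)" and q: "q \<in> D"
  shows "\<exists>\<gamma>. \<gamma> 0 = q \<and> icurve A X UNIV \<gamma>"
proof -
  \<comment> \<open>Life times after \<open>n\<close> doublings; they exhaust the real line.\<close>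
  define J where "J n = {-(2^n*\<delta>)<..<2^n*\<delta>}" for n :: nat
  have "\<exists>F. \<forall>q\<in>D. F q 0 = q \<and> icurve A X (J n) (F q) \<and> (\<forall>t\<in>J n. F q t \<in> D)" for n
  proof (induction n)
    case 0 show ?case using bchoice[of D "\<lambda>q \<gamma>. \<gamma> 0 = q \<and> icurve A X {-\<delta><..<\<delta>} \<gamma> \<and> (\<forall>t\<in>{-\<delta><..<\<delta>}. \<gamma> t \<in> D)"] D by (simp add: J_def)
  next
    case (Suc n)
    then obtain F where "\<And>q. q \<in> D \<Longrightarrow> F q 0 = q" "\<And>q. q \<in> D \<Longrightarrow> icurve A X (J n) (F q)" "\<And>q t. q \<in> D \<Longrightarrow> t \<in> J n \<Longrightarrow> F q t \<in> D"
      by blast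
    from icurve_extend[OF A X _ this[unfolded J_def]] \<delta> show ?case by (simp add: J_def mult.assoc)
  qed
  then have "\<forall>n. \<exists>\<gamma>. \<gamma> 0 = q \<and> icurve A X (J n) \<gamma>" using q by blast
  from choice[OF this] obtain F where F: "\<And>n. F n 0 = q" "\<And>n. icurve A X (J n) (F n)" by blast
  have "\<exists>n. t \<in> J n" for t
  proof -
    obtain n where "\<bar>t\<bar> / \<delta> < 2 ^ n" using real_arch_pow[of 2 "\<bar>t\<bar> / \<delta>"] by auto
    then have "\<bar>t\<bar> < 2 ^ n * \<delta>" using \<delta> by (simp add: field_simps)
    then show ?thesis by (intro exI[of _ n]) (auto simp: J_def)
  qed
  then obtain N where N: "\<And>t. t \<in> J (N t)" by metis
  have agree: "F n t = F m t" if "t \<in> J n" "t \<in> J m" for n m t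
  proof -
    have o: "open (J n \<inter> J m)" unfolding J_def by (intro open_Int open_greaterThanLessThan)
    have k: "connected (J n \<inter> J m)" unfolding J_def by (intro iffD1[OF is_interval_connected_1] is_interval_Int is_interval_oo)
    show ?thesis
      by (rule icurve_unique[OF A X o k _ icurve_subset[OF F(2)] icurve_subset[OF F(2)], of 0]) (use that \<delta> F(1) in \<open>auto simp: J_def\<close>)
  qed
  have "icurve A X UNIV (\<lambda>t. F (N t) t)"
    unfolding icurve_def
  proof (intro ballI)
    fix t f assume f: "f \<in> smooth_fun A"
    have "open (J (N t))" by (simp add: J_def)
    from icurve_cong_at[OF F(2) N f this N agree[OF _ N]]
    show "((\<lambda>s. f (F (N s) s)) has_real_derivative X (F (N t) t) f) (at t)" by simp
  qed
  then show ?thesis using F(1) by (intro exI[of _ "\<lambda>t. F (N t) t"]) simp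
qed

text \<open>The set \<open>G p\<close> of times at which the flow is jointly smooth near
  \<open>p\<close> contains 0 and is open and closed: smoothness at a time \<open>a\<close> passes
  to neighbouring times by composing with a flow box.\<close>

lemma complete_flow:
  fixes A :: "('p::t2_space, 'e::real_normed_vector) chart set"
  assumes A: "mfd A" and X: "X \<in> vector_fields A" and ex: "\<And>p. \<exists>\<gamma>. \<gamma> 0 = p \<and> icurve A X UNIV \<gamma>"
  shows "\<exists>\<Theta>. smooth_family A A \<Theta> \<and> (\<forall>p. \<Theta> 0 p = p \<and> icurve A X UNIV (\<lambda>t. \<Theta> t p))"
proof -
  have "\<forall>p. \<exists>\<gamma>. \<gamma> 0 = p \<and> icurve A X UNIV \<gamma>" using ex by blast
  from choice[OF this] obtain \<Gamma> where \<Gamma>: "\<And>p. \<Gamma> p 0 = p" "\<And>p. icurve A X UNIV (\<Gamma> p)" by blast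
  let ?Q = "prod_atlas (model_atlas :: (real, real) chart set) A"
  have Q: "mfd ?Q" by (rule mfd_prod[OF mfd_real A])
  have restart: "\<Gamma> p (t + a) = \<eta> t" if F: "icurve A X {-\<epsilon><..<\<epsilon>} \<eta>" "\<eta> 0 = \<Gamma> p a" and t: "\<bar>t\<bar> < \<epsilon>" for p a t \<eta> \<epsilon>
    by (rule icurve_unique[OF A X open_greaterThanLessThan connected_symmetric_interval _ icurve_shift[OF \<Gamma>(2)] F(1), of 0])
       (use t F(2) in auto)
  define G where "G p = {t. \<exists>N. open N \<and> (t, p) \<in> N \<and> smooth_map_on N ?Q A (\<lambda>z. \<Gamma> (snd z) (fst z))}" for p
  have 0: "0 \<in> G p" for p
  proof -
    from flow_box[OF A X, of p] obtain \<epsilon> W F where "\<epsilon> > 0 \<and> open W \<and> p \<in> W \<and>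
      smooth_map_on ({-\<epsilon><..<\<epsilon>} \<times> W) ?Q A (\<lambda>z. F (fst z) (snd z)) \<and> (\<forall>q\<in>W. F 0 q = q \<and> icurve A X {-\<epsilon><..<\<epsilon>} (\<lambda>t. F t q))"
      by (elim exE)
    then have \<epsilon>: "\<epsilon> > 0" and W: "open W" "p \<in> W" and Fs: "smooth_map_on ({-\<epsilon><..<\<epsilon>} \<times> W) ?Q A (\<lambda>z. F (fst z) (snd z))"
      and F: "\<And>q. q \<in> W \<Longrightarrow> F 0 q = q" "\<And>q. q \<in> W \<Longrightarrow> icurve A X {-\<epsilon><..<\<epsilon>} (\<lambda>t. F t q)" by auto
    have o: "open ({-\<epsilon><..<\<epsilon>} \<times> W)" by (rule open_Times[OF open_greaterThanLessThan W(1)])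
    have "F (fst z) (snd z) = \<Gamma> (snd z) (fst z)" if "z \<in> {-\<epsilon><..<\<epsilon>} \<times> W" for z
    proof -
      have "snd z \<in> W" "\<bar>fst z\<bar> < \<epsilon>" using that by auto
      then show ?thesis using restart[OF F(2), of "snd z" "snd z" 0 "fst z"] F(1) \<Gamma>(1) by simp
    qed
    from smooth_map_on_cong[OF Q A o Fs this] show ?thesis
      unfolding G_def using o \<epsilon> W(2) by (intro CollectI exI[of _ "{-\<epsilon><..<\<epsilon>} \<times> W"]) auto
  qed
  \<comment> \<open>One radius works for all \<open>a\<close> near \<open>t0\<close>, whether
    \<open>t0\<close> belongs to \<open>G p\<close> or not. This gives openness of
    \<open>G p\<close> and of its complement alike.\<close>
  have near: "\<exists>\<epsilon>>0. \<forall>a t. \<bar>a - t0\<bar> < \<epsilon> \<longrightarrow> \<bar>t - t0\<bar> < \<epsilon> \<longrightarrow> a \<in> G p \<longrightarrow> t \<in> G p" for p t0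
  proof -
    from flow_box[OF A X, of "\<Gamma> p t0"] obtain \<epsilon> W F where "\<epsilon> > 0 \<and> open W \<and> \<Gamma> p t0 \<in> W \<and>
      smooth_map_on ({-\<epsilon><..<\<epsilon>} \<times> W) ?Q A (\<lambda>z. F (fst z) (snd z)) \<and> (\<forall>q\<in>W. F 0 q = q \<and> icurve A X {-\<epsilon><..<\<epsilon>} (\<lambda>t. F t q))"
      by (elim exE)
    then have \<epsilon>: "\<epsilon> > 0" and W: "open W" "\<Gamma> p t0 \<in> W" and Fs: "smooth_map_on ({-\<epsilon><..<\<epsilon>} \<times> W) ?Q A (\<lambda>z. F (fst z) (snd z))"
      and F: "\<And>q. q \<in> W \<Longrightarrow> F 0 q = q" "\<And>q. q \<in> W \<Longrightarrow> icurve A X {-\<epsilon><..<\<epsilon>} (\<lambda>t. F t q)" by auto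
    have oF: "open ({-\<epsilon><..<\<epsilon>} \<times> W)" by (rule open_Times[OF open_greaterThanLessThan W(1)])
    obtain d where d: "d > 0" "\<And>s. \<bar>s - t0\<bar> < d \<Longrightarrow> \<Gamma> p s \<in> W" using icurve_near[OF A \<Gamma>(2) UNIV_I W] by blast
    have "t \<in> G p" if a: "\<bar>a - t0\<bar> < min d (\<epsilon>/2)" and t: "\<bar>t - t0\<bar> < min d (\<epsilon>/2)" and aG: "a \<in> G p" for a t
    proof -
      obtain N where N: "open N" "(a, p) \<in> N" "smooth_map_on N ?Q A (\<lambda>z. \<Gamma> (snd z) (fst z))" using aG by (auto simp: G_def)
      define B where "B = Pair a -` N"
      have B: "open B" unfolding B_def by (rule open_vimage[OF N(1)]) (intro continuous_intros)
      have "smooth_map_on B A ?Q (\<lambda>q. (a, q))"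
        by (rule smooth_map_on_Pair[OF mfd_real A A B smooth_map_on_const[OF A B] smooth_map_on_id[OF A]])
      from smooth_map_on_compose[OF A Q A B N(1) this N(3)]
      have m: "smooth_map_on B A A (\<lambda>q. \<Gamma> q a)" by (simp add: B_def)
      define C where "C = B \<inter> (\<lambda>q. \<Gamma> q a) -` W"
      have C: "open C" unfolding C_def by (rule continuous_open_preimage[OF smooth_map_on_continuous[OF m] B W(1)])
      have pC: "p \<in> C" using N(2) d(2)[of a] a by (simp add: C_def B_def)
      \<comment> \<open>On this set the flow at time \<open>t\<close> is the flow box for time
        \<open>t - a\<close> applied to \<open>\<Gamma> q a\<close>.\<close>
      let ?N = "{a-\<epsilon><..<a+\<epsilon>} \<times> C"
      have oN: "open ?N" by (rule open_Times[OF open_greaterThanLessThan C])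
      have s1: "smooth_map_on ?N ?Q model_atlas (\<lambda>z. fst z - a)"
        by (rule smooth_map_on_diff[OF Q oN smooth_map_on_fst[OF mfd_real A oN] smooth_map_on_const[OF Q oN]])
      have s2: "smooth_map_on ?N ?Q A (\<lambda>z. \<Gamma> (snd z) a)"
        by (rule smooth_map_on_compose[OF Q A A oN B smooth_map_on_snd[OF mfd_real A oN] m]) (auto simp: C_def)
      have "smooth_map_on ?N ?Q A (\<lambda>z. F (fst (fst z - a, \<Gamma> (snd z) a)) (snd (fst z - a, \<Gamma> (snd z) a)))"
        by (rule smooth_map_on_compose[OF Q Q A oN oF smooth_map_on_Pair[OF mfd_real A Q oN s1 s2] Fs]) (auto simp: C_def)
      then have sN: "smooth_map_on ?N ?Q A (\<lambda>z. \<Gamma> (snd z) (fst z))"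
      proof (rule smooth_map_on_cong[OF Q A oN])
        fix z assume z: "z \<in> ?N"
        then have "\<Gamma> (snd z) a \<in> W" "\<bar>fst z - a\<bar> < \<epsilon>" by (auto simp: C_def)
        then show "F (fst (fst z - a, \<Gamma> (snd z) a)) (snd (fst z - a, \<Gamma> (snd z) a)) = \<Gamma> (snd z) (fst z)"
          using restart[OF F(2), of "\<Gamma> (snd z) a" "snd z" a "fst z - a"] F(1) z by (simp add: abs_less_iff algebra_simps)
      qed
      have "a - \<epsilon> < t" "t < a + \<epsilon>" using a t by linarith+
      then have "(t, p) \<in> ?N" using pC by simp
      then show ?thesis unfolding G_def by (intro CollectI exI[of _ ?N] conjI oN sN)
    qed
    moreover have "min d (\<epsilon>/2) > 0" using d(1) \<epsilon> by simp
    ultimately show ?thesis by blast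
  qed
  have G: "G p = UNIV" for p
  proof (rule ccontr)
    assume ne: "G p \<noteq> UNIV"
    have "open (G p)"
    proof (rule openI)
      fix a assume a: "a \<in> G p"
      obtain \<epsilon> where "\<epsilon> > 0" "\<And>a' t. \<bar>a' - a\<bar> < \<epsilon> \<Longrightarrow> \<bar>t - a\<bar> < \<epsilon> \<Longrightarrow> a' \<in> G p \<Longrightarrow> t \<in> G p" using near[of a p] by (elim exE conjE) blast
      then have "t \<in> ball a \<epsilon> \<Longrightarrow> t \<in> G p" for t using a by (metis abs_0 abs_minus_commute diff_self dist_real_def mem_ball)
      then show "\<exists>e>0. ball a e \<subseteq> G p" using \<open>\<epsilon> > 0\<close> by blast
    qed
    moreover have "open (- G p)"
    proof (rule openI)
      fix a assume a: "a \<in> - G p"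
      obtain \<epsilon> where "\<epsilon> > 0" "\<And>a' t. \<bar>a' - a\<bar> < \<epsilon> \<Longrightarrow> \<bar>t - a\<bar> < \<epsilon> \<Longrightarrow> a' \<in> G p \<Longrightarrow> t \<in> G p" using near[of a p] by (elim exE conjE) blast
      then have "t \<in> ball a \<epsilon> \<Longrightarrow> t \<notin> G p" for t using a by (metis abs_0 abs_minus_commute diff_self dist_real_def mem_ball Compl_iff)
      then show "\<exists>e>0. ball a e \<subseteq> - G p" using \<open>\<epsilon> > 0\<close> by blast
    qed
    ultimately have "G p \<inter> UNIV = {} \<or> - G p \<inter> UNIV = {}"
      by (intro connectedD[OF connected_UNIV]) auto
    then show False using 0 ne by auto
  qed
  have "smooth_map ?Q A (\<lambda>z. \<Gamma> (snd z) (fst z))"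
  proof (rule smooth_map_on_local[OF Q A open_UNIV])
    fix z :: "real \<times> 'p"
    have "fst z \<in> G (snd z)" by (simp add: G)
    then show "\<exists>W. open W \<and> z \<in> W \<and> W \<subseteq> UNIV \<and> smooth_map_on W ?Q A (\<lambda>z. \<Gamma> (snd z) (fst z))" by (auto simp: G_def)
  qed
  then have "smooth_family A A (\<lambda>t p. \<Gamma> p t)" by (rule smooth_familyI)
  then show ?thesis using \<Gamma> by (intro exI[of _ "\<lambda>t p. \<Gamma> p t"]) auto
qed

section \<open>Invariant Hamiltonians generate curves of automorphisms\<close>

lemma smooth_fun_prod:
  fixes b :: "nat \<Rightarrow> 'p::topological_space \<Rightarrow> real"
  assumes A: "mfd A" and b: "\<And>i. b i \<in> smooth_fun A"
  shows "(\<lambda>p. \<Prod>i\<le>n. b i p) \<in> smooth_fun A"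
  by (induction n) (auto simp: b intro!: smooth_fun_mult[OF A])

text \<open>With countably many bumps \<open>b i\<close> that take the value 1 on a cover,
  \<open>r\<close> sums the products of \<open>1 - b i\<close> over \<open>i \<le> n\<close>. Where
  \<open>b j = 1\<close> all products from \<open>j\<close> on vanish, so the sum is locally finite;
  outside the first \<open>n\<close> compact sets the first \<open>n\<close> products are 1, so
  there \<open>r\<close> is at least \<open>n\<close>.\<close>

lemma proper_function:
  fixes A :: "('p::{t2_space, second_countable_topology}, 'e::real_normed_vector) chart set"
  assumes A: "mfd A"
  shows "\<exists>r\<in>smooth_fun A. \<forall>a. compact {p. r p \<le> a}"
proof -
  have "\<forall>p. \<exists>b V K. b \<in> smooth_fun A \<and> (\<forall>q. 0 \<le> b q \<and> b q \<le> 1) \<and> open V \<and> p \<in> V \<and> (\<forall>q\<in>V. b q = 1)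
    \<and> compact K \<and> (\<forall>q. q \<notin> K \<longrightarrow> b q = 0)"
  proof
    fix p
    from manifold_bump[OF A open_UNIV UNIV_I, of p] obtain b V K where "b \<in> smooth_fun A" "(\<forall>q. 0 \<le> b q \<and> b q \<le> 1) \<and> open V \<and> p \<in> V \<and> (\<forall>q\<in>V. b q = 1)
      \<and> V \<subseteq> K \<and> compact K \<and> K \<subseteq> UNIV \<and> (\<forall>q. q \<notin> K \<longrightarrow> b q = 0)" by (elim bexE exE)
    then show "\<exists>b V K. b \<in> smooth_fun A \<and> (\<forall>q. 0 \<le> b q \<and> b q \<le> 1) \<and> open V \<and> p \<in> V \<and> (\<forall>q\<in>V. b q = 1)
      \<and> compact K \<and> (\<forall>q. q \<notin> K \<longrightarrow> b q = 0)" by (intro exI[of _ b] exI[of _ V] exI[of _ K]) simp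
  qed
  from this[unfolded choice_iff] obtain b' V' K' where "\<forall>p. b' p \<in> smooth_fun A \<and> (\<forall>q. 0 \<le> b' p q \<and> b' p q \<le> 1) \<and> open (V' p) \<and> p \<in> V' p \<and> (\<forall>q\<in>V' p. b' p q = 1)
    \<and> compact (K' p) \<and> (\<forall>q. q \<notin> K' p \<longrightarrow> b' p q = 0)" by (elim exE)
  then have b': "\<And>p. b' p \<in> smooth_fun A" "\<And>p q. 0 \<le> b' p q" "\<And>p q. b' p q \<le> 1" and V': "\<And>p. open (V' p)" "\<And>p. p \<in> V' p"
    "\<And>p q. q \<in> V' p \<Longrightarrow> b' p q = 1" and K': "\<And>p. compact (K' p)" "\<And>p q. q \<notin> K' p \<Longrightarrow> b' p q = 0" by auto
  \<comment> \<open>Second countability reduces the cover to a countable one.\<close>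
  obtain F where F: "F \<subseteq> range V'" "countable F" "\<Union>F = \<Union>(range V')"
    by (rule Lindelof[of "range V'"]) (use V'(1) in auto)
  obtain T where T: "countable T" "F = V' ` T" using F(1,2) countable_subset_image[of F V' UNIV] by blast
  have cover: "\<exists>t\<in>T. q \<in> V' t" for q
  proof -
    have "q \<in> \<Union>F" unfolding F(3) using V'(2)[of q] by blast
    then show ?thesis using T(2) by blast
  qed
  then have "T \<noteq> {}" by blast
  then have e: "range (from_nat_into T) = T" using T(1) by (rule range_from_nat_into)
  define b V K where "b n = b' (from_nat_into T n)" and "V n = V' (from_nat_into T n)" and "K n = K' (from_nat_into T n)" for n
  have b: "b n \<in> smooth_fun A" "0 \<le> b n q" "b n q \<le> 1" and V: "open (V n)" "q \<in> V n \<Longrightarrow> b n q = 1"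
    and K: "compact (K n)" "q \<notin> K n \<Longrightarrow> b n q = 0" for n q
    using b' V' K' by (auto simp: b_def V_def K_def)
  have cover: "\<exists>n. q \<in> V n" for q using cover[of q] e unfolding V_def by (metis imageE)
  define P where "P n q = (\<Prod>i\<le>n. 1 - b i q)" for n q
  \<comment> \<open>Any index with \<open>b j q = 1\<close> may end the sum without changing its
    value; the least one serves to define it.\<close>
  define N where "N q = (LEAST j. b j q = 1)" for q
  define r where "r q = (\<Sum>n<N q. P n q)" for q
  have Ps: "P n \<in> smooth_fun A" for n
    unfolding P_def[abs_def] by (rule smooth_fun_prod[OF A smooth_fun_diff[OF A smooth_fun_const[OF A] b(1)]])
  have r: "r q = (\<Sum>n<j. P n q)" if j: "b j q = 1" for j q
  proof -
    have Nj: "N q \<le> j" unfolding N_def by (rule Least_le[of "\<lambda>j. b j q = 1", OF j])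
    have bN: "b (N q) q = 1" unfolding N_def by (rule LeastI[of "\<lambda>j. b j q = 1", OF j])
    have "P n q = 0" if "n \<ge> N q" for n using bN that by (auto simp: P_def)
    then show ?thesis unfolding r_def using Nj by (intro sum.mono_neutral_left) auto
  qed
  have rs: "r \<in> smooth_fun A"
  proof (rule smooth_fun_local[OF A])
    fix q
    obtain j where j: "q \<in> V j" using cover by blast
    have "smooth_map_on (V j) A model_atlas (\<lambda>q. \<Sum>n<j. P n q)"
      by (rule smooth_map_on_sum[OF A fin_dim_real V(1) smooth_funD[OF Ps]])
    then have "smooth_map_on (V j) A model_atlas r"
      by (rule smooth_map_on_cong[OF A mfd_real V(1)]) (simp add: r[OF V(2)])
    then show "\<exists>W. open W \<and> q \<in> W \<and> smooth_map_on W A model_atlas r" using V(1) j by blast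
  qed
  have "compact {q. r q \<le> a}" for a
  proof -
    obtain n where n: "a < real n" using reals_Archimedean2 by blast
    have "{q. r q \<le> a} \<subseteq> (\<Union>i<n. K i)"
    proof (rule ccontr)
      assume "\<not> ?thesis"
      then obtain q where q: "r q \<le> a" "\<And>i. i < n \<Longrightarrow> b i q = 0" using K(2) by blast
      have bN: "b (N q) q = 1" using cover[of q] V(2) unfolding N_def by (metis (mono_tags, lifting) LeastI)
      then have "n \<le> N q" using q(2)[of "N q"] by (cases "n \<le> N q") auto
      then have "(\<Sum>i<n. P i q) \<le> r q"
        unfolding r_def by (intro sum_mono2) (auto simp: P_def b intro!: prod_nonneg)
      moreover have "(\<Sum>i<n. P i q) = real n" using q(2) by (simp add: P_def)
      ultimately show False using q(1) n by simp
    qed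
    moreover have "compact (\<Union>i<n. K i)" using K(1) by (intro compact_UN) auto
    moreover have "closed {q. r q \<le> a}"
      using closed_Collect_le[OF smooth_map_on_continuous[OF smooth_funD[OF rs]] continuous_on_const] .
    ultimately show ?thesis using closed_Int_compact by (metis inf.absorb_iff1)
  qed
  then show ?thesis using rs by blast
qed

text \<open>The product of \<open>f\<close> with a bump inside \<open>N\<close> is 0, and the
  product rule at \<open>p\<close> recovers \<open>v f\<close> from it.\<close>

lemma tangent_vanishing:
  fixes A :: "('p::t2_space, 'e::real_normed_vector) chart set"
  assumes A: "mfd A" and v: "v \<in> tangent_space A p" and f: "f \<in> smooth_fun A" and N: "open N" "p \<in> N" "\<And>q. q \<in> N \<Longrightarrow> f q = 0"
  shows "v f = 0"
proof -
  from manifold_bump[OF A N(1,2)] obtain b V K where b: "b \<in> smooth_fun A"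
    and bVK: "(\<forall>q. 0 \<le> b q \<and> b q \<le> 1) \<and> open V \<and> p \<in> V \<and> (\<forall>q\<in>V. b q = 1)
    \<and> V \<subseteq> K \<and> compact K \<and> K \<subseteq> N \<and> (\<forall>q. q \<notin> K \<longrightarrow> b q = 0)" by (elim bexE exE)
  have bp: "b p = 1" using bVK by auto
  have bf: "(\<lambda>q. b q * f q) = (\<lambda>q. 0 * f q)"
  proof
    fix q
    show "b q * f q = 0 * f q" using bVK N(3)[of q] by (cases "q \<in> K") auto
  qed
  have "v (\<lambda>q. b q * f q) = b p * v f + f p * v b" by (rule tangent_spaceD(3)[OF v b f])
  then show ?thesis unfolding bf tangent_spaceD(2)[OF v f] using bp N(2,3) by simp
qed

lemma ham_vf_zero:
  fixes A :: "('p::{t2_space, second_countable_topology}, 'e::real_normed_vector) chart set"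
  assumes es: "exact_symplectic A \<theta>" and h: "h \<in> smooth_fun A" and X: "is_ham_vf A \<theta> h X"
    and N: "open N" "p \<in> N" "\<And>q. q \<in> N \<Longrightarrow> h q = 0"
  shows "X p = (\<lambda>f. 0)"
proof (rule exact_symplecticD(3)[OF es])
  show "X \<in> vector_fields A" using X by (simp add: is_ham_vf_def)
  fix Y assume Y: "Y \<in> vector_fields A"
  then show "symp \<theta> X Y p = 0"
    using X tangent_vanishing[OF exact_symplecticD(1)[OF es] vector_field_tangent[OF Y] h N] by (simp add: is_ham_vf_def differential_def)
qed

section \<open>Complete invariant fields and curves of automorphisms\<close>

context exact_bundle
begin

text \<open>The group translates a flow box around one point of a fibre along the whole fibre, so
  the life time can be bounded in terms of the base point. A continuous local section makes the
  bound uniform near \<open>m\<close>.\<close>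

lemma local_life_time:
  assumes X: "X \<in> vector_fields P" and eqv: "\<And>g p. pushforward P (\<Phi> g) (X p) = X (\<Phi> g p)"
  shows "\<exists>N \<epsilon>. open N \<and> m \<in> N \<and> \<epsilon> > 0 \<and> (\<forall>q. \<pi> q \<in> N \<longrightarrow> (\<exists>\<gamma>. \<gamma> 0 = q \<and> icurve P X {-\<epsilon><..<\<epsilon>} \<gamma>))"
proof -
  have triv: "\<forall>m. \<exists>U \<tau>. open U \<and> m \<in> U \<and> smooth_map_on (\<pi> -` U) P L \<tau> \<and> (\<forall>p\<in>\<pi> -` U. \<forall>g. \<tau> (\<Phi> g p) = \<tau> p \<otimes>\<^bsub>G\<^esub> g) \<and>
        bij_betw (\<lambda>p. (\<pi> p, \<tau> p)) (\<pi> -` U) (U \<times> UNIV) \<and>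
        smooth_map_on (U \<times> UNIV) (prod_atlas M L) P (inv_into (\<pi> -` U) (\<lambda>p. (\<pi> p, \<tau> p)))"
    and \<pi>\<Phi>: "\<And>g p. \<pi> (\<Phi> g p) = \<pi> p"
    using pb by (auto simp: principal_bundle_def)
  from triv[THEN spec, of m] obtain U \<tau> where "open U \<and> m \<in> U \<and> smooth_map_on (\<pi> -` U) P L \<tau> \<and> (\<forall>p\<in>\<pi> -` U. \<forall>g. \<tau> (\<Phi> g p) = \<tau> p \<otimes>\<^bsub>G\<^esub> g) \<and>
        bij_betw (\<lambda>p. (\<pi> p, \<tau> p)) (\<pi> -` U) (U \<times> UNIV) \<and>
        smooth_map_on (U \<times> UNIV) (prod_atlas M L) P (inv_into (\<pi> -` U) (\<lambda>p. (\<pi> p, \<tau> p)))" by (elim exE)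
  then have U: "open U" "m \<in> U" and \<tau>: "\<And>p g. \<pi> p \<in> U \<Longrightarrow> \<tau> (\<Phi> g p) = \<tau> p \<otimes>\<^bsub>G\<^esub> g"
    and bij: "bij_betw (\<lambda>p. (\<pi> p, \<tau> p)) (\<pi> -` U) (U \<times> UNIV)"
    and sm: "smooth_map_on (U \<times> UNIV) (prod_atlas M L) P (inv_into (\<pi> -` U) (\<lambda>p. (\<pi> p, \<tau> p)))" by auto
  let ?k = "inv_into (\<pi> -` U) (\<lambda>p. (\<pi> p, \<tau> p))"
  \<comment> \<open>The local section on which the trivialization takes the unit of the group as its
    value.\<close>
  define s where "s u = ?k (u, \<one>\<^bsub>G\<^esub>)" for u
  have s: "\<pi> (s u) = u" "\<tau> (s u) = \<one>\<^bsub>G\<^esub>" if "u \<in> U" for u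
    using bij_betw_inv_into_right[OF bij, of "(u, \<one>\<^bsub>G\<^esub>)"] that by (auto simp: s_def)
  have fibre: "q = \<Phi> (\<tau> q) (s (\<pi> q))" if q: "\<pi> q \<in> U" for q
  proof -
    interpret group G by (rule grp)
    have "\<tau> (\<Phi> (\<tau> q) (s (\<pi> q))) = \<tau> q" using \<tau>[of "s (\<pi> q)"] s[OF q] q l_one[of "\<tau> q"] car by simp
    then show ?thesis
      using inj_onD[OF bij_betw_imp_inj_on[OF bij], of q "\<Phi> (\<tau> q) (s (\<pi> q))"] q s[OF q] by (simp add: \<pi>\<Phi>)
  qed
  have "continuous_on U (\<lambda>u. (u, \<one>\<^bsub>G\<^esub>))" by (intro continuous_intros)
  then have cs: "continuous_on U s"
    unfolding s_def by (rule continuous_on_compose2[OF smooth_map_on_continuous[OF sm]]) auto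
  from flow_box[OF mP X, of "s m"] obtain \<epsilon> W F where "\<epsilon> > 0 \<and> open W \<and> s m \<in> W \<and>
    smooth_map_on ({-\<epsilon><..<\<epsilon>} \<times> W) (prod_atlas (model_atlas :: (real, real) chart set) P) P (\<lambda>z. F (fst z) (snd z)) \<and>
    (\<forall>q\<in>W. F 0 q = q \<and> icurve P X {-\<epsilon><..<\<epsilon>} (\<lambda>t. F t q))" by (elim exE)
  then have \<epsilon>: "\<epsilon> > 0" and W: "open W" "s m \<in> W" and F: "\<And>q. q \<in> W \<Longrightarrow> F 0 q = q" "\<And>q. q \<in> W \<Longrightarrow> icurve P X {-\<epsilon><..<\<epsilon>} (\<lambda>t. F t q)"
    by auto
  have "open (U \<inter> s -` W)" by (rule continuous_open_preimage[OF cs U(1) W(1)])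
  moreover have "\<exists>\<gamma>. \<gamma> 0 = q \<and> icurve P X {-\<epsilon><..<\<epsilon>} \<gamma>" if q: "\<pi> q \<in> U \<inter> s -` W" for q
  proof -
    have "icurve P X {-\<epsilon><..<\<epsilon>} (\<lambda>t. \<Phi> (\<tau> q) (F t (s (\<pi> q))))"
      by (rule icurve_image[OF mP act_smooth eqv F(2)]) (use q in simp)
    moreover have "\<Phi> (\<tau> q) (F 0 (s (\<pi> q))) = q" using q F(1) fibre[of q] by simp
    ultimately show ?thesis by (intro exI[of _ "\<lambda>t. \<Phi> (\<tau> q) (F t (s (\<pi> q)))"] conjI)
  qed
  ultimately show ?thesis using \<epsilon> U(2) W(2) by (intro exI[of _ "U \<inter> s -` W"] exI[of _ \<epsilon>]) auto
qed

text \<open>The levels \<open>r \<circ> \<pi> \<in> a + 2\<int>\<close> consist of zeros of \<open>X\<close> and hence are barriers for the integral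
  curves: these stay in a shell over a compact subset of the base, where they have a common life time.\<close>

lemma barriers_complete:
  assumes X: "X \<in> vector_fields P" and eqv: "\<And>g p. pushforward P (\<Phi> g) (X p) = X (\<Phi> g p)"
    and r: "r \<in> smooth_fun M" and proper: "\<And>b. compact {m. r m \<le> b}"
    and zero: "\<And>q (k::int). r (\<pi> q) = a + 2 * of_int k \<Longrightarrow> X q = (\<lambda>f. 0)"
  shows "\<exists>\<gamma>. \<gamma> 0 = q \<and> icurve P X UNIV \<gamma>"
proof -
  have cr: "continuous_on UNIV r" by (rule smooth_map_on_continuous[OF smooth_funD[OF r]])
  have c\<pi>: "continuous_on UNIV \<pi>" using pb by (auto simp: principal_bundle_def smooth_map_on_def)
  \<comment> \<open>Selects the shell between two consecutive barriers that contains
    \<open>q\<close>, with \<open>lo \<le> r (\<pi> q) < hi\<close>.\<close>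
  define k where "k = \<lfloor>(r (\<pi> q) - a) / 2\<rfloor>"
  define lo where "lo = a + 2 * of_int k"
  define hi where "hi = a + 2 * of_int (k + 1)"
  define K where "K = {m. lo \<le> r m} \<inter> {m. r m \<le> hi}"
  have "compact K" unfolding K_def
    by (rule closed_Int_compact[OF closed_Collect_le[OF continuous_on_const cr] proper])
  obtain N e where Ne: "\<And>m. open (N m)" "\<And>m. m \<in> N m" "\<And>m. e m > 0" "\<And>m q. \<pi> q \<in> N m \<Longrightarrow> \<exists>\<gamma>. \<gamma> 0 = q \<and> icurve P X {-e m<..<e m} \<gamma>"
    using local_life_time[OF X eqv] by metis
  obtain C where C: "finite C" "K \<subseteq> (\<Union>m\<in>C. N m)"
    by (rule compactE_image[OF \<open>compact K\<close>, of K N]) (use Ne(1,2) in auto)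
  \<comment> \<open>The inserted 1 keeps the minimum meaningful for an empty cover.\<close>
  define \<epsilon> where "\<epsilon> = Min (insert 1 (e ` C))"
  have \<epsilon>: "\<epsilon> > 0" unfolding \<epsilon>_def using C(1) Ne(3) by (subst Min_gr_iff) auto
  have \<epsilon>le: "\<epsilon> \<le> e m" if "m \<in> C" for m unfolding \<epsilon>_def using C(1) that by (intro Min_le) auto
  let ?J = "{-\<epsilon><..<\<epsilon>}"
  have "\<exists>\<gamma>. \<gamma> 0 = p \<and> icurve P X ?J \<gamma> \<and> (\<forall>t\<in>?J. \<gamma> t \<in> \<pi> -` K)" if p: "p \<in> \<pi> -` K" for p
  proof -
    obtain m where m: "m \<in> C" "\<pi> p \<in> N m" using p C(2) by blast
    obtain \<gamma> where g0: "\<gamma> 0 = p" and g': "icurve P X {-e m<..<e m} \<gamma>" using Ne(4)[OF m(2)] by blast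
    have g: "icurve P X ?J \<gamma>" by (rule icurve_subset[OF g']) (use \<epsilon>le[OF m(1)] in auto)
    define \<rho> where "\<rho> t = r (\<pi> (\<gamma> t))" for t
    have "continuous_on ?J \<rho>" unfolding \<rho>_def
      by (rule continuous_on_compose2[OF cr continuous_on_compose2[OF c\<pi> icurve_continuous[OF mP g]]]) auto
    then have conn\<rho>: "connected (\<rho> ` ?J)" by (rule connected_continuous_image[OF _ connected_symmetric_interval])
    \<comment> \<open>By the intermediate value theorem the curve meets the barrier at a time
      \<open>s\<close>. There \<open>X\<close> vanishes, so by uniqueness the curve coincides with
      the constant one.\<close>
    have barrier: "\<rho> t = \<rho> t'" if t: "t \<in> ?J" and t': "t' \<in> ?J" and b: "\<rho> t \<le> a + 2 * of_int j" "a + 2 * of_int j \<le> \<rho> t'" for t t' and j :: int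
    proof -
      have "a + 2 * of_int j \<in> \<rho> ` ?J" by (rule connectedD_interval[OF conn\<rho> imageI[OF t] imageI[OF t'] b])
      then obtain s where s: "s \<in> ?J" "\<rho> s = a + 2 * of_int j" by (metis imageE)
      have "X (\<gamma> s) = (\<lambda>f. 0)" by (rule zero[of _ j]) (use s(2) in \<open>simp add: \<rho>_def\<close>)
      then have const: "icurve P X ?J (\<lambda>_. \<gamma> s)" by (simp add: icurve_def)
      have "\<gamma> x = \<gamma> s" if "x \<in> ?J" for x
        by (rule icurve_unique[OF mP X open_greaterThanLessThan connected_symmetric_interval s(1) g const refl that])
      then show ?thesis using t t' by (simp add: \<rho>_def)
    qed
    have J0: "0 \<in> ?J" using \<epsilon> by simp
    have \<rho>0: "lo \<le> \<rho> 0" "\<rho> 0 \<le> hi" using p by (simp_all add: \<rho>_def g0 K_def)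
    have "\<gamma> t \<in> \<pi> -` K" if t: "t \<in> ?J" for t
    proof -
      have "\<rho> t < lo \<Longrightarrow> \<rho> t = \<rho> 0" using barrier[OF t J0, of k] \<rho>0(1) by (simp add: lo_def)
      moreover have "\<rho> t > hi \<Longrightarrow> \<rho> 0 = \<rho> t" using barrier[OF J0 t, of "k + 1"] \<rho>0(2) by (simp add: hi_def)
      ultimately have "lo \<le> \<rho> t" "\<rho> t \<le> hi" using \<rho>0 by linarith+
      then show ?thesis by (simp add: \<rho>_def K_def)
    qed
    then show ?thesis using g0 g by blast
  qed
  moreover have "of_int k \<le> (r (\<pi> q) - a) / 2" "(r (\<pi> q) - a) / 2 < of_int k + 1"
    unfolding k_def by linarith+
  then have "q \<in> \<pi> -` K" by (simp add: K_def lo_def hi_def field_simps)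
  ultimately show ?thesis by (rule icurve_complete[OF mP X \<epsilon>])
qed

lemma flow_Aut_ham_curve:
  assumes h: "h \<in> smooth_fun P" "\<And>g p. h (\<Phi> g p) = h p" and X: "is_ham_vf P \<theta> h X"
    and T: "smooth_family P P \<Theta>" "\<And>p. \<Theta> 0 p = p" "\<And>p. icurve P X UNIV (\<lambda>t. \<Theta> t p)"
  shows "Aut_ham_curve P \<theta> \<Phi> X \<Theta>"
proof -
  have XV: "X \<in> vector_fields P" using X by (simp add: is_ham_vf_def)
  have uniq: "\<gamma> t = \<delta> t" if "icurve P X UNIV \<gamma>" "icurve P X UNIV \<delta>" "\<gamma> 0 = \<delta> 0" for \<gamma> \<delta> t
    by (rule icurve_unique[OF mP XV open_UNIV connected_UNIV UNIV_I that UNIV_I])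
  have grp: "\<Theta> (s + t) p = \<Theta> s (\<Theta> t p)" for s t p
    by (rule uniq[where \<gamma> = "\<lambda>s. \<Theta> (s + t) p" and \<delta> = "\<lambda>s. \<Theta> s (\<Theta> t p)" and t = s, OF icurve_shift[OF T(3)] T(3)]) (simp_all add: T(2))
  have inv1: "\<Theta> t (\<Theta> (- t) p) = p" "\<Theta> (- t) (\<Theta> t p) = p" for t p
    using grp[of t "- t" p] grp[of "- t" t p] by (simp_all add: T(2))
  have eqv: "\<Theta> t (\<Phi> g p) = \<Phi> g (\<Theta> t p)" for t g p
    by (rule uniq[where \<gamma> = "\<lambda>t. \<Theta> t (\<Phi> g p)" and \<delta> = "\<lambda>t. \<Phi> g (\<Theta> t p)" and t = t, OF T(3) icurve_image[OF mP act_smooth invariant_ham_equivariant[OF h X] T(3)]]) (simp add: T(2))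
  have slice: "smooth_map P P (\<Theta> t)" for t by (rule smooth_family_slice[OF mP mP T(1)])
  have inv2: "inv_into UNIV (\<Theta> t) = \<Theta> (- t)" for t by (rule inv_equality) (simp_all add: inv1)
  have diff: "diffeomorphism P (\<Theta> t)" for t
    unfolding diffeomorphism_def inv2 using slice by (auto intro!: bijI' simp: inv1) (metis inv1)+
  \<comment> \<open>The map \<open>\<Theta> t\<close> is the end of the isotopy with parameter
    \<open>s\<close> given by \<open>\<Theta> (t * s)\<close>, which the time-independent
    Hamiltonian \<open>t * h\<close> generates.\<close>
  have "\<Theta> t \<in> Diff_ham P \<theta>" for t
    unfolding Diff_ham_def
  proof (intro CollectI exI[of _ "\<lambda>s. \<Theta> (t * s)"] exI[of _ "\<lambda>s p. t * h p"] exI[of _ "\<lambda>s p f. t * X p f"] conjI allI ballI diff)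
    have ts: "smooth_on UNIV (\<lambda>s. t * s)" by (intro smooth_on_mult smooth_on_const smooth_on_id open_UNIV)
    have "smooth_map P P (\<lambda>p. p)" by (rule smooth_map_on_id[OF mP])
    from smooth_family_comp2[OF mP mP mP T(1) smooth_family_const[OF mP mP this] ts ts]
    show "smooth_family P P (\<lambda>s. \<Theta> (t * s))" .
    show "\<Theta> (t * 0) = id" by (simp add: fun_eq_iff T(2))
    show "smooth_family P (model_atlas :: (real, real) chart set) (\<lambda>s p. t * h p)"
      by (rule smooth_family_const[OF mP mfd_real smooth_funD[OF smooth_fun_cmult[OF mP h(1)]]])
    show "is_ham_vf P \<theta> (\<lambda>p. t * h p) (\<lambda>p f. t * X p f)"
      using ham_vf_lincomb[OF mP th h(1) h(1) X X, of t 0] by simp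
    fix s p f assume f: "f \<in> smooth_fun P"
    have "((\<lambda>s. t * s) has_real_derivative t) (at s)" by (auto intro!: derivative_eq_intros)
    from DERIV_chain2[OF icurveD[OF T(3) UNIV_I f] this]
    show "((\<lambda>s. f (\<Theta> (t * s) p)) has_real_derivative t * X (\<Theta> (t * s) p) f) (at s)" by (simp add: mult.commute)
  qed simp
  then have "\<Theta> t \<in> carrier (Aut_ham P \<theta> \<Phi>)" for t
    using diff by (auto simp: Aut_ham_def Aut_def fun_eq_iff eqv)
  moreover have "((\<lambda>t. f (\<Theta> t p)) has_real_derivative X p f) (at 0)" if "f \<in> smooth_fun P" for p f
    using icurveD[OF T(3) UNIV_I that, of p 0] by (simp add: T(2))
  ultimately show ?thesis unfolding Aut_ham_curve_def using T(1,2) by (auto simp: fun_eq_iff)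
qed

text \<open>At time 0 both curves pass through the identity, so the chain rule leaves the sum of the
  velocities.\<close>

lemma Aut_ham_curve_add:
  assumes c: "Aut_ham_curve P \<theta> \<Phi> X c" and d: "Aut_ham_curve P \<theta> \<Phi> Y d"
  shows "Aut_ham_curve P \<theta> \<Phi> (\<lambda>p f. X p f + Y p f) (\<lambda>t. c t \<circ> d t)"
proof -
  have cs: "smooth_family P P c" "c 0 = id" and cA: "\<And>t. c t \<in> carrier (Aut_ham P \<theta> \<Phi>)"
    and cd: "\<And>p f. f \<in> smooth_fun P \<Longrightarrow> ((\<lambda>t. f (c t p)) has_real_derivative X p f) (at 0)"
    using c by (auto simp: Aut_ham_curve_def)
  have ds: "smooth_family P P d" "d 0 = id" and dA: "\<And>t. d t \<in> carrier (Aut_ham P \<theta> \<Phi>)"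
    and dd: "\<And>p f. f \<in> smooth_fun P \<Longrightarrow> ((\<lambda>t. f (d t p)) has_real_derivative Y p f) (at 0)"
    using d by (auto simp: Aut_ham_curve_def)
  have id: "smooth_on UNIV (\<lambda>t::real. t)" by (rule smooth_on_id[OF open_UNIV])
  have sm: "smooth_family P P (\<lambda>t. c t \<circ> d t)"
    using smooth_family_comp2[OF mP mP mP cs(1) ds(1) id id] by (simp add: o_def)
  have A: "c t \<circ> d t \<in> carrier (Aut_ham P \<theta> \<Phi>)" for t
    using monoid.m_closed[OF group.is_monoid[OF Aut_ham_group] cA dA] by (simp add: Aut_ham_def)
  have "((\<lambda>t. f (c t (d t p))) has_real_derivative X p f + Y p f) (at 0)" if f: "f \<in> smooth_fun P" for f p
    using two_parameter_derivative[OF composed_families_smooth[OF mP cs(1) ds(1) f] DERIV_ident DERIV_ident, of 0 p "X p f" "Y p f"]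
      cd[OF f, of p] dd[OF f, of p] by (simp add: cs(2) ds(2))
  then show ?thesis unfolding Aut_ham_curve_def using sm A cs(2) ds(2) by simp
qed

lemma Aut_ham_curve_exists:
  assumes h: "h \<in> smooth_fun P" "\<And>g p. h (\<Phi> g p) = h p" and X: "is_ham_vf P \<theta> h X"
  shows "\<exists>c. Aut_ham_curve P \<theta> \<Phi> X c"
proof -
  obtain r where r: "r \<in> smooth_fun M" "\<And>a. compact {m. r m \<le> a}" using proper_function[OF mM] by blast
  have \<pi>s: "smooth_map P M \<pi>" and \<pi>\<Phi>: "\<And>g p. \<pi> (\<Phi> g p) = \<pi> p" using pb by (auto simp: principal_bundle_def)
  have rP: "(\<lambda>p. r (\<pi> p)) \<in> smooth_fun P" by (rule smooth_fun_compose[OF mP mM \<pi>s r(1)])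
  have crP: "continuous_on UNIV (\<lambda>p. cos (pi * r (\<pi> p)))"
    using smooth_map_on_continuous[OF smooth_funD[OF rP, of UNIV]] by (intro continuous_intros)
  \<comment> \<open>Equal to 0 where the cosine is at most -1/2 and to 1 where it is at least 1/2;
    these sets are neighbourhoods of the odd and of the even levels of
    \<open>r \<circ> \<pi>\<close>. The margin makes the two summands vanish on open sets around
    their barriers, and so do their vector fields.\<close>
  define k where "k p = step (1 / 2 + cos (pi * r (\<pi> p)))" for p
  have "smooth_on UNIV (\<lambda>x. step (1 / 2 + cos (pi * x)))"
  proof (rule smooth_on_compose[OF fin_dim_real open_UNIV open_UNIV _ smooth_on_step UNIV_I])
    have "smooth_on UNIV (\<lambda>x::real. cos (pi * x))"
      by (rule smooth_on_compose[OF fin_dim_real open_UNIV open_UNIV smooth_on_mult[OF open_UNIV smooth_on_const smooth_on_id[OF open_UNIV]] smooth_on_cos UNIV_I])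
    then show "smooth_on UNIV (\<lambda>x::real. 1 / 2 + cos (pi * x))" by (rule smooth_on_add[OF open_UNIV smooth_on_const])
  qed
  from smooth_map_on_model_compose[OF mP fin_dim_real fin_dim_real open_UNIV open_UNIV smooth_funD[OF rP] this UNIV_I]
  have k: "k \<in> smooth_fun P" unfolding k_def[abs_def] by (rule smooth_funI)
  have kh: "(\<lambda>p. k p * h p) \<in> smooth_fun P" by (rule smooth_fun_mult[OF mP k h(1)])
  \<comment> \<open>Serves both summands of \<open>h\<close>: the barriers are the odd levels for
    \<open>a = 1\<close> and the even levels for \<open>a = 0\<close>.\<close>
  have complete: "\<exists>c. Aut_ham_curve P \<theta> \<Phi> Y c"
    if f: "f \<in> smooth_fun P" "\<And>g p. f (\<Phi> g p) = f p" and Y: "is_ham_vf P \<theta> f Y"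
      and N: "\<And>q (j::int). r (\<pi> q) = a + 2 * of_int j \<Longrightarrow> \<exists>N. open N \<and> q \<in> N \<and> (\<forall>p\<in>N. f p = 0)" for f Y a
  proof -
    have YV: "Y \<in> vector_fields P" using Y by (simp add: is_ham_vf_def)
    have z: "Y q = (\<lambda>f. 0)" if "r (\<pi> q) = a + 2 * of_int j" for q and j :: int
      using N[OF that] ham_vf_zero[OF es f(1) Y] by blast
    have "\<exists>\<gamma>. \<gamma> 0 = q \<and> icurve P Y UNIV \<gamma>" for q
      by (rule barriers_complete[OF YV invariant_ham_equivariant[OF f Y] r z])
    from complete_flow[OF mP YV this] obtain \<Theta> where "smooth_family P P \<Theta>" "\<And>p. \<Theta> 0 p = p" "\<And>p. icurve P Y UNIV (\<lambda>t. \<Theta> t p)"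
      by blast
    from flow_Aut_ham_curve[OF f Y this] show ?thesis by blast
  qed
  obtain X1 where X1: "is_ham_vf P \<theta> (\<lambda>p. k p * h p) X1" using ham_vf_exists[OF es kh] by blast
  define X2 where "X2 p f = X p f - X1 p f" for p f
  have X2: "is_ham_vf P \<theta> (\<lambda>p. h p - k p * h p) X2"
    using ham_vf_lincomb[OF mP th h(1) kh X X1, of 1 "-1"] by (simp add: X2_def[abs_def])
  have "\<exists>c. Aut_ham_curve P \<theta> \<Phi> X1 c"
  proof (rule complete[OF kh _ X1, of 1])
    fix q and j :: int assume q: "r (\<pi> q) = 1 + 2 * of_int j"
    have "cos (pi * r (\<pi> q)) = cos (2 * pi * of_int j + pi)" by (simp add: q algebra_simps)
    also have "\<dots> = -1" by (simp add: cos_add)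
    finally have "q \<in> {p. cos (pi * r (\<pi> p)) < - (1 / 2)}" by simp
    moreover have "open {p. cos (pi * r (\<pi> p)) < - (1 / 2)}" by (rule open_Collect_less[OF crP continuous_on_const])
    ultimately show "\<exists>N. open N \<and> q \<in> N \<and> (\<forall>p\<in>N. k p * h p = 0)"
      by (intro exI[of _ "{p. cos (pi * r (\<pi> p)) < - (1 / 2)}"]) (auto simp: k_def step_eq_0)
  qed (simp add: k_def \<pi>\<Phi> h(2))
  moreover have "\<exists>c. Aut_ham_curve P \<theta> \<Phi> X2 c"
  proof (rule complete[OF smooth_fun_diff[OF mP h(1) kh] _ X2, of 0])
    fix q and j :: int assume q: "r (\<pi> q) = 0 + 2 * of_int j"
    have "cos (pi * r (\<pi> q)) = cos (2 * pi * of_int j)" by (simp add: q algebra_simps)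
    also have "\<dots> = 1" by simp
    finally have "q \<in> {p. 1 / 2 < cos (pi * r (\<pi> p))}" by simp
    moreover have "open {p. 1 / 2 < cos (pi * r (\<pi> p))}" by (rule open_Collect_less[OF continuous_on_const crP])
    ultimately show "\<exists>N. open N \<and> q \<in> N \<and> (\<forall>p\<in>N. h p - k p * h p = 0)"
      by (intro exI[of _ "{p. 1 / 2 < cos (pi * r (\<pi> p))}"]) (auto simp: k_def step_eq_1)
  qed (simp add: k_def \<pi>\<Phi> h(2))
  ultimately obtain c d where "Aut_ham_curve P \<theta> \<Phi> X1 c" "Aut_ham_curve P \<theta> \<Phi> X2 d" by blast
  from Aut_ham_curve_add[OF this] show ?thesis by (auto simp: X2_def)
qed

end

theorem theorem5p3:
  fixes P :: "('p::{t2_space, second_countable_topology}, 'e::real_normed_vector) chart set"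
    and M :: "('m::{t2_space, second_countable_topology}, 'b::real_normed_vector) chart set"
    and L :: "('g::{t2_space, second_countable_topology}, 'l::real_normed_vector) chart set"
    and G :: "'g monoid"
    and \<pi> :: "'p \<Rightarrow> 'm"
    and \<Phi> :: "'g \<Rightarrow> 'p \<Rightarrow> 'p"
    and \<theta> :: "'p \<Rightarrow> 'p tvec \<Rightarrow> real"
  assumes "connected (UNIV :: 'p set)"
    and "principal_bundle P M L G \<pi> \<Phi>"
    and "exact_symplectic P \<theta>"
    and "\<theta> \<in> invariant_one_forms P \<Phi>"
  shows
    \<comment> \<open>\<open>\<Psi>\<close> is well defined\<close>
    "(\<forall>\<phi>\<in>carrier (Aut_ham P \<theta> \<Phi>).
        (\<exists>F. primitive P \<theta> \<phi> F) \<and>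
        (\<forall>F. primitive P \<theta> \<phi> F \<longrightarrow> (\<forall>g p. F p - F (\<Phi> g p) = Psi P \<theta> \<Phi> \<phi> g)) \<and>
        Psi P \<theta> \<Phi> \<phi> \<in> hom G real_add_group)
     \<and> group_hom (Aut_ham P \<theta> \<Phi>) (Hom_real G) (Psi P \<theta> \<Phi>)
     \<and> kernel (Aut_ham P \<theta> \<Phi>) (Hom_real G) (Psi P \<theta> \<Phi>) \<lhd> Aut_ham P \<theta> \<Phi>
     \<comment> \<open>\<open>\<beta>\<close> is well defined\<close>
     \<and> (\<forall>X\<in>aut_ham P \<theta> \<Phi>. \<forall>c. Aut_ham_curve P \<theta> \<Phi> X c \<longrightarrow>
          beta P \<theta> \<Phi> X \<in> hom G real_add_group \<and>
          (\<forall>g. ((\<lambda>t. Psi P \<theta> \<Phi> (c t) g) has_real_derivative beta P \<theta> \<Phi> X g) (at 0)))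
     \<and> formal_lie_algebra_ker_Psi P \<theta> \<Phi> = {X. \<exists>h\<in>invariant_fun P \<Phi>. is_ham_vf P \<theta> h X}"
proof -
  interpret exact_bundle P M L G \<pi> \<Phi> \<theta> by (rule exact_bundle.intro[OF assms])
  have "formal_lie_algebra_ker_Psi P \<theta> \<Phi> = {X. \<exists>h\<in>invariant_fun P \<Phi>. is_ham_vf P \<theta> h X}"
  proof (intro equalityI subsetI CollectI)
    fix X assume "X \<in> {X. \<exists>h\<in>invariant_fun P \<Phi>. is_ham_vf P \<theta> h X}"
    then obtain h where h: "h \<in> invariant_fun P \<Phi>" "is_ham_vf P \<theta> h X" by blast
    then have "h \<in> smooth_fun P" "h (\<Phi> g p) = h p" for g p by (auto simp: invariant_fun_def fun_eq_iff)
    from Aut_ham_curve_exists[OF this h(2)] invariant_subset_kernel[OF h]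
    show "X \<in> formal_lie_algebra_ker_Psi P \<theta> \<Phi>" by blast
  qed (rule kernel_subset_invariant)
  then show ?thesis
    using primitive_exists Psi_eq Psi_hom Psi_group_hom group_hom.normal_kernel[OF Psi_group_hom] beta_well_defined by simp
qed

end
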